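(* Let $\alpha_1,\alpha_2$ be the simple roots of $G_2$, with positive roots $\alpha_1,\ \alpha_2,\ \alpha_1+\alpha_2,\ \alpha_1+2\alpha_2,\ \alpha_1+3\alpha_2,\ 2\alpha_1+3\alpha_2$, and let $\mathbb{F}_{G_{\alpha_2}}=G_2/U(2)$ be the generalized flag manifold whose isotropy group $U(2)$ has root system $\{\pm\alpha_1\}$ (so that its isotropy representation has $3$ irreducible summands). Then $\mathbb{F}_{G_{\alpha_2}}$ admits at least $3$ invariant almost complex structures, up to conjugation and equivalence.
   Context: $G_2$ denotes the compact simple Lie group of type $G_2$. The isotropy group is the connected subgroup containing the maximal torus whose complexified Lie algebra is the Cartan subalgebra plus the root spaces of $\pm\alpha_1$; in flag-manifold notation, it corresponds to the subset $\Theta=\{\alpha_1,\alpha_2\}\setminus\{\alpha_2\}$ of simple roots. The three irreducible summands correspond to the sets of positive roots $\{\alpha_2,\alpha_1+\alpha_2\}$, $\{\alpha_1+2\alpha_2\}$, $\{\alpha_1+3\alpha_2,2\alpha_1+3\alpha_2\}$. An invariant almost complex structure on $M=U/K$ is an almost complex structure $J$ (a $(1,1)$-tensor with $J^2=-\mathrm{Id}$) commuting with the differentials of the left action of $U$ on $M$. The conjugate of $J$ is $-J$. Two almost complex structures $J_1,J_2$ on $M$ are equivalent if there is a diffeomorphism $\phi:M\to M$ with $d\phi\circ J_1=J_2\circ d\phi$ (for integrable structures: $(M,J_1)$ and $(M,J_2)$ are biholomorphic). "Up to conjugation and equivalence" means modulo the equivalence relation generated by $J\sim -J$ and equivalence.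 *)

theory Defs
  imports "HOL-Analysis.Analysis" "HOL-Algebra.Left_Coset"
begin

section \<open>Smooth maps\<close>

primrec times_differentiable_on ::
  "nat \<Rightarrow> 'a::real_normed_vector set \<Rightarrow> ('a \<Rightarrow> 'b::real_normed_vector) \<Rightarrow> bool" where
  "times_differentiable_on 0 S f \<longleftrightarrow> continuous_on S f"
| "times_differentiable_on (Suc k) S f \<longleftrightarrow>
     (\<forall>x\<in>S. f differentiable at x) \<and>
     (\<forall>v. times_differentiable_on k S (\<lambda>x. frechet_derivative f (at x) v))"

text \<open>Meant for open \<open>S\<close>.\<close>

definition smooth_on :: "'a::real_normed_vector set \<Rightarrow> ('a \<Rightarrow> 'b::real_normed_vector) \<Rightarrow> bool" where
  "smooth_on S f \<longleftrightarrow> (\<forall>k. times_differentiable_on k S f)"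

text \<open>Smoothness of a function on an embedded submanifold \<open>A\<close>: local smooth extendability.\<close>

definition smooth_on_submanifold ::
  "'a::real_normed_vector set \<Rightarrow> ('a \<Rightarrow> 'b::real_normed_vector) \<Rightarrow> bool" where
  "smooth_on_submanifold A f \<longleftrightarrow>
     (\<forall>a\<in>A. \<exists>W F. open W \<and> a \<in> W \<and> smooth_on W F \<and> (\<forall>x\<in>A \<inter> W. f x = F x))"


section \<open>Smooth manifolds through their algebra of smooth functions\<close>

text \<open>
  A manifold is given by its set of points \<open>M\<close> and its algebra \<open>C\<close> of global smooth real functions,
  which are taken to vanish outside \<open>M\<close> so that they are determined by their values on \<open>M\<close>.
  Tangent vectors at \<open>p\<close> are the derivations of \<open>C\<close> at \<open>p\<close>, extended by \<open>0\<close> outside \<open>C\<close>;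
  the linear structure of a tangent space is the pointwise one.
\<close>

definition tangent_space ::
  "('p \<Rightarrow> real) set \<Rightarrow> 'p \<Rightarrow> (('p \<Rightarrow> real) \<Rightarrow> real) set" where
  "tangent_space C p = {v.
     (\<forall>f. f \<notin> C \<longrightarrow> v f = 0) \<and>
     (\<forall>f\<in>C. \<forall>g\<in>C. \<forall>a b. v (\<lambda>q. a * f q + b * g q) = a * v f + b * v g) \<and>
     (\<forall>f\<in>C. \<forall>g\<in>C. v (\<lambda>q. f q * g q) = v f * g p + f p * v g)}"

definition pullback :: "'p set \<Rightarrow> ('p \<Rightarrow> 'p) \<Rightarrow> ('p \<Rightarrow> real) \<Rightarrow> 'p \<Rightarrow> real" where
  "pullback M \<phi> f = (\<lambda>p. if p \<in> M then f (\<phi> p) else 0)"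

definition smooth_map :: "'p set \<Rightarrow> ('p \<Rightarrow> real) set \<Rightarrow> ('p \<Rightarrow> 'p) \<Rightarrow> bool" where
  "smooth_map M C \<phi> \<longleftrightarrow> (\<forall>p\<in>M. \<phi> p \<in> M) \<and> (\<forall>f\<in>C. pullback M \<phi> f \<in> C)"

definition diffeomorphism :: "'p set \<Rightarrow> ('p \<Rightarrow> real) set \<Rightarrow> ('p \<Rightarrow> 'p) \<Rightarrow> bool" where
  "diffeomorphism M C \<phi> \<longleftrightarrow>
     bij_betw \<phi> M M \<and> smooth_map M C \<phi> \<and> smooth_map M C (inv_into M \<phi>)"

text \<open>The differential of \<open>\<phi>\<close>; as a derivation, \<open>v\<close> carries its base point implicitly.\<close>

definition differential ::
  "'p set \<Rightarrow> ('p \<Rightarrow> real) set \<Rightarrow> ('p \<Rightarrow> 'p) \<Rightarrow> (('p \<Rightarrow> real) \<Rightarrow> real) \<Rightarrow> ('p \<Rightarrow> real) \<Rightarrow> real" where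
  "differential M C \<phi> v = (\<lambda>f. if f \<in> C then v (pullback M \<phi> f) else 0)"

definition smooth_vector_field ::
  "'p set \<Rightarrow> ('p \<Rightarrow> real) set \<Rightarrow> ('p \<Rightarrow> ('p \<Rightarrow> real) \<Rightarrow> real) \<Rightarrow> bool" where
  "smooth_vector_field M C X \<longleftrightarrow>
     (\<forall>p\<in>M. X p \<in> tangent_space C p) \<and>
     (\<forall>f\<in>C. (\<lambda>p. if p \<in> M then X p f else 0) \<in> C)"


section \<open>Almost complex structures\<close>

type_synonym 'p endo_field = "'p \<Rightarrow> (('p \<Rightarrow> real) \<Rightarrow> real) \<Rightarrow> (('p \<Rightarrow> real) \<Rightarrow> real)"

definition almost_complex_structure ::
  "'p set \<Rightarrow> ('p \<Rightarrow> real) set \<Rightarrow> 'p endo_field \<Rightarrow> bool" where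
  "almost_complex_structure M C J \<longleftrightarrow>
     (\<forall>p\<in>M. \<forall>v\<in>tangent_space C p. J p v \<in> tangent_space C p) \<and>
     (\<forall>p\<in>M. \<forall>v\<in>tangent_space C p. \<forall>w\<in>tangent_space C p. \<forall>a b.
        J p (\<lambda>f. a * v f + b * w f) = (\<lambda>f. a * J p v f + b * J p w f)) \<and>
     (\<forall>p\<in>M. \<forall>v\<in>tangent_space C p. J p (J p v) = (\<lambda>f. - v f)) \<and>
     (\<forall>X. smooth_vector_field M C X \<longrightarrow> smooth_vector_field M C (\<lambda>p. J p (X p)))"

definition acs_equivalent ::
  "'p set \<Rightarrow> ('p \<Rightarrow> real) set \<Rightarrow> 'p endo_field \<Rightarrow> 'p endo_field \<Rightarrow> bool" where
  "acs_equivalent M C J1 J2 \<longleftrightarrow>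
     (\<exists>\<phi>. diffeomorphism M C \<phi> \<and>
        (\<forall>p\<in>M. \<forall>v\<in>tangent_space C p.
           differential M C \<phi> (J1 p v) = J2 (\<phi> p) (differential M C \<phi> v)))"

definition acs_conjugate :: "'p endo_field \<Rightarrow> 'p endo_field" where
  "acs_conjugate J = (\<lambda>p v f. - J p v f)"

definition acs_equivalent_or_conjugate ::
  "'p set \<Rightarrow> ('p \<Rightarrow> real) set \<Rightarrow> 'p endo_field \<Rightarrow> 'p endo_field \<Rightarrow> bool" where
  "acs_equivalent_or_conjugate M C =
     equivclp (\<lambda>J1 J2. almost_complex_structure M C J1 \<and> almost_complex_structure M C J2 \<and>
       (J2 = acs_conjugate J1 \<or> acs_equivalent M C J1 J2))"


section \<open>Matrix Lie groups and their Lie algebras\<close>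

definition matrix_group :: "(real^'n^'n) set \<Rightarrow> (real^'n^'n) monoid" where
  "matrix_group U = \<lparr>carrier = U, mult = (**), one = mat 1\<rparr>"

abbreviation GL :: "(real^'n^'n) monoid" where
  "GL \<equiv> matrix_group {A. invertible A}"

definition lie_algebra :: "(real^'n^'n) set \<Rightarrow> (real^'n^'n) set" where
  "lie_algebra U = {X. \<exists>\<gamma> :: real \<Rightarrow> real^'n^'n.
     smooth_on UNIV \<gamma> \<and> (\<forall>t. \<gamma> t \<in> U) \<and> \<gamma> 0 = mat 1 \<and> (\<gamma> has_vector_derivative X) (at 0)}"

definition commutator :: "'a::ring_1^'n^'n \<Rightarrow> 'a^'n^'n \<Rightarrow> 'a^'n^'n" where
  "commutator X Y = X ** Y - Y ** X"

definition simple_lie_algebra :: "(real^'n^'n) set \<Rightarrow> bool" where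
  "simple_lie_algebra L \<longleftrightarrow>
     (\<exists>X\<in>L. \<exists>Y\<in>L. commutator X Y \<noteq> 0) \<and>
     (\<forall>I. subspace I \<and> I \<subseteq> L \<and> (\<forall>X\<in>L. \<forall>Y\<in>I. commutator X Y \<in> I) \<longrightarrow> I = {0} \<or> I = L)"

text \<open>Every compact Lie group has a faithful real matrix representation.\<close>

definition compact_simple_lie_group :: "(real^'n^'n) set \<Rightarrow> bool" where
  "compact_simple_lie_group U \<longleftrightarrow>
     subgroup U GL \<and> compact U \<and> connected U \<and> simple_lie_algebra (lie_algebra U)"

definition torus_in :: "(real^'n^'n) set \<Rightarrow> (real^'n^'n) set \<Rightarrow> bool" where
  "torus_in U T \<longleftrightarrow>
     subgroup T GL \<and> T \<subseteq> U \<and> compact T \<and> connected T \<and> (\<forall>A\<in>T. \<forall>B\<in>T. A ** B = B ** A)"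

definition maximal_torus :: "(real^'n^'n) set \<Rightarrow> (real^'n^'n) set \<Rightarrow> bool" where
  "maximal_torus U T \<longleftrightarrow> torus_in U T \<and> (\<forall>T'. torus_in U T' \<and> T \<subseteq> T' \<longrightarrow> T' = T)"


section \<open>Roots\<close>

definition complexification :: "(real^'n^'n) set \<Rightarrow> (complex^'n^'n) set" where
  "complexification L = {(\<chi> i j. Complex (X $ i $ j) (Y $ i $ j)) | X Y. X \<in> L \<and> Y \<in> L}"

definition cartan_subalgebra :: "(real^'n^'n) set \<Rightarrow> (complex^'n^'n) set" where
  "cartan_subalgebra T = complexification (lie_algebra T)"

definition root_space ::
  "(real^'n^'n) set \<Rightarrow> (real^'n^'n) set \<Rightarrow> (complex^'n^'n \<Rightarrow> complex) \<Rightarrow> (complex^'n^'n) set" where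
  "root_space U T \<alpha> = {Z \<in> complexification (lie_algebra U).
     \<forall>H\<in>cartan_subalgebra T. commutator H Z = map_matrix ((*) (\<alpha> H)) Z}"

text \<open>
  Roots are functionals on the Cartan subalgebra, extended by \<open>0\<close> so that equality of functions is
  equality of functionals. Linearity on the Cartan subalgebra follows from \<open>root_space U T \<alpha> \<noteq> {0}\<close>.
\<close>

definition roots :: "(real^'n^'n) set \<Rightarrow> (real^'n^'n) set \<Rightarrow> (complex^'n^'n \<Rightarrow> complex) set" where
  "roots U T = {\<alpha>. (\<forall>H. H \<notin> cartan_subalgebra T \<longrightarrow> \<alpha> H = 0) \<and>
     \<alpha> \<noteq> (\<lambda>H. 0) \<and> root_space U T \<alpha> \<noteq> {0}}"

definition simple_roots :: "('h \<Rightarrow> complex) set \<Rightarrow> ('h \<Rightarrow> complex) set \<Rightarrow> bool" where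
  "simple_roots R \<Delta> \<longleftrightarrow> finite \<Delta> \<and> \<Delta> \<subseteq> R \<and>
     (\<forall>c. (\<lambda>H. \<Sum>\<delta>\<in>\<Delta>. c \<delta> * \<delta> H) = (\<lambda>H. 0) \<longrightarrow> (\<forall>\<delta>\<in>\<Delta>. c \<delta> = 0)) \<and>
     (\<forall>\<beta>\<in>R. \<exists>c :: ('h \<Rightarrow> complex) \<Rightarrow> nat.
        \<beta> = (\<lambda>H. \<Sum>\<delta>\<in>\<Delta>. of_nat (c \<delta>) * \<delta> H) \<or>
        \<beta> = (\<lambda>H. - (\<Sum>\<delta>\<in>\<Delta>. of_nat (c \<delta>) * \<delta> H)))"

definition positive_roots :: "('h \<Rightarrow> complex) set \<Rightarrow> ('h \<Rightarrow> complex) set \<Rightarrow> ('h \<Rightarrow> complex) set" where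
  "positive_roots R \<Delta> =
     {\<beta>\<in>R. \<exists>c :: ('h \<Rightarrow> complex) \<Rightarrow> nat. \<beta> = (\<lambda>H. \<Sum>\<delta>\<in>\<Delta>. of_nat (c \<delta>) * \<delta> H)}"


section \<open>Homogeneous spaces and flag manifolds\<close>

text \<open>
  The connected isotropy group of a flag manifold of \<open>U\<close>, with root system \<open>\<Phi>\<close> (a finite set of
  roots closed under negation).
\<close>

definition flag_isotropy_group ::
  "(real^'n^'n) set \<Rightarrow> (real^'n^'n) set \<Rightarrow> (complex^'n^'n \<Rightarrow> complex) set \<Rightarrow> (real^'n^'n) set \<Rightarrow> bool" where
  "flag_isotropy_group U T \<Phi> K \<longleftrightarrow>
     subgroup K GL \<and> T \<subseteq> K \<and> K \<subseteq> U \<and> closed K \<and> connected K \<and>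
     complexification (lie_algebra K) =
       {H + (\<Sum>\<beta>\<in>\<Phi>. Z \<beta>) | H Z. H \<in> cartan_subalgebra T \<and> (\<forall>\<beta>\<in>\<Phi>. Z \<beta> \<in> root_space U T \<beta>)}"

definition homogeneous_space :: "(real^'n^'n) set \<Rightarrow> (real^'n^'n) set \<Rightarrow> (real^'n^'n) set set" where
  "homogeneous_space U K = lcosets\<^bsub>matrix_group U\<^esub> K"

text \<open>
  The quotient smooth structure: \<open>U \<rightarrow> U / K\<close> is a surjective submersion, so a function on \<open>U / K\<close> is
  smooth iff its lift to \<open>U\<close> is.
\<close>

definition homogeneous_smooth_functions ::
  "(real^'n^'n) set \<Rightarrow> (real^'n^'n) set \<Rightarrow> ((real^'n^'n) set \<Rightarrow> real) set" where
  "homogeneous_smooth_functions U K =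
     {f. (\<forall>x. x \<notin> homogeneous_space U K \<longrightarrow> f x = 0) \<and>
         smooth_on_submanifold U (\<lambda>g. f (g <#\<^bsub>matrix_group U\<^esub> K))}"

abbreviation left_translation ::
  "(real^'n^'n) set \<Rightarrow> real^'n^'n \<Rightarrow> (real^'n^'n) set \<Rightarrow> (real^'n^'n) set" where
  "left_translation U g \<equiv> (\<lambda>x. g <#\<^bsub>matrix_group U\<^esub> x)"

definition invariant_acs ::
  "(real^'n^'n) set \<Rightarrow> (real^'n^'n) set \<Rightarrow> (real^'n^'n) set endo_field \<Rightarrow> bool" where
  "invariant_acs U K J \<longleftrightarrow>
     (let M = homogeneous_space U K; C = homogeneous_smooth_functions U K in
      almost_complex_structure M C J \<and>
      (\<forall>g\<in>U. \<forall>p\<in>M. \<forall>v\<in>tangent_space C p.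
         differential M C (left_translation U g) (J p v) =
         J (left_translation U g p) (differential M C (left_translation U g) v)))"

end

theory Submission imports Defs begin

text \<open>Let \<open>H0\<close> span the centre of the isotropy algebra, normalised by \<open>\<alpha>\<^sub>1(H0) = 0\<close> and
  \<open>\<alpha>\<^sub>2(H0) = i\<close>. Then \<open>ad H0\<close> grades the complexified algebra by \<open>-3, \<dots>, 3\<close>, with the isotropy algebra
  in degree 0 and the three isotropy summands in degrees \<open>\<plusminus>1\<close>, \<open>\<plusminus>2\<close>, \<open>\<plusminus>3\<close>. A choice of signs
  \<open>e\<^sub>1, e\<^sub>2, e\<^sub>3\<close> (extended oddly, with \<open>e\<^sub>0 = 0\<close>) gives the invariant structure that is multiplication by
  \<open>i e\<^sub>k\<close> in degree \<open>k\<close>. Its Nijenhuis tensor on degrees \<open>a, b\<close> is the bracket multiplied by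
  \<open>- e\<^sub>a e\<^sub>b + (e\<^sub>a + e\<^sub>b) e\<^bsub>a+b\<^esub> - 1\<close>, modulo the isotropy algebra. For the signs \<open>(+,+,+)\<close> it vanishes; for
  \<open>(+,-,+)\<close> it is non-zero but takes no values in degrees \<open>\<plusminus>3\<close>; for \<open>(+,+,-)\<close> its values span the
  tangent space, because the brackets between the root spaces involved are non-zero. These three properties
  are preserved by equivalence and by conjugation.

  The analytic part identifies the tangent vectors, which are derivations of the algebra of smooth functions,
  with velocities of curves \<open>g exp (s A) K\<close>. For this \<open>U / K\<close> is mapped to the adjoint orbit of \<open>H0\<close>, whose
  stabiliser has the Lie algebra of \<open>K\<close>.\<close>

section \<open>Functions with iterated derivatives\<close>

text \<open>For nonzero degrees a, b and c = a + b within -3, ..., 3, the factor of the bracket is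
  -4 if \<open>e_a = e_b = - e_c\<close> and 0 in all other cases. The signs (+,+,+) admit no such
  triple, (+,-,+) only the rearrangements of 1 + 1 = 2, and (+,+,-) those of 1 + 2 = 3, which reach
  every degree. The fourth choice up to a global sign, (+,-,-), has the same pattern as (+,-,+), so
  the two invariants do not separate it; hence three structures. The obstacle is that a
  diffeomorphism need not respect the group action. The structures can only be told apart by
  properties stated for arbitrary smooth fields, so the Nijenhuis tensor is defined over the bare
  function algebra, and its computation on the Lie algebra requires that all derivations and all
  smooth fields are known, not merely the invariant ones. The root theory (one-dimensional root
  spaces, nonvanishing brackets) is extracted from a single source of positivity: compactness of
  \<open>U\<close> makes the trace form negative definite on its Lie algebra.\<close>

lemma td_Suc_diffD: "times_differentiable_on (Suc k) S f \<Longrightarrow> x \<in> S \<Longrightarrow> f differentiable at x"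
  by simp

text \<open>\<open>frechet_derivative f (at x)\<close> sees a full neighbourhood of
  \<open>x\<close>, which openness of \<open>S\<close> provides. The induction generalises over both
  functions because it passes to their directional derivatives.\<close>

lemma td_cong:
  assumes "open S" "\<And>x. x \<in> S \<Longrightarrow> f x = g x" "times_differentiable_on k S f"
  shows "times_differentiable_on k S g"
  using assms
proof (induction k arbitrary: f g)
  case 0
  then show ?case using continuous_on_cong by (metis times_differentiable_on.simps(1))
next
  case (Suc k)
  have d: "(g has_derivative frechet_derivative f (at x)) (at x)" if "x \<in> S" for x
    using Suc.prems that
    by (metis frechet_derivative_works has_derivative_transform_within_open td_Suc_diffD)
  then have e: "frechet_derivative f (at x) = frechet_derivative g (at x)" if "x \<in> S" for x
    using frechet_derivative_at that by blast
  have "times_differentiable_on k S (\<lambda>x. frechet_derivative g (at x) v)" for v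
    by (rule Suc.IH[where f = "\<lambda>x. frechet_derivative f (at x) v"]) (use Suc.prems e in auto)
  then show ?case using d unfolding times_differentiable_on.simps differentiable_def by blast
qed

lemma td_subset:
  "times_differentiable_on k S f \<Longrightarrow> T \<subseteq> S \<Longrightarrow> times_differentiable_on k T f"
  by (induction k arbitrary: f) (auto intro: continuous_on_subset)

lemma td_SucD: "times_differentiable_on (Suc k) S f \<Longrightarrow> times_differentiable_on k S f"
proof (induction k arbitrary: f)
  case 0
  then show ?case
    by (auto intro!: continuous_at_imp_continuous_on differentiable_imp_continuous_within)
next
  case (Suc k)
  then show ?case unfolding times_differentiable_on.simps by blast
qed

text \<open>The definition speaks of the derivative chosen by \<open>frechet_derivative\<close>;
  uniqueness of derivatives allows any explicit candidate \<open>f'\<close> instead, so that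
  inductions can run on formulas.\<close>

lemma td_SucI:
  assumes "\<And>x. x \<in> S \<Longrightarrow> (f has_derivative f' x) (at x)" "open S"
    "\<And>v. times_differentiable_on k S (\<lambda>x. f' x v)"
  shows "times_differentiable_on (Suc k) S f"
proof -
  have "times_differentiable_on k S (\<lambda>x. frechet_derivative f (at x) v)" for v
    by (rule td_cong[OF assms(2) _ assms(3)[of v]]) (use assms(1) frechet_derivative_at in metis)
  then show ?thesis using assms(1) unfolding times_differentiable_on.simps differentiable_def by blast
qed

lemma td_Suc_iff:
  assumes "open S"
  shows "times_differentiable_on (Suc k) S f \<longleftrightarrow> (\<exists>f'. (\<forall>x\<in>S. (f has_derivative f' x) (at x)) \<and>
    (\<forall>v. times_differentiable_on k S (\<lambda>x. f' x v)))"
  using td_SucI[OF _ assms] frechet_derivative_works by (metis times_differentiable_on.simps(2))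

lemma td_const: "times_differentiable_on k S (\<lambda>x. c)"
  by (induction k arbitrary: c) (auto simp: frechet_derivative_const)

lemma td_bounded_linear:
  assumes "bounded_linear h" shows "times_differentiable_on k S h"
proof (cases k)
  case 0
  then show ?thesis using assms by (simp add: linear_continuous_on)
next
  case (Suc j)
  have "frechet_derivative h (at x) = h" for x
    using bounded_linear_imp_has_derivative[OF assms] frechet_derivative_at by metis
  then show ?thesis
    using Suc assms bounded_linear_imp_differentiable by (auto intro: td_const)
qed

lemma td_bounded_linear_compose:
  assumes "bounded_linear h" "open S" "times_differentiable_on k S f"
  shows "times_differentiable_on k S (\<lambda>x. h (f x))"
  using assms(3)
proof (induction k arbitrary: f)
  case 0
  then show ?case using assms(1) bounded_linear.continuous_on by auto
next
  case (Suc k)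
  then obtain f' where "\<forall>x\<in>S. (f has_derivative f' x) (at x)"
      and f': "\<forall>v. times_differentiable_on k S (\<lambda>x. f' x v)"
    using td_Suc_iff[OF assms(2)] by blast
  then show ?case
    by (intro td_SucI[where f' = "\<lambda>x v. h (f' x v)"])
      (auto intro: Suc.IH assms bounded_linear.has_derivative)
qed

lemma td_add:
  assumes "open S" "times_differentiable_on k S f" "times_differentiable_on k S g"
  shows "times_differentiable_on k S (\<lambda>x. f x + g x)"
  using assms(2,3)
proof (induction k arbitrary: f g)
  case 0
  then show ?case by (auto intro: continuous_intros)
next
  case (Suc k)
  obtain f' g' where "\<forall>x\<in>S. (f has_derivative f' x) (at x)" "\<forall>x\<in>S. (g has_derivative g' x) (at x)"
      "\<forall>v. times_differentiable_on k S (\<lambda>x. f' x v)" "\<forall>v. times_differentiable_on k S (\<lambda>x. g' x v)"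
    using td_Suc_iff[OF assms(1)] Suc.prems by metis
  then show ?case
    by (intro td_SucI[where f' = "\<lambda>x v. f' x v + g' x v"] Suc.IH assms(1) has_derivative_add) auto
qed

lemma td_bilinear:
  assumes "bounded_bilinear pr" "open S"
    "times_differentiable_on k S f" "times_differentiable_on k S g"
  shows "times_differentiable_on k S (\<lambda>x. pr (f x) (g x))"
  using assms(3,4)
proof (induction k arbitrary: f g)
  case 0
  then show ?case using bounded_bilinear.continuous_on[OF assms(1)] by auto
next
  case (Suc k)
  obtain f' g' where fg: "\<forall>x\<in>S. (f has_derivative f' x) (at x)" "\<forall>x\<in>S. (g has_derivative g' x) (at x)"
      "\<forall>v. times_differentiable_on k S (\<lambda>x. f' x v)" "\<forall>v. times_differentiable_on k S (\<lambda>x. g' x v)"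
    using td_Suc_iff[OF assms(2)] Suc.prems by metis
  have fk: "times_differentiable_on k S f" "times_differentiable_on k S g"
    using Suc.prems td_SucD by blast+
  show ?case
    by (intro td_SucI[where f' = "\<lambda>x v. pr (f x) (g' x v) + pr (f' x v) (g x)"] td_add
        Suc.IH assms(2) bounded_bilinear.FDERIV[OF assms(1)]) (use fg fk in auto)
qed

lemma td_sum:
  assumes "open S" "\<And>i. i \<in> I \<Longrightarrow> times_differentiable_on k S (f i)"
  shows "times_differentiable_on k S (\<lambda>x. \<Sum>i\<in>I. f i x)"
  using assms(2)
  by (induction I rule: infinite_finite_induct) (auto intro: td_const td_add[OF assms(1)])

text \<open>In the chain rule \<open>f' (g x) (g' x v)\<close> the direction depends on
  \<open>x\<close>, so the induction hypothesis does not apply to it directly. Expanding it in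
  \<open>Basis\<close> gives a sum of products of \<open>g' x v \<bullet> b\<close> with composites
  of partial derivatives of \<open>f\<close>; this is where the Euclidean space in the middle
  enters.\<close>

lemma td_compose:
  fixes f :: "'b::euclidean_space \<Rightarrow> 'c::real_normed_vector"
  assumes "open S" "open T" "g ` S \<subseteq> T" "times_differentiable_on k T f" "times_differentiable_on k S g"
  shows "times_differentiable_on k S (\<lambda>x. f (g x))"
  using assms(4,5)
proof (induction k arbitrary: f)
  case 0
  then show ?case using assms(3) continuous_on_compose2 by (metis times_differentiable_on.simps(1))
next
  case (Suc k)
  obtain f' g' where fg: "\<forall>x\<in>T. (f has_derivative f' x) (at x)" "\<forall>x\<in>S. (g has_derivative g' x) (at x)"
      "\<forall>v. times_differentiable_on k T (\<lambda>x. f' x v)" "\<forall>v. times_differentiable_on k S (\<lambda>x. g' x v)"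
    using Suc.prems td_Suc_iff[OF assms(1)] td_Suc_iff[OF assms(2)] by metis
  have eq: "f' (g x) (g' x v) = (\<Sum>b\<in>Basis. (g' x v \<bullet> b) *\<^sub>R f' (g x) b)" if "x \<in> S" for x v
  proof -
    have l: "linear (f' (g x))"
      using fg(1) assms(3) that by (auto intro: has_derivative_linear)
    have "f' (g x) (\<Sum>b\<in>Basis. (g' x v \<bullet> b) *\<^sub>R b) = (\<Sum>b\<in>Basis. (g' x v \<bullet> b) *\<^sub>R f' (g x) b)"
      by (simp add: linear_sum[OF l] linear_cmul[OF l])
    then show ?thesis by (simp add: euclidean_representation)
  qed
  have gk: "times_differentiable_on k S g" using Suc.prems td_SucD by blast
  show ?case
  proof (rule td_SucI[where f' = "\<lambda>x v. f' (g x) (g' x v)"])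
    fix x assume "x \<in> S"
    then have "(g has_derivative g' x) (at x)" "(f has_derivative f' (g x)) (at (g x))"
      using fg(1,2) assms(3) by auto
    then show "((\<lambda>x. f (g x)) has_derivative (\<lambda>v. f' (g x) (g' x v))) (at x)"
      by (rule has_derivative_compose)
  next
    fix v
    have "times_differentiable_on k S (\<lambda>x. f' (g x) b)" for b
      by (rule Suc.IH[OF fg(3)[rule_format] gk])
    moreover have "times_differentiable_on k S (\<lambda>x. g' x v \<bullet> b)" for b
      by (rule td_bounded_linear_compose[OF bounded_linear_inner_left assms(1) fg(4)[rule_format]])
    ultimately have "times_differentiable_on k S (\<lambda>x. \<Sum>b\<in>Basis. (g' x v \<bullet> b) *\<^sub>R f' (g x) b)"
      by (intro td_sum td_bilinear[OF bounded_bilinear_scaleR] assms(1))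
    then show "times_differentiable_on k S (\<lambda>x. f' (g x) (g' x v))"
      by (rule td_cong[OF assms(1) eq[symmetric], rotated])
  qed fact
qed

section \<open>Calculus rules for smooth maps\<close>

lemma smooth_on_cong: "open S \<Longrightarrow> smooth_on S f \<Longrightarrow> (\<And>x. x \<in> S \<Longrightarrow> f x = g x) \<Longrightarrow> smooth_on S g"
  unfolding smooth_on_def using td_cong by blast

lemma smooth_on_subset: "smooth_on S f \<Longrightarrow> T \<subseteq> S \<Longrightarrow> smooth_on T f"
  unfolding smooth_on_def using td_subset by blast

lemma smooth_on_const [simp]: "smooth_on S (\<lambda>x. c)"
  unfolding smooth_on_def using td_const by blast

lemma smooth_on_bounded_linear: "bounded_linear h \<Longrightarrow> smooth_on S h"
  unfolding smooth_on_def using td_bounded_linear by blast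

lemma smooth_on_ident [simp]: "smooth_on S (\<lambda>x. x)"
  by (simp add: smooth_on_bounded_linear bounded_linear_ident)

lemma smooth_on_bounded_linear_compose:
  "bounded_linear h \<Longrightarrow> open S \<Longrightarrow> smooth_on S f \<Longrightarrow> smooth_on S (\<lambda>x. h (f x))"
  unfolding smooth_on_def using td_bounded_linear_compose by blast

lemma smooth_on_add: "open S \<Longrightarrow> smooth_on S f \<Longrightarrow> smooth_on S g \<Longrightarrow> smooth_on S (\<lambda>x. f x + g x)"
  unfolding smooth_on_def using td_add by blast

lemma smooth_on_bilinear:
  "bounded_bilinear pr \<Longrightarrow> open S \<Longrightarrow> smooth_on S f \<Longrightarrow> smooth_on S g \<Longrightarrow> smooth_on S (\<lambda>x. pr (f x) (g x))"
  unfolding smooth_on_def using td_bilinear by blast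

lemma smooth_on_sum: "open S \<Longrightarrow> (\<And>i. i \<in> I \<Longrightarrow> smooth_on S (f i)) \<Longrightarrow> smooth_on S (\<lambda>x. \<Sum>i\<in>I. f i x)"
  unfolding smooth_on_def by (intro allI td_sum) auto

lemma smooth_on_compose:
  fixes f :: "'b::euclidean_space \<Rightarrow> 'c::real_normed_vector"
  shows "smooth_on T f \<Longrightarrow> smooth_on S g \<Longrightarrow> open S \<Longrightarrow> open T \<Longrightarrow> g ` S \<subseteq> T \<Longrightarrow> smooth_on S (\<lambda>x. f (g x))"
  unfolding smooth_on_def by (intro allI td_compose[of S T g _ f]) auto

lemma smooth_on_scaleR: "open S \<Longrightarrow> smooth_on S f \<Longrightarrow> smooth_on S g \<Longrightarrow> smooth_on S (\<lambda>x. f x *\<^sub>R g x)"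
  using smooth_on_bilinear[OF bounded_bilinear_scaleR] .

lemma smooth_on_mult:
  fixes f g :: "_ \<Rightarrow> 'b::real_normed_algebra"
  shows "open S \<Longrightarrow> smooth_on S f \<Longrightarrow> smooth_on S g \<Longrightarrow> smooth_on S (\<lambda>x. f x * g x)"
  using smooth_on_bilinear[OF bounded_bilinear_mult] .

lemma smooth_on_uminus: "open S \<Longrightarrow> smooth_on S f \<Longrightarrow> smooth_on S (\<lambda>x. - f x)"
  using smooth_on_bounded_linear_compose[OF bounded_linear_minus[OF bounded_linear_ident]] .

lemma smooth_on_diff: "open S \<Longrightarrow> smooth_on S f \<Longrightarrow> smooth_on S g \<Longrightarrow> smooth_on S (\<lambda>x. f x - g x)"
  using smooth_on_add[of S f "\<lambda>x. - g x"] smooth_on_uminus[of S g] by simp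

lemma smooth_on_prod:
  fixes f :: "_ \<Rightarrow> _ \<Rightarrow> 'b::{real_normed_algebra_1, comm_ring_1}"
  assumes "open S" "\<And>i. i \<in> I \<Longrightarrow> smooth_on S (f i)"
  shows "smooth_on S (\<lambda>x. \<Prod>i\<in>I. f i x)"
  using assms(2)
  by (induction I rule: infinite_finite_induct) (auto intro: smooth_on_mult[OF assms(1)])

lemma smooth_on_differentiable: "smooth_on S f \<Longrightarrow> x \<in> S \<Longrightarrow> f differentiable at x"
  unfolding smooth_on_def using td_Suc_diffD by blast

lemma smooth_on_has_derivative:
  "smooth_on S f \<Longrightarrow> x \<in> S \<Longrightarrow> (f has_derivative frechet_derivative f (at x)) (at x)"
  using smooth_on_differentiable frechet_derivative_works by blast

lemma smooth_on_continuous: "smooth_on S f \<Longrightarrow> continuous_on S f"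
  unfolding smooth_on_def using times_differentiable_on.simps(1) by blast

lemma smooth_on_frechet: "smooth_on S f \<Longrightarrow> smooth_on S (\<lambda>x. frechet_derivative f (at x) v)"
  unfolding smooth_on_def using times_differentiable_on.simps(2) by blast

lemma smooth_on_frechet_apply:
  fixes f :: "'a::euclidean_space \<Rightarrow> 'b::real_normed_vector"
  assumes "smooth_on S f" "smooth_on S w" "open S"
  shows "smooth_on S (\<lambda>x. frechet_derivative f (at x) (w x))"
proof (rule smooth_on_cong[OF assms(3)])
  show "smooth_on S (\<lambda>x. \<Sum>b\<in>Basis. (w x \<bullet> b) *\<^sub>R frechet_derivative f (at x) b)"
    by (intro smooth_on_sum smooth_on_scaleR smooth_on_frechet
        smooth_on_bounded_linear_compose[OF bounded_linear_inner_left] assms)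
  fix x assume "x \<in> S"
  then have l: "linear (frechet_derivative f (at x))"
    using smooth_on_has_derivative[OF assms(1)] has_derivative_linear by blast
  have "frechet_derivative f (at x) (\<Sum>b\<in>Basis. (w x \<bullet> b) *\<^sub>R b) = (\<Sum>b\<in>Basis. (w x \<bullet> b) *\<^sub>R frechet_derivative f (at x) b)"
    by (simp add: linear_sum[OF l] linear_cmul[OF l])
  then show "(\<Sum>b\<in>Basis. (w x \<bullet> b) *\<^sub>R frechet_derivative f (at x) b) = frechet_derivative f (at x) (w x)"
    by (simp add: euclidean_representation)
qed

lemma smooth_on_componentwise:
  fixes f :: "_ \<Rightarrow> 'b::euclidean_space"
  assumes "open S" "\<And>b. b \<in> Basis \<Longrightarrow> smooth_on S (\<lambda>x. f x \<bullet> b)"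
  shows "smooth_on S f"
proof (rule smooth_on_cong[OF assms(1)])
  show "smooth_on S (\<lambda>x. \<Sum>b\<in>Basis. (f x \<bullet> b) *\<^sub>R b)"
    by (intro smooth_on_sum smooth_on_scaleR assms smooth_on_const)
qed (simp add: euclidean_representation)

lemma smooth_on_vec:
  fixes f :: "_ \<Rightarrow> 'b::euclidean_space^'m"
  assumes "open S" "\<And>i. smooth_on S (\<lambda>x. f x $ i)"
  shows "smooth_on S f"
proof (rule smooth_on_componentwise[OF assms(1)])
  fix b :: "'b^'m" assume "b \<in> Basis"
  then obtain i u where "b = axis i u" "u \<in> Basis" unfolding Basis_vec_def by auto
  then have "(\<lambda>x. f x \<bullet> b) = (\<lambda>x. f x $ i \<bullet> u)" by (simp add: inner_axis)
  then show "smooth_on S (\<lambda>x. f x \<bullet> b)"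
    using smooth_on_bounded_linear_compose[OF bounded_linear_inner_left assms] by simp
qed

lemma smooth_on_matrix:
  fixes f :: "_ \<Rightarrow> real^'n^'m"
  assumes "open S" "\<And>i j. smooth_on S (\<lambda>x. f x $ i $ j)"
  shows "smooth_on S f"
  by (intro smooth_on_vec assms)

lemma smooth_on_nth: "open S \<Longrightarrow> smooth_on S f \<Longrightarrow> smooth_on S (\<lambda>x. f x $ i)"
  using smooth_on_bounded_linear_compose[OF bounded_linear_vec_nth] .

lemma smooth_on_inverse: "smooth_on {x::real. x \<noteq> 0} inverse"
proof -
  have o: "open {x::real. x \<noteq> 0}"
    using open_Compl[of "{0::real}"] by (simp add: Compl_eq)
  have "times_differentiable_on k {x::real. x \<noteq> 0} inverse" for k
  proof (induction k)
    case 0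
    then show ?case by (auto intro!: continuous_intros)
  next
    case (Suc k)
    show ?case
      by (rule td_SucI[where f' = "\<lambda>x v. - (inverse x * v * inverse x)"])
        (auto intro!: has_derivative_inverse' o td_bilinear[OF bounded_bilinear_mult] td_const Suc
          td_bounded_linear_compose[OF bounded_linear_minus[OF bounded_linear_ident]])
  qed
  then show ?thesis by (simp add: smooth_on_def)
qed

lemma smooth_on_divide:
  fixes f g :: "'a::real_normed_vector \<Rightarrow> real"
  assumes "open S" "smooth_on S f" "smooth_on S g" "\<And>x. x \<in> S \<Longrightarrow> g x \<noteq> 0"
  shows "smooth_on S (\<lambda>x. f x / g x)"
proof -
  have o: "open {x::real. x \<noteq> 0}"
    using open_Compl[of "{0::real}"] by (simp add: Compl_eq)
  show ?thesis unfolding divide_inverse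
    by (intro smooth_on_mult assms smooth_on_compose[OF smooth_on_inverse assms(3) assms(1) o]) (use assms in auto)
qed

section \<open>Smoothness of determinants, products and inverses of matrices\<close>

lemma smooth_on_det:
  fixes f :: "_ \<Rightarrow> real^'n^'n"
  assumes "open S" "smooth_on S f"
  shows "smooth_on S (\<lambda>x. det (f x))"
  unfolding det_def
  by (intro smooth_on_sum smooth_on_mult smooth_on_prod smooth_on_const assms smooth_on_nth)

lemma bounded_bilinear_matrix_matrix_mult:
  "bounded_bilinear ((**) :: real^'n^'m \<Rightarrow> real^'p^'n \<Rightarrow> real^'p^'m)"
  by (rule bilinear_conv_bounded_bilinear[THEN iffD1])
    (auto simp: bilinear_def matrix_matrix_mult_def vec_eq_iff sum.distrib algebra_simps
      sum_distrib_left intro!: linearI)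

lemma bounded_bilinear_matrix_vector_mult:
  "bounded_bilinear ((*v) :: real^'n^'m \<Rightarrow> real^'n \<Rightarrow> real^'m)"
  by (rule bilinear_conv_bounded_bilinear[THEN iffD1])
    (auto simp: bilinear_def intro!: linearI simp: algebra_simps scaleR_matrix_vector_assoc)

lemmas smooth_on_matrix_mult = smooth_on_bilinear[OF bounded_bilinear_matrix_matrix_mult]

lemma matrix_inv_left: "invertible A \<Longrightarrow> matrix_inv A ** A = mat 1"
  and matrix_inv_right: "invertible A \<Longrightarrow> A ** matrix_inv A = mat 1"
  unfolding invertible_def matrix_inv_def by (metis (mono_tags, lifting) someI_ex)+

lemma matrix_inv_unique:
  fixes A :: "'a::semiring_1^'n^'n"
  assumes "A ** B = mat 1" "B ** A = mat 1"
  shows "matrix_inv A = B"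
proof -
  have "invertible A" using assms unfolding invertible_def by blast
  then show ?thesis
    by (metis assms(1) matrix_inv_left matrix_mul_assoc matrix_mul_lid matrix_mul_rid)
qed

lemma open_invertible: "open {A :: real^'n^'n. invertible A}"
proof -
  have "open {A :: real^'n^'n. det A \<noteq> 0}"
    by (intro open_Collect_neq continuous_on_const smooth_on_continuous smooth_on_det) auto
  then show ?thesis by (simp add: invertible_det_nz)
qed

text \<open>By Cramer's rule every entry of the inverse is a quotient of determinants in the
  entries, with the nonvanishing denominator \<open>det (f x)\<close>.\<close>

lemma smooth_on_matrix_inv:
  fixes f :: "_ \<Rightarrow> real^'n^'n"
  assumes S: "open S" and f: "smooth_on S f" and inv: "\<And>x. x \<in> S \<Longrightarrow> invertible (f x)"
  shows "smooth_on S (\<lambda>x. matrix_inv (f x))"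
proof (rule smooth_on_matrix[OF S])
  fix k l
  let ?c = "\<lambda>x. det (\<chi> i j. if j = k then axis l 1 $ i else f x $ i $ j) / det (f x)"
  have "smooth_on S ?c"
  proof (intro smooth_on_divide S smooth_on_det f)
    show "smooth_on S (\<lambda>x. \<chi> i j. if j = k then axis l 1 $ i else f x $ i $ j)"
    proof (rule smooth_on_matrix[OF S])
      fix i j
      show "smooth_on S (\<lambda>x. (\<chi> i j. if j = k then axis l 1 $ i else f x $ i $ j) $ i $ j)"
        using smooth_on_nth[OF S smooth_on_nth[OF S f]] by (cases "j = k") auto
    qed
    show "det (f x) \<noteq> 0" if "x \<in> S" for x using inv[OF that] by (simp add: invertible_det_nz)
  qed
  then show "smooth_on S (\<lambda>x. matrix_inv (f x) $ k $ l)"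
  proof (rule smooth_on_cong[OF S])
    fix x assume "x \<in> S"
    then have i: "invertible (f x)" "det (f x) \<noteq> 0" using inv by (auto simp: invertible_det_nz)
    have "f x *v (matrix_inv (f x) *v axis l 1) = axis l 1"
      by (simp add: matrix_vector_mul_assoc matrix_inv_right i)
    then have "matrix_inv (f x) *v axis l 1 = (\<chi> k. det (\<chi> i j. if j = k then axis l 1 $ i else f x $ i $ j) / det (f x))"
      using cramer[OF i(2)] by blast
    then show "?c x = matrix_inv (f x) $ k $ l"
      by (simp add: vec_eq_iff matrix_vector_mul_component inner_axis)
  qed
qed

section \<open>Hadamard's lemma, bump functions and smooth local inverses\<close>

text \<open>The second difference \<open>F (x + s u + s v) - F (x + s u) - F (x + s v) + F x\<close>
  is symmetric in \<open>u\<close> and \<open>v\<close>, and two applications of the mean value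
  theorem express it as \<open>s * s\<close> times a mixed second derivative at a nearby point.
  Continuity of both mixed derivatives does the rest.\<close>

lemma symmetric_second_derivative:
  fixes F :: "'a::euclidean_space \<Rightarrow> real"
  assumes W: "open W" "x \<in> W" and F: "smooth_on W F"
  shows "frechet_derivative (\<lambda>y. frechet_derivative F (at y) u) (at x) v =
         frechet_derivative (\<lambda>y. frechet_derivative F (at y) v) (at x) u"
proof -
  define D where "D u v y = frechet_derivative (\<lambda>y. frechet_derivative F (at y) u) (at y) v" for u v y
  have near: "\<exists>p. dist p x < e \<and> F (x + s *\<^sub>R u + s *\<^sub>R v) - F (x + s *\<^sub>R u) - F (x + s *\<^sub>R v) + F x = s * (s * D u v p)"
    if e: "e > 0" "ball x e \<subseteq> W" and s: "s > 0" "s * (norm u + norm v) < e" for e s u v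
  proof -
    have inb: "x + a *\<^sub>R u + b *\<^sub>R v \<in> ball x e" if "0 \<le> a" "a \<le> s" "0 \<le> b" "b \<le> s" for a b
    proof -
      have "norm (a *\<^sub>R u + b *\<^sub>R v) \<le> a * norm u + b * norm v"
        using that by (intro norm_triangle_le) simp
      also have "\<dots> \<le> s * (norm u + norm v)" using that by (simp add: distrib_left add_mono mult_right_mono)
      finally have "norm (a *\<^sub>R u + b *\<^sub>R v) < e" using s by linarith
      moreover have "x - (x + a *\<^sub>R u + b *\<^sub>R v) = - (a *\<^sub>R u + b *\<^sub>R v)" by simp
      ultimately show ?thesis by (metis dist_norm mem_ball norm_minus_cancel)
    qed
    have dF: "((\<lambda>t. F (y + t *\<^sub>R w)) has_real_derivative frechet_derivative F (at (y + t *\<^sub>R w)) w) (at t)"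
      if "y + t *\<^sub>R w \<in> W" for y t w
    proof -
      have "((\<lambda>t. F (y + t *\<^sub>R w)) has_derivative (\<lambda>h. frechet_derivative F (at (y + t *\<^sub>R w)) (h *\<^sub>R w))) (at t)"
        by (rule has_derivative_compose[where f = "\<lambda>t. y + t *\<^sub>R w", OF _ smooth_on_has_derivative[OF F that]]) (auto intro!: derivative_eq_intros)
      moreover have "linear (frechet_derivative F (at (y + t *\<^sub>R w)))"
        using smooth_on_has_derivative[OF F that] has_derivative_linear by blast
      ultimately show ?thesis
        by (simp add: has_field_derivative_def linear_cmul mult_commute_abs)
    qed
    have dF2: "((\<lambda>t. frechet_derivative F (at (y + t *\<^sub>R w)) u) has_real_derivative D u w (y + t *\<^sub>R w)) (at t)"
      if "y + t *\<^sub>R w \<in> W" for y t w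
    proof -
      note sm = smooth_on_has_derivative[OF smooth_on_frechet[OF F] that]
      have "((\<lambda>t. frechet_derivative F (at (y + t *\<^sub>R w)) u) has_derivative (\<lambda>h. D u (h *\<^sub>R w) (y + t *\<^sub>R w))) (at t)"
        unfolding D_def
        by (rule has_derivative_compose[where f = "\<lambda>t. y + t *\<^sub>R w", OF _ sm]) (auto intro!: derivative_eq_intros)
      moreover have "linear (\<lambda>w'. D u w' (y + t *\<^sub>R w))"
        using sm has_derivative_linear unfolding D_def by blast
      then have "(\<lambda>h. D u (h *\<^sub>R w) (y + t *\<^sub>R w)) = (*) (D u w (y + t *\<^sub>R w))"
        using linear_cmul by (fastforce simp: mult.commute)
      ultimately show ?thesis by (simp add: has_field_derivative_def)
    qed
    define \<phi> where "\<phi> = (\<lambda>t. F ((x + s *\<^sub>R v) + t *\<^sub>R u) - F (x + t *\<^sub>R u))"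
    have "\<exists>z. 0 < z \<and> z < s \<and> \<phi> s - \<phi> 0 = (s - 0) *
       (frechet_derivative F (at ((x + s *\<^sub>R v) + z *\<^sub>R u)) u - frechet_derivative F (at (x + z *\<^sub>R u)) u)"
    proof (rule MVT2[OF s(1)])
      fix t assume t: "0 \<le> t" "t \<le> s"
      have "(x + s *\<^sub>R v) + t *\<^sub>R u \<in> W" "x + t *\<^sub>R u \<in> W"
        using inb[of t s] inb[of t 0] e(2) t s by (auto simp: algebra_simps)
      then show "(\<phi> has_real_derivative frechet_derivative F (at ((x + s *\<^sub>R v) + t *\<^sub>R u)) u -
          frechet_derivative F (at (x + t *\<^sub>R u)) u) (at t)"
        unfolding \<phi>_def by (intro DERIV_diff dF)
    qed
    then obtain z where z: "0 < z" "z < s" "\<phi> s - \<phi> 0 = s *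
       (frechet_derivative F (at ((x + z *\<^sub>R u) + s *\<^sub>R v)) u - frechet_derivative F (at (x + z *\<^sub>R u + 0 *\<^sub>R v)) u)"
      by (auto simp: add_ac)
    have "\<exists>y. 0 < y \<and> y < s \<and> frechet_derivative F (at ((x + z *\<^sub>R u) + s *\<^sub>R v)) u - frechet_derivative F (at (x + z *\<^sub>R u + 0 *\<^sub>R v)) u
       = (s - 0) * D u v (x + z *\<^sub>R u + y *\<^sub>R v)"
    proof (rule MVT2[OF s(1)])
      fix t assume t: "0 \<le> t" "t \<le> s"
      have "(x + z *\<^sub>R u) + t *\<^sub>R v \<in> W"
        using inb[of z t] e(2) t z by auto
      then show "((\<lambda>t. frechet_derivative F (at (x + z *\<^sub>R u + t *\<^sub>R v)) u) has_real_derivative D u v (x + z *\<^sub>R u + t *\<^sub>R v)) (at t)"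
        by (rule dF2)
    qed
    then obtain y where y: "0 < y" "y < s" "frechet_derivative F (at ((x + z *\<^sub>R u) + s *\<^sub>R v)) u - frechet_derivative F (at (x + z *\<^sub>R u + 0 *\<^sub>R v)) u
       = s * D u v (x + z *\<^sub>R u + y *\<^sub>R v)" by auto
    have "dist (x + z *\<^sub>R u + y *\<^sub>R v) x < e" using inb[of z y] z y by (simp add: dist_commute)
    moreover have "F (x + s *\<^sub>R u + s *\<^sub>R v) - F (x + s *\<^sub>R u) - F (x + s *\<^sub>R v) + F x = \<phi> s - \<phi> 0"
      by (simp add: \<phi>_def algebra_simps)
    ultimately show ?thesis using z(3) y(3) by metis
  qed
  obtain e0 where e0: "e0 > 0" "ball x e0 \<subseteq> W" using W openE by blast
  have cont: "isCont (D u v) x" for u v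
  proof -
    have "continuous_on W (D u v)" unfolding D_def
      by (intro smooth_on_continuous smooth_on_frechet F)
    then show ?thesis using W continuous_on_eq_continuous_at by blast
  qed
  have "\<bar>D u v x - D v u x\<bar> \<le> \<epsilon>" if eps: "\<epsilon> > 0" for \<epsilon>
  proof -
    obtain d1 where d1: "d1 > 0" "\<And>p. dist p x < d1 \<Longrightarrow> dist (D u v p) (D u v x) < \<epsilon>/2"
      using cont[of u v, unfolded continuous_at_eps_delta, rule_format, of "\<epsilon>/2"] eps by auto
    obtain d2 where d2: "d2 > 0" "\<And>p. dist p x < d2 \<Longrightarrow> dist (D v u p) (D v u x) < \<epsilon>/2"
      using cont[of v u, unfolded continuous_at_eps_delta, rule_format, of "\<epsilon>/2"] eps by auto
    define e where "e = min e0 (min d1 d2)"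
    have e: "e > 0" "ball x e \<subseteq> W" using e0 d1(1) d2(1) unfolding e_def by auto
    \<comment> \<open>The summand 1 keeps the denominator positive when \<open>u = v = 0\<close> and
      makes the bound \<open>s * (norm u + norm v) < e\<close> strict.\<close>
    define s where "s = e / (norm u + norm v + 1)"
    have n: "norm u + norm v + 1 > 0" by (simp add: add_nonneg_pos)
    have s: "s > 0" using e(1) n by (simp add: s_def)
    have "s * (norm u + norm v + 1) = e" using n by (simp add: s_def)
    with s have s2: "s * (norm u + norm v) < e" "s * (norm v + norm u) < e" by (auto simp: algebra_simps)
    obtain p where p: "dist p x < e" "F (x + s *\<^sub>R u + s *\<^sub>R v) - F (x + s *\<^sub>R u) - F (x + s *\<^sub>R v) + F x = s * (s * D u v p)"
      using near[OF e s s2(1)] by blast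
    obtain q where q: "dist q x < e" "F (x + s *\<^sub>R v + s *\<^sub>R u) - F (x + s *\<^sub>R v) - F (x + s *\<^sub>R u) + F x = s * (s * D v u q)"
      using near[OF e s s2(2)] by blast
    have "x + s *\<^sub>R v + s *\<^sub>R u = x + s *\<^sub>R u + s *\<^sub>R v" by (simp add: add_ac)
    then have "s * (s * D u v p) = s * (s * D v u q)" using p(2) q(2) by (simp add: algebra_simps)
    then have "D u v p = D v u q" using s by simp
    moreover have "dist p x < d1" "dist q x < d2" using p(1) q(1) unfolding e_def by auto
    ultimately show ?thesis using d1(2)[of p] d2(2)[of q] unfolding dist_real_def by linarith
  qed
  then have "\<bar>D u v x - D v u x\<bar> \<le> 0" by (rule dense_ge)
  then have "D u v x = D v u x" by simp
  then show ?thesis unfolding D_def .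
qed

text \<open>Differentiation under the integral replaces \<open>F\<close> by a partial derivative and
  produces one more factor \<open>s\<close>. The weight \<open>s ^ m\<close> is included so that the
  statement is stable under this operation; the case applied later is \<open>m = 0\<close>.\<close>

lemma td_segment_integral:
  fixes F :: "'a::euclidean_space \<Rightarrow> real"
  assumes "smooth_on (ball y0 r) F"
  shows "times_differentiable_on k (ball y0 r) (\<lambda>y. integral {0..1} (\<lambda>s. s ^ m * F (y0 + s *\<^sub>R (y - y0))))"
  using assms
proof (induction k arbitrary: F m)
  case (0 F m)
  have c: "continuous_on (ball y0 r) F" using smooth_on_continuous[OF 0] .
  have "continuous_on (ball y0 r) (\<lambda>y. integral (cbox 0 1) (\<lambda>s. s ^ m * F (y0 + s *\<^sub>R (y - y0))))"
  proof (rule integral_continuous_on_param)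
    show "continuous_on (ball y0 r \<times> cbox 0 1) (\<lambda>(y, s). s ^ m * F (y0 + s *\<^sub>R (y - y0)))"
      unfolding split_beta
    proof (intro continuous_intros continuous_on_compose2[OF c])
      show "(\<lambda>p. y0 + snd p *\<^sub>R (fst p - y0)) ` (ball y0 r \<times> cbox 0 1) \<subseteq> ball y0 r"
      proof safe
        fix y and s :: real assume "y \<in> ball y0 r" "s \<in> cbox 0 1"
        then have "norm (y - y0) < r" "0 \<le> s" "s \<le> 1" by (auto simp: dist_norm norm_minus_commute)
        then have "s * norm (y - y0) < r" using mult_left_le_one_le[of "norm (y - y0)" s] by simp
        then show "y0 + snd (y, s) *\<^sub>R (fst (y, s) - y0) \<in> ball y0 r" using \<open>0 \<le> s\<close> by (simp add: dist_norm)
      qed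
    qed
  qed
  then show ?case by simp
next
  case (Suc k F m)
  have inb: "y0 + s *\<^sub>R (y - y0) \<in> ball y0 r" if "y \<in> ball y0 r" "s \<in> cbox 0 1" for y and s :: real
  proof -
    have "norm (y - y0) < r" "0 \<le> s" "s \<le> 1" using that by (auto simp: dist_norm norm_minus_commute)
    then have "s * norm (y - y0) < r" using mult_left_le_one_le[of "norm (y - y0)" s] by simp
    then show ?thesis using \<open>0 \<le> s\<close> by (simp add: dist_norm)
  qed
  have c: "continuous_on (ball y0 r) F" using smooth_on_continuous[OF Suc.prems] .
  \<comment> \<open>\<open>leibniz_rule\<close> takes the derivative as a bounded linear map that
    depends jointly continuously on the parameter and the integration variable, hence the packaging
    by \<open>Blinfun\<close>.\<close>
  define fx where "fx y s = Blinfun (\<lambda>v. s ^ m * (s * frechet_derivative F (at (y0 + s *\<^sub>R (y - y0))) v))" for y and s :: real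
  have bl: "bounded_linear (\<lambda>v. s ^ m * (s * frechet_derivative F (at (y0 + s *\<^sub>R (y - y0))) v))"
    if "y \<in> ball y0 r" "s \<in> cbox 0 1" for y s
    using has_derivative_bounded_linear[OF smooth_on_has_derivative[OF Suc.prems inb[OF that]]]
    by (intro bounded_linear_const_mult)
  have fxa: "blinfun_apply (fx y s) v = s ^ m * (s * frechet_derivative F (at (y0 + s *\<^sub>R (y - y0))) v)"
    if "y \<in> ball y0 r" "s \<in> cbox 0 1" for y s v
    unfolding fx_def using bounded_linear_Blinfun_apply[OF bl[OF that]] by metis
  have cfx: "continuous_on (ball y0 r \<times> cbox 0 1) (\<lambda>(y, s). fx y s)"
  proof (rule continuous_on_blinfun_componentwise)
    fix i :: 'a
    have cF: "continuous_on (ball y0 r) (\<lambda>y. frechet_derivative F (at y) i)"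
      by (intro smooth_on_continuous smooth_on_frechet Suc.prems)
    have "continuous_on (ball y0 r \<times> cbox 0 1) (\<lambda>p. snd p ^ m * (snd p * frechet_derivative F (at (y0 + snd p *\<^sub>R (fst p - y0))) i))"
      by (intro continuous_intros continuous_on_compose2[OF cF]) (use inb in auto)
    then show "continuous_on (ball y0 r \<times> cbox 0 1) (\<lambda>x. blinfun_apply (case x of (y, s) \<Rightarrow> fx y s) i)"
      by (rule continuous_on_eq) (use fxa in auto)
  qed
  have der: "((\<lambda>y. integral (cbox 0 1) (\<lambda>s. s ^ m * F (y0 + s *\<^sub>R (y - y0)))) has_derivative
      integral (cbox 0 1) (fx y)) (at y within ball y0 r)" if y: "y \<in> ball y0 r" for y
  proof (rule leibniz_rule[OF _ _ cfx y convex_ball])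
    fix y and s :: real assume ys: "y \<in> ball y0 r" "s \<in> cbox 0 1"
    have l: "linear (frechet_derivative F (at (y0 + s *\<^sub>R (y - y0))))"
      using smooth_on_has_derivative[OF Suc.prems inb[OF ys]] has_derivative_linear by blast
    have "((\<lambda>y. s ^ m * F (y0 + s *\<^sub>R (y - y0))) has_derivative
        (\<lambda>v. s ^ m * frechet_derivative F (at (y0 + s *\<^sub>R (y - y0))) (s *\<^sub>R v))) (at y)"
      by (intro has_derivative_mult_right has_derivative_compose[where f = "\<lambda>y. y0 + s *\<^sub>R (y - y0)", OF _ smooth_on_has_derivative[OF Suc.prems inb[OF ys]]])
        (auto intro!: derivative_eq_intros)
    then show "((\<lambda>y. s ^ m * F (y0 + s *\<^sub>R (y - y0))) has_derivative blinfun_apply (fx y s)) (at y within ball y0 r)"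
      using fxa[OF ys] linear_cmul[OF l] by (auto intro!: has_derivative_at_withinI simp: fun_eq_iff elim!: has_derivative_eq_rhs)
  next
    fix y assume y: "y \<in> ball y0 r"
    show "(\<lambda>s. s ^ m * F (y0 + s *\<^sub>R (y - y0))) integrable_on cbox 0 1"
      by (intro integrable_continuous continuous_intros continuous_on_compose2[OF c]) (use inb[OF y] in auto)
  qed
  have app: "blinfun_apply (integral (cbox 0 1) (fx y)) v =
      integral {0..1} (\<lambda>s. s ^ Suc m * frechet_derivative F (at (y0 + s *\<^sub>R (y - y0))) v)" if y: "y \<in> ball y0 r" for y v
  proof -
    have "continuous_on (cbox 0 1) (fx y)"
      using continuous_on_compose2[OF cfx, of "cbox 0 1" "\<lambda>s. (y, s)"] y
      by (auto simp: continuous_on_Pair continuous_on_const image_subset_iff)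
    then have "fx y integrable_on cbox 0 1" by (rule integrable_continuous)
    then have "blinfun_apply (integral (cbox 0 1) (fx y)) v = integral (cbox 0 1) (\<lambda>s. blinfun_apply (fx y s) v)"
      by (rule blinfun_apply_integral)
    also have "\<dots> = integral (cbox 0 1) (\<lambda>s. s ^ Suc m * frechet_derivative F (at (y0 + s *\<^sub>R (y - y0))) v)"
      by (rule integral_cong) (use fxa[OF y] in auto)
    finally show ?thesis by simp
  qed
  show ?case
  proof (rule td_SucI)
    show "((\<lambda>y. integral {0..1} (\<lambda>s. s ^ m * F (y0 + s *\<^sub>R (y - y0)))) has_derivative
      blinfun_apply (integral (cbox 0 1) (fx y))) (at y)" if "y \<in> ball y0 r" for y
      using der[OF that] at_within_open[OF that] by simp
    show "times_differentiable_on k (ball y0 r) (\<lambda>y. blinfun_apply (integral (cbox 0 1) (fx y)) v)" for v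
      by (rule td_cong[OF open_ball app[symmetric] Suc.IH[OF smooth_on_frechet[OF Suc.prems]]])
  qed simp
qed

text \<open>\<open>F y - F y0\<close> is the integral of the derivative of \<open>F\<close> along
  the segment from \<open>y0\<close> to \<open>y\<close>, and \<open>G b\<close> is the mean of the
  partial derivative in direction \<open>b\<close> over that segment. The factorisation is what
  later lets a derivation be evaluated through its values on coordinates.\<close>

lemma hadamard:
  fixes F :: "'a::euclidean_space \<Rightarrow> real"
  assumes F: "smooth_on (ball y0 r) F"
  obtains G where "\<And>b. smooth_on (ball y0 r) (G b)" "\<And>b. G b y0 = frechet_derivative F (at y0) b"
    "\<And>y. y \<in> ball y0 r \<Longrightarrow> F y = F y0 + (\<Sum>b\<in>Basis. ((y - y0) \<bullet> b) * G b y)"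
proof
  \<comment> \<open>The factor \<open>s ^ 0\<close> brings the integrand into the shape of
    \<open>td_segment_integral\<close>.\<close>
  define G where "G b y = integral {0..1} (\<lambda>s. s ^ 0 * frechet_derivative F (at (y0 + s *\<^sub>R (y - y0))) b)" for b y
  show "smooth_on (ball y0 r) (G b)" for b
    unfolding G_def smooth_on_def using td_segment_integral[OF smooth_on_frechet[OF F]] by blast
  show "G b y0 = frechet_derivative F (at y0) b" for b by (simp add: G_def)
  fix y assume y: "y \<in> ball y0 r"
  have inb: "y0 + s *\<^sub>R (y - y0) \<in> ball y0 r" if "s \<in> {0..1}" for s :: real
  proof -
    have "norm (y - y0) < r" "0 \<le> s" "s \<le> 1" using that y by (auto simp: dist_norm norm_minus_commute)
    then have "s * norm (y - y0) < r" using mult_left_le_one_le[of "norm (y - y0)" s] by simp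
    then show ?thesis using \<open>0 \<le> s\<close> by (simp add: dist_norm)
  qed
  have lin: "linear (frechet_derivative F (at (y0 + s *\<^sub>R (y - y0))))" if "s \<in> {0..1}" for s
    using smooth_on_has_derivative[OF F inb[OF that]] has_derivative_linear by blast
  have int: "((\<lambda>s. frechet_derivative F (at (y0 + s *\<^sub>R (y - y0))) (y - y0)) has_integral
      F (y0 + 1 *\<^sub>R (y - y0)) - F (y0 + 0 *\<^sub>R (y - y0))) {0..1}"
  proof (rule fundamental_theorem_of_calculus)
    fix s :: real assume s: "s \<in> {0..1}"
    have "((\<lambda>s. F (y0 + s *\<^sub>R (y - y0))) has_derivative (\<lambda>h. frechet_derivative F (at (y0 + s *\<^sub>R (y - y0))) (h *\<^sub>R (y - y0)))) (at s)"
      by (rule has_derivative_compose[where f = "\<lambda>s. y0 + s *\<^sub>R (y - y0)", OF _ smooth_on_has_derivative[OF F inb[OF s]]]) (auto intro!: derivative_eq_intros)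
    then show "((\<lambda>s. F (y0 + s *\<^sub>R (y - y0))) has_vector_derivative frechet_derivative F (at (y0 + s *\<^sub>R (y - y0))) (y - y0)) (at s within {0..1})"
      unfolding has_vector_derivative_def using has_derivative_at_withinI by (simp add: linear_cmul[OF lin[OF s]])
  qed simp
  have eq: "frechet_derivative F (at (y0 + s *\<^sub>R (y - y0))) (y - y0) =
      (\<Sum>b\<in>Basis. ((y - y0) \<bullet> b) * frechet_derivative F (at (y0 + s *\<^sub>R (y - y0))) b)" if "s \<in> {0..1}" for s
  proof -
    have "frechet_derivative F (at (y0 + s *\<^sub>R (y - y0))) (\<Sum>b\<in>Basis. ((y - y0) \<bullet> b) *\<^sub>R b) =
      (\<Sum>b\<in>Basis. ((y - y0) \<bullet> b) * frechet_derivative F (at (y0 + s *\<^sub>R (y - y0))) b)"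
      by (simp add: linear_sum[OF lin[OF that]] linear_cmul[OF lin[OF that]])
    then show ?thesis by (simp add: euclidean_representation)
  qed
  have ci: "(\<lambda>s. frechet_derivative F (at (y0 + s *\<^sub>R (y - y0))) b) integrable_on {0..1}" for b
  proof -
    have "continuous_on (ball y0 r) (\<lambda>y. frechet_derivative F (at y) b)"
      by (intro smooth_on_continuous smooth_on_frechet F)
    then have "continuous_on {0..1} (\<lambda>s. frechet_derivative F (at (y0 + s *\<^sub>R (y - y0))) b)"
      by (rule continuous_on_compose2) (use inb in \<open>auto intro!: continuous_intros\<close>)
    then show ?thesis by (rule integrable_continuous_real)
  qed
  have "F y - F y0 = integral {0..1} (\<lambda>s. frechet_derivative F (at (y0 + s *\<^sub>R (y - y0))) (y - y0))"
    using int by (simp add: integral_unique)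
  also have "\<dots> = integral {0..1} (\<lambda>s. \<Sum>b\<in>Basis. ((y - y0) \<bullet> b) * frechet_derivative F (at (y0 + s *\<^sub>R (y - y0))) b)"
    by (rule integral_cong) (rule eq)
  also have "\<dots> = (\<Sum>b\<in>Basis. integral {0..1} (\<lambda>s. ((y - y0) \<bullet> b) * frechet_derivative F (at (y0 + s *\<^sub>R (y - y0))) b))"
    by (rule integral_sum) (auto intro: integrable_on_mult_right ci)
  also have "\<dots> = (\<Sum>b\<in>Basis. ((y - y0) \<bullet> b) * G b y)"
    by (simp add: G_def)
  finally show "F y = F y0 + (\<Sum>b\<in>Basis. ((y - y0) \<bullet> b) * G b y)" by simp
qed

section \<open>Bump functions\<close>

lemma smooth_flat: "smooth_on UNIV (\<lambda>x::real. if x \<le> 0 then 0 else exp (- inverse x))"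
proof -
  \<comment> \<open>This family makes the induction close up: the derivative of \<open>f n\<close>
    is \<open>f (n + 2) - n * f (n + 1)\<close>, and at 0 the difference quotient of
    \<open>f n\<close> is exactly \<open>f (n + 1)\<close>, which tends to 0. The flat function
    itself is \<open>f 0\<close>.\<close>
  define f where "f n = (\<lambda>x::real. if x \<le> 0 then 0 else inverse x ^ n * exp (- inverse x))" for n :: nat
  have lim: "(f n \<longlongrightarrow> 0) (at_right 0)" for n
  proof -
    have "((\<lambda>x::real. x ^ n / exp x) \<longlongrightarrow> 0) at_top" by (rule tendsto_power_div_exp_0)
    then have "((\<lambda>x::real. inverse x ^ n / exp (inverse x)) \<longlongrightarrow> 0) (at_right 0)"
      by (rule filterlim_compose) (rule filterlim_inverse_at_top_right)
    then show ?thesis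
      by (rule Lim_transform_eventually)
        (auto simp: f_def exp_minus field_simps eventually_at intro!: exI[of _ 1])
  qed
  have lim0: "(f n \<longlongrightarrow> 0) (at 0)" for n
  proof -
    have "(f n \<longlongrightarrow> 0) (at_left 0)"
      by (rule Lim_transform_eventually[OF tendsto_const])
        (auto simp: f_def eventually_at intro!: exI[of _ 1])
    then show ?thesis using lim filterlim_split_at by blast
  qed
  have der: "(f n has_real_derivative f (n + 2) x - n * f (n + 1) x) (at x)" for n x
  proof -
    consider "x > 0" | "x < 0" | "x = 0" by linarith
    then show ?thesis
    proof cases
      case 1
      have "((\<lambda>x. inverse x ^ n * exp (- inverse x)) has_real_derivative f (n + 2) x - n * f (n + 1) x) (at x)"
        using 1 by (auto intro!: derivative_eq_intros simp: f_def power2_eq_square algebra_simps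
             power_Suc[symmetric] simp del: power_Suc) (cases n; simp add: field_simps)
      then show ?thesis
        by (rule has_field_derivative_transform_within_open[where S = "{0<..}"]) (use 1 in \<open>auto simp: f_def\<close>)
    next
      case 2
      have "((\<lambda>x. 0) has_real_derivative f (n + 2) x - n * f (n + 1) x) (at x)"
        using 2 by (auto simp: f_def)
      then show ?thesis
        by (rule has_field_derivative_transform_within_open[where S = "{..<0}"]) (use 2 in \<open>auto simp: f_def\<close>)
    next
      case 3
      have "(\<lambda>h. (f n (0 + h) - f n 0) / h) = f (n + 1)"
        by (auto simp: f_def fun_eq_iff field_simps)
      then have "(f n has_real_derivative 0) (at 0)"
        using lim0[of "n+1"] by (simp add: DERIV_def)
      then show ?thesis using 3 by (simp add: f_def)
    qed
  qed
  have "times_differentiable_on k UNIV (f n)" for k n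
  proof (induction k arbitrary: n)
    case 0
    have "isCont (f n) x" for x using der by (rule DERIV_isCont)
    then show ?case by (auto intro!: continuous_at_imp_continuous_on)
  next
    case (Suc k)
    have "times_differentiable_on k UNIV (\<lambda>x. (f (n + 2) x + (- real n) * f (n + 1) x) * v)" for v
      by (intro td_bounded_linear_compose[OF bounded_linear_mult_left] open_UNIV td_add Suc
          td_bounded_linear_compose[OF bounded_linear_mult_right])
    then show ?case
      using der by (intro td_SucI[where f' = "\<lambda>x v. (f (n + 2) x + (- real n) * f (n + 1) x) * v"])
        (auto simp: has_field_derivative_def)
  qed
  then have "smooth_on UNIV (f 0)" by (simp add: smooth_on_def)
  moreover have "f 0 = (\<lambda>x::real. if x \<le> 0 then 0 else exp (- inverse x))" by (auto simp: f_def)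
  ultimately show ?thesis by simp
qed

lemma smooth_bump:
  fixes y0 :: "'a::euclidean_space"
  assumes "r > 0"
  obtains \<psi> :: "'a \<Rightarrow> real" where "smooth_on UNIV \<psi>" "\<psi> y0 = 1" "\<And>y. dist y0 y \<ge> r \<Longrightarrow> \<psi> y = 0"
proof
  let ?h = "\<lambda>x::real. if x \<le> 0 then 0 else exp (- inverse x)"
  \<comment> \<open>The squared distance is taken because the distance itself is not smooth at
    \<open>y0\<close>; division by the value at the centre yields
    \<open>\<psi> y0 = 1\<close>.\<close>
  let ?\<psi> = "\<lambda>y. ?h (r\<^sup>2 - (y - y0) \<bullet> (y - y0)) / ?h (r\<^sup>2)"
  have "smooth_on UNIV (\<lambda>y. r\<^sup>2 - (y - y0) \<bullet> (y - y0))"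
    by (intro smooth_on_diff smooth_on_bilinear[OF bounded_bilinear_inner] open_UNIV smooth_on_const smooth_on_ident)
  from smooth_on_compose[OF smooth_flat this]
  have "smooth_on UNIV (\<lambda>y. ?h (r\<^sup>2 - (y - y0) \<bullet> (y - y0)))" by simp
  from smooth_on_bounded_linear_compose[OF bounded_linear_divide[of "?h (r\<^sup>2)"] open_UNIV this]
  show "smooth_on UNIV ?\<psi>" .
  show "?\<psi> y0 = 1" using assms by simp
  fix y assume "dist y0 y \<ge> r"
  then have "r\<^sup>2 \<le> (dist y0 y)\<^sup>2" using assms by (intro power_mono) auto
  then show "?\<psi> y = 0"
    by (simp add: dist_norm norm_minus_commute dot_square_norm)
qed

section \<open>Smoothness of local inverses\<close>

lemma smooth_local_inverse_vec:
  fixes f :: "real^'m \<Rightarrow> real^'m"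
  assumes U: "open U" "x0 \<in> U" and f: "smooth_on U f" and der: "(f has_derivative id) (at x0)"
  obtains U' V g where "open U'" "U' \<subseteq> U" "x0 \<in> U'" "open V" "f x0 \<in> V" "homeomorphism U' V f g" "smooth_on V g"
proof -
  define f' where "f' x = Blinfun (frechet_derivative f (at x))" for x
  have f'a: "blinfun_apply (f' x) = frechet_derivative f (at x)" if "x \<in> U" for x
    unfolding f'_def using has_derivative_bounded_linear[OF smooth_on_has_derivative[OF f that]]
    by (rule bounded_linear_Blinfun_apply)
  have d: "(f has_derivative blinfun_apply (f' x)) (at x)" if "x \<in> U" for x
    using smooth_on_has_derivative[OF f that] f'a[OF that] by simp
  have c: "continuous_on U f'"
  proof (rule continuous_on_blinfun_componentwise)
    fix i :: "real^'m"
    have "continuous_on U (\<lambda>x. frechet_derivative f (at x) i)"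
      by (intro smooth_on_continuous smooth_on_frechet f)
    then show "continuous_on U (\<lambda>x. blinfun_apply (f' x) i)"
      by (rule continuous_on_eq) (use f'a in auto)
  qed
  have "f' x0 = id_blinfun"
    using f'a[OF U(2)] frechet_derivative_at[OF der] by (intro blinfun_eqI) auto
  then have iv: "id_blinfun o\<^sub>L f' x0 = id_blinfun" by (intro blinfun_eqI) simp
  obtain U' V g g' where g: "open U'" "U' \<subseteq> U" "x0 \<in> U'" "open V" "f x0 \<in> V" "homeomorphism U' V f g"
    "\<And>y. y \<in> V \<Longrightarrow> (g has_derivative (g' y)) (at y)"
    "\<And>y. y \<in> V \<Longrightarrow> g' y = inv_into UNIV (blinfun_apply (f'(g y)))"
    "\<And>y. y \<in> V \<Longrightarrow> bij (blinfun_apply (f'(g y)))"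
    using inverse_function_theorem[OF U(1) d c U(2) iv] by metis
  have gU: "g y \<in> U" if "y \<in> V" for y
    using g(2,6) that unfolding homeomorphism_def by blast
  define M where "M x = matrix (frechet_derivative f (at x))" for x
  define I where "I = {x \<in> U. invertible (M x)}"
  have M: "M x *v v = frechet_derivative f (at x) v" if "x \<in> U" for x v
    unfolding M_def using has_derivative_linear[OF smooth_on_has_derivative[OF f that]] by (simp add: matrix_works)
  have smM: "smooth_on U M"
  proof (rule smooth_on_matrix[OF U(1)])
    fix i j
    have "smooth_on U (\<lambda>x. frechet_derivative f (at x) (axis j 1) $ i)"
      by (intro smooth_on_nth U(1) smooth_on_frechet f)
    then show "smooth_on U (\<lambda>x. M x $ i $ j)" by (simp add: M_def matrix_def)
  qed
  have oI: "open I"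
  proof -
    have "open (U \<inter> M -` {A. invertible A})"
      using smooth_on_continuous[OF smM] U(1) open_invertible by (rule continuous_open_preimage)
    then show ?thesis by (simp add: I_def vimage_def Int_def)
  qed
  have smI: "smooth_on I (\<lambda>x. matrix_inv (M x))"
    by (rule smooth_on_matrix_inv[OF oI smooth_on_subset[OF smM]]) (auto simp: I_def)
  have gI: "g y \<in> I" and g'eq: "g' y v = matrix_inv (M (g y)) *v v" if "y \<in> V" for y v
  proof -
    have eq: "blinfun_apply (f' (g y)) = (*v) (M (g y))" using f'a[OF gU[OF that]] M[OF gU[OF that]] by auto
    then have b: "bij ((*v) (M (g y)))" using g(9)[OF that] by simp
    then have i: "invertible (M (g y))"
      using invertible_eq_bij by blast
    then show "g y \<in> I" using gU[OF that] by (simp add: I_def)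
    have "inv_into UNIV ((*v) (M (g y))) v = matrix_inv (M (g y)) *v v"
      by (rule inv_f_eq) (use b i in \<open>auto simp: bij_is_inj matrix_vector_mul_assoc matrix_inv_right\<close>)
    then show "g' y v = matrix_inv (M (g y)) *v v" using g(8)[OF that] eq by simp
  qed
  \<comment> \<open>Bootstrapping: the derivative of \<open>g\<close> is the inverse of the Jacobian
    of \<open>f\<close> at \<open>g y\<close>, so \<open>k\<close> derivatives of \<open>g\<close>
    give \<open>k\<close> derivatives of \<open>g'\<close>, and hence \<open>k + 1\<close> of
    \<open>g\<close>.\<close>
  have "times_differentiable_on k V g" for k
  proof (induction k)
    case 0
    then show ?case using g(6) unfolding homeomorphism_def by simp
  next
    case (Suc k)
    have "times_differentiable_on k V (\<lambda>y. g' y v)" for v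
    proof (rule td_cong[OF g(4)])
      have "smooth_on I (\<lambda>x. matrix_inv (M x) *v v)"
        by (intro smooth_on_bilinear[OF bounded_bilinear_matrix_vector_mult] oI smI smooth_on_const)
      then show "times_differentiable_on k V (\<lambda>y. matrix_inv (M (g y)) *v v)"
        using gI Suc unfolding smooth_on_def
        by (intro td_compose[OF g(4) oI, where f = "\<lambda>x. matrix_inv (M x) *v v"]) auto
    qed (simp add: g'eq)
    then show ?case using g(7) by (intro td_SucI[where f' = g'] g(4)) auto
  qed
  then have "smooth_on V g" by (simp add: smooth_on_def)
  then show thesis using that g by blast
qed

text \<open>The Jacobian has to be a square matrix acting on vectors. Matrices are therefore
  flattened to vectors indexed by pairs, and the vector case is transported along this linear
  isomorphism.\<close>

lemma smooth_local_inverse: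
  fixes f :: "real^'n^'m \<Rightarrow> real^'n^'m"
  assumes U: "open U" "x0 \<in> U" and f: "smooth_on U f" and der: "(f has_derivative id) (at x0)"
  obtains U' V g where "open U'" "U' \<subseteq> U" "x0 \<in> U'" "open V" "f x0 \<in> V" "homeomorphism U' V f g" "smooth_on V g"
proof -
  define h :: "real^'n^'m \<Rightarrow> real^('m \<times> 'n)" where "h A = (\<chi> p. A $ fst p $ snd p)" for A
  define k :: "real^('m \<times> 'n) \<Rightarrow> real^'n^'m" where "k v = (\<chi> i j. v $ (i, j))" for v
  have hk [simp]: "h (k v) = v" "k (h A) = A" for v A by (simp_all add: h_def k_def vec_eq_iff)
  have bh: "bounded_linear h" and bk: "bounded_linear k"
    by (auto intro!: linear_conv_bounded_linear[THEN iffD1] linearI simp: h_def k_def vec_eq_iff)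
  have oU: "open (k -` U)" using bk U(1) by (intro open_vimage linear_continuous_on) auto
  have sm: "smooth_on (k -` U) (\<lambda>v. h (f (k v)))"
    by (intro smooth_on_bounded_linear_compose[OF bh oU] smooth_on_compose[OF f smooth_on_bounded_linear[OF bk] oU U(1)]) auto
  have "(f has_derivative id) (at (k (h x0)))" using der by simp
  from has_derivative_compose[OF bounded_linear_imp_has_derivative[OF bk] this]
  have "((\<lambda>v. h (f (k v))) has_derivative (\<lambda>v. h (id (k v)))) (at (h x0))"
    by (rule bounded_linear.has_derivative[OF bh])
  then have d: "((\<lambda>v. h (f (k v))) has_derivative id) (at (h x0))" by (simp add: id_def)
  obtain U' V g where g: "open U'" "U' \<subseteq> k -` U" "h x0 \<in> U'" "open V" "h (f (k (h x0))) \<in> V"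
      "homeomorphism U' V (\<lambda>v. h (f (k v))) g" "smooth_on V g"
    using smooth_local_inverse_vec[OF oU _ sm d] U(2) by (metis hk(2) vimageI2)
  have im: "k ` X = h -` X" "h ` Y = k -` Y" for X Y
    by (auto simp: image_iff) (metis hk)+
  show thesis
  proof
    show "open (h -` U')" "open (h -` V)" using bh g(1,4) by (auto intro!: open_vimage linear_continuous_on)
    show "h -` U' \<subseteq> U" using g(2) by (metis hk(2) subsetI subset_vimage_iff vimageE imageI im(1))
    show "x0 \<in> h -` U'" "f x0 \<in> h -` V" using g(3,5) by auto
    have hm: "\<And>x. x \<in> U' \<Longrightarrow> g (h (f (k x))) = x" "(\<lambda>v. h (f (k v))) ` U' = V" "\<And>y. y \<in> V \<Longrightarrow> h (f (k (g y))) = y" "g ` V = U'"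
      using g(6) unfolding homeomorphism_def by auto
    show "smooth_on (h -` V) (\<lambda>y. k (g (h y)))"
      using bh g(4) by (intro smooth_on_bounded_linear_compose[OF bk] smooth_on_compose[OF g(7) smooth_on_bounded_linear[OF bh] _ g(4)]
        open_vimage linear_continuous_on) auto
    then have c2: "continuous_on (h -` V) (\<lambda>y. k (g (h y)))" by (rule smooth_on_continuous)
    have sub: "h -` U' \<subseteq> U" using \<open>h -` U' \<subseteq> U\<close> .
    have c1: "continuous_on (h -` U') f"
      using smooth_on_continuous[OF f] sub continuous_on_subset by blast
    show "homeomorphism (h -` U') (h -` V) f (\<lambda>y. k (g (h y)))"
    proof (rule homeomorphismI[OF c1 c2])
      show "f ` (h -` U') \<subseteq> h -` V" using hm(2) by (force simp: image_iff)
      show "(\<lambda>y. k (g (h y))) ` (h -` V) \<subseteq> h -` U'" using hm(4) by force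
      show "\<And>x. x \<in> h -` U' \<Longrightarrow> k (g (h (f x))) = x" using hm(1) by (metis hk(2) vimageE)
      show "\<And>y. y \<in> h -` V \<Longrightarrow> f (k (g (h y))) = y" using hm(3) by (metis hk(2) vimageE)
    qed
  qed
qed

section \<open>One-parameter groups and Lie algebras of compact matrix groups\<close>

text \<open>The componentwise norm of \<open>real^'n^'n\<close> does not make it a normed algebra; this copy with the
  operator norm gives access to the library's \<open>exp\<close>.\<close>

typedef (overloaded) 'n matop = "UNIV :: ((real^'n) \<Rightarrow>\<^sub>L (real^'n)) set"
  by simp

setup_lifting type_definition_matop

instantiation matop :: (finite) real_normed_algebra_1
begin

lift_definition zero_matop :: "'a matop" is 0 .
lift_definition one_matop :: "'a matop" is id_blinfun .
lift_definition plus_matop :: "'a matop \<Rightarrow> 'a matop \<Rightarrow> 'a matop" is "(+)" .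
lift_definition minus_matop :: "'a matop \<Rightarrow> 'a matop \<Rightarrow> 'a matop" is "(-)" .
lift_definition uminus_matop :: "'a matop \<Rightarrow> 'a matop" is "uminus" .
lift_definition times_matop :: "'a matop \<Rightarrow> 'a matop \<Rightarrow> 'a matop" is "blinfun_compose" .
lift_definition scaleR_matop :: "real \<Rightarrow> 'a matop \<Rightarrow> 'a matop" is "scaleR" .
lift_definition norm_matop :: "'a matop \<Rightarrow> real" is norm .
definition dist_matop :: "'a matop \<Rightarrow> 'a matop \<Rightarrow> real" where "dist_matop a b = norm (a - b)"
definition sgn_matop :: "'a matop \<Rightarrow> 'a matop" where "sgn_matop x = inverse (norm x) *\<^sub>R x"
definition uniformity_matop :: "('a matop \<times> 'a matop) filter"
  where "uniformity_matop = (INF e\<in>{0 <..}. principal {(x, y). dist x y < e})"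
definition open_matop :: "'a matop set \<Rightarrow> bool"
  where "open_matop U = (\<forall>x\<in>U. eventually (\<lambda>(x', y). x' = x \<longrightarrow> y \<in> U) uniformity)"

instance
proof
  fix a b c :: "'a matop" and r s :: real
  show "a + b + c = a + (b + c)" by transfer simp
  show "a + b = b + a" by transfer simp
  show "0 + a = a" by transfer simp
  show "- a + a = 0" by transfer simp
  show "a - b = a + - b" by transfer simp
  show "r *\<^sub>R (a + b) = r *\<^sub>R a + r *\<^sub>R b" by transfer (simp add: scaleR_add_right)
  show "(r + s) *\<^sub>R a = r *\<^sub>R a + s *\<^sub>R a" by transfer (simp add: scaleR_add_left)
  show "r *\<^sub>R s *\<^sub>R a = (r * s) *\<^sub>R a" by transfer simp
  show "1 *\<^sub>R a = a" by transfer simp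
  show "a * b * c = a * (b * c)" by transfer (rule blinfun_eqI, simp)
  show "(a + b) * c = a * c + b * c" by transfer (simp add: bounded_bilinear.add_left[OF bounded_bilinear_blinfun_compose])
  show "a * (b + c) = a * b + a * c" by transfer (simp add: bounded_bilinear.add_right[OF bounded_bilinear_blinfun_compose])
  show "r *\<^sub>R a * b = r *\<^sub>R (a * b)" by transfer (simp add: bounded_bilinear.scaleR_left[OF bounded_bilinear_blinfun_compose])
  show "a * r *\<^sub>R b = r *\<^sub>R (a * b)" by transfer (simp add: bounded_bilinear.scaleR_right[OF bounded_bilinear_blinfun_compose])
  show "1 * a = a" by transfer (rule blinfun_eqI, simp)
  show "a * 1 = a" by transfer (rule blinfun_eqI, simp)
  show "(0::'a matop) \<noteq> 1"
  proof (transfer, rule notI)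
    assume "(0 :: (real^'a) \<Rightarrow>\<^sub>L (real^'a)) = id_blinfun"
    then have "blinfun_apply (0 :: (real^'a) \<Rightarrow>\<^sub>L (real^'a)) 1 = blinfun_apply id_blinfun 1" by simp
    then show False by simp
  qed
  show "dist a b = norm (a - b)" by (rule dist_matop_def)
  show "sgn a = inverse (norm a) *\<^sub>R a" by (rule sgn_matop_def)
  show "uniformity = (INF e\<in>{0 <..}. principal {(x::'a matop, y). dist x y < e})" by (rule uniformity_matop_def)
  show "open U = (\<forall>x\<in>U. eventually (\<lambda>(x', y). x' = x \<longrightarrow> y \<in> U) uniformity)" for U :: "'a matop set" by (rule open_matop_def)
  show "(norm a = 0) = (a = 0)" by transfer simp
  show "norm (a + b) \<le> norm a + norm b" by transfer (rule norm_triangle_ineq)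
  show "norm (r *\<^sub>R a) = \<bar>r\<bar> * norm a" by transfer simp
  show "norm (a * b) \<le> norm a * norm b" by transfer (rule norm_blinfun_compose)
  show "norm (1::'a matop) = 1"
  proof transfer
    show "norm (id_blinfun :: (real^'a) \<Rightarrow>\<^sub>L (real^'a)) = 1"
      by (rule norm_blinfun_id)
  qed
qed

end

instance matop :: (finite) banach
proof
  fix X :: "nat \<Rightarrow> 'a matop"
  assume X: "Cauchy X"
  have d: "dist (Rep_matop a) (Rep_matop b) = dist a b" for a b :: "'a matop"
    by (simp add: dist_norm norm_matop.rep_eq minus_matop.rep_eq)
  have "Cauchy (\<lambda>n. Rep_matop (X n))" using X by (simp add: Cauchy_def d)
  then obtain L where L: "(\<lambda>n. Rep_matop (X n)) \<longlonglongrightarrow> L" using Cauchy_convergent_iff convergent_def by blast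
  have "X \<longlonglongrightarrow> Abs_matop L"
    using L unfolding lim_sequentially by (metis Abs_matop_inverse UNIV_I d)
  then show "convergent X" by (auto simp: convergent_def)
qed

definition to_op :: "real^'n^'n \<Rightarrow> 'n matop" where "to_op A = Abs_matop (Blinfun ((*v) A))"
definition of_op :: "'n matop \<Rightarrow> real^'n^'n" where "of_op a = matrix (blinfun_apply (Rep_matop a))"

lemma Rep_to_op: "blinfun_apply (Rep_matop (to_op A)) = (*v) A"
  unfolding to_op_def
  by (simp add: Abs_matop_inverse bounded_linear_Blinfun_apply matrix_vector_mul_bounded_linear)

lemma of_to_op [simp]: "of_op (to_op A) = A"
  by (simp add: of_op_def Rep_to_op matrix_of_matrix_vector_mul)

lemma to_of_op [simp]: "to_op (of_op a) = a"
proof -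
  have "linear (blinfun_apply (Rep_matop a))" using blinfun.bounded_linear_right bounded_linear.linear by blast
  then have "blinfun_apply (Rep_matop (to_op (of_op a))) = blinfun_apply (Rep_matop a)"
    by (auto simp: Rep_to_op of_op_def matrix_works)
  then show ?thesis by (simp add: blinfun_apply_inject Rep_matop_inject)
qed

lemma op_eqI: "(\<And>v. blinfun_apply (Rep_matop a) v = blinfun_apply (Rep_matop b) v) \<Longrightarrow> a = b"
  by (metis Rep_matop_inject blinfun_eqI)

lemma to_op_mult: "to_op (A ** B) = to_op A * to_op B"
  by (rule op_eqI) (simp add: Rep_to_op times_matop.rep_eq matrix_vector_mul_assoc)

lemma to_op_one: "to_op (mat 1) = 1"
  by (rule op_eqI) (simp add: Rep_to_op one_matop.rep_eq)

lemma of_op_mult: "of_op (a * b) = of_op a ** of_op b"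
  by (metis of_to_op to_of_op to_op_mult)

lemma of_op_one: "of_op 1 = mat 1"
  by (metis of_to_op to_op_one)

lemma bounded_linear_to_op: "bounded_linear to_op"
  by (rule linear_conv_bounded_linear[THEN iffD1], rule linearI; rule op_eqI)
    (simp_all add: Rep_to_op plus_matop.rep_eq scaleR_matop.rep_eq blinfun.bilinear_simps algebra_simps scaleR_matrix_vector_assoc)

lemma bounded_linear_of_op: "bounded_linear of_op"
proof -
  have "bounded_linear (\<lambda>a::'a matop. blinfun_apply (Rep_matop a) v)" for v
  proof (rule bounded_linear_intro)
    show "norm (blinfun_apply (Rep_matop a) v) \<le> norm a * norm v" for a :: "'a matop"
      by (simp add: norm_matop.rep_eq norm_blinfun)
  qed (simp_all add: plus_matop.rep_eq scaleR_matop.rep_eq blinfun.bilinear_simps)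
  then have "bounded_linear (\<lambda>a::'a matop. \<Sum>i\<in>UNIV. \<Sum>j\<in>UNIV. (blinfun_apply (Rep_matop a) (axis j 1) $ i) *\<^sub>R axis i (axis j 1) :: real^'a^'a)"
    by (intro bounded_linear_sum bounded_linear_scaleR_const
        bounded_linear_compose[OF bounded_linear_vec_nth])
  moreover have "of_op = (\<lambda>a::'a matop. \<Sum>i\<in>UNIV. \<Sum>j\<in>UNIV. (blinfun_apply (Rep_matop a) (axis j 1) $ i) *\<^sub>R axis i (axis j 1))"
  proof
    fix a :: "'a matop"
    have *: "(c *\<^sub>R axis i (axis j 1)) $ k $ l = (if l = j then if k = i then c else 0 else 0)"
      for c :: real and i j k l :: 'a
      by (simp add: axis_def)
    show "of_op a = (\<Sum>i\<in>UNIV. \<Sum>j\<in>UNIV. (blinfun_apply (Rep_matop a) (axis j 1) $ i) *\<^sub>R axis i (axis j 1))"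
      unfolding vec_eq_iff sum_component *
      by (simp add: of_op_def matrix_def)
  qed
  ultimately show ?thesis by simp
qed

lemma of_op_linear: "of_op (a + b) = of_op a + of_op b" "of_op (a - b) = of_op a - of_op b" "of_op (r *\<^sub>R a) = r *\<^sub>R of_op a"
  by (fact linear_add[OF bounded_linear.linear[OF bounded_linear_of_op]] linear_diff[OF bounded_linear.linear[OF bounded_linear_of_op]]
      linear_cmul[OF bounded_linear.linear[OF bounded_linear_of_op]])+

lemma to_op_linear: "to_op (a + b) = to_op a + to_op b" "to_op (a - b) = to_op a - to_op b" "to_op (r *\<^sub>R a) = r *\<^sub>R to_op a"
  by (fact linear_add[OF bounded_linear.linear[OF bounded_linear_to_op]] linear_diff[OF bounded_linear.linear[OF bounded_linear_to_op]]
      linear_cmul[OF bounded_linear.linear[OF bounded_linear_to_op]])+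

lemma to_op_zero [simp]: "to_op 0 = 0"
  by (rule linear_0, rule bounded_linear.linear[OF bounded_linear_to_op])

section \<open>The matrix exponential\<close>

definition mexp :: "real^'n^'n \<Rightarrow> real^'n^'n" where "mexp A = of_op (exp (to_op A))"

lemma mexp_0 [simp]: "mexp 0 = mat 1"
  by (simp add: mexp_def of_op_one)

lemma mexp_add: "mexp ((s + t) *\<^sub>R X) = mexp (s *\<^sub>R X) ** mexp (t *\<^sub>R X)"
proof -
  have "exp ((s + t) *\<^sub>R to_op X) = exp (s *\<^sub>R to_op X) * exp (t *\<^sub>R to_op X)"
    unfolding scaleR_add_left by (rule exp_add_commuting) simp
  then show ?thesis by (simp add: mexp_def to_op_linear of_op_mult)
qed

lemma mexp_inverse: "mexp (t *\<^sub>R X) ** mexp ((- t) *\<^sub>R X) = mat 1" "mexp ((- t) *\<^sub>R X) ** mexp (t *\<^sub>R X) = mat 1"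
  using mexp_add[of t "- t" X] mexp_add[of "- t" t X] by simp_all

lemma mexp_has_vector_derivative:
  "((\<lambda>t. mexp (t *\<^sub>R X)) has_vector_derivative X ** mexp (t *\<^sub>R X)) (at t)"
  using bounded_linear.has_vector_derivative[OF bounded_linear_of_op exp_scaleR_has_vector_derivative_left[of "to_op X"]]
  by (simp add: mexp_def to_op_linear of_op_mult)

lemma smooth_mexp: "smooth_on UNIV (\<lambda>t. mexp (t *\<^sub>R X))"
proof -
  have "times_differentiable_on k UNIV (\<lambda>t. mexp (t *\<^sub>R X))" for k
  proof (induction k)
    case 0
    have "isCont (\<lambda>t. mexp (t *\<^sub>R X)) t" for t
      using mexp_has_vector_derivative by (rule has_vector_derivative_continuous)
    then show ?case by (auto intro!: continuous_at_imp_continuous_on)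
  next
    case (Suc k)
    show ?case
      by (rule td_SucI[where f' = "\<lambda>t h. h *\<^sub>R (X ** mexp (t *\<^sub>R X))"])
        (auto intro!: td_bilinear[OF bounded_bilinear_scaleR] td_bilinear[OF bounded_bilinear_matrix_matrix_mult] td_const Suc
          mexp_has_vector_derivative[unfolded has_vector_derivative_def])
  qed
  then show ?thesis by (simp add: smooth_on_def)
qed

lemma mexp_commute:
  assumes "A ** X = X ** A" shows "A ** mexp X = mexp X ** A"
proof -
  have c: "to_op A * to_op X = to_op X * to_op A" using assms by (metis to_op_mult)
  have p: "to_op A * to_op X ^ n = to_op X ^ n * to_op A" for n
    by (induction n) (simp_all add: mult.assoc[symmetric] c, simp add: mult.assoc c)
  have s: "summable (\<lambda>n. to_op X ^ n /\<^sub>R fact n)" by (rule summable_exp_generic)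
  have "to_op A * exp (to_op X) = exp (to_op X) * to_op A"
    unfolding exp_def by (simp add: suminf_mult[OF s, symmetric] suminf_mult2[OF s] p)
  from arg_cong[OF this, of of_op] show ?thesis by (simp add: mexp_def of_op_mult)
qed

lemma has_vector_derivative_quotient:
  "(f has_vector_derivative X) (at t) \<longleftrightarrow> ((\<lambda>h. (f (t + h) - f t) /\<^sub>R h) \<longlongrightarrow> X) (at 0)"
proof -
  have "(f has_vector_derivative X) (at t) \<longleftrightarrow> ((\<lambda>h. norm (f (t + h) - f t - h *\<^sub>R X) / norm h) \<longlongrightarrow> 0) (at 0)"
    by (simp add: has_vector_derivative_def has_derivative_at bounded_linear_scaleR_left)
  also have "\<dots> \<longleftrightarrow> ((\<lambda>h. norm ((f (t + h) - f t) /\<^sub>R h - X)) \<longlongrightarrow> 0) (at 0)"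
  proof (rule Lim_cong_within)
    fix h :: real assume "h \<noteq> 0"
    then have "(f (t + h) - f t) /\<^sub>R h - X = (f (t + h) - f t - h *\<^sub>R X) /\<^sub>R h"
      by (simp add: scaleR_diff_right)
    then show "norm (f (t + h) - f t - h *\<^sub>R X) / norm h = norm ((f (t + h) - f t) /\<^sub>R h - X)"
      by (simp add: divide_inverse mult.commute)
  qed auto
  also have "\<dots> \<longleftrightarrow> ((\<lambda>h. (f (t + h) - f t) /\<^sub>R h) \<longlongrightarrow> X) (at 0)"
    by (simp add: tendsto_norm_zero_iff Lim_null[symmetric])
  finally show ?thesis .
qed

section \<open>Powers of elements close to the identity\<close>

lemma norm_exp_diff_le:
  fixes x :: "'a::{real_normed_algebra_1,banach}"
  assumes "norm x \<le> 1"
  shows "norm (exp x - 1 - x) \<le> (norm x)\<^sup>2"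
proof -
  have s: "summable (\<lambda>n. norm x ^ (n + 2) /\<^sub>R fact (n + 2))"
    using summable_exp_generic[of "norm x"] by (subst summable_iff_shift)
  have "norm (exp x - 1 - x) = norm (\<Sum>n. x ^ (n + 2) /\<^sub>R fact (n + 2))"
    using exp_first_two_terms[of x] by simp
  also have "\<dots> \<le> (\<Sum>n. norm x ^ (n + 2) /\<^sub>R fact (n + 2))"
    by (rule norm_suminf_le[OF _ s]) (simp add: norm_power_ineq divide_right_mono del: power_Suc)
  also have "\<dots> = exp (norm x) - 1 - norm x"
    using exp_first_two_terms[of "norm x"] by simp
  also have "\<dots> \<le> (norm x)\<^sup>2"
    using exp_bound[of "norm x"] assms by simp
  finally show ?thesis .
qed

lemma norm_power_diff_le:
  fixes x y :: "'a::real_normed_algebra_1"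
  assumes "norm x \<le> M" "norm y \<le> M" "1 \<le> M"
  shows "norm (x ^ m - y ^ m) \<le> real m * M ^ m * norm (x - y)"
proof (induction m)
  case 0
  then show ?case by simp
next
  case (Suc m)
  have "x ^ Suc m - y ^ Suc m = x * (x ^ m - y ^ m) + (x - y) * y ^ m" by (simp add: algebra_simps)
  also have "norm \<dots> \<le> norm x * norm (x ^ m - y ^ m) + norm (x - y) * norm (y ^ m)"
    by (meson add_mono norm_mult_ineq norm_triangle_le)
  also have "\<dots> \<le> M * (real m * M ^ m * norm (x - y)) + norm (x - y) * M ^ m"
    using assms Suc by (intro add_mono mult_mono order_trans[OF norm_power_ineq] power_mono) auto
  also have "\<dots> \<le> M * (real m * M ^ m * norm (x - y)) + norm (x - y) * M ^ Suc m"
    using assms by (intro add_left_mono mult_left_mono power_increasing) auto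
  finally show ?case by (simp add: algebra_simps)
qed

lemma exp_scaleR_nat:
  fixes x :: "'a::{real_normed_algebra_1,banach}"
  shows "exp (real m *\<^sub>R x) = exp x ^ m"
proof (induction m)
  case (Suc m)
  have "exp (real (Suc m) *\<^sub>R x) = exp (x + real m *\<^sub>R x)" by (simp add: algebra_simps)
  also have "\<dots> = exp x * exp (real m *\<^sub>R x)" by (rule exp_add_commuting) simp
  finally show ?case by (simp add: Suc)
qed simp

lemma isCont_exp_algebra:
  fixes y :: "'a::{real_normed_algebra_1,banach}"
  shows "isCont exp y"
proof -
  let ?M = "norm y + 1"
  have "uniform_limit (cball 0 ?M) (\<lambda>n x::'a. \<Sum>i<n. x ^ i /\<^sub>R fact i) (\<lambda>x. \<Sum>i. x ^ i /\<^sub>R fact i) sequentially"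
  proof (rule Weierstrass_m_test)
    show "summable (\<lambda>i. ?M ^ i /\<^sub>R fact i)" by (rule summable_exp_generic)
    fix i and x :: 'a assume "x \<in> cball 0 ?M"
    then have "norm (x ^ i) \<le> ?M ^ i"
      by (intro order_trans[OF norm_power_ineq] power_mono) auto
    then show "norm (x ^ i /\<^sub>R fact i) \<le> ?M ^ i /\<^sub>R fact i" by (simp add: mult_left_mono)
  qed
  then have "continuous_on (cball 0 ?M) (\<lambda>x::'a. \<Sum>i. x ^ i /\<^sub>R fact i)"
    by (rule uniform_limit_theorem[rotated]) (auto intro!: always_eventually continuous_intros)
  then have "continuous_on (cball 0 ?M) (exp :: 'a \<Rightarrow> 'a)" by (simp add: exp_def[abs_def])
  then show ?thesis by (rule continuous_on_interior) simp
qed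

text \<open>The telescoping estimate bounds the difference of \<open>(1 + z) ^ m\<close> and
  \<open>exp z ^ m = exp (m z)\<close> by \<open>m * exp (m * norm z) * (norm z)\<^sup>2\<close>,
  which tends to 0 because \<open>m z\<close> converges and \<open>z\<close> tends to 0. This takes
  the place of a matrix logarithm.\<close>

lemma power_limit_exp:
  fixes z :: "nat \<Rightarrow> 'a::{real_normed_algebra_1,banach}" and m :: "nat \<Rightarrow> nat"
  assumes z: "z \<longlonglongrightarrow> 0" and mz: "(\<lambda>j. real (m j) *\<^sub>R z j) \<longlonglongrightarrow> y"
  shows "(\<lambda>j. (1 + z j) ^ m j) \<longlonglongrightarrow> exp y"
proof -
  define e where "e j = (1 + z j) ^ m j - exp (real (m j) *\<^sub>R z j)" for j
  have "e \<longlonglongrightarrow> 0"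
  proof (rule tendsto_0_le[where K = 1])
    have "(\<lambda>j. norm (real (m j) *\<^sub>R z j) * exp (norm (real (m j) *\<^sub>R z j)) * norm (z j)) \<longlonglongrightarrow> norm y * exp (norm y) * norm (0::'a)"
      by (intro tendsto_intros z mz)
    then show "(\<lambda>j. norm (real (m j) *\<^sub>R z j) * exp (norm (real (m j) *\<^sub>R z j)) * norm (z j)) \<longlonglongrightarrow> 0" by simp
    have "eventually (\<lambda>j. norm (z j) < 1) sequentially"
      using tendstoD[OF z, of 1] by simp
    then show "eventually (\<lambda>j. norm (e j) \<le> norm (norm (real (m j) *\<^sub>R z j) * exp (norm (real (m j) *\<^sub>R z j)) * norm (z j)) * 1) sequentially"
    proof eventually_elim
      case (elim j)
      let ?M = "exp (norm (z j))"
      have 1: "norm (1 + z j) \<le> ?M"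
        by (rule order_trans[OF norm_triangle_ineq]) (simp add: exp_ge_add_one_self)
      have "norm (e j) = norm ((1 + z j) ^ m j - exp (z j) ^ m j)"
        unfolding e_def exp_scaleR_nat ..
      also have "\<dots> \<le> real (m j) * ?M ^ m j * norm (1 + z j - exp (z j))"
        by (rule norm_power_diff_le) (use 1 norm_exp in auto)
      also have "norm (1 + z j - exp (z j)) = norm (exp (z j) - 1 - z j)"
        by (metis diff_diff_eq norm_minus_commute)
      also have "real (m j) * ?M ^ m j * norm (exp (z j) - 1 - z j) \<le> real (m j) * ?M ^ m j * (norm (z j))\<^sup>2"
        using elim by (intro mult_left_mono norm_exp_diff_le) auto
      also have "?M ^ m j = exp (norm (real (m j) *\<^sub>R z j))"
        by (simp add: exp_of_nat_mult)
      finally show ?case by (simp add: power2_eq_square mult_ac abs_mult)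
    qed
  qed
  moreover have "(\<lambda>j. exp (real (m j) *\<^sub>R z j)) \<longlonglongrightarrow> exp y"
    using isCont_tendsto_compose[OF isCont_exp_algebra mz] .
  ultimately have "(\<lambda>j. e j + exp (real (m j) *\<^sub>R z j)) \<longlonglongrightarrow> 0 + exp y" by (rule tendsto_add)
  then show ?thesis by (simp add: e_def)
qed

section \<open>The Lie algebra of a compact matrix group\<close>

locale compact_matrix_group =
  fixes U :: "(real^'n^'n) set"
  assumes compact: "compact U"
    and one_mem: "mat 1 \<in> U"
    and mult_mem: "A \<in> U \<Longrightarrow> B \<in> U \<Longrightarrow> A ** B \<in> U"
    and invertible_mem: "A \<in> U \<Longrightarrow> invertible A"
    and inv_mem: "A \<in> U \<Longrightarrow> matrix_inv A \<in> U"
begin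

lemma closed: "closed U" using compact compact_imp_closed by blast

lemma left_inv: "A \<in> U \<Longrightarrow> matrix_inv A ** A = mat 1"
  and right_inv: "A \<in> U \<Longrightarrow> A ** matrix_inv A = mat 1"
  using invertible_mem matrix_inv_left matrix_inv_right by blast+

text \<open>If group elements approach the identity along a direction, suitable powers of them
  approach points of the corresponding one-parameter group, and closedness keeps these limits in
  \<open>U\<close>. Tangents of curves and limits of secant directions both reduce to this.\<close>

lemma mexp_limit_mem:
  assumes "\<And>j. mat 1 + Z j \<in> U" and z: "Z \<longlonglongrightarrow> 0" and mz: "(\<lambda>j. real (m j) *\<^sub>R Z j) \<longlonglongrightarrow> Y"
  shows "mexp Y \<in> U"
proof -
  have mem: "of_op ((1 + to_op (Z j)) ^ k) \<in> U" for j k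
  proof (induction k)
    case 0 show ?case by (simp add: of_op_one one_mem)
  next
    case (Suc k)
    then show ?case using mult_mem[OF assms(1)[of j]] by (simp add: of_op_mult of_op_linear of_op_one)
  qed
  have "(\<lambda>j. to_op (Z j)) \<longlonglongrightarrow> 0"
    using bounded_linear.tendsto[OF bounded_linear_to_op z] by simp
  moreover have "(\<lambda>j. real (m j) *\<^sub>R to_op (Z j)) \<longlonglongrightarrow> to_op Y"
    using bounded_linear.tendsto[OF bounded_linear_to_op mz] by (simp add: to_op_linear)
  ultimately have "(\<lambda>j. (1 + to_op (Z j)) ^ m j) \<longlonglongrightarrow> exp (to_op Y)" by (rule power_limit_exp)
  from bounded_linear.tendsto[OF bounded_linear_of_op this]
  have "(\<lambda>j. of_op ((1 + to_op (Z j)) ^ m j)) \<longlonglongrightarrow> mexp Y" by (simp add: mexp_def)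
  then show ?thesis by (rule closed_sequentially[OF closed mem])
qed

lemma lie_algebra_mexpI:
  assumes "\<And>t. mexp (t *\<^sub>R X) \<in> U" shows "X \<in> lie_algebra U"
proof -
  have "((\<lambda>t. mexp (t *\<^sub>R X)) has_vector_derivative X) (at 0)"
    using mexp_has_vector_derivative[of X 0] by simp
  then show ?thesis unfolding lie_algebra_def using assms smooth_mexp by fastforce
qed

text \<open>The powers of \<open>\<gamma> (t / m)\<close> with exponent \<open>m\<close> converge to
  \<open>exp (t X)\<close>. Consequently the Lie algebra consists of the \<open>X\<close> whose
  one-parameter group lies in \<open>U\<close>, and later membership proofs only have to exhibit a
  curve with the right velocity.\<close>

lemma lie_algebra_tangentI:
  assumes g: "\<And>t. \<gamma> t \<in> U" "\<gamma> 0 = mat 1" "(\<gamma> has_vector_derivative X) (at 0)"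
  shows "mexp (t *\<^sub>R X) \<in> U"
proof -
  define Z where "Z j = \<gamma> (t / real (Suc j)) - mat 1" for j
  have lim0: "(\<lambda>j. t / real (Suc j)) \<longlonglongrightarrow> 0"
    by (rule LIMSEQ_Suc[OF lim_const_over_n])
  have "isCont \<gamma> 0" using g(3) by (rule has_vector_derivative_continuous)
  then have "(\<lambda>j. \<gamma> (t / real (Suc j))) \<longlonglongrightarrow> \<gamma> 0" using lim0 by (rule isCont_tendsto_compose)
  then have Z: "Z \<longlonglongrightarrow> 0" unfolding Z_def using g(2) LIM_zero by fastforce
  have "(\<lambda>j. real (Suc j) *\<^sub>R Z j) \<longlonglongrightarrow> t *\<^sub>R X"
  proof (cases "t = 0")
    case True then show ?thesis by (simp add: Z_def g(2))
  next
    case False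
    have "((\<lambda>h. (\<gamma> (0 + h) - \<gamma> 0) /\<^sub>R h) \<longlongrightarrow> X) (at 0)"
      using g(3) by (simp add: has_vector_derivative_quotient)
    then have "((\<lambda>h. (\<gamma> h - mat 1) /\<^sub>R h) \<longlongrightarrow> X) (at 0)" by (simp add: g(2))
    moreover have "filterlim (\<lambda>j. t / real (Suc j)) (at 0) sequentially"
      using lim0 False by (auto simp: filterlim_at)
    ultimately have "(\<lambda>j. (\<gamma> (t / real (Suc j)) - mat 1) /\<^sub>R (t / real (Suc j))) \<longlonglongrightarrow> X"
      by (rule filterlim_compose)
    from tendsto_scaleR[OF tendsto_const[of t] this] show ?thesis
      using False by (simp add: Z_def)
  qed
  moreover have "mat 1 + Z j \<in> U" for j unfolding Z_def using g(1) by simp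
  ultimately show ?thesis using mexp_limit_mem[OF _ Z, where m = Suc] by blast
qed

lemma mexp_mem: "X \<in> lie_algebra U \<Longrightarrow> mexp (t *\<^sub>R X) \<in> U"
  using lie_algebra_tangentI unfolding lie_algebra_def by blast

lemma lie_algebra_curveI:
  assumes "\<And>t. \<gamma> t \<in> U" "\<gamma> 0 = mat 1" "(\<gamma> has_vector_derivative X) (at 0)"
  shows "X \<in> lie_algebra U"
  using lie_algebra_mexpI lie_algebra_tangentI assms by blast

lemma subspace_lie_algebra: "subspace (lie_algebra U)"
proof (rule subspaceI)
  show "0 \<in> lie_algebra U" by (rule lie_algebra_mexpI) (simp add: one_mem)
  fix X Y assume X: "X \<in> lie_algebra U" and Y: "Y \<in> lie_algebra U"
  show "c *\<^sub>R X \<in> lie_algebra U" for c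
    by (rule lie_algebra_mexpI) (use mexp_mem[OF X, of "_ * c"] in simp)
  \<comment> \<open>The product of the two one-parameter groups is a curve in \<open>U\<close> with
    velocity \<open>X + Y\<close> at 0.\<close>
  have "((\<lambda>t. mexp (t *\<^sub>R X) ** mexp (t *\<^sub>R Y)) has_vector_derivative
      mexp (0 *\<^sub>R X) ** (Y ** mexp (0 *\<^sub>R Y)) + (X ** mexp (0 *\<^sub>R X)) ** mexp (0 *\<^sub>R Y)) (at 0)"
    by (rule bounded_bilinear.has_vector_derivative[OF bounded_bilinear_matrix_matrix_mult mexp_has_vector_derivative mexp_has_vector_derivative])
  then show "X + Y \<in> lie_algebra U"
    by (intro lie_algebra_curveI[where \<gamma> = "\<lambda>t. mexp (t *\<^sub>R X) ** mexp (t *\<^sub>R Y)"])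
      (auto intro: mult_mem mexp_mem X Y simp: add.commute)
qed

lemma Ad_mem:
  assumes "g \<in> U" "X \<in> lie_algebra U"
  shows "g ** X ** matrix_inv g \<in> lie_algebra U"
proof -
  have "((\<lambda>t. g ** mexp (t *\<^sub>R X) ** matrix_inv g) has_vector_derivative g ** (X ** mexp (0 *\<^sub>R X)) ** matrix_inv g) (at 0)"
    using bounded_linear.has_vector_derivative[OF bounded_bilinear.bounded_linear_left[OF bounded_bilinear_matrix_matrix_mult]
      bounded_linear.has_vector_derivative[OF bounded_bilinear.bounded_linear_right[OF bounded_bilinear_matrix_matrix_mult] mexp_has_vector_derivative]] .
  then show ?thesis using assms
    by (intro lie_algebra_curveI[where \<gamma> = "\<lambda>t. g ** mexp (t *\<^sub>R X) ** matrix_inv g"])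
      (auto intro!: mult_mem inv_mem mexp_mem simp: right_inv)
qed

lemma curve_derivative_mem:
  assumes "(\<gamma> has_vector_derivative X) (at (t::real))" "subspace S" "\<And>t. \<gamma> t \<in> S"
  shows "(X :: 'b::euclidean_space) \<in> S"
proof -
  have "((\<lambda>h. (\<gamma> (t + h) - \<gamma> t) /\<^sub>R h) \<longlongrightarrow> X) (at 0)"
    using assms(1) by (simp add: has_vector_derivative_quotient)
  moreover have "closed S" using assms(2) by (rule closed_subspace)
  moreover have "(\<gamma> (t + h) - \<gamma> t) /\<^sub>R h \<in> S" for h
    using assms(2,3) by (simp add: subspace_diff subspace_scale)
  ultimately show ?thesis by (intro Lim_in_closed_set) auto
qed

text \<open>The bracket is the derivative at 0 of \<open>exp (t X) Y exp (- t X)\<close>, a curve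
  inside the Lie algebra, which is closed as a subspace of finite dimension.\<close>

lemma bracket_mem:
  assumes X: "X \<in> lie_algebra U" and Y: "Y \<in> lie_algebra U"
  shows "commutator X Y \<in> lie_algebra U"
proof (rule curve_derivative_mem[OF _ subspace_lie_algebra])
  have i: "matrix_inv (mexp (t *\<^sub>R X)) = mexp ((- t) *\<^sub>R X)" for t
    by (rule matrix_inv_unique) (rule mexp_inverse)+
  have d: "((\<lambda>t. mexp ((- t) *\<^sub>R X)) has_vector_derivative - X) (at 0)"
    using mexp_has_vector_derivative[of "- X" 0] by simp
  have "((\<lambda>t. (mexp (t *\<^sub>R X) ** Y) ** mexp ((- t) *\<^sub>R X)) has_vector_derivative
      (mexp (0 *\<^sub>R X) ** Y) ** (- X) + ((X ** mexp (0 *\<^sub>R X)) ** Y) ** mexp ((- 0) *\<^sub>R X)) (at 0)"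
    by (intro bounded_bilinear.has_vector_derivative[OF bounded_bilinear_matrix_matrix_mult] d
      bounded_linear.has_vector_derivative[OF bounded_bilinear.bounded_linear_left[OF bounded_bilinear_matrix_matrix_mult]] mexp_has_vector_derivative)
  then show "((\<lambda>t. mexp (t *\<^sub>R X) ** Y ** mexp ((- t) *\<^sub>R X)) has_vector_derivative commutator X Y) (at 0)"
    by (simp add: commutator_def bounded_bilinear.minus_right[OF bounded_bilinear_matrix_matrix_mult])
  show "mexp (t *\<^sub>R X) ** Y ** mexp ((- t) *\<^sub>R X) \<in> lie_algebra U" for t
    using Ad_mem[OF mexp_mem[OF X] Y, of t] by (simp add: i)
qed

end

section \<open>Connected groups and their subgroups\<close>

lemma invertible_matrix_inv: "invertible A \<Longrightarrow> invertible (matrix_inv A)"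
  using matrix_inv_left matrix_inv_right invertible_def by blast

lemma group_GL: "group (GL :: (real^'n^'n) monoid)"
proof (rule groupI)
  fix A :: "real^'n^'n" assume "A \<in> carrier GL"
  then have "invertible A" by (simp add: matrix_group_def)
  then show "\<exists>B\<in>carrier GL. B \<otimes>\<^bsub>GL\<^esub> A = \<one>\<^bsub>GL\<^esub>"
    using invertible_matrix_inv matrix_inv_left by (auto simp: matrix_group_def)
qed (auto simp: matrix_group_def invertible_mult matrix_mul_assoc, auto simp: invertible_def)

lemma inv_GL: "invertible A \<Longrightarrow> inv\<^bsub>GL\<^esub> A = matrix_inv A" for A :: "real^'n^'n"
  using group.inv_equality[OF group_GL, of "matrix_inv A" A] invertible_matrix_inv[of A] matrix_inv_left[of A]
  by (simp add: matrix_group_def)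

lemma compact_matrix_groupI:
  assumes "subgroup U GL" "compact U" shows "compact_matrix_group U"
proof -
  have inv: "invertible A" if "A \<in> U" for A
    using subgroup.mem_carrier[OF assms(1) that] by (simp add: matrix_group_def)
  show ?thesis
  proof
    show "mat 1 \<in> U" using subgroup.one_closed[OF assms(1)] by (simp add: matrix_group_def)
    show "A ** B \<in> U" if "A \<in> U" "B \<in> U" for A B
      using subgroup.m_closed[OF assms(1) that] by (simp add: matrix_group_def)
    show "invertible A" if "A \<in> U" for A using inv that .
    show "matrix_inv A \<in> U" if "A \<in> U" for A
      using subgroup.m_inv_closed[OF assms(1) that] inv_GL[OF inv[OF that]] by simp
  qed fact
qed

lemma (in compact_matrix_group) subgroup_GL: "subgroup U GL"
proof (rule group.subgroupI[OF group_GL])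
  show "U \<subseteq> carrier GL" using invertible_mem by (auto simp: matrix_group_def)
  show "U \<noteq> {}" using one_mem by blast
  show "inv\<^bsub>GL\<^esub> A \<in> U" if "A \<in> U" for A using that inv_GL inv_mem invertible_mem by metis
  show "A \<otimes>\<^bsub>GL\<^esub> B \<in> U" if "A \<in> U" "B \<in> U" for A B using mult_mem[OF that] by (simp add: matrix_group_def)
qed

lemma continuous_on_matrix_mult [continuous_intros]:
  fixes f :: "_ \<Rightarrow> real^'n^'m" and g :: "_ \<Rightarrow> real^'p^'n"
  shows "continuous_on S f \<Longrightarrow> continuous_on S g \<Longrightarrow> continuous_on S (\<lambda>x. f x ** g x)"
  by (rule bounded_bilinear.continuous_on[OF bounded_bilinear_matrix_matrix_mult])

lemma tendsto_matrix_mult [tendsto_intros]: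
  fixes f :: "_ \<Rightarrow> real^'n^'m" and g :: "_ \<Rightarrow> real^'p^'n"
  shows "(f \<longlongrightarrow> a) F \<Longrightarrow> (g \<longlongrightarrow> b) F \<Longrightarrow> ((\<lambda>x. f x ** g x) \<longlongrightarrow> a ** b) F"
  by (rule bounded_bilinear.tendsto[OF bounded_bilinear_matrix_matrix_mult])

lemma isCont_matrix_inv:
  assumes "invertible A" shows "isCont matrix_inv (A :: real^'n^'n)"
proof -
  have "continuous_on {A :: real^'n^'n. invertible A} matrix_inv"
    by (rule smooth_on_continuous, rule smooth_on_matrix_inv[OF open_invertible smooth_on_ident]) auto
  then show ?thesis using open_invertible assms by (simp add: continuous_on_eq_continuous_at[OF open_invertible])
qed

lemma tendsto_matrix_inv [tendsto_intros]:
  fixes f :: "_ \<Rightarrow> real^'n^'n"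
  shows "(f \<longlongrightarrow> A) F \<Longrightarrow> invertible A \<Longrightarrow> ((\<lambda>x. matrix_inv (f x)) \<longlongrightarrow> matrix_inv A) F"
  using isCont_tendsto_compose[OF isCont_matrix_inv] .

lemma matrix_inv_one [simp]: "matrix_inv (mat 1 :: real^'n^'n) = mat 1"
  by (rule matrix_inv_unique) simp_all

lemma matrix_inv_mult:
  fixes A B :: "real^'n^'n"
  assumes "invertible A" "invertible B"
  shows "matrix_inv (A ** B) = matrix_inv B ** matrix_inv A"
proof (rule matrix_inv_unique)
  have "A ** B ** (matrix_inv B ** matrix_inv A) = A ** (B ** matrix_inv B) ** matrix_inv A"
    by (simp add: matrix_mul_assoc)
  then show "A ** B ** (matrix_inv B ** matrix_inv A) = mat 1" by (simp add: matrix_inv_right assms)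
  have "matrix_inv B ** matrix_inv A ** (A ** B) = matrix_inv B ** (matrix_inv A ** A) ** B"
    by (simp add: matrix_mul_assoc)
  then show "matrix_inv B ** matrix_inv A ** (A ** B) = mat 1" by (simp add: matrix_inv_left assms)
qed

lemma matrix_inv_cancel:
  fixes A B :: "real^'n^'n"
  assumes "invertible A"
  shows "matrix_inv A ** (A ** B) = B" "A ** (matrix_inv A ** B) = B"
    "B ** A ** matrix_inv A = B" "B ** matrix_inv A ** A = B"
  using assms by (simp_all add: matrix_mul_assoc matrix_inv_left matrix_inv_right)
     (simp_all add: matrix_mul_assoc[symmetric] matrix_inv_left matrix_inv_right)

lemma matrix_inv_inv: "invertible A \<Longrightarrow> matrix_inv (matrix_inv A) = (A :: real^'n^'n)"
  by (rule matrix_inv_unique) (simp_all add: matrix_inv_left matrix_inv_right)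

context compact_matrix_group
begin

text \<open>The corrections \<open>k j\<close> are chosen as nearest points, which makes the limit direction \<open>Y\<close>
  orthogonal to the Lie algebra of the subgroup.\<close>

lemma transverse_direction:
  assumes K: "compact_matrix_group K" "K \<subseteq> U"
    and g: "\<And>j::nat. g j \<in> U" "\<And>j. g j \<notin> K" "g \<longlonglongrightarrow> mat 1"
  obtains r k Y where "strict_mono r" "\<And>j::nat. k j \<in> K"
    "(\<lambda>j. g (r j) ** k j) \<longlonglongrightarrow> mat 1" "\<And>j. g (r j) ** k j \<noteq> mat 1"
    "(\<lambda>j. (g (r j) ** k j - mat 1) /\<^sub>R norm (g (r j) ** k j - mat 1)) \<longlonglongrightarrow> Y"
    "norm Y = 1" "Y \<in> lie_algebra U" "\<And>X. X \<in> lie_algebra K \<Longrightarrow> X \<bullet> Y = 0"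
proof -
  interpret K: compact_matrix_group K by fact
  have "\<exists>c\<in>K. \<forall>y\<in>K. norm (g j ** c - mat 1) \<le> norm (g j ** y - mat 1)" for j
    by (rule continuous_attains_inf[OF K.compact]) (use K.one_mem in \<open>auto intro!: continuous_intros\<close>)
  then obtain c where c: "\<And>j. c j \<in> K" "\<And>j y. y \<in> K \<Longrightarrow> norm (g j ** c j - mat 1) \<le> norm (g j ** y - mat 1)"
    by metis
  define Z where "Z j = g j ** c j - mat 1" for j
  have Z0: "Z \<longlonglongrightarrow> 0"
  proof (rule tendsto_0_le[where K = 1])
    show "(\<lambda>j. g j - mat 1) \<longlonglongrightarrow> 0" using g(3) by (rule LIM_zero)
    show "eventually (\<lambda>j. norm (Z j) \<le> norm (g j - mat 1) * 1) sequentially"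
      using c(2)[OF K.one_mem] by (simp add: Z_def)
  qed
  have Zne: "Z j \<noteq> 0" for j
  proof
    assume "Z j = 0"
    then have "g j ** c j ** matrix_inv (c j) = matrix_inv (c j)" by (simp add: Z_def)
    then have "g j = matrix_inv (c j)" using matrix_inv_cancel(3)[OF K.invertible_mem[OF c(1)[of j]]] by metis
    then show False using g(2) K.inv_mem c(1) by metis
  qed
  define W where "W j = Z j /\<^sub>R norm (Z j)" for j
  have "\<forall>j. W j \<in> sphere 0 1" using Zne by (simp add: W_def)
  moreover have "compact (sphere (0::real^'n^'n) 1)" by simp
  ultimately obtain Y r where Y: "Y \<in> sphere 0 1" "strict_mono r" "(W \<circ> r) \<longlonglongrightarrow> Y"
    unfolding compact_def by metis
  have Zr: "(\<lambda>j. Z (r j)) \<longlonglongrightarrow> 0" using LIMSEQ_subseq_LIMSEQ[OF Z0 Y(2)] by (simp add: o_def)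
  have Wr: "(\<lambda>j. W (r j)) \<longlonglongrightarrow> Y" using Y(3) by (simp add: o_def)
  have memZ: "mat 1 + Z j \<in> U" for j
  proof -
    have "g j ** c j \<in> U" using g(1) c(1) K(2) mult_mem by blast
    then show ?thesis by (simp add: Z_def)
  qed
  have pos: "mexp (t *\<^sub>R Y) \<in> U" if t: "t \<ge> 0" for t
  proof (rule mexp_limit_mem[OF memZ Zr])
    \<comment> \<open>The direction of \<open>Z (r j)\<close> tends to \<open>Y\<close>, so about
      \<open>t / norm (Z (r j))\<close> copies of it have limit \<open>t Y\<close>; the rounding
      error is at most one step. Only nonnegative \<open>t\<close> is reached by powers, negative
      \<open>t\<close> follows by inversion.\<close>
    define m where "m j = nat \<lfloor>t / norm (Z (r j))\<rfloor>" for j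
    have "(\<lambda>j. real (m j) * norm (Z (r j)) - t) \<longlonglongrightarrow> 0"
    proof (rule tendsto_0_le[where K = 1, OF Zr])
      have "\<bar>real (m j) * norm (Z (r j)) - t\<bar> \<le> norm (Z (r j))" for j
      proof -
        have n: "norm (Z (r j)) > 0" using Zne by simp
        have "real (m j) \<le> t / norm (Z (r j))" "t / norm (Z (r j)) \<le> real (m j) + 1"
          using t n unfolding m_def by (auto simp: of_nat_nat)
        then have "real (m j) * norm (Z (r j)) \<le> t" "t \<le> (real (m j) + 1) * norm (Z (r j))"
          using n by (simp_all add: field_simps)
        then show ?thesis by (simp add: algebra_simps abs_le_iff)
      qed
      then show "eventually (\<lambda>j. norm (real (m j) * norm (Z (r j)) - t) \<le> norm (Z (r j)) * 1) sequentially" by simp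
    qed
    then have "(\<lambda>j. real (m j) * norm (Z (r j))) \<longlonglongrightarrow> t" by (simp add: LIM_zero_iff)
    from tendsto_scaleR[OF this Wr]
    have "(\<lambda>j. (real (m j) * norm (Z (r j))) *\<^sub>R W (r j)) \<longlonglongrightarrow> t *\<^sub>R Y" .
    moreover have "(real (m j) * norm (Z (r j))) *\<^sub>R W (r j) = real (m j) *\<^sub>R Z (r j)" for j
      using Zne[of "r j"] by (simp add: W_def)
    ultimately show "(\<lambda>j. real (m j) *\<^sub>R Z (r j)) \<longlonglongrightarrow> t *\<^sub>R Y" by simp
  qed
  have "mexp (t *\<^sub>R Y) \<in> U" for t
  proof (cases "t \<ge> 0")
    case False
    have "matrix_inv (mexp ((- t) *\<^sub>R Y)) = mexp (t *\<^sub>R Y)"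
      using mexp_inverse[of t Y] by (intro matrix_inv_unique) simp_all
    then show ?thesis using inv_mem[OF pos[of "- t"]] False by simp
  qed (rule pos)
  then have Yl: "Y \<in> lie_algebra U" by (rule lie_algebra_mexpI)
  have orth: "X \<bullet> Y = 0" if X: "X \<in> lie_algebra K" for X
  proof -
    \<comment> \<open>First-order condition for the nearest point: moving \<open>c j\<close> along
      \<open>c j exp (s X)\<close> inside \<open>K\<close> cannot bring the product with
      \<open>g j\<close> closer to the identity.\<close>
    have z: "(g j ** c j ** X) \<bullet> Z j = 0" for j
    proof -
      define f where "f s = (g j ** c j ** mexp (s *\<^sub>R X) - mat 1) \<bullet> (g j ** c j ** mexp (s *\<^sub>R X) - mat 1)" for s
      have d: "((\<lambda>s. g j ** c j ** mexp (s *\<^sub>R X) - mat 1) has_vector_derivative g j ** c j ** (X ** mexp (0 *\<^sub>R X)) - 0) (at 0)"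
        by (intro has_vector_derivative_diff has_vector_derivative_const
          bounded_linear.has_vector_derivative[OF bounded_bilinear.bounded_linear_right[OF bounded_bilinear_matrix_matrix_mult]] mexp_has_vector_derivative)
      have "(f has_vector_derivative (2 * ((g j ** c j ** X) \<bullet> Z j))) (at 0)"
        using bounded_bilinear.has_vector_derivative[OF bounded_bilinear_inner d d] unfolding f_def Z_def
        by (simp add: inner_commute)
      then have "(f has_real_derivative 2 * ((g j ** c j ** X) \<bullet> Z j)) (at 0)"
        by (simp add: has_real_derivative_iff_has_vector_derivative)
      moreover have "f 0 \<le> f s" for s
      proof -
        have "norm (g j ** c j - mat 1) \<le> norm (g j ** (c j ** mexp (s *\<^sub>R X)) - mat 1)"
          by (intro c(2) K.mult_mem c(1) K.mexp_mem X)
        then show ?thesis unfolding f_def by (simp add: dot_square_norm matrix_mul_assoc)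
      qed
      ultimately have "2 * ((g j ** c j ** X) \<bullet> Z j) = 0"
        by (intro DERIV_local_min[of f _ 0 1]) auto
      then show ?thesis by simp
    qed
    have "(\<lambda>j. ((mat 1 + Z (r j)) ** X) \<bullet> W (r j)) \<longlonglongrightarrow> ((mat 1 + 0) ** X) \<bullet> Y"
      by (intro tendsto_intros Zr Wr)
    moreover have "((mat 1 + Z (r j)) ** X) \<bullet> W (r j) = 0" for j
      using z[of "r j"] by (simp add: W_def Z_def)
    ultimately show ?thesis by (simp add: LIMSEQ_const_iff)
  qed
  show thesis
  proof
    show "(\<lambda>j. g (r j) ** c (r j)) \<longlonglongrightarrow> mat 1"
      using tendsto_add[OF Zr tendsto_const[of "mat 1"]] by (simp add: Z_def)
    show "(\<lambda>j. (g (r j) ** c (r j) - mat 1) /\<^sub>R norm (g (r j) ** c (r j) - mat 1)) \<longlonglongrightarrow> Y"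
      using Wr by (simp add: W_def Z_def)
    show "g (r j) ** c (r j) \<noteq> mat 1" for j using Zne[of "r j"] by (simp add: Z_def)
  qed (use Y c Yl orth in auto)
qed

text \<open>If \<open>K\<close> missed elements of \<open>U\<close> arbitrarily close to the
  identity, the transverse direction would be a unit vector of \<open>lie_algebra U\<close>
  orthogonal to \<open>lie_algebra K\<close>, hence to itself. So \<open>K\<close> contains a
  neighbourhood of the identity in \<open>U\<close>, and is open and closed in the connected group
  \<open>U\<close>.\<close>

lemma subgroup_eqI:
  assumes K: "compact_matrix_group K" "K \<subseteq> U" and conn: "connected U"
    and lie: "lie_algebra U \<subseteq> lie_algebra K"
  shows "K = U"
proof -
  interpret K: compact_matrix_group K by fact
  have "\<exists>\<delta>>0. \<forall>g\<in>U. dist g (mat 1) < \<delta> \<longrightarrow> g \<in> K"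
  proof (rule ccontr)
    assume "\<not> ?thesis"
    then have "\<forall>j::nat. \<exists>g\<in>U. dist g (mat 1) < inverse (real (Suc j)) \<and> g \<notin> K"
      by (metis inverse_positive_iff_positive of_nat_0_less_iff zero_less_Suc)
    then obtain g where g: "\<And>j::nat. g j \<in> U" "\<And>j. dist (g j) (mat 1) < inverse (real (Suc j))" "\<And>j. g j \<notin> K"
      by metis
    have "eventually (\<lambda>j. dist (g j) (mat 1) \<le> dist (inverse (real (Suc j))) 0) sequentially"
      using g(2) by (intro always_eventually allI) (simp add: dist_real_def less_imp_le)
    then have "g \<longlonglongrightarrow> mat 1"
      by (rule metric_tendsto_imp_tendsto[OF LIMSEQ_inverse_real_of_nat])
    from transverse_direction[OF K g(1) g(3) this]
    obtain Y where "norm Y = 1" "Y \<in> lie_algebra U" "\<And>X. X \<in> lie_algebra K \<Longrightarrow> X \<bullet> Y = 0" by metis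
    then show False using lie by (metis inner_eq_zero_iff norm_zero subsetD zero_neq_one)
  qed
  then obtain \<delta> where \<delta>: "\<delta> > 0" "\<And>g. g \<in> U \<Longrightarrow> dist g (mat 1) < \<delta> \<Longrightarrow> g \<in> K" by metis
  have "openin (top_of_set U) K"
    unfolding openin_euclidean_subtopology_iff
  proof (intro conjI ballI K(2))
    fix k assume k: "k \<in> K"
    have "isCont (\<lambda>g. matrix_inv k ** g) k"
      using continuous_on_matrix_mult[of UNIV "\<lambda>g. matrix_inv k" "\<lambda>g::real^'n^'n. g"] by (simp add: continuous_on_eq_continuous_at)
    then obtain e where e: "e > 0" "\<And>g. dist g k < e \<Longrightarrow> dist (matrix_inv k ** g) (matrix_inv k ** k) < \<delta>"
      using \<delta>(1) unfolding continuous_at_eps_delta by blast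
    have "g \<in> K" if g: "g \<in> U" "dist g k < e" for g
    proof -
      have "matrix_inv k ** g \<in> K"
        using e(2)[OF g(2)] k K(2) g by (intro \<delta>(2) mult_mem inv_mem) (auto simp: K.left_inv)
      then have "k ** (matrix_inv k ** g) \<in> K" using k K.mult_mem by blast
      then show ?thesis using matrix_inv_cancel(2)[OF K.invertible_mem[OF k]] by simp
    qed
    then show "\<exists>e>0. \<forall>g\<in>U. dist g k < e \<longrightarrow> g \<in> K" using e(1) by blast
  qed
  moreover have "closedin (top_of_set U) K"
    using K(2) K.closed closedin_subset_trans[of UNIV K U] by (simp add: closed_subset)
  ultimately have "K = {} \<or> K = U" using conn unfolding connected_clopen by blast
  then show ?thesis using K.one_mem by blast
qed

text \<open>\<open>subgroup_eqI\<close> applies to the centraliser of \<open>H\<close> in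
  \<open>U\<close>: commutation on the Lie algebra passes to the exponentials, so the centraliser
  has the full Lie algebra.\<close>

lemma centralizes:
  assumes conn: "connected U" and X: "\<And>X. X \<in> lie_algebra U \<Longrightarrow> X ** H = H ** X" and g: "g \<in> U"
  shows "g ** H = H ** g"
proof -
  define K where "K = {g \<in> U. g ** H = H ** g}"
  have K: "compact_matrix_group K"
  proof
    have "closed {g. g ** H = H ** g}" by (intro closed_Collect_eq continuous_intros)
    moreover have "K = U \<inter> {g. g ** H = H ** g}" by (auto simp: K_def)
    ultimately show "compact K" using compact_Int_closed[OF compact] by simp
    show "mat 1 \<in> K" using one_mem by (simp add: K_def)
    show "A ** B \<in> K" if "A \<in> K" "B \<in> K" for A B
    proof -
      have "A ** B ** H = A ** (B ** H)" by (simp add: matrix_mul_assoc)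
      also have "\<dots> = A ** H ** B" using that by (simp add: K_def matrix_mul_assoc)
      also have "\<dots> = H ** (A ** B)" using that by (simp add: K_def matrix_mul_assoc)
      finally show ?thesis using that mult_mem by (simp add: K_def)
    qed
    show inv: "invertible A" if "A \<in> K" for A using that invertible_mem by (simp add: K_def)
    show "matrix_inv A \<in> K" if "A \<in> K" for A
    proof -
      have "matrix_inv A ** H = matrix_inv A ** (H ** A) ** matrix_inv A"
        using matrix_inv_cancel(3)[OF inv[OF that], of "matrix_inv A ** H"] by (simp add: matrix_mul_assoc)
      also have "H ** A = A ** H" using that by (simp add: K_def)
      also have "matrix_inv A ** (A ** H) = H" by (rule matrix_inv_cancel(1)[OF inv[OF that]])
      finally show ?thesis using that inv_mem by (simp add: K_def)
    qed
  qed
  have "K = U"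
  proof (rule subgroup_eqI[OF K _ conn])
    show "K \<subseteq> U" by (auto simp: K_def)
    show "lie_algebra U \<subseteq> lie_algebra K"
    proof
      fix Y assume Y: "Y \<in> lie_algebra U"
      have "mexp (t *\<^sub>R Y) \<in> K" for t
        unfolding K_def using mexp_mem[OF Y] mexp_commute[of H "t *\<^sub>R Y"] X[OF Y]
        by (simp add: matrix_scalar_ac scalar_matrix_assoc[symmetric])
      then show "Y \<in> lie_algebra K" by (rule compact_matrix_group.lie_algebra_mexpI[OF K])
    qed
  qed
  then show ?thesis using g by (auto simp: K_def)
qed

end

text \<open>The one-parameter group of \<open>X\<close> commutes with \<open>T\<close>, so the
  closure of the group generated by both is a torus containing \<open>T\<close>. By maximality it
  equals \<open>T\<close>, whence \<open>X\<close> is tangent to \<open>T\<close>.\<close>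

lemma maximal_torus_centralizer:
  assumes U: "compact_matrix_group U" and T: "maximal_torus U T"
    and X: "X \<in> lie_algebra U" and comm: "\<And>H. H \<in> lie_algebra T \<Longrightarrow> H ** X = X ** H"
  shows "X \<in> lie_algebra T"
proof -
  interpret U: compact_matrix_group U by fact
  have tT: "subgroup T GL" "T \<subseteq> U" "compact T" "connected T" "\<And>A B. A \<in> T \<Longrightarrow> B \<in> T \<Longrightarrow> A ** B = B ** A"
    using T by (auto simp: maximal_torus_def torus_in_def)
  interpret T: compact_matrix_group T using tT by (intro compact_matrix_groupI)
  have cX: "A ** X = X ** A" if "A \<in> T" for A
    using T.centralizes[OF tT(4) comm that] by simp
  define e where "e s = mexp (s *\<^sub>R X)" for s
  have cE: "A ** e s = e s ** A" if "A \<in> T" for A s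
    unfolding e_def using cX[OF that] by (intro mexp_commute) (simp add: matrix_scalar_ac scalar_matrix_assoc[symmetric])
  have eadd: "e s ** e t = e (s + t)" for s t by (simp add: e_def mexp_add)
  have einv: "e s ** e (- s) = mat 1" "e (- s) ** e s = mat 1" for s by (simp_all add: eadd) (simp_all add: e_def)
  define S0 where "S0 = (\<lambda>(A, s). A ** e s) ` (T \<times> UNIV)"
  \<comment> \<open>The product set need not be closed, since a one-parameter group may wind
    densely; the group laws, commutativity and connectedness survive the passage to the
    closure.\<close>
  define S where "S = closure S0"
  have S0I: "A ** e s \<in> S0" if "A \<in> T" for A s using that by (force simp: S0_def)
  have S0mult: "p ** q \<in> S0" "p ** q = q ** p" if pq: "p \<in> S0" "q \<in> S0" for p q
  proof -
    obtain A s B t where *: "p = A ** e s" "q = B ** e t" "A \<in> T" "B \<in> T" using pq by (auto simp: S0_def)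
    have 1: "A ** e s ** (B ** e t) = A ** B ** e (s + t)" if "A \<in> T" "B \<in> T" for A B s t
    proof -
      have "A ** e s ** (B ** e t) = A ** (e s ** B) ** e t" by (simp add: matrix_mul_assoc)
      also have "e s ** B = B ** e s" using cE[OF that(2)] by simp
      also have "A ** (B ** e s) ** e t = A ** B ** (e s ** e t)" by (simp add: matrix_mul_assoc)
      finally show ?thesis by (simp add: eadd)
    qed
    show "p ** q \<in> S0" using * 1 S0I T.mult_mem by simp
    show "p ** q = q ** p" using * 1 tT(5) by (simp add: add.commute)
  qed
  have S0inv: "matrix_inv p \<in> S0" if p: "p \<in> S0" for p
  proof -
    obtain A s where *: "p = A ** e s" "A \<in> T" using p by (auto simp: S0_def)
    have "matrix_inv (e s) = e (- s)" by (rule matrix_inv_unique) (rule einv)+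
    moreover have "invertible (e s)" using einv invertible_def by blast
    ultimately have "matrix_inv p = e (- s) ** matrix_inv A" using * T.invertible_mem by (simp add: matrix_inv_mult)
    also have "\<dots> = matrix_inv A ** e (- s)" using cE T.inv_mem *(2) by metis
    finally show ?thesis using S0I T.inv_mem *(2) by simp
  qed
  have S0U: "S0 \<subseteq> U" using tT(2) U.mult_mem U.mexp_mem[OF X] by (auto simp: S0_def e_def)
  have SU: "S \<subseteq> U" unfolding S_def using S0U U.closed by (rule closure_minimal)
  have cS: "compact S" using compact_Int_closed[OF U.compact closed_closure[of S0]] SU by (simp add: S_def Int_absorb1)
  have Sseq: "\<exists>x. (\<forall>n::nat. x n \<in> S0) \<and> x \<longlonglongrightarrow> p" if "p \<in> S" for p
    using that unfolding S_def closure_sequential .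
  have lim: "p \<in> S" if "\<And>n::nat. x n \<in> S0" "x \<longlonglongrightarrow> p" for x p
    using that unfolding S_def closure_sequential by blast
  have "compact_matrix_group S"
  proof
    show "mat 1 \<in> S" using S0I[OF T.one_mem, of 0] closure_subset by (auto simp: S_def e_def)
    show "p ** q \<in> S" if pq: "p \<in> S" "q \<in> S" for p q
    proof -
      obtain x y where "\<And>n::nat. x n \<in> S0" "x \<longlonglongrightarrow> p" "\<And>n::nat. y n \<in> S0" "y \<longlonglongrightarrow> q" using Sseq pq by metis
      then show ?thesis using S0mult(1) tendsto_matrix_mult by (intro lim[of "\<lambda>n. x n ** y n"]) auto
    qed
    show "invertible p" if "p \<in> S" for p using that SU U.invertible_mem by blast
    show "matrix_inv p \<in> S" if p: "p \<in> S" for p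
    proof -
      obtain x where x: "\<And>n::nat. x n \<in> S0" "x \<longlonglongrightarrow> p" using Sseq p by metis
      have "invertible p" using U.invertible_mem SU p by blast
      from tendsto_matrix_inv[OF x(2) this] show ?thesis by (rule lim[rotated]) (rule S0inv[OF x(1)])
    qed
  qed (rule cS)
  then interpret S: compact_matrix_group S .
  have comS: "p ** q = q ** p" if pq: "p \<in> S" "q \<in> S" for p q
  proof -
    obtain x y where xy: "\<And>n::nat. x n \<in> S0" "x \<longlonglongrightarrow> p" "\<And>n::nat. y n \<in> S0" "y \<longlonglongrightarrow> q" using Sseq pq by metis
    have "(\<lambda>n. x n ** y n) \<longlonglongrightarrow> p ** q" "(\<lambda>n. x n ** y n) \<longlonglongrightarrow> q ** p"
      using tendsto_matrix_mult[OF xy(2,4)] tendsto_matrix_mult[OF xy(4,2)] S0mult(2)[OF xy(1,3)] by auto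
    then show ?thesis by (rule LIMSEQ_unique)
  qed
  have "connected (T \<times> (UNIV :: real set))" using tT(4) by (intro connected_Times connected_UNIV)
  moreover have "continuous_on (T \<times> UNIV) (\<lambda>(A, s). A ** e s)"
    unfolding split_beta
  proof (intro continuous_intros)
    have "continuous_on UNIV e" unfolding e_def by (rule smooth_on_continuous[OF smooth_mexp])
    then show "continuous_on (T \<times> UNIV) (\<lambda>x. e (snd x))"
      by (rule continuous_on_compose2) (auto intro!: continuous_intros)
  qed
  ultimately have "connected S0" unfolding S0_def by (intro connected_continuous_image)
  then have "connected S" unfolding S_def by (rule connected_imp_connected_closure)
  then have "torus_in U S" unfolding torus_in_def using S.subgroup_GL SU cS comS by blast
  moreover have "T \<subseteq> S"
  proof
    fix A assume "A \<in> T"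
    then show "A \<in> S" using S0I[of A 0] closure_subset by (auto simp: S_def e_def)
  qed
  ultimately have "S = T" using T by (simp add: maximal_torus_def)
  moreover have "e s \<in> S" for s using S0I[OF T.one_mem, of s] closure_subset by (auto simp: S_def)
  ultimately show ?thesis by (intro T.lie_algebra_mexpI) (auto simp: e_def)
qed

section \<open>Adjoint orbits and smooth local sections\<close>

text \<open>Canonical coordinates of the second kind. The coordinates are read off by inner
  products, so the map is defined on all matrices, and for an orthonormal list its derivative at 0
  is the orthogonal projection onto the span.\<close>

fun exp_prod :: "(real^'n^'n) list \<Rightarrow> real^'n^'n \<Rightarrow> real^'n^'n" where
  "exp_prod [] A = mat 1"
| "exp_prod (E # Es) A = mexp ((A \<bullet> E) *\<^sub>R E) ** exp_prod Es A"

lemma smooth_exp_prod: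
  fixes Es :: "(real^'n^'n) list"
  shows "smooth_on UNIV (exp_prod Es)"
proof (induction Es)
  case Nil
  have "exp_prod [] = (\<lambda>A. mat 1 :: real^'n^'n)" by auto
  then show ?case by simp
next
  case (Cons E Es)
  have "smooth_on UNIV (\<lambda>A. mexp ((A \<bullet> E) *\<^sub>R E))"
    by (rule smooth_on_compose[OF smooth_mexp smooth_on_bounded_linear[OF bounded_linear_inner_left]]) auto
  then have "smooth_on UNIV (\<lambda>A. mexp ((A \<bullet> E) *\<^sub>R E) ** exp_prod Es A)"
    using Cons by (intro smooth_on_matrix_mult) auto
  moreover have "exp_prod (E # Es) = (\<lambda>A. mexp ((A \<bullet> E) *\<^sub>R E) ** exp_prod Es A)" by auto
  ultimately show ?case by simp
qed

lemma exp_prod_0 [simp]: "exp_prod Es 0 = mat 1"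
  by (induction Es) simp_all

lemma exp_prod_has_derivative:
  fixes Es :: "(real^'n^'n) list"
  shows "(exp_prod Es has_derivative (\<lambda>A. \<Sum>E\<leftarrow>Es. (A \<bullet> E) *\<^sub>R E)) (at 0)"
proof (induction Es)
  case Nil
  have "exp_prod [] = (\<lambda>A. mat 1 :: real^'n^'n)" by auto
  then show ?case by simp
next
  case (Cons E Es)
  have "((\<lambda>t. mexp (t *\<^sub>R E)) has_derivative (\<lambda>t. t *\<^sub>R E)) (at ((0::real^'n^'n) \<bullet> E))"
    using mexp_has_vector_derivative[of E 0] by (simp add: has_vector_derivative_def)
  from has_derivative_compose[OF bounded_linear_imp_has_derivative[OF bounded_linear_inner_left] this]
  have d: "((\<lambda>A. mexp ((A \<bullet> E) *\<^sub>R E)) has_derivative (\<lambda>A. (A \<bullet> E) *\<^sub>R E)) (at 0)" .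
  have "((\<lambda>A. mexp ((A \<bullet> E) *\<^sub>R E) ** exp_prod Es A) has_derivative
      (\<lambda>A. mexp ((0 \<bullet> E) *\<^sub>R E) ** (\<Sum>E\<leftarrow>Es. (A \<bullet> E) *\<^sub>R E) + ((A \<bullet> E) *\<^sub>R E) ** exp_prod Es 0)) (at 0)"
    by (rule bounded_bilinear.FDERIV[OF bounded_bilinear_matrix_matrix_mult d Cons])
  moreover have "exp_prod (E # Es) = (\<lambda>A. mexp ((A \<bullet> E) *\<^sub>R E) ** exp_prod Es A)" by auto
  ultimately show ?case by (simp add: add.commute)
qed

lemma (in compact_matrix_group) exp_prod_mem: "set Es \<subseteq> lie_algebra U \<Longrightarrow> exp_prod Es A \<in> U"
  by (induction Es) (auto simp: one_mem mult_mem mexp_mem)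

lemma bracket_conj_identity:
  fixes g H :: "real^'n^'n"
  assumes "invertible g"
  shows "g ** H ** matrix_inv g - H = commutator (g - mat 1) H ** matrix_inv g"
proof -
  have "commutator (g - mat 1) H = g ** H - H ** g"
    by (simp add: commutator_def bounded_bilinear.diff_left[OF bounded_bilinear_matrix_matrix_mult]
        bounded_bilinear.diff_right[OF bounded_bilinear_matrix_matrix_mult])
  then show ?thesis
    using matrix_inv_cancel(3)[OF assms, of H]
    by (simp add: bounded_bilinear.diff_left[OF bounded_bilinear_matrix_matrix_mult])
qed

text \<open>The last two conditions say that \<open>K\<close> lies in the stabiliser of
  \<open>H0\<close> and has the same Lie algebra. \<open>K\<close> may still be smaller than the
  stabiliser, so the orbit map on cosets is only locally injective.\<close>

locale orbit =
  U: compact_matrix_group U + K: compact_matrix_group K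
  for U K :: "(real^'n^'n) set" and H0 :: "real^'n^'n" +
  assumes KU: "K \<subseteq> U"
    and K_centralizes: "k \<in> K \<Longrightarrow> k ** H0 = H0 ** k"
    and centralizer_lie: "X \<in> lie_algebra U \<Longrightarrow> commutator X H0 = 0 \<Longrightarrow> X \<in> lie_algebra K"
begin

definition \<iota> :: "real^'n^'n \<Rightarrow> real^'n^'n" where "\<iota> g = g ** H0 ** matrix_inv g"

lemma \<iota>_one [simp]: "\<iota> (mat 1) = H0" by (simp add: \<iota>_def)

lemma \<iota>_mult: "invertible a \<Longrightarrow> invertible b \<Longrightarrow> \<iota> (a ** b) = a ** \<iota> b ** matrix_inv a"
  by (simp add: \<iota>_def matrix_inv_mult matrix_mul_assoc)

lemma \<iota>_K: "k \<in> K \<Longrightarrow> \<iota> k = H0"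
  using matrix_inv_cancel(3)[OF K.invertible_mem, of k H0] by (simp add: \<iota>_def K_centralizes)

lemma \<iota>_mult_K: "g \<in> U \<Longrightarrow> k \<in> K \<Longrightarrow> \<iota> (g ** k) = \<iota> g"
  using \<iota>_mult[of g k] U.invertible_mem K.invertible_mem \<iota>_K by (simp add: \<iota>_def)

lemma smooth_\<iota>: "smooth_on {g. invertible g} \<iota>"
  unfolding \<iota>_def[abs_def]
  by (intro smooth_on_matrix_mult smooth_on_matrix_inv open_invertible smooth_on_ident smooth_on_const) auto

lemma tendsto_\<iota>: "(f \<longlongrightarrow> g) F \<Longrightarrow> invertible g \<Longrightarrow> ((\<lambda>x. \<iota> (f x)) \<longlongrightarrow> \<iota> g) F"
  unfolding \<iota>_def by (intro tendsto_intros)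

text \<open>The derivative exists by smoothness, so it can be tested on the curves
  \<open>exp (t A)\<close>, whose inverses are explicit.\<close>

lemma \<iota>_has_derivative: "(\<iota> has_derivative (\<lambda>A. commutator A H0)) (at (mat 1))"
proof -
  have inv1: "invertible (mat 1 :: real^'n^'n)" using U.one_mem U.invertible_mem by blast
  have "(\<iota> has_derivative frechet_derivative \<iota> (at (mat 1))) (at (mat 1))"
    using smooth_on_has_derivative[OF smooth_\<iota>] inv1 by simp
  moreover have "frechet_derivative \<iota> (at (mat 1)) = (\<lambda>A. commutator A H0)"
  proof
    fix A :: "real^'n^'n"
    let ?D = "frechet_derivative \<iota> (at (mat 1))"
    have "((\<lambda>t. mexp (t *\<^sub>R A)) has_derivative (\<lambda>t. t *\<^sub>R A)) (at 0)"
      using mexp_has_vector_derivative[of A 0] by (simp add: has_vector_derivative_def)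
    moreover have "(\<iota> has_derivative ?D) (at (mexp (0 *\<^sub>R A)))"
      using smooth_on_has_derivative[OF smooth_\<iota>] inv1 by simp
    ultimately have d1: "((\<lambda>t. \<iota> (mexp (t *\<^sub>R A))) has_derivative (\<lambda>t. ?D (t *\<^sub>R A))) (at 0)"
      by (rule has_derivative_compose)
    have i: "matrix_inv (mexp (t *\<^sub>R A)) = mexp ((- t) *\<^sub>R A)" for t
      by (rule matrix_inv_unique) (rule mexp_inverse)+
    have d: "((\<lambda>t. mexp ((- t) *\<^sub>R A)) has_vector_derivative - A) (at 0)"
      using mexp_has_vector_derivative[of "- A" 0] by simp
    have "((\<lambda>t. (mexp (t *\<^sub>R A) ** H0) ** mexp ((- t) *\<^sub>R A)) has_vector_derivative
        (mexp (0 *\<^sub>R A) ** H0) ** (- A) + ((A ** mexp (0 *\<^sub>R A)) ** H0) ** mexp ((- 0) *\<^sub>R A)) (at 0)"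
      by (intro bounded_bilinear.has_vector_derivative[OF bounded_bilinear_matrix_matrix_mult] d
        bounded_linear.has_vector_derivative[OF bounded_bilinear.bounded_linear_left[OF bounded_bilinear_matrix_matrix_mult]] mexp_has_vector_derivative)
    then have "((\<lambda>t. \<iota> (mexp (t *\<^sub>R A))) has_vector_derivative commutator A H0) (at 0)"
      by (simp add: commutator_def \<iota>_def i bounded_bilinear.minus_right[OF bounded_bilinear_matrix_matrix_mult])
    then have d2: "((\<lambda>t. \<iota> (mexp (t *\<^sub>R A))) has_derivative (\<lambda>t. t *\<^sub>R commutator A H0)) (at 0)"
      by (simp add: has_vector_derivative_def)
    have "(\<lambda>t. ?D (t *\<^sub>R A)) = (\<lambda>t. t *\<^sub>R commutator A H0)"
      using d1 d2 by (rule has_derivative_unique)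
    from fun_cong[OF this, of 1] show "?D A = commutator A H0" by simp
  qed
  ultimately show ?thesis by simp
qed

lemma linear_commutator_left: "linear (\<lambda>A :: real^'n^'n. commutator A B)"
  unfolding commutator_def
  by (intro linearI) (simp_all add: bounded_bilinear.add_left[OF bounded_bilinear_matrix_matrix_mult]
    bounded_bilinear.add_right[OF bounded_bilinear_matrix_matrix_mult]
    bounded_bilinear.scaleR_left[OF bounded_bilinear_matrix_matrix_mult]
    bounded_bilinear.scaleR_right[OF bounded_bilinear_matrix_matrix_mult] algebra_simps)

text \<open>A smooth map \<open>s\<close> on a neighbourhood of \<open>H0\<close> that restricts to a local section of the orbit map
  \<open>g \<mapsto> g H0 g\<inverse>\<close>. It plays the role of a chart of \<open>U / K\<close> around the base point.\<close>

lemma local_section: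
  obtains s \<rho> \<delta> L where "\<rho> > 0" "\<delta> > 0" "smooth_on (ball H0 \<rho>) s"
    "\<And>y. s y \<in> U" "s H0 = mat 1"
    "linear L" "range L \<subseteq> lie_algebra U" "(s has_derivative L) (at H0)"
    "\<And>g. g \<in> U \<Longrightarrow> dist g (mat 1) < \<delta> \<Longrightarrow> \<iota> g \<in> ball H0 \<rho> \<and> (\<exists>k\<in>K. g = s (\<iota> g) ** k)"
proof -
  \<comment> \<open>\<open>m\<close> is the complement of \<open>lie_algebra K\<close> in
    \<open>lie_algebra U\<close> for the entrywise inner product. Bracketing with \<open>H0\<close>
    is injective on it by \<open>centralizer_lie\<close>, which is what provides the left inverse
    \<open>L\<close>.\<close>
  define m where "m = {X \<in> lie_algebra U. \<forall>Y\<in>lie_algebra K. X \<bullet> Y = 0}"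
  have sm: "subspace m"
    unfolding m_def using U.subspace_lie_algebra
    by (auto simp: subspace_def inner_add_left)
  obtain B where B: "B \<subseteq> m" "pairwise orthogonal B" "\<And>x. x \<in> B \<Longrightarrow> norm x = 1" "independent B" "span B = m"
    using orthonormal_basis_subspace[OF sm] by metis
  have fB: "finite B" using B(4) by (rule independent_imp_finite)
  obtain Es where Es: "set Es = B" "distinct Es" using finite_distinct_list[OF fB] by blast
  define pr where "pr A = (\<Sum>E\<in>B. (A \<bullet> E) *\<^sub>R E)" for A
  have pr_lin: "linear pr" unfolding pr_def
    by (intro linear_compose_sum ballI linearI) (auto simp: inner_add_left scaleR_add_left)
  have pr_mem: "pr A \<in> m" for A
    unfolding pr_def B(5)[symmetric] by (intro span_sum span_scale span_base)
  have inB: "E \<bullet> F = (if E = F then 1 else 0)" if "E \<in> B" "F \<in> B" for E F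
    using that B(2,3) by (auto simp: pairwise_def orthogonal_def dot_square_norm)
  have "B \<subseteq> {A. pr A = A}"
  proof
    fix F assume F: "F \<in> B"
    have "pr F = (\<Sum>E\<in>B. if E = F then F else 0)"
      unfolding pr_def by (rule sum.cong) (use inB F in auto)
    then show "F \<in> {A. pr A = A}" using F fB by simp
  qed
  moreover have "subspace {A. pr A = A}"
    using pr_lin by (auto simp: subspace_def linear_add linear_cmul linear_0)
  ultimately have pr_id: "pr A = A" if "A \<in> m" for A
    using that span_minimal[of B "{A. pr A = A}"] B(5) by blast
  have pr_inner: "(A - pr A) \<bullet> X = 0" if "X \<in> m" for A X
  proof -
    have "B \<subseteq> {X. (A - pr A) \<bullet> X = 0}"
    proof
      fix F assume F: "F \<in> B"
      have "pr A \<bullet> F = (\<Sum>E\<in>B. if E = F then A \<bullet> F else 0)"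
        unfolding pr_def inner_sum_left by (rule sum.cong) (use inB F in auto)
      then show "F \<in> {X. (A - pr A) \<bullet> X = 0}" using F fB by (simp add: inner_diff_left)
    qed
    moreover have "subspace {X. (A - pr A) \<bullet> X = 0}" by (auto simp: subspace_def inner_add_right)
    ultimately show ?thesis using that span_minimal B(5) by blast
  qed
  have mK: "X = 0" if "X \<in> m" "commutator X H0 = 0" for X
    using that centralizer_lie[of X] unfolding m_def by (simp add: inner_eq_zero_iff) (metis inner_eq_zero_iff)
  have injm: "inj_on (\<lambda>X. commutator X H0) m"
    by (rule linear_injective_on_subspace_0[THEN iffD2, OF linear_commutator_left sm]) (use mK in auto)
  obtain L where L: "range L \<subseteq> m" "linear L" "\<And>X. X \<in> m \<Longrightarrow> L (commutator X H0) = X"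
    using linear_exists_left_inverse_on[OF linear_commutator_left sm injm] by auto
  have bL: "bounded_linear L" using L(2) by (simp add: linear_conv_bounded_linear)
  have bpr: "bounded_linear pr" using pr_lin by (simp add: linear_conv_bounded_linear)
  define sg where "sg = exp_prod Es"
  have sgU: "sg A \<in> U" for A
    unfolding sg_def using B(1) Es(1) by (intro U.exp_prod_mem) (auto simp: m_def)
  have sgs: "smooth_on UNIV sg" unfolding sg_def by (rule smooth_exp_prod)
  have sgd: "(sg has_derivative pr) (at 0)"
    using exp_prod_has_derivative[of Es] unfolding sg_def pr_def Es(1)[symmetric]
    by (simp add: sum_list_distinct_conv_sum_set[OF Es(2)])
  have sg0: "sg 0 = mat 1" by (simp add: sg_def)
  \<comment> \<open>On \<open>m\<close> this is the orbit map in exponential coordinates, read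
    through \<open>L\<close>; on the orthogonal complement it is the identity. Adding the complement
    makes the derivative at 0 the identity of the whole matrix space, as the inverse function
    theorem asks.\<close>
  define \<beta> where "\<beta> A = L (\<iota> (sg A) - H0) + (A - pr A)" for A
  have \<beta>0: "\<beta> 0 = 0" using L(2) pr_lin by (simp add: \<beta>_def sg0 linear_0)
  have \<beta>s: "smooth_on UNIV \<beta>" unfolding \<beta>_def
    by (intro smooth_on_add smooth_on_bounded_linear_compose[OF bL] smooth_on_diff smooth_on_const smooth_on_ident
      smooth_on_compose[OF smooth_\<iota> sgs] open_invertible open_UNIV smooth_on_bounded_linear[OF bpr])
     (use sgU U.invertible_mem in auto)
  have \<beta>d: "(\<beta> has_derivative id) (at 0)"
  proof -
    have "(\<iota> has_derivative (\<lambda>A. commutator A H0)) (at (sg 0))" unfolding sg0 by (rule \<iota>_has_derivative)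
    from has_derivative_compose[OF sgd this]
    have "((\<lambda>A. \<iota> (sg A) - H0) has_derivative (\<lambda>A. commutator (pr A) H0 - 0)) (at 0)"
      by (intro has_derivative_diff has_derivative_const)
    from bounded_linear.has_derivative[OF bL this]
    have "((\<lambda>A. L (\<iota> (sg A) - H0) + (A - pr A)) has_derivative (\<lambda>A. L (commutator (pr A) H0 - 0) + (A - pr A))) (at 0)"
      by (intro has_derivative_add has_derivative_diff has_derivative_ident bounded_linear_imp_has_derivative[OF bpr])
    then show ?thesis using L(3) pr_mem unfolding \<beta>_def by (simp add: id_def)
  qed
  obtain U' V h where h: "open U'" "0 \<in> U'" "open V" "\<beta> 0 \<in> V" "homeomorphism U' V \<beta> h" "smooth_on V h"
    using smooth_local_inverse[OF open_UNIV UNIV_I \<beta>s \<beta>d] by metis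
  have h0: "h 0 = 0" using h(2,5) \<beta>0 unfolding homeomorphism_def by metis
  define W where "W = (\<lambda>y. L (y - H0)) -` V"
  have sL: "smooth_on UNIV (\<lambda>y. L (y - H0))"
    by (intro smooth_on_bounded_linear_compose[OF bL] smooth_on_diff smooth_on_const smooth_on_ident open_UNIV)
  have "open W" unfolding W_def
    using smooth_on_continuous[OF sL] h(3) by (intro open_vimage) auto
  moreover have "H0 \<in> W" using h(4) \<beta>0 L(2) by (simp add: W_def linear_0)
  ultimately obtain \<rho> where \<rho>: "\<rho> > 0" "ball H0 \<rho> \<subseteq> W" using openE by blast
  define s where "s y = sg (h (L (y - H0)))" for y
  have sU: "s y \<in> U" for y unfolding s_def by (rule sgU)
  have sH: "s H0 = mat 1" using L(2) by (simp add: s_def linear_0 h0 sg0)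
  have ss: "smooth_on (ball H0 \<rho>) s" unfolding s_def
    by (intro smooth_on_compose[OF sgs] smooth_on_compose[OF h(6) smooth_on_subset[OF sL]] open_ball open_UNIV h(3))
      (use \<rho>(2) W_def in auto)
  have hd: "(h has_derivative id) (at 0)"
  proof -
    have *: "0 \<in> V" using h(4) \<beta>0 by simp
    have hd0: "(h has_derivative frechet_derivative h (at 0)) (at 0)" by (rule smooth_on_has_derivative[OF h(6) *])
    have "(\<beta> has_derivative id) (at (h 0))" using \<beta>d h0 by simp
    from has_derivative_compose[OF hd0 this]
    have "((\<lambda>y. \<beta> (h y)) has_derivative frechet_derivative h (at 0)) (at 0)" by simp
    then have "((\<lambda>y. y) has_derivative frechet_derivative h (at 0)) (at 0)"
      by (rule has_derivative_transform_within_open[OF _ h(3) *]) (use h(5) in \<open>auto simp: homeomorphism_def\<close>)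
    then have "frechet_derivative h (at 0) = (\<lambda>y. y)" using has_derivative_ident has_derivative_unique by blast
    then show ?thesis using hd0 by (simp add: id_def)
  qed
  have sd: "(s has_derivative L) (at H0)"
  proof -
    have e0: "L (H0 - H0) = 0" using L(2) by (simp add: linear_0)
    have 1: "((\<lambda>y. L (y - H0)) has_derivative (\<lambda>y. L (y - 0))) (at H0)"
      by (intro bounded_linear.has_derivative[OF bL] has_derivative_diff has_derivative_ident has_derivative_const)
    have "(h has_derivative id) (at (L (H0 - H0)))" using hd e0 by simp
    from has_derivative_compose[OF 1 this]
    have 2: "((\<lambda>y. h (L (y - H0))) has_derivative (\<lambda>y. id (L (y - 0)))) (at H0)" .
    have "(sg has_derivative pr) (at (h (L (H0 - H0))))" using sgd e0 h0 by simp
    from has_derivative_compose[OF 2 this] show ?thesis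
      using L(1) pr_id unfolding s_def by (simp add: image_subset_iff)
  qed
  \<comment> \<open>If points \<open>g\<close> near the identity violate the claim, the discrepancy
    between \<open>g\<close> and \<open>s (\<iota> g)\<close> stays outside \<open>K\<close> and
    tends to the identity. Its transverse direction \<open>Y\<close> lies in \<open>m\<close>, and
    equality of the \<open>L\<close>-parts of the two orbit points forces
    \<open>L [Y, H0] = 0\<close> in the limit, so \<open>Y = 0\<close>.\<close>
  have "\<exists>\<delta>>0. \<forall>g\<in>U. dist g (mat 1) < \<delta> \<longrightarrow> \<iota> g \<in> ball H0 \<rho> \<and> (\<exists>k\<in>K. g = s (\<iota> g) ** k)"
  proof (rule ccontr)
    assume "\<not> ?thesis"
    then have "\<forall>j::nat. \<exists>g\<in>U. dist g (mat 1) < inverse (real (Suc j)) \<and> \<not> (\<iota> g \<in> ball H0 \<rho> \<and> (\<exists>k\<in>K. g = s (\<iota> g) ** k))"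
      by (metis inverse_positive_iff_positive of_nat_0_less_iff zero_less_Suc)
    then obtain g where g: "\<And>j::nat. g j \<in> U" "\<And>j. dist (g j) (mat 1) < inverse (real (Suc j))"
      "\<And>j. \<not> (\<iota> (g j) \<in> ball H0 \<rho> \<and> (\<exists>k\<in>K. g j = s (\<iota> (g j)) ** k))"
      by metis
    have "eventually (\<lambda>j. dist (g j) (mat 1) \<le> dist (inverse (real (Suc j))) 0) sequentially"
      using g(2) by (intro always_eventually allI) (simp add: dist_real_def less_imp_le)
    then have g1: "g \<longlonglongrightarrow> mat 1"
      by (rule metric_tendsto_imp_tendsto[OF LIMSEQ_inverse_real_of_nat])
    have "(\<lambda>j. \<iota> (g j)) \<longlonglongrightarrow> \<iota> (mat 1)" using tendsto_\<iota>[OF g1] U.one_mem U.invertible_mem by blast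
    then have \<iota>g: "(\<lambda>j. \<iota> (g j)) \<longlonglongrightarrow> H0" by simp
    then have "eventually (\<lambda>j. \<iota> (g j) \<in> ball H0 \<rho>) sequentially"
      using \<rho>(1) by (intro topological_tendstoD) auto
    then obtain N where N: "\<And>j. j \<ge> N \<Longrightarrow> \<iota> (g j) \<in> ball H0 \<rho>" by (auto simp: eventually_sequentially)
    define g' where "g' j = g (j + N)" for j
    have g': "g' j \<in> U" "\<iota> (g' j) \<in> ball H0 \<rho>" "\<not> (\<exists>k\<in>K. g' j = s (\<iota> (g' j)) ** k)" for j
      using g(1,3)[of "j + N"] N[of "j + N"] by (auto simp: g'_def)
    have g'1: "g' \<longlonglongrightarrow> mat 1" unfolding g'_def using g1 by (rule LIMSEQ_ignore_initial_segment)
    have \<iota>g': "(\<lambda>j. \<iota> (g' j)) \<longlonglongrightarrow> H0" unfolding g'_def using \<iota>g by (rule LIMSEQ_ignore_initial_segment)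
    define S where "S j = s (\<iota> (g' j))" for j
    have SU: "S j \<in> U" for j unfolding S_def by (rule sU)
    have Sinv: "invertible (S j)" for j using SU U.invertible_mem by blast
    have "isCont s H0" using has_derivative_continuous[OF sd] .
    from isCont_tendsto_compose[OF this \<iota>g'] have S1: "S \<longlonglongrightarrow> mat 1" by (simp add: S_def[abs_def] sH)
    have iS1: "(\<lambda>j. matrix_inv (S j)) \<longlonglongrightarrow> mat 1"
      using tendsto_matrix_inv[OF S1] U.one_mem U.invertible_mem by force
    \<comment> \<open>At the argument \<open>?A\<close> the map \<open>\<beta>\<close> takes the
      value \<open>L (\<iota> (g' j) - H0)\<close>, which lies in \<open>m\<close>. Hence the part
      of \<open>?A\<close> orthogonal to \<open>m\<close> vanishes, and only the
      \<open>L\<close>-component of the orbit map is left.\<close>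
    have LS: "L (\<iota> (S j)) = L (\<iota> (g' j))" for j
    proof -
      let ?A = "h (L (\<iota> (g' j) - H0))"
      have "L (\<iota> (g' j) - H0) \<in> V" using g'(2)[of j] \<rho>(2) by (auto simp: W_def)
      then have "\<beta> ?A = L (\<iota> (g' j) - H0)" using h(5) by (auto simp: homeomorphism_def)
      then have e: "?A - pr ?A = L (\<iota> (g' j) - H0) - L (\<iota> (S j) - H0)"
        by (simp add: \<beta>_def S_def s_def algebra_simps)
      have "?A - pr ?A \<in> m" unfolding e using L(1) sm by (intro subspace_diff) auto
      from pr_inner[OF this] have "?A - pr ?A = 0" using inner_eq_zero_iff by blast
      then have "L (\<iota> (g' j) - H0) = L (\<iota> (S j) - H0)" using e by simp
      then show ?thesis using L(2) by (simp add: linear_diff)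
    qed
    define u where "u j = matrix_inv (S j) ** g' j" for j
    have Su: "S j ** u j = g' j" for j unfolding u_def by (rule matrix_inv_cancel(2)[OF Sinv])
    have uU: "u j \<in> U" for j unfolding u_def by (intro U.mult_mem U.inv_mem SU g')
    have u1: "u \<longlonglongrightarrow> mat 1" using tendsto_matrix_mult[OF iS1 g'1] by (simp add: u_def[abs_def])
    have uK: "u j \<notin> K" for j using g'(3)[of j] Su[of j] unfolding S_def by metis
    obtain r k Y where Y: "strict_mono r" "\<And>j::nat. k j \<in> K"
      "(\<lambda>j. u (r j) ** k j) \<longlonglongrightarrow> mat 1" "\<And>j. u (r j) ** k j \<noteq> mat 1"
      "(\<lambda>j. (u (r j) ** k j - mat 1) /\<^sub>R norm (u (r j) ** k j - mat 1)) \<longlonglongrightarrow> Y"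
      "norm Y = 1" "Y \<in> lie_algebra U" "\<And>X. X \<in> lie_algebra K \<Longrightarrow> X \<bullet> Y = 0"
      by (rule U.transverse_direction[OF K.compact_matrix_group_axioms KU uU uK u1]) (rule that)
    define w where "w j = u (r j) ** k j" for j
    have wU: "w j \<in> U" for j unfolding w_def using uU Y(2) KU U.mult_mem by blast
    have winv: "invertible (w j)" for j using wU U.invertible_mem by blast
    have iw1: "(\<lambda>j. matrix_inv (w j)) \<longlonglongrightarrow> mat 1"
      using tendsto_matrix_inv[OF Y(3)] U.one_mem U.invertible_mem by (force simp: w_def)
    define c where "c j = inverse (norm (w j - mat 1))" for j
    have z: "L (S (r j) ** (commutator (c j *\<^sub>R (w j - mat 1)) H0 ** matrix_inv (w j)) ** matrix_inv (S (r j))) = 0" for j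
    proof -
      have "\<iota> (g' (r j)) = \<iota> (g' (r j) ** k j)" using \<iota>_mult_K[OF g'(1) Y(2)] by simp
      also have "g' (r j) ** k j = S (r j) ** w j" using Su[of "r j"] by (simp add: w_def matrix_mul_assoc)
      also have "\<iota> (S (r j) ** w j) = S (r j) ** \<iota> (w j) ** matrix_inv (S (r j))"
        by (rule \<iota>_mult[OF Sinv winv])
      finally have "S (r j) ** (\<iota> (w j) - H0) ** matrix_inv (S (r j)) = \<iota> (g' (r j)) - \<iota> (S (r j))"
        by (simp add: \<iota>_def bounded_bilinear.diff_left[OF bounded_bilinear_matrix_matrix_mult]
            bounded_bilinear.diff_right[OF bounded_bilinear_matrix_matrix_mult])
      then have "L (S (r j) ** (\<iota> (w j) - H0) ** matrix_inv (S (r j))) = 0"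
        using LS[of "r j"] L(2) by (simp add: linear_diff)
      moreover have "\<iota> (w j) - H0 = commutator (w j - mat 1) H0 ** matrix_inv (w j)"
        unfolding \<iota>_def by (rule bracket_conj_identity[OF winv])
      ultimately have "c j *\<^sub>R L (S (r j) ** (commutator (w j - mat 1) H0 ** matrix_inv (w j)) ** matrix_inv (S (r j))) = 0"
        by simp
      then show ?thesis
        using linear_cmul[OF linear_commutator_left, of "c j" "w j - mat 1" H0] L(2)
        by (simp add: linear_cmul[symmetric] bounded_bilinear.scaleR_left[OF bounded_bilinear_matrix_matrix_mult]
          bounded_bilinear.scaleR_right[OF bounded_bilinear_matrix_matrix_mult])
    qed
    have Sr: "(\<lambda>j. S (r j)) \<longlonglongrightarrow> mat 1" "(\<lambda>j. matrix_inv (S (r j))) \<longlonglongrightarrow> mat 1"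
      using LIMSEQ_subseq_LIMSEQ[OF S1 Y(1)] LIMSEQ_subseq_LIMSEQ[OF iS1 Y(1)] by (simp_all add: o_def)
    have "(\<lambda>j. c j *\<^sub>R (w j - mat 1)) \<longlonglongrightarrow> Y" using Y(5) by (simp add: c_def w_def)
    then have "(\<lambda>j. L (S (r j) ** (commutator (c j *\<^sub>R (w j - mat 1)) H0 ** matrix_inv (w j)) ** matrix_inv (S (r j))))
        \<longlonglongrightarrow> L (mat 1 ** (commutator Y H0 ** mat 1) ** mat 1)"
      unfolding commutator_def
      by (intro bounded_linear.tendsto[OF bL] tendsto_matrix_mult tendsto_diff Sr iw1 tendsto_const)
    then have "L (commutator Y H0) = 0" using z by (simp add: LIMSEQ_const_iff)
    moreover have "Y \<in> m" unfolding m_def using Y(7,8) by (simp add: inner_commute)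
    ultimately have "Y = 0" using L(3) by metis
    then show False using Y(6) by simp
  qed
  then obtain \<delta> where "\<delta> > 0" "\<And>g. g \<in> U \<Longrightarrow> dist g (mat 1) < \<delta> \<Longrightarrow> \<iota> g \<in> ball H0 \<rho> \<and> (\<exists>k\<in>K. g = s (\<iota> g) ** k)"
    by metis
  moreover have "range L \<subseteq> lie_algebra U" using L(1) by (auto simp: m_def)
  ultimately show thesis using that[OF \<rho>(1) _ ss sU sH L(2) _ sd] by blast
qed

end

section \<open>The Nijenhuis tensor over an algebra of functions\<close>

text \<open>The assumptions are purely algebraic: they suffice to form brackets of fields of
  derivations, so invariance of the Nijenhuis conditions under diffeomorphisms can be shown without
  charts.\<close>

locale smooth_algebra =
  fixes M :: "'p set" and C :: "('p \<Rightarrow> real) set"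
  assumes zero_outside: "f \<in> C \<Longrightarrow> p \<notin> M \<Longrightarrow> f p = 0"
    and lincomb_mem: "f \<in> C \<Longrightarrow> g \<in> C \<Longrightarrow> (\<lambda>q. a * f q + b * g q) \<in> C"
    and mult_fn_mem: "f \<in> C \<Longrightarrow> g \<in> C \<Longrightarrow> (\<lambda>q. f q * g q) \<in> C"
begin

abbreviation TS where "TS p \<equiv> tangent_space C p"
abbreviation field where "field X \<equiv> smooth_vector_field M C X"

text \<open>The value 0 off \<open>M\<close> is what allows the result to be a member of
  \<open>C\<close>.\<close>

definition act :: "('p \<Rightarrow> ('p \<Rightarrow> real) \<Rightarrow> real) \<Rightarrow> ('p \<Rightarrow> real) \<Rightarrow> 'p \<Rightarrow> real" where
  "act X f = (\<lambda>p. if p \<in> M then X p f else 0)"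

definition bracket :: "('p \<Rightarrow> ('p \<Rightarrow> real) \<Rightarrow> real) \<Rightarrow> ('p \<Rightarrow> ('p \<Rightarrow> real) \<Rightarrow> real) \<Rightarrow> 'p \<Rightarrow> ('p \<Rightarrow> real) \<Rightarrow> real" where
  "bracket X Y p = (\<lambda>f. if f \<in> C then X p (act Y f) - Y p (act X f) else 0)"

definition nijenhuis :: "'p endo_field \<Rightarrow> ('p \<Rightarrow> ('p \<Rightarrow> real) \<Rightarrow> real) \<Rightarrow> ('p \<Rightarrow> ('p \<Rightarrow> real) \<Rightarrow> real) \<Rightarrow> 'p \<Rightarrow> ('p \<Rightarrow> real) \<Rightarrow> real" where
  "nijenhuis J X Y p = (\<lambda>f. bracket (\<lambda>q. J q (X q)) (\<lambda>q. J q (Y q)) p f - J p (bracket (\<lambda>q. J q (X q)) Y p) f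
      - J p (bracket X (\<lambda>q. J q (Y q)) p) f - bracket X Y p f)"

definition torsion_free :: "'p endo_field \<Rightarrow> bool" where
  "torsion_free J \<longleftrightarrow> (\<forall>X Y. field X \<longrightarrow> field Y \<longrightarrow> (\<forall>p\<in>M. \<forall>f\<in>C. nijenhuis J X Y p f = 0))"

text \<open>Covectors at a point are the differentials of functions, so this condition says that the values of the
  Nijenhuis tensor span each tangent space.\<close>

definition torsion_full :: "'p endo_field \<Rightarrow> bool" where
  "torsion_full J \<longleftrightarrow> (\<forall>p\<in>M. \<forall>f\<in>C. (\<forall>X Y. field X \<longrightarrow> field Y \<longrightarrow> nijenhuis J X Y p f = 0) \<longrightarrow>
     (\<forall>v\<in>TS p. v f = 0))"

lemma TS_outside: "v \<in> TS p \<Longrightarrow> f \<notin> C \<Longrightarrow> v f = 0"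
  by (simp add: tangent_space_def)

lemma TS_lincomb: "v \<in> TS p \<Longrightarrow> f \<in> C \<Longrightarrow> g \<in> C \<Longrightarrow> v (\<lambda>q. a * f q + b * g q) = a * v f + b * v g"
  by (simp add: tangent_space_def)

lemma TS_mult: "v \<in> TS p \<Longrightarrow> f \<in> C \<Longrightarrow> g \<in> C \<Longrightarrow> v (\<lambda>q. f q * g q) = v f * g p + f p * v g"
  by (simp add: tangent_space_def)

lemma TS_uminus: "v \<in> TS p \<Longrightarrow> f \<in> C \<Longrightarrow> v (\<lambda>q. - f q) = - v f"
  using TS_lincomb[of v p f f "-1" 0] by simp

lemma fieldD: "field X \<Longrightarrow> p \<in> M \<Longrightarrow> X p \<in> TS p" "field X \<Longrightarrow> f \<in> C \<Longrightarrow> act X f \<in> C"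
  by (auto simp: smooth_vector_field_def act_def)

lemma TS_I:
  assumes "\<And>f. f \<notin> C \<Longrightarrow> v f = 0"
    "\<And>f g a b. f \<in> C \<Longrightarrow> g \<in> C \<Longrightarrow> v (\<lambda>q. a * f q + b * g q) = a * v f + b * v g"
    "\<And>f g. f \<in> C \<Longrightarrow> g \<in> C \<Longrightarrow> v (\<lambda>q. f q * g q) = v f * g p + f p * v g"
  shows "v \<in> TS p"
  using assms by (simp add: tangent_space_def)

text \<open>In the Leibniz rule the mixed products \<open>X f * Y g\<close> and
  \<open>Y f * X g\<close> occur symmetrically and cancel.\<close>

lemma bracket_mem:
  assumes X: "field X" and Y: "field Y" and p: "p \<in> M"
  shows "bracket X Y p \<in> TS p"
proof (rule TS_I)
  fix f g assume f: "f \<in> C" and g: "g \<in> C"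
  have lin: "act Z (\<lambda>q. a * f q + b * g q) = (\<lambda>q. a * act Z f q + b * act Z g q)" if "field Z" for Z a b
    using TS_lincomb[OF fieldD(1)[OF that] f g] by (auto simp: act_def)
  have mul: "act Z (\<lambda>q. f q * g q) = (\<lambda>q. 1 * (act Z f q * g q) + 1 * (f q * act Z g q))" if "field Z" for Z
    using TS_mult[OF fieldD(1)[OF that] f g] by (auto simp: act_def)
  show "bracket X Y p (\<lambda>q. a * f q + b * g q) = a * bracket X Y p f + b * bracket X Y p g" for a b
    using f g lincomb_mem[OF f g] TS_lincomb[OF fieldD(1)[OF X p] fieldD(2)[OF Y f] fieldD(2)[OF Y g], of a b]
      TS_lincomb[OF fieldD(1)[OF Y p] fieldD(2)[OF X f] fieldD(2)[OF X g], of a b]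
    by (simp add: bracket_def lin[OF X] lin[OF Y] algebra_simps)
  have m: "(\<lambda>q. act Z f q * g q) \<in> C" "(\<lambda>q. f q * act Z g q) \<in> C" if "field Z" for Z
    using mult_fn_mem fieldD(2)[OF that] f g by auto
  have v: "v (\<lambda>q. 1 * (act Z f q * g q) + 1 * (f q * act Z g q)) =
      v (act Z f) * g p + act Z f p * v g + v f * act Z g p + f p * v (act Z g)" if "field Z" "v \<in> TS p" for Z v
    using TS_lincomb[OF that(2) m(1)[OF that(1)] m(2)[OF that(1)], of 1 1]
      TS_mult[OF that(2) fieldD(2)[OF that(1) f] g] TS_mult[OF that(2) f fieldD(2)[OF that(1) g]] by simp
  have "bracket X Y p (\<lambda>q. f q * g q) = X p (act Y (\<lambda>q. f q * g q)) - Y p (act X (\<lambda>q. f q * g q))"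
    using mult_fn_mem[OF f g] by (simp add: bracket_def)
  also have "\<dots> = bracket X Y p f * g p + f p * bracket X Y p g"
    unfolding mul[OF X] mul[OF Y] v[OF Y fieldD(1)[OF X p]] v[OF X fieldD(1)[OF Y p]]
    using f g p by (simp add: bracket_def act_def algebra_simps)
  finally show "bracket X Y p (\<lambda>q. f q * g q) = bracket X Y p f * g p + f p * bracket X Y p g" .
qed (simp add: bracket_def)

lemma pullback_mem: "smooth_map M C \<phi> \<Longrightarrow> f \<in> C \<Longrightarrow> pullback M \<phi> f \<in> C"
  by (simp add: smooth_map_def)

lemma differential_mem:
  assumes \<phi>: "smooth_map M C \<phi>" and p: "p \<in> M" and v: "v \<in> TS p"
  shows "differential M C \<phi> v \<in> TS (\<phi> p)"
proof (rule TS_I)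
  fix f g assume f: "f \<in> C" and g: "g \<in> C"
  have 1: "pullback M \<phi> (\<lambda>q. a * f q + b * g q) = (\<lambda>q. a * pullback M \<phi> f q + b * pullback M \<phi> g q)" for a b
    by (auto simp: pullback_def)
  have 2: "pullback M \<phi> (\<lambda>q. f q * g q) = (\<lambda>q. pullback M \<phi> f q * pullback M \<phi> g q)"
    by (auto simp: pullback_def)
  show "differential M C \<phi> v (\<lambda>q. a * f q + b * g q) = a * differential M C \<phi> v f + b * differential M C \<phi> v g" for a b
    using f g lincomb_mem[OF f g] TS_lincomb[OF v pullback_mem[OF \<phi> f] pullback_mem[OF \<phi> g]]
    by (simp add: differential_def 1)
  show "differential M C \<phi> v (\<lambda>q. f q * g q) = differential M C \<phi> v f * g (\<phi> p) + f (\<phi> p) * differential M C \<phi> v g"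
    using f g p mult_fn_mem[OF f g] TS_mult[OF v pullback_mem[OF \<phi> f] pullback_mem[OF \<phi> g]]
    by (simp add: differential_def 2) (simp add: pullback_def)
qed (simp add: differential_def)

lemma pullback_inverse:
  assumes "f \<in> C" "\<And>p. p \<in> M \<Longrightarrow> \<psi> p \<in> M" "\<And>p. p \<in> M \<Longrightarrow> \<phi> (\<psi> p) = p"
  shows "pullback M \<psi> (pullback M \<phi> f) = f"
  using assms zero_outside[OF assms(1)] by (auto simp: pullback_def)

lemma differential_inverse:
  assumes "w \<in> TS q" "smooth_map M C \<phi>" "smooth_map M C \<psi>" "\<And>p. p \<in> M \<Longrightarrow> \<phi> (\<psi> p) = p"
  shows "differential M C \<phi> (differential M C \<psi> w) = w"
proof
  fix f
  show "differential M C \<phi> (differential M C \<psi> w) f = w f"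
  proof (cases "f \<in> C")
    case True
    then have "pullback M \<psi> (pullback M \<phi> f) = f"
      using assms(3,4) by (intro pullback_inverse) (auto simp: smooth_map_def)
    then show ?thesis using True pullback_mem[OF assms(2)] by (simp add: differential_def)
  qed (use TS_outside[OF assms(1)] in \<open>simp add: differential_def\<close>)
qed

lemma inverse_diffeo:
  assumes "diffeomorphism M C \<phi>"
  shows "diffeomorphism M C (inv_into M \<phi>)" "\<And>p. p \<in> M \<Longrightarrow> inv_into M \<phi> (\<phi> p) = p"
    "\<And>p. p \<in> M \<Longrightarrow> \<phi> (inv_into M \<phi> p) = p" "\<And>p. p \<in> M \<Longrightarrow> \<phi> p \<in> M" "\<And>p. p \<in> M \<Longrightarrow> inv_into M \<phi> p \<in> M"
    "smooth_map M C \<phi>" "smooth_map M C (inv_into M \<phi>)"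
proof -
  have b: "bij_betw \<phi> M M" and s: "smooth_map M C \<phi>" "smooth_map M C (inv_into M \<phi>)"
    using assms by (auto simp: diffeomorphism_def)
  show 1: "\<And>p. p \<in> M \<Longrightarrow> inv_into M \<phi> (\<phi> p) = p" "\<And>p. p \<in> M \<Longrightarrow> \<phi> (inv_into M \<phi> p) = p"
    "\<And>p. p \<in> M \<Longrightarrow> \<phi> p \<in> M" "\<And>p. p \<in> M \<Longrightarrow> inv_into M \<phi> p \<in> M"
    using b by (auto simp: bij_betw_def f_inv_into_f inv_into_into)
  show "smooth_map M C \<phi>" "smooth_map M C (inv_into M \<phi>)" by fact+
  have b': "bij_betw (inv_into M \<phi>) M M" using b by (rule bij_betw_inv_into)
  have e: "inv_into M (inv_into M \<phi>) p = \<phi> p" if "p \<in> M" for p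
    using inv_into_inv_into_eq[OF b that] .
  have "smooth_map M C (inv_into M (inv_into M \<phi>))"
    using s(1) e unfolding smooth_map_def pullback_def by (simp cong: if_cong)
  then show "diffeomorphism M C (inv_into M \<phi>)" using b' s by (simp add: diffeomorphism_def)
qed

lemma acs_equivalent_sym:
  assumes acs: "almost_complex_structure M C J1" "almost_complex_structure M C J2"
    and e: "acs_equivalent M C J1 J2"
  shows "acs_equivalent M C J2 J1"
proof -
  obtain \<phi> where d: "diffeomorphism M C \<phi>" and
    \<phi>: "\<And>p v. p \<in> M \<Longrightarrow> v \<in> TS p \<Longrightarrow> differential M C \<phi> (J1 p v) = J2 (\<phi> p) (differential M C \<phi> v)"
    using e unfolding acs_equivalent_def by blast
  let ?\<psi> = "inv_into M \<phi>"
  note i = inverse_diffeo[OF d]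
  have "differential M C ?\<psi> (J2 q w) = J1 (?\<psi> q) (differential M C ?\<psi> w)" if q: "q \<in> M" and w: "w \<in> TS q" for q w
  proof -
    let ?v = "differential M C ?\<psi> w"
    have v: "?v \<in> TS (?\<psi> q)" using differential_mem[OF i(7) q w] .
    have J1v: "J1 (?\<psi> q) ?v \<in> TS (?\<psi> q)"
      using acs(1) v i(5)[OF q] unfolding almost_complex_structure_def by blast
    have "differential M C \<phi> (J1 (?\<psi> q) ?v) = J2 q w"
      using \<phi>[OF i(5)[OF q] v] differential_inverse[OF w i(6,7,3)] i(3)[OF q] by simp
    then show ?thesis using differential_inverse[OF J1v i(7,6,2)] by simp
  qed
  then show ?thesis using i(1) unfolding acs_equivalent_def by blast
qed

definition push where "push \<phi> X q = differential M C \<phi> (X (inv_into M \<phi> q))"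

context
  fixes \<phi> assumes d: "diffeomorphism M C \<phi>"
begin

lemma act_push: "f \<in> C \<Longrightarrow> act (push \<phi> X) f = pullback M (inv_into M \<phi>) (act X (pullback M \<phi> f))"
  using inverse_diffeo(5)[OF d] by (auto simp: act_def push_def pullback_def differential_def)

lemma push_field: "field X \<Longrightarrow> field (push \<phi> X)"
  unfolding smooth_vector_field_def
proof (intro conjI ballI)
  note i = inverse_diffeo[OF d]
  assume X: "(\<forall>p\<in>M. X p \<in> TS p) \<and> (\<forall>f\<in>C. (\<lambda>p. if p \<in> M then X p f else 0) \<in> C)"
  then have X': "field X" by (simp add: smooth_vector_field_def)
  show "push \<phi> X q \<in> TS q" if "q \<in> M" for q
    using differential_mem[OF i(6) i(5)[OF that] fieldD(1)[OF X' i(5)[OF that]]] i(3)[OF that] by (simp add: push_def)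
  show "(\<lambda>p. if p \<in> M then push \<phi> X p f else 0) \<in> C" if "f \<in> C" for f
    using act_push[OF that, of X] pullback_mem[OF i(7) fieldD(2)[OF X' pullback_mem[OF i(6) that]]] by (simp add: act_def)
qed

lemma push_apply: "p \<in> M \<Longrightarrow> f \<in> C \<Longrightarrow> push \<phi> X (\<phi> p) f = X p (pullback M \<phi> f)"
  using inverse_diffeo(2)[OF d] by (simp add: push_def differential_def)

lemma bracket_push:
  assumes X: "field X" and Y: "field Y" and p: "p \<in> M"
  shows "bracket (push \<phi> X) (push \<phi> Y) (\<phi> p) = differential M C \<phi> (bracket X Y p)"
proof
  fix f
  note i = inverse_diffeo[OF d]
  have "pullback M \<phi> (act (push \<phi> Z) f) = act Z (pullback M \<phi> f)" if "f \<in> C" "field Z" for Z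
    unfolding act_push[OF that(1)]
    using pullback_inverse[OF fieldD(2)[OF that(2) pullback_mem[OF i(6) that(1)]] i(4) i(2)] by blast
  then show "bracket (push \<phi> X) (push \<phi> Y) (\<phi> p) f = differential M C \<phi> (bracket X Y p) f"
    using X Y p push_apply[OF p fieldD(2)[OF push_field]] pullback_mem[OF i(6)]
    by (auto simp: bracket_def differential_def)
qed

text \<open>This serves to replace \<open>J2\<close> of a pushed field by the pushed field of
  \<open>J1 X\<close>, which agree at points of \<open>M\<close> but perhaps not elsewhere.\<close>

lemma bracket_cong:
  assumes "\<And>q. q \<in> M \<Longrightarrow> X q = X' q" "\<And>q. q \<in> M \<Longrightarrow> Y q = Y' q" "p \<in> M"
  shows "bracket X Y p = bracket X' Y' p"
proof -
  have "act X = act X'" "act Y = act Y'" using assms by (auto simp: act_def fun_eq_iff)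
  moreover have "X p = X' p" "Y p = Y' p" using assms by auto
  ultimately show ?thesis by (simp add: bracket_def cong: if_cong)
qed

lemma nijenhuis_push:
  assumes acs: "almost_complex_structure M C J1" "almost_complex_structure M C J2"
    and \<phi>: "\<And>p v. p \<in> M \<Longrightarrow> v \<in> TS p \<Longrightarrow> differential M C \<phi> (J1 p v) = J2 (\<phi> p) (differential M C \<phi> v)"
    and X: "field X" and Y: "field Y" and p: "p \<in> M" and f: "f \<in> C"
  shows "nijenhuis J2 (push \<phi> X) (push \<phi> Y) (\<phi> p) f = nijenhuis J1 X Y p (pullback M \<phi> f)"
proof -
  note i = inverse_diffeo[OF d]
  have JX: "field (\<lambda>q. J1 q (Z q))" if "field Z" for Z
    using acs(1) that unfolding almost_complex_structure_def by blast
  have J2: "J2 q (push \<phi> Z q) = push \<phi> (\<lambda>q. J1 q (Z q)) q" if "q \<in> M" "field Z" for q Z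
    using \<phi>[OF i(5)[OF that(1)] fieldD(1)[OF that(2) i(5)[OF that(1)]]] i(3)[OF that(1)] by (simp add: push_def)
  have ap: "differential M C \<phi> v f = v (pullback M \<phi> f)" for v using f by (simp add: differential_def)
  have "bracket (\<lambda>q. J2 q (push \<phi> X q)) (\<lambda>q. J2 q (push \<phi> Y q)) (\<phi> p) =
      bracket (push \<phi> (\<lambda>q. J1 q (X q))) (push \<phi> (\<lambda>q. J1 q (Y q))) (\<phi> p)"
    by (rule bracket_cong) (use J2 X Y i(4)[OF p] in auto)
  then have 1: "bracket (\<lambda>q. J2 q (push \<phi> X q)) (\<lambda>q. J2 q (push \<phi> Y q)) (\<phi> p) f =
      bracket (\<lambda>q. J1 q (X q)) (\<lambda>q. J1 q (Y q)) p (pullback M \<phi> f)"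
    using bracket_push[OF JX[OF X] JX[OF Y] p] ap by simp
  have "bracket (\<lambda>q. J2 q (push \<phi> X q)) (push \<phi> Y) (\<phi> p) = bracket (push \<phi> (\<lambda>q. J1 q (X q))) (push \<phi> Y) (\<phi> p)"
    by (rule bracket_cong) (use J2 X Y i(4)[OF p] in auto)
  then have 2: "J2 (\<phi> p) (bracket (\<lambda>q. J2 q (push \<phi> X q)) (push \<phi> Y) (\<phi> p)) f = J1 p (bracket (\<lambda>q. J1 q (X q)) Y p) (pullback M \<phi> f)"
    using bracket_push[OF JX[OF X] Y p] ap \<phi>[OF p bracket_mem[OF JX[OF X] Y p], symmetric] by simp
  have "bracket (push \<phi> X) (\<lambda>q. J2 q (push \<phi> Y q)) (\<phi> p) = bracket (push \<phi> X) (push \<phi> (\<lambda>q. J1 q (Y q))) (\<phi> p)"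
    by (rule bracket_cong) (use J2 X Y i(4)[OF p] in auto)
  then have 3: "J2 (\<phi> p) (bracket (push \<phi> X) (\<lambda>q. J2 q (push \<phi> Y q)) (\<phi> p)) f = J1 p (bracket X (\<lambda>q. J1 q (Y q)) p) (pullback M \<phi> f)"
    using bracket_push[OF X JX[OF Y] p] ap \<phi>[OF p bracket_mem[OF X JX[OF Y] p], symmetric] by simp
  have 4: "bracket (push \<phi> X) (push \<phi> Y) (\<phi> p) f = bracket X Y p (pullback M \<phi> f)"
    using bracket_push[OF X Y p] ap by simp
  show ?thesis unfolding nijenhuis_def 1 2 3 4 ..
qed

end

text \<open>Fields and test functions are transported by the diffeomorphism. Each property moves in
  one direction here: vanishing is pulled back, spanning is pushed forward. The symmetry of
  equivalence supplies the converses.\<close>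

lemma torsion_equivalent_imp:
  assumes acs: "almost_complex_structure M C J1" "almost_complex_structure M C J2"
    and e: "acs_equivalent M C J1 J2"
  shows "torsion_free J2 \<Longrightarrow> torsion_free J1" "torsion_full J1 \<Longrightarrow> torsion_full J2"
proof -
  obtain \<phi> where d: "diffeomorphism M C \<phi>" and
    \<phi>: "\<And>p v. p \<in> M \<Longrightarrow> v \<in> TS p \<Longrightarrow> differential M C \<phi> (J1 p v) = J2 (\<phi> p) (differential M C \<phi> v)"
    using e unfolding acs_equivalent_def by blast
  let ?\<psi> = "inv_into M \<phi>"
  note i = inverse_diffeo[OF d]
  have np: "nijenhuis J2 (push \<phi> X) (push \<phi> Y) (\<phi> p) f = nijenhuis J1 X Y p (pullback M \<phi> f)"
    if "field X" "field Y" "p \<in> M" "f \<in> C" for X Y p f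
    by (rule nijenhuis_push[OF d acs _ that]) (rule \<phi>)
  show "torsion_free J1" if t: "torsion_free J2"
    unfolding torsion_free_def
  proof (intro allI impI ballI)
    fix X Y p f assume X: "field X" and Y: "field Y" and p: "p \<in> M" and f: "f \<in> C"
    have "pullback M \<phi> (pullback M ?\<psi> f) = f" by (rule pullback_inverse[OF f i(4) i(2)])
    then have "nijenhuis J1 X Y p f = nijenhuis J2 (push \<phi> X) (push \<phi> Y) (\<phi> p) (pullback M ?\<psi> f)"
      using np[OF X Y p pullback_mem[OF i(7) f]] by simp
    also have "\<dots> = 0" using t X Y p f push_field[OF d] i(4) pullback_mem[OF i(7)] unfolding torsion_free_def by blast
    finally show "nijenhuis J1 X Y p f = 0" .
  qed
  show "torsion_full J2" if t: "torsion_full J1"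
    unfolding torsion_full_def
  proof (intro allI impI ballI)
    fix q f w assume q: "q \<in> M" and f: "f \<in> C" and w: "w \<in> TS q"
      and z: "\<forall>X Y. field X \<longrightarrow> field Y \<longrightarrow> nijenhuis J2 X Y q f = 0"
    let ?p = "?\<psi> q"
    have "nijenhuis J1 X Y ?p (pullback M \<phi> f) = 0" if "field X" "field Y" for X Y
      using np[OF that i(5)[OF q] f] z push_field[OF d] that i(3)[OF q] by simp
    then have "\<forall>v\<in>TS ?p. v (pullback M \<phi> f) = 0"
      using t i(5)[OF q] pullback_mem[OF i(6) f] unfolding torsion_full_def by blast
    then have "differential M C ?\<psi> w (pullback M \<phi> f) = 0"
      using differential_mem[OF i(7) q w] by blast
    moreover have "differential M C \<phi> (differential M C ?\<psi> w) f = w f"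
      using differential_inverse[OF w i(6,7,3)] by simp
    ultimately show "w f = 0" using f by (simp add: differential_def)
  qed
qed

text \<open>Every term of the Nijenhuis tensor contains \<open>J\<close> twice or not at all, so the
  signs cancel.\<close>

lemma nijenhuis_conjugate:
  assumes acs: "almost_complex_structure M C J" and X: "field X" and Y: "field Y" and p: "p \<in> M" and f: "f \<in> C"
  shows "nijenhuis (acs_conjugate J) X Y p f = nijenhuis J X Y p f"
proof -
  have JX: "field (\<lambda>q. J q (Z q))" if "field Z" for Z
    using acs that unfolding almost_complex_structure_def by blast
  have an: "act (\<lambda>q f. - Z q f) f = (\<lambda>q. - act Z f q)" for Z f by (simp add: act_def fun_eq_iff)
  have b: "bracket (\<lambda>q f. - Z q f) W p = (\<lambda>f. - bracket Z W p f)"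
    "bracket W (\<lambda>q f. - Z q f) p = (\<lambda>f. - bracket W Z p f)" if Z: "field Z" and W: "W p \<in> TS p" for Z W
    using TS_uminus[OF W fieldD(2)[OF Z]] by (auto simp: bracket_def an)
  have Jm: "J p (\<lambda>f. - v f) = (\<lambda>f. - J p v f)" if "v \<in> TS p" for v
  proof -
    have "J p (\<lambda>f. (-1) * v f + 0 * v f) = (\<lambda>f. (-1) * J p v f + 0 * J p v f)"
      using acs p that unfolding almost_complex_structure_def by blast
    then show ?thesis by simp
  qed
  have mX: "(\<lambda>f. - J p (X p) f) \<in> TS p"
    using fieldD(1)[OF JX[OF X] p] unfolding tangent_space_def by (auto simp: algebra_simps)
  have 1: "bracket (\<lambda>q. acs_conjugate J q (X q)) (\<lambda>q. acs_conjugate J q (Y q)) p = bracket (\<lambda>q. J q (X q)) (\<lambda>q. J q (Y q)) p"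
    unfolding acs_conjugate_def using b(1)[OF JX[OF X], of "\<lambda>q. J q (Y q)"] fieldD(1)[OF JX[OF Y] p]
      b(2)[OF JX[OF Y], of "\<lambda>q f. - J q (X q) f"] mX by (simp add: fun_eq_iff)
  have 2: "acs_conjugate J p (bracket (\<lambda>q. acs_conjugate J q (X q)) Y p) = J p (bracket (\<lambda>q. J q (X q)) Y p)"
    unfolding acs_conjugate_def b(1)[of "\<lambda>q. J q (X q)" Y, OF JX[OF X] fieldD(1)[OF Y p]] Jm[OF bracket_mem[OF JX[OF X] Y p]] by simp
  have 3: "acs_conjugate J p (bracket X (\<lambda>q. acs_conjugate J q (Y q)) p) = J p (bracket X (\<lambda>q. J q (Y q)) p)"
    unfolding acs_conjugate_def b(2)[of "\<lambda>q. J q (Y q)" X, OF JX[OF Y] fieldD(1)[OF X p]] Jm[OF bracket_mem[OF X JX[OF Y] p]] by simp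
  show ?thesis unfolding nijenhuis_def 1 2 3 ..
qed

lemma torsion_invariant:
  assumes "acs_equivalent_or_conjugate M C J1 J2"
  shows "torsion_free J1 \<longleftrightarrow> torsion_free J2" "torsion_full J1 \<longleftrightarrow> torsion_full J2"
proof -
  let ?r = "\<lambda>J1 J2. almost_complex_structure M C J1 \<and> almost_complex_structure M C J2 \<and>
       (J2 = acs_conjugate J1 \<or> acs_equivalent M C J1 J2)"
  have stp: "(torsion_free J1 \<longleftrightarrow> torsion_free J2) \<and> (torsion_full J1 \<longleftrightarrow> torsion_full J2)" if r: "?r J1 J2" for J1 J2
  proof (cases "acs_equivalent M C J1 J2")
    case True
    then show ?thesis using r torsion_equivalent_imp acs_equivalent_sym by meson
  next
    case False
    then have "J2 = acs_conjugate J1" using r by blast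
    then show ?thesis using r nijenhuis_conjugate[of J1] unfolding torsion_free_def torsion_full_def by (simp cong: imp_cong)
  qed
  have "equivclp ?r J1 J2" using assms unfolding acs_equivalent_or_conjugate_def .
  then have "(torsion_free J1 \<longleftrightarrow> torsion_free J2) \<and> (torsion_full J1 \<longleftrightarrow> torsion_full J2)"
  proof (induction rule: equivclp_induct)
    case base then show ?case by simp
  next
    case (step y z)
    then show ?case using stp by metis
  qed
  then show "torsion_free J1 \<longleftrightarrow> torsion_free J2" "torsion_full J1 \<longleftrightarrow> torsion_full J2" by auto
qed

end

section \<open>Homogeneous spaces as adjoint orbits\<close>

lemma td_union:
  "open S \<Longrightarrow> open T \<Longrightarrow> times_differentiable_on k S f \<Longrightarrow> times_differentiable_on k T f \<Longrightarrow>
    times_differentiable_on k (S \<union> T) f"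
  by (induction k arbitrary: f) (auto intro: continuous_on_open_Un)

lemma smooth_on_union: "open S \<Longrightarrow> open T \<Longrightarrow> smooth_on S f \<Longrightarrow> smooth_on T f \<Longrightarrow> smooth_on (S \<union> T) f"
  unfolding smooth_on_def by (intro allI td_union) auto

text \<open>\<open>G\<close> is arbitrary outside the ball of radius \<open>R\<close>, but the
  product vanishes off the closed ball of radius \<open>r\<close>, and the open ball of radius
  \<open>R\<close> together with the complement of that closed ball covers the space.\<close>

lemma smooth_on_bump_mult:
  fixes G :: "'a::euclidean_space \<Rightarrow> real"
  assumes G: "smooth_on (ball y0 R) G" and \<psi>: "smooth_on UNIV \<psi>" "\<And>y. dist y0 y \<ge> r \<Longrightarrow> \<psi> y = 0" and "r < R"
  shows "smooth_on UNIV (\<lambda>y. \<psi> y * G y)"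
proof -
  have "smooth_on (ball y0 R) (\<lambda>y. \<psi> y * G y)"
    by (intro smooth_on_mult open_ball G smooth_on_subset[OF \<psi>(1)]) auto
  moreover have "smooth_on (- cball y0 r) (\<lambda>y. \<psi> y * G y)"
    by (rule smooth_on_cong[OF _ smooth_on_const[of _ 0]]) (use \<psi>(2) in auto)
  ultimately have "smooth_on (ball y0 R \<union> - cball y0 r) (\<lambda>y. \<psi> y * G y)"
    by (intro smooth_on_union) auto
  moreover have "ball y0 R \<union> - cball y0 r = UNIV" using \<open>r < R\<close> by auto
  ultimately show ?thesis by simp
qed

abbreviation "sub_smooth \<equiv> smooth_on_submanifold"

lemma sub_smoothI:
  assumes "\<And>a. a \<in> A \<Longrightarrow> \<exists>W F. open W \<and> a \<in> W \<and> smooth_on W F \<and> (\<forall>x\<in>A \<inter> W. f x = F x)"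
  shows "sub_smooth A f"
  using assms by (simp add: smooth_on_submanifold_def)

lemma sub_smoothE:
  assumes "sub_smooth A f" "a \<in> A"
  obtains W F where "open W" "a \<in> W" "smooth_on W F" "\<And>x. x \<in> A \<Longrightarrow> x \<in> W \<Longrightarrow> f x = F x"
proof -
  have "\<exists>W F. open W \<and> a \<in> W \<and> smooth_on W F \<and> (\<forall>x\<in>A \<inter> W. f x = F x)"
    using assms by (simp add: smooth_on_submanifold_def)
  then obtain W F where "open W" "a \<in> W" "smooth_on W F" "\<forall>x\<in>A \<inter> W. f x = F x" by (elim exE conjE)
  then show thesis by (intro that[of W F]) auto
qed

lemma sub_smooth_of_smooth: "open W \<Longrightarrow> A \<subseteq> W \<Longrightarrow> smooth_on W f \<Longrightarrow> sub_smooth A f"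
  by (rule sub_smoothI) auto

lemma sub_smooth_const [simp]: "sub_smooth A (\<lambda>x. c)"
  by (rule sub_smooth_of_smooth[of UNIV]) auto

lemma sub_smooth_cong:
  assumes "sub_smooth A f" "\<And>x. x \<in> A \<Longrightarrow> f x = g x" shows "sub_smooth A g"
proof (rule sub_smoothI)
  fix a assume "a \<in> A"
  with assms(1) obtain W F where "open W" "a \<in> W" "smooth_on W F" "\<And>x. x \<in> A \<Longrightarrow> x \<in> W \<Longrightarrow> f x = F x"
    by (rule sub_smoothE) (rule that)
  then show "\<exists>W F. open W \<and> a \<in> W \<and> smooth_on W F \<and> (\<forall>x\<in>A \<inter> W. g x = F x)"
    using assms(2) by (intro exI[of _ W] exI[of _ F]) auto
qed

lemma sub_smooth_bilinear:
  assumes "bounded_bilinear pr" "sub_smooth A f" "sub_smooth A g"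
  shows "sub_smooth A (\<lambda>x. pr (f x) (g x))"
proof (rule sub_smoothI)
  fix a assume a: "a \<in> A"
  obtain W F where F: "open W" "a \<in> W" "smooth_on W F" "\<And>x. x \<in> A \<Longrightarrow> x \<in> W \<Longrightarrow> f x = F x"
    using assms(2) a by (rule sub_smoothE) (rule that)
  obtain V G where G: "open V" "a \<in> V" "smooth_on V G" "\<And>x. x \<in> A \<Longrightarrow> x \<in> V \<Longrightarrow> g x = G x"
    using assms(3) a by (rule sub_smoothE) (rule that)
  have "smooth_on (W \<inter> V) (\<lambda>x. pr (F x) (G x))"
    by (intro smooth_on_bilinear[OF assms(1)] open_Int F(1) G(1) smooth_on_subset[OF F(3)] smooth_on_subset[OF G(3)]) auto
  then show "\<exists>W F. open W \<and> a \<in> W \<and> smooth_on W F \<and> (\<forall>x\<in>A \<inter> W. pr (f x) (g x) = F x)"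
    using F G by (intro exI[of _ "W \<inter> V"] exI[of _ "\<lambda>x. pr (F x) (G x)"]) auto
qed

lemma sub_smooth_compose:
  fixes h :: "'b::euclidean_space \<Rightarrow> 'c::real_normed_vector"
  assumes "smooth_on T h" "open T" "sub_smooth A f" "f ` A \<subseteq> T"
  shows "sub_smooth A (\<lambda>x. h (f x))"
proof (rule sub_smoothI)
  fix a assume a: "a \<in> A"
  obtain W F where F: "open W" "a \<in> W" "smooth_on W F" "\<And>x. x \<in> A \<Longrightarrow> x \<in> W \<Longrightarrow> f x = F x"
    using assms(3) a by (rule sub_smoothE) (rule that)
  have o: "open (W \<inter> F -` T)" using smooth_on_continuous[OF F(3)] F(1) assms(2) by (rule continuous_open_preimage)
  have "smooth_on (W \<inter> F -` T) (\<lambda>x. h (F x))"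
    by (intro smooth_on_compose[OF assms(1)] o assms(2) smooth_on_subset[OF F(3)]) auto
  moreover have "a \<in> F -` T" using F(4)[OF a F(2)] assms(4) a by auto
  ultimately show "\<exists>W F. open W \<and> a \<in> W \<and> smooth_on W F \<and> (\<forall>x\<in>A \<inter> W. h (f x) = F x)"
    using F o by (intro exI[of _ "W \<inter> F -` T"] exI[of _ "\<lambda>x. h (F x)"]) auto
qed

lemma sub_smooth_linear:
  fixes h :: "'b::euclidean_space \<Rightarrow> 'c::real_normed_vector"
  shows "bounded_linear h \<Longrightarrow> sub_smooth A f \<Longrightarrow> sub_smooth A (\<lambda>x. h (f x))"
  using sub_smooth_compose[OF smooth_on_bounded_linear open_UNIV] by blast

lemma sub_smooth_precompose:
  fixes h :: "'a::real_normed_vector \<Rightarrow> 'b::euclidean_space"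
  assumes "sub_smooth B f" "smooth_on V h" "open V" "A \<subseteq> V" "h ` A \<subseteq> B"
  shows "sub_smooth A (\<lambda>x. f (h x))"
proof (rule sub_smoothI)
  fix a assume a: "a \<in> A"
  then have "h a \<in> B" using assms(5) by auto
  with assms(1) obtain W F where F: "open W" "h a \<in> W" "smooth_on W F" "\<And>x. x \<in> B \<Longrightarrow> x \<in> W \<Longrightarrow> f x = F x"
    by (rule sub_smoothE) (rule that)
  have o: "open (V \<inter> h -` W)" using smooth_on_continuous[OF assms(2)] assms(3) F(1) by (rule continuous_open_preimage)
  have "smooth_on (V \<inter> h -` W) (\<lambda>x. F (h x))"
    by (intro smooth_on_compose[OF F(3)] o F(1) smooth_on_subset[OF assms(2)]) auto
  then show "\<exists>W F. open W \<and> a \<in> W \<and> smooth_on W F \<and> (\<forall>x\<in>A \<inter> W. f (h x) = F x)"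
    using F o a assms(4,5) by (intro exI[of _ "V \<inter> h -` W"] exI[of _ "\<lambda>x. F (h x)"]) auto
qed

lemma sub_smooth_add:
  assumes "sub_smooth A f" "sub_smooth A g" shows "sub_smooth A (\<lambda>x. f x + g x)"
proof (rule sub_smoothI)
  fix a assume a: "a \<in> A"
  obtain W F where F: "open W" "a \<in> W" "smooth_on W F" "\<And>x. x \<in> A \<Longrightarrow> x \<in> W \<Longrightarrow> f x = F x"
    using assms(1) a by (rule sub_smoothE) (rule that)
  obtain V G where G: "open V" "a \<in> V" "smooth_on V G" "\<And>x. x \<in> A \<Longrightarrow> x \<in> V \<Longrightarrow> g x = G x"
    using assms(2) a by (rule sub_smoothE) (rule that)
  have "smooth_on (W \<inter> V) (\<lambda>x. F x + G x)"
    by (intro smooth_on_add open_Int F(1) G(1) smooth_on_subset[OF F(3)] smooth_on_subset[OF G(3)]) auto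
  then show "\<exists>W F. open W \<and> a \<in> W \<and> smooth_on W F \<and> (\<forall>x\<in>A \<inter> W. f x + g x = F x)"
    using F G by (intro exI[of _ "W \<inter> V"] exI[of _ "\<lambda>x. F x + G x"]) auto
qed

lemma sub_smooth_sum: "(\<And>i. i \<in> I \<Longrightarrow> sub_smooth A (f i)) \<Longrightarrow> sub_smooth A (\<lambda>x. \<Sum>i\<in>I. f i x)"
  by (induction I rule: infinite_finite_induct) (auto intro: sub_smooth_add)

lemmas sub_smooth_mult = sub_smooth_bilinear[OF bounded_bilinear_mult]
lemmas sub_smooth_matrix_mult = sub_smooth_bilinear[OF bounded_bilinear_matrix_matrix_mult]

section \<open>The coset space and its algebra of functions\<close>

context orbit
begin

abbreviation M where "M \<equiv> homogeneous_space U K"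
abbreviation C where "C \<equiv> homogeneous_smooth_functions U K"

definition \<pi> where "\<pi> g = g <#\<^bsub>matrix_group U\<^esub> K"

lemma \<pi>_eq: "\<pi> g = (\<lambda>k. g ** k) ` K"
  by (auto simp: \<pi>_def l_coset_def matrix_group_def)

lemma M_eq: "M = \<pi> ` U"
  by (auto simp: homogeneous_space_def LCOSETS_def \<pi>_def matrix_group_def)

lemma \<pi>_mem [simp]: "g \<in> U \<Longrightarrow> \<pi> g \<in> M" by (simp add: M_eq)

lemma M_cases:
  assumes "p \<in> M" obtains g where "g \<in> U" "p = \<pi> g"
  using assms by (auto simp: M_eq)

lemma \<pi>_mult_K: assumes "g \<in> U" "k \<in> K" shows "\<pi> (g ** k) = \<pi> g"
proof -
  have "g ** k ** l \<in> (\<lambda>k. g ** k) ` K" if "l \<in> K" for l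
    using K.mult_mem[OF assms(2) that] by (simp add: matrix_mul_assoc[symmetric])
  moreover have "g ** l \<in> (\<lambda>l. g ** k ** l) ` K" if "l \<in> K" for l
  proof
    show "matrix_inv k ** l \<in> K" using K.mult_mem K.inv_mem assms(2) that by blast
    show "g ** l = g ** k ** (matrix_inv k ** l)"
      using matrix_inv_cancel(2)[OF K.invertible_mem[OF assms(2)], of l] by (simp add: matrix_mul_assoc[symmetric])
  qed
  ultimately show ?thesis by (auto simp: \<pi>_eq)
qed

lemma \<pi>_eqD:
  assumes "\<pi> g = \<pi> h" obtains k where "k \<in> K" "h = g ** k"
proof -
  have "h \<in> \<pi> h" using K.one_mem by (auto simp: \<pi>_eq image_iff intro!: bexI[of _ "mat 1"])
  then show thesis using that assms by (auto simp: \<pi>_eq)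
qed

lemma left_translation_\<pi>: "left_translation U a (\<pi> g) = \<pi> (a ** g)"
  by (auto simp: \<pi>_eq l_coset_def matrix_group_def matrix_mul_assoc image_iff)

lemma C_iff: "f \<in> C \<longleftrightarrow> (\<forall>p. p \<notin> M \<longrightarrow> f p = 0) \<and> sub_smooth U (\<lambda>g. f (\<pi> g))"
  by (simp add: homogeneous_smooth_functions_def \<pi>_def)

text \<open>The representative is arbitrary, so the value is meaningful for
  \<open>K_invariant\<close> functions; the value 0 off \<open>M\<close> is what membership in
  \<open>C\<close> requires.\<close>

definition descend :: "(real^'n^'n \<Rightarrow> real) \<Rightarrow> (real^'n^'n) set \<Rightarrow> real" where
  "descend F p = (if p \<in> M then F (SOME g. g \<in> U \<and> p = \<pi> g) else 0)"

definition K_invariant :: "(real^'n^'n \<Rightarrow> 'b) \<Rightarrow> bool" where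
  "K_invariant F \<longleftrightarrow> (\<forall>g\<in>U. \<forall>k\<in>K. F (g ** k) = F g)"

lemma descend_\<pi>:
  assumes "K_invariant F" "g \<in> U" shows "descend F (\<pi> g) = F g"
proof -
  have "\<exists>h. h \<in> U \<and> \<pi> g = \<pi> h" using assms by blast
  then have s: "(SOME h. h \<in> U \<and> \<pi> g = \<pi> h) \<in> U" "\<pi> g = \<pi> (SOME h. h \<in> U \<and> \<pi> g = \<pi> h)"
    by (metis (mono_tags, lifting) someI_ex)+
  from s(2) obtain k where "k \<in> K" "(SOME h. h \<in> U \<and> \<pi> g = \<pi> h) = g ** k" by (rule \<pi>_eqD)
  then show ?thesis using assms by (simp add: descend_def K_invariant_def)
qed

lemma descend_mem:
  assumes "K_invariant F" "sub_smooth U F" shows "descend F \<in> C"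
  unfolding C_iff using sub_smooth_cong[OF assms(2)] descend_\<pi>[OF assms(1)] by (auto simp: descend_def)

lemma C_eqI: "f \<in> C \<Longrightarrow> f' \<in> C \<Longrightarrow> (\<And>g. g \<in> U \<Longrightarrow> f (\<pi> g) = f' (\<pi> g)) \<Longrightarrow> f = f'"
  unfolding C_iff by (metis M_cases ext)

sublocale A: smooth_algebra M C
proof
  fix f g assume f: "f \<in> C" and g: "g \<in> C"
  show "(\<lambda>q. f q * g q) \<in> C" using f g sub_smooth_mult unfolding C_iff by fastforce
  show "(\<lambda>q. a * f q + b * g q) \<in> C" for a b
    using f g sub_smooth_add[OF sub_smooth_mult[OF sub_smooth_const] sub_smooth_mult[OF sub_smooth_const]]
    unfolding C_iff by fastforce
qed (simp add: C_iff)

text \<open>\<open>tv g A\<close> is the velocity at \<open>s = 0\<close> of the curve \<open>g exp (s A) K\<close>; it identifies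
  the tangent space at \<open>g K\<close> with the quotient of the Lie algebras.\<close>

definition tv :: "real^'n^'n \<Rightarrow> real^'n^'n \<Rightarrow> ((real^'n^'n) set \<Rightarrow> real) \<Rightarrow> real" where
  "tv g A f = (if f \<in> C then vector_derivative (\<lambda>s. f (\<pi> (g ** mexp (s *\<^sub>R A)))) (at 0) else 0)"

lemma curve_has_derivative:
  assumes W: "open W" "g \<in> W" and F: "smooth_on W F" "\<And>x. x \<in> U \<Longrightarrow> x \<in> W \<Longrightarrow> \<Phi> x = F x"
    and \<gamma>: "\<And>s. \<gamma> s \<in> U" "\<gamma> 0 = g" "(\<gamma> has_vector_derivative A) (at 0)"
  shows "((\<lambda>s. \<Phi> (\<gamma> s)) has_vector_derivative frechet_derivative F (at g) A) (at (0::real))"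
proof -
  have "(F has_derivative frechet_derivative F (at g)) (at (\<gamma> 0))"
    using smooth_on_has_derivative[OF F(1) W(2)] \<gamma>(2) by simp
  from has_derivative_compose[OF \<gamma>(3)[unfolded has_vector_derivative_def] this]
  have "((\<lambda>s. F (\<gamma> s)) has_vector_derivative frechet_derivative F (at g) A) (at 0)"
    unfolding has_vector_derivative_def
    using linear_cmul[OF has_derivative_linear[OF smooth_on_has_derivative[OF F(1) W(2)]]] by simp
  moreover have "eventually (\<lambda>s. F (\<gamma> s) = \<Phi> (\<gamma> s)) (nhds 0)"
  proof -
    have "isCont \<gamma> 0" using \<gamma>(3) by (rule has_vector_derivative_continuous)
    then have "filterlim \<gamma> (nhds (\<gamma> 0)) (nhds 0)" unfolding isCont_def tendsto_at_iff_tendsto_nhds .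
    then have "filterlim \<gamma> (nhds g) (nhds 0)" using \<gamma>(2) by simp
    then have "eventually (\<lambda>s. \<gamma> s \<in> W) (nhds 0)" using W by (auto simp: filterlim_iff eventually_nhds)
    then show ?thesis by eventually_elim (use F(2) \<gamma>(1) in auto)
  qed
  ultimately show ?thesis
    unfolding has_vector_derivative_def
    using eventually_nhds_x_imp_x[of "\<lambda>s. F (\<gamma> s) = \<Phi> (\<gamma> s)" 0]
    by (elim has_derivative_transform_eventually) (auto simp: eventually_at_filter elim: eventually_mono)
qed

lemma left_curve:
  assumes "g \<in> U" "A \<in> lie_algebra U"
  shows "g ** mexp (s *\<^sub>R A) \<in> U" "g ** mexp (0 *\<^sub>R A) = g"
    "((\<lambda>s. g ** mexp (s *\<^sub>R A)) has_vector_derivative g ** A) (at 0)"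
  using assms U.mult_mem U.mexp_mem
    bounded_linear.has_vector_derivative[OF bounded_bilinear.bounded_linear_right[OF bounded_bilinear_matrix_matrix_mult, of g] mexp_has_vector_derivative[of A 0]]
  by auto

lemma tv_eq:
  assumes f: "f \<in> C" and W: "open W" "g \<in> W" "smooth_on W F" "\<And>x. x \<in> U \<Longrightarrow> x \<in> W \<Longrightarrow> f (\<pi> x) = F x"
    and g: "g \<in> U" and A: "A \<in> lie_algebra U"
  shows "tv g A f = frechet_derivative F (at g) (g ** A)"
  using vector_derivative_at[OF curve_has_derivative[OF W left_curve[OF g A]]] f by (simp add: tv_def)

lemma C_extension:
  assumes "f \<in> C" "g \<in> U"
  obtains W F where "open W" "g \<in> W" "smooth_on W F" "\<And>x. x \<in> U \<Longrightarrow> x \<in> W \<Longrightarrow> f (\<pi> x) = F x"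
  using sub_smoothE[of U "\<lambda>g. f (\<pi> g)" g thesis] assms that unfolding C_iff by simp

lemma tv_curve:
  assumes f: "f \<in> C" and g: "g \<in> U" and A: "A \<in> lie_algebra U"
    and \<gamma>: "\<And>s. \<gamma> s \<in> U" "\<gamma> 0 = g" "(\<gamma> has_vector_derivative g ** A) (at 0)"
  shows "((\<lambda>s. f (\<pi> (\<gamma> s))) has_vector_derivative tv g A f) (at 0)"
proof -
  obtain W F where W: "open W" "g \<in> W" "smooth_on W F" "\<And>x. x \<in> U \<Longrightarrow> x \<in> W \<Longrightarrow> f (\<pi> x) = F x"
    using C_extension[OF f g] by blast
  show ?thesis using curve_has_derivative[OF W \<gamma>] tv_eq[OF f W g A] by simp
qed

lemma tv_has_derivative:
  assumes "f \<in> C" "g \<in> U" "A \<in> lie_algebra U"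
  shows "((\<lambda>s. f (\<pi> (g ** mexp (s *\<^sub>R A)))) has_vector_derivative tv g A f) (at 0)"
  by (rule tv_curve[OF assms left_curve[OF assms(2,3)]])

lemma tv_mem: assumes g: "g \<in> U" and A: "A \<in> lie_algebra U" shows "tv g A \<in> tangent_space C (\<pi> g)"
proof (rule A.TS_I)
  fix f h assume f: "f \<in> C" and h: "h \<in> C"
  note df = tv_has_derivative[OF f g A] and dh = tv_has_derivative[OF h g A]
  show "tv g A (\<lambda>q. a * f q + b * h q) = a * tv g A f + b * tv g A h" for a b
  proof (rule vector_derivative_unique_at)
    show "((\<lambda>s. a * f (\<pi> (g ** mexp (s *\<^sub>R A))) + b * h (\<pi> (g ** mexp (s *\<^sub>R A)))) has_vector_derivative
        tv g A (\<lambda>q. a * f q + b * h q)) (at 0)"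
      using tv_has_derivative[OF A.lincomb_mem[OF f h] g A] .
    show "((\<lambda>s. a * f (\<pi> (g ** mexp (s *\<^sub>R A))) + b * h (\<pi> (g ** mexp (s *\<^sub>R A)))) has_vector_derivative
        a * tv g A f + b * tv g A h) (at 0)"
      by (intro has_vector_derivative_add has_vector_derivative_mult_right df dh)
  qed
  show "tv g A (\<lambda>q. f q * h q) = tv g A f * h (\<pi> g) + f (\<pi> g) * tv g A h"
  proof (rule vector_derivative_unique_at)
    show "((\<lambda>s. f (\<pi> (g ** mexp (s *\<^sub>R A))) * h (\<pi> (g ** mexp (s *\<^sub>R A)))) has_vector_derivative
        tv g A (\<lambda>q. f q * h q)) (at 0)"
      using tv_has_derivative[OF A.mult_fn_mem[OF f h] g A] .
    show "((\<lambda>s. f (\<pi> (g ** mexp (s *\<^sub>R A))) * h (\<pi> (g ** mexp (s *\<^sub>R A)))) has_vector_derivative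
        tv g A f * h (\<pi> g) + f (\<pi> g) * tv g A h) (at 0)"
      using has_vector_derivative_mult[OF df dh] by (simp add: add.commute)
  qed
qed (simp add: tv_def)

lemma tv_linear:
  assumes g: "g \<in> U" and A: "A \<in> lie_algebra U" and B: "B \<in> lie_algebra U"
  shows "tv g (a *\<^sub>R A + b *\<^sub>R B) f = a * tv g A f + b * tv g B f"
proof (cases "f \<in> C")
  case True
  obtain W F where W: "open W" "g \<in> W" "smooth_on W F" "\<And>x. x \<in> U \<Longrightarrow> x \<in> W \<Longrightarrow> f (\<pi> x) = F x"
    using C_extension[OF True g] by blast
  have AB: "a *\<^sub>R A + b *\<^sub>R B \<in> lie_algebra U"
    using U.subspace_lie_algebra A B by (intro subspace_add subspace_scale)
  have l: "linear (frechet_derivative F (at g))"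
    using smooth_on_has_derivative[OF W(3,2)] has_derivative_linear by blast
  have "g ** (a *\<^sub>R A + b *\<^sub>R B) = a *\<^sub>R (g ** A) + b *\<^sub>R (g ** B)"
    by (simp add: bounded_bilinear.add_right[OF bounded_bilinear_matrix_matrix_mult]
      bounded_bilinear.scaleR_right[OF bounded_bilinear_matrix_matrix_mult])
  then have "frechet_derivative F (at g) (g ** (a *\<^sub>R A + b *\<^sub>R B)) =
      a * frechet_derivative F (at g) (g ** A) + b * frechet_derivative F (at g) (g ** B)"
    by (simp add: linear_add[OF l] linear_cmul[OF l])
  then show ?thesis by (simp only: tv_eq[OF True W g AB] tv_eq[OF True W g A] tv_eq[OF True W g B])
qed (simp add: tv_def)

lemma tv_K: assumes g: "g \<in> U" and A: "A \<in> lie_algebra K" shows "tv g A f = 0"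
proof -
  have "\<pi> (g ** mexp (s *\<^sub>R A)) = \<pi> g" for s using \<pi>_mult_K[OF g K.mexp_mem[OF A]] .
  then show ?thesis by (simp add: tv_def)
qed

lemma lie_KU: "X \<in> lie_algebra K \<Longrightarrow> X \<in> lie_algebra U"
  using K.mexp_mem KU by (intro U.lie_algebra_mexpI) blast

text \<open>Multiplying the curve \<open>g k exp (s A)\<close> on the right by the inverse of
  \<open>k\<close> does not change its cosets and makes it start at \<open>g\<close>; its velocity
  is then conjugated by \<open>k\<close>. Independence of coset representatives rests on this
  rule.\<close>

lemma tv_mult_K:
  assumes g: "g \<in> U" and k: "k \<in> K" and A: "A \<in> lie_algebra U"
  shows "tv (g ** k) A = tv g (k ** A ** matrix_inv k)"
proof
  fix f
  show "tv (g ** k) A f = tv g (k ** A ** matrix_inv k) f"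
  proof (cases "f \<in> C")
    case f: True
    have kU: "k \<in> U" and gk: "g ** k \<in> U" and A': "k ** A ** matrix_inv k \<in> lie_algebra U"
      using k KU U.mult_mem g U.Ad_mem A by auto
    have ki: "invertible k" using K.invertible_mem k .
    let ?\<gamma> = "\<lambda>s. g ** k ** mexp (s *\<^sub>R A) ** matrix_inv k"
    have "(?\<gamma> has_vector_derivative g ** k ** A ** matrix_inv k) (at 0)"
      by (rule bounded_linear.has_vector_derivative[OF bounded_bilinear.bounded_linear_left[OF bounded_bilinear_matrix_matrix_mult] left_curve(3)[OF gk A]])
    then have "(?\<gamma> has_vector_derivative g ** (k ** A ** matrix_inv k)) (at 0)" by (simp add: matrix_mul_assoc)
    moreover have "?\<gamma> s \<in> U" for s using left_curve(1)[OF gk A] U.mult_mem U.inv_mem kU by blast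
    moreover have "?\<gamma> 0 = g" using matrix_inv_cancel(3)[OF ki, of g] by simp
    ultimately have "((\<lambda>s. f (\<pi> (?\<gamma> s))) has_vector_derivative tv g (k ** A ** matrix_inv k) f) (at 0)"
      by (intro tv_curve[OF f g A'])
    moreover have "\<pi> (?\<gamma> s) = \<pi> (g ** k ** mexp (s *\<^sub>R A))" for s
      using \<pi>_mult_K[OF left_curve(1)[OF gk A] K.inv_mem[OF k]] .
    ultimately have "((\<lambda>s. f (\<pi> (g ** k ** mexp (s *\<^sub>R A)))) has_vector_derivative tv g (k ** A ** matrix_inv k) f) (at 0)"
      by simp
    with tv_has_derivative[OF f gk A] show ?thesis by (rule vector_derivative_unique_at)
  qed (simp add: tv_def)
qed

text \<open>The pullback of \<open>\<phi>\<close> along the orbit map; for linear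
  \<open>\<phi>\<close> these functions are enough to detect tangent vectors.\<close>

definition orbit_fn :: "(real^'n^'n \<Rightarrow> real) \<Rightarrow> (real^'n^'n) set \<Rightarrow> real" where
  "orbit_fn \<phi> = descend (\<lambda>g. \<phi> (\<iota> g))"

lemma sub_smooth_\<iota>: "sub_smooth U \<iota>"
  using U.invertible_mem by (intro sub_smooth_of_smooth[OF open_invertible _ smooth_\<iota>]) auto

lemma K_invariant_\<iota>: "K_invariant (\<lambda>g. \<phi> (\<iota> g))"
  by (simp add: K_invariant_def \<iota>_mult_K)

lemma orbit_fn_mem: "smooth_on UNIV \<phi> \<Longrightarrow> orbit_fn \<phi> \<in> C"
  unfolding orbit_fn_def
  by (intro descend_mem K_invariant_\<iota> sub_smooth_compose[OF _ open_UNIV sub_smooth_\<iota>]) auto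

lemma orbit_fn_\<pi>: "g \<in> U \<Longrightarrow> orbit_fn \<phi> (\<pi> g) = \<phi> (\<iota> g)"
  unfolding orbit_fn_def by (rule descend_\<pi>[OF K_invariant_\<iota>])

lemma tv_orbit_fn:
  assumes \<phi>: "linear \<phi>" and g: "g \<in> U" and A: "A \<in> lie_algebra U"
  shows "tv g A (orbit_fn \<phi>) = \<phi> (g ** commutator A H0 ** matrix_inv g)"
proof -
  have b: "bounded_linear \<phi>" using \<phi> by (simp add: linear_conv_bounded_linear)
  have f: "orbit_fn \<phi> \<in> C" by (intro orbit_fn_mem smooth_on_bounded_linear b)
  have "(\<iota> has_derivative (\<lambda>A. commutator A H0)) (at (mexp (0 *\<^sub>R A)))" using \<iota>_has_derivative by simp
  from has_derivative_compose[OF mexp_has_vector_derivative[of A 0, unfolded has_vector_derivative_def] this]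
  have d: "((\<lambda>s. \<iota> (mexp (s *\<^sub>R A))) has_vector_derivative commutator A H0) (at 0)"
    using linear_cmul[OF linear_commutator_left] by (simp add: has_vector_derivative_def)
  have "((\<lambda>s. \<phi> (g ** \<iota> (mexp (s *\<^sub>R A)) ** matrix_inv g)) has_vector_derivative \<phi> (g ** commutator A H0 ** matrix_inv g)) (at 0)"
    by (intro bounded_linear.has_vector_derivative[OF b]
      bounded_linear.has_vector_derivative[OF bounded_bilinear.bounded_linear_left[OF bounded_bilinear_matrix_matrix_mult]]
      bounded_linear.has_vector_derivative[OF bounded_bilinear.bounded_linear_right[OF bounded_bilinear_matrix_matrix_mult]] d)
  moreover have "orbit_fn \<phi> (\<pi> (g ** mexp (s *\<^sub>R A))) = \<phi> (g ** \<iota> (mexp (s *\<^sub>R A)) ** matrix_inv g)" for s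
    using orbit_fn_\<pi>[OF left_curve(1)[OF g A]] \<iota>_mult U.invertible_mem g U.mexp_mem[OF A] by metis
  ultimately have "((\<lambda>s. orbit_fn \<phi> (\<pi> (g ** mexp (s *\<^sub>R A)))) has_vector_derivative \<phi> (g ** commutator A H0 ** matrix_inv g)) (at 0)"
    by simp
  with tv_has_derivative[OF f g A] show ?thesis by (rule vector_derivative_unique_at)
qed

text \<open>Linear functions of the orbit map see \<open>tv g A\<close> as the matrix
  \<open>g [A, H0] g^-1\<close>. Equal tangent vectors therefore have equal brackets with
  \<open>H0\<close>, and \<open>centralizer_lie\<close> applies to the difference.\<close>

lemma tv_eqD:
  assumes g: "g \<in> U" and A: "A \<in> lie_algebra U" and B: "B \<in> lie_algebra U" and e: "tv g A = tv g B"
  shows "A - B \<in> lie_algebra K"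
proof (rule centralizer_lie)
  show AB: "A - B \<in> lie_algebra U" using U.subspace_lie_algebra A B by (rule subspace_diff)
  have gi: "invertible g" using U.invertible_mem g .
  define X where "X = g ** commutator (A - B) H0 ** matrix_inv g"
  have "X \<bullet> b = 0" for b
  proof -
    have l: "linear (\<lambda>x. x \<bullet> b)" by (intro linearI) (auto simp: inner_add_left)
    have "tv g (A - B) f = 0" for f
      using tv_linear[OF g A B, of 1 "-1" f] e by simp
    then show ?thesis using tv_orbit_fn[OF l g AB] by (simp add: X_def)
  qed
  then have "X = 0" using inner_eq_zero_iff by blast
  then have "matrix_inv g ** X ** g = 0" by simp
  moreover have "matrix_inv g ** X ** g = commutator (A - B) H0"
    unfolding X_def using matrix_inv_cancel[OF gi] by (simp add: matrix_mul_assoc[symmetric] matrix_inv_left[OF gi])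
  ultimately show "commutator (A - B) H0 = 0" by simp
qed

lemma translation_smooth: assumes a: "a \<in> U" shows "smooth_map M C (left_translation U a)"
  unfolding smooth_map_def
proof (intro conjI ballI)
  show "left_translation U a p \<in> M" if "p \<in> M" for p
    using that a U.mult_mem by (auto simp: M_eq left_translation_\<pi>)
  show "pullback M (left_translation U a) f \<in> C" if f: "f \<in> C" for f
  proof -
    have "sub_smooth U (\<lambda>g. f (\<pi> g))" using f by (simp add: C_iff)
    then have "sub_smooth U (\<lambda>g. f (\<pi> (a ** g)))"
      by (rule sub_smooth_precompose[OF _ smooth_on_matrix_mult[OF open_UNIV smooth_on_const smooth_on_ident] open_UNIV])
        (use a U.mult_mem in auto)
    then have "sub_smooth U (\<lambda>g. pullback M (left_translation U a) f (\<pi> g))"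
      by (rule sub_smooth_cong) (simp add: pullback_def left_translation_\<pi>)
    then show ?thesis by (simp add: C_iff pullback_def)
  qed
qed

lemma differential_translation:
  assumes a: "a \<in> U" and g: "g \<in> U" and A: "A \<in> lie_algebra U"
  shows "differential M C (left_translation U a) (tv g A) = tv (a ** g) A"
proof
  fix f
  have "\<pi> (g ** mexp (s *\<^sub>R A)) \<in> M" for s using left_curve(1)[OF g A] by simp
  then show "differential M C (left_translation U a) (tv g A) f = tv (a ** g) A f"
    using translation_smooth[OF a] A.pullback_mem
    by (simp add: differential_def tv_def pullback_def left_translation_\<pi> matrix_mul_assoc)
qed

end

section \<open>Tangent spaces of homogeneous spaces\<close>

context smooth_algebra
begin

lemma TS_sum:
  assumes v: "v \<in> TS p" and z: "(\<lambda>q. 0) \<in> C" and f: "\<And>i. i \<in> I \<Longrightarrow> f i \<in> C" and I: "finite I"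
  shows "(\<lambda>q. \<Sum>i\<in>I. f i q) \<in> C \<and> v (\<lambda>q. \<Sum>i\<in>I. f i q) = (\<Sum>i\<in>I. v (f i))"
  using I f
proof (induction I rule: finite_induct)
  case empty
  then show ?case using z TS_lincomb[OF v z z, of 0 0] by simp
next
  case (insert i I)
  then have i: "f i \<in> C" "(\<lambda>q. \<Sum>i\<in>I. f i q) \<in> C" "v (\<lambda>q. \<Sum>i\<in>I. f i q) = (\<Sum>i\<in>I. v (f i))" by auto
  show ?case
    using lincomb_mem[OF i(1,2), of 1 1] TS_lincomb[OF v i(1,2), of 1 1] i(3) insert(1,2) by simp
qed

end

context orbit
begin

text \<open>Members of \<open>C\<close> vanish off \<open>M\<close>, so the unit of the algebra is
  the indicator of \<open>M\<close>. As an idempotent with value 1 at the base point it is killed by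
  derivations there.\<close>

definition one_fn where "one_fn = descend (\<lambda>g. 1)"

lemma one_fn: "one_fn \<in> C" "g \<in> U \<Longrightarrow> one_fn (\<pi> g) = 1"
  unfolding one_fn_def by (auto intro!: descend_mem descend_\<pi> simp: K_invariant_def)

lemma zero_fn: "(\<lambda>q. 0) \<in> C"
  using A.lincomb_mem[OF one_fn(1) one_fn(1), of 0 0] by simp

lemma TS_one_fn: assumes "v \<in> tangent_space C (\<pi> g)" "g \<in> U" shows "v one_fn = 0"
proof -
  have "(\<lambda>q. one_fn q * one_fn q) = one_fn"
    by (rule C_eqI[OF A.mult_fn_mem[OF one_fn(1) one_fn(1)] one_fn(1)]) (simp add: one_fn)
  then show ?thesis using A.TS_mult[OF assms(1) one_fn(1) one_fn(1)] one_fn(2)[OF assms(2)] by simp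
qed

text \<open>Points of \<open>U / K\<close> far from the base point may lie over \<open>H0\<close> as well, since the full centralizer
  of \<open>H0\<close> in \<open>U\<close> might be larger than \<open>K\<close>; functions of \<open>\<iota>\<close> therefore have to be cut off.\<close>

lemma tangent_at_base:
  assumes v: "v \<in> tangent_space C (\<pi> (mat 1))"
  obtains X where "X \<in> lie_algebra U" "v = tv (mat 1) X"
proof -
  obtain s \<rho> \<delta> L where s: "\<rho> > 0" "\<delta> > 0" "smooth_on (ball H0 \<rho>) s"
    "\<And>y. s y \<in> U" "s H0 = mat 1" "linear L" "range L \<subseteq> lie_algebra U" "(s has_derivative L) (at H0)"
    "\<And>g. g \<in> U \<Longrightarrow> dist g (mat 1) < \<delta> \<Longrightarrow> \<iota> g \<in> ball H0 \<rho> \<and> (\<exists>k\<in>K. g = s (\<iota> g) ** k)"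
    by (rule local_section) (rule that)
  \<comment> \<open>Half of \<open>\<delta>\<close>, so that even the closed tube \<open>Q\<close>
    stays within reach of the local section.\<close>
  define \<delta>1 where "\<delta>1 = \<delta> / 2"
  have \<delta>1: "\<delta>1 > 0" "\<delta>1 < \<delta>" using s(2) by (auto simp: \<delta>1_def)
  \<comment> \<open>\<open>N\<close> and \<open>Q\<close> consist of the points that some element of
    \<open>K\<close> moves to within \<open>\<delta>1\<close> of the identity, with strict and with
    weak inequality. Both are unions of cosets, \<open>N\<close> is open in \<open>U\<close> and
    \<open>Q\<close> is compact; a cut-off function must vanish already on the shell between
    them.\<close>
  define N where "N = {g \<in> U. \<exists>k\<in>K. dist (g ** k) (mat 1) < \<delta>1}"
  define Q where "Q = (\<lambda>(g, k). g ** k) ` ((U \<inter> cball (mat 1) \<delta>1) \<times> K)"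
  have kU: "k \<in> U" if "k \<in> K" for k using that KU by blast
  have Q_iff: "g \<in> Q \<longleftrightarrow> g \<in> U \<and> (\<exists>k\<in>K. dist (g ** k) (mat 1) \<le> \<delta>1)" for g
  proof
    assume "g \<in> Q"
    then obtain h k where h: "h \<in> U" "dist (mat 1) h \<le> \<delta>1" "k \<in> K" "g = h ** k" by (auto simp: Q_def)
    then have "g ** matrix_inv k = h" using matrix_inv_cancel(3)[OF K.invertible_mem] by simp
    then show "g \<in> U \<and> (\<exists>k\<in>K. dist (g ** k) (mat 1) \<le> \<delta>1)"
      using h U.mult_mem kU K.inv_mem by (auto simp: dist_commute intro!: bexI[of _ "matrix_inv k"])
  next
    assume "g \<in> U \<and> (\<exists>k\<in>K. dist (g ** k) (mat 1) \<le> \<delta>1)"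
    then obtain k where k: "g \<in> U" "k \<in> K" "dist (g ** k) (mat 1) \<le> \<delta>1" by blast
    then have "g = (\<lambda>(g, k). g ** k) (g ** k, matrix_inv k)" using matrix_inv_cancel(3)[OF K.invertible_mem] by simp
    moreover have "(g ** k, matrix_inv k) \<in> (U \<inter> cball (mat 1) \<delta>1) \<times> K"
      using k U.mult_mem kU K.inv_mem by (auto simp: dist_commute)
    ultimately show "g \<in> Q" unfolding Q_def by blast
  qed
  have cQ: "compact Q" unfolding Q_def split_beta
    by (intro compact_continuous_image compact_Times compact_Int_closed U.compact K.compact closed_cball continuous_intros)
  have near_section: "\<iota> g \<in> ball H0 \<rho> \<and> \<pi> g = \<pi> (s (\<iota> g))" if g: "g \<in> Q" for g
  proof -
    obtain k where k: "g \<in> U" "k \<in> K" "dist (g ** k) (mat 1) \<le> \<delta>1" using g Q_iff by blast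
    then have gk: "g ** k \<in> U" "dist (g ** k) (mat 1) < \<delta>" using U.mult_mem kU \<delta>1 by auto
    obtain k' where k': "k' \<in> K" "g ** k = s (\<iota> g) ** k'" "\<iota> g \<in> ball H0 \<rho>"
      using s(9)[OF gk] \<iota>_mult_K[OF k(1,2)] by auto
    have "\<pi> g = \<pi> (g ** k)" using \<pi>_mult_K[OF k(1,2)] by simp
    also have "\<dots> = \<pi> (s (\<iota> g))" unfolding k'(2) by (rule \<pi>_mult_K[OF s(4) k'(1)])
    finally show ?thesis using k'(3) by blast
  qed
  define S where "S = Q - N"
  have oN: "\<exists>W. open W \<and> a \<in> W \<and> U \<inter> W \<subseteq> N" if "a \<in> N" for a
  proof -
    obtain k where k: "k \<in> K" "dist (a ** k) (mat 1) < \<delta>1" using \<open>a \<in> N\<close> by (auto simp: N_def)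
    have "open {x. dist (x ** k) (mat 1) < \<delta>1}" by (intro open_Collect_less continuous_intros)
    then show ?thesis using k by (intro exI[of _ "{x. dist (x ** k) (mat 1) < \<delta>1}"]) (auto simp: N_def)
  qed
  have NQ: "N \<subseteq> Q" using Q_iff by (force simp: N_def)
  have cS: "compact S"
  proof -
    have "S = Q \<inter> (\<Inter>k\<in>K. {x. \<delta>1 \<le> dist (x ** k) (mat 1)})"
      using Q_iff by (fastforce simp: S_def N_def not_le[symmetric])
    moreover have "closed (\<Inter>k\<in>K. {x. \<delta>1 \<le> dist (x ** k) (mat 1)})"
      by (intro closed_INT ballI closed_Collect_le continuous_intros)
    ultimately show ?thesis using cQ by (simp add: compact_Int_closed)
  qed
  \<comment> \<open>Inside \<open>Q\<close> the section recovers the coset from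
    \<open>\<iota> g\<close>, so the only coset over \<open>H0\<close> is \<open>K\<close>, and
    \<open>K\<close> lies in \<open>N\<close>. Compactness of the shell then gives a positive
    distance \<open>\<rho>1\<close>.\<close>
  have S\<iota>: "\<iota> g \<noteq> H0" if g: "g \<in> S" for g
  proof
    assume e: "\<iota> g = H0"
    have gQ: "g \<in> Q" "g \<in> U" "g \<notin> N" using g Q_iff by (auto simp: S_def)
    have "\<pi> (mat 1) = \<pi> g" using near_section[OF gQ(1)] e s(5) by simp
    then obtain k where "k \<in> K" "g = mat 1 ** k" by (rule \<pi>_eqD)
    then have "g \<in> K" by simp
    then have "matrix_inv g \<in> K" "g ** matrix_inv g = mat 1" using K.inv_mem K.right_inv by auto
    then have "g \<in> N" using gQ(2) \<delta>1(1) unfolding N_def by (auto intro!: bexI[of _ "matrix_inv g"])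
    then show False using gQ(3) by simp
  qed
  have c\<iota>: "continuous_on {g. invertible g} \<iota>" by (rule smooth_on_continuous[OF smooth_\<iota>])
  have QU: "Q \<subseteq> U" using Q_iff by blast
  have "\<exists>\<rho>1>0. \<forall>g\<in>S. \<rho>1 \<le> dist H0 (\<iota> g)"
  proof (cases "S = {}")
    case True then show ?thesis by (intro exI[of _ 1]) auto
  next
    case False
    have "continuous_on S (\<lambda>g. dist H0 (\<iota> g))"
      by (intro continuous_intros continuous_on_subset[OF c\<iota>]) (use QU U.invertible_mem in \<open>auto simp: S_def\<close>)
    then obtain g0 where "g0 \<in> S" "\<And>g. g \<in> S \<Longrightarrow> dist H0 (\<iota> g0) \<le> dist H0 (\<iota> g)"
      using continuous_attains_inf[OF cS False] by blast
    then show ?thesis using S\<iota>[of g0] by (intro exI[of _ "dist H0 (\<iota> g0)"]) auto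
  qed
  then obtain \<rho>1 where \<rho>1: "\<rho>1 > 0" "\<And>g. g \<in> S \<Longrightarrow> \<rho>1 \<le> dist H0 (\<iota> g)" by blast
  define cut where "cut \<Theta> = descend (\<lambda>g. if g \<in> N then \<Theta> (\<iota> g) else 0)" for \<Theta> :: "real^'n^'n \<Rightarrow> real"
  have N_K: "g ** k \<in> N \<longleftrightarrow> g \<in> N" if g: "g \<in> U" "k \<in> K" for g k
  proof -
    have 1: "h \<in> N" if "h ** l \<in> N" "h \<in> U" "l \<in> K" for h l
    proof -
      obtain k' where "k' \<in> K" "dist (h ** l ** k') (mat 1) < \<delta>1" using \<open>h ** l \<in> N\<close> by (auto simp: N_def)
      then show ?thesis using that K.mult_mem[of l k'] by (auto simp: N_def matrix_mul_assoc intro!: bexI[of _ "l ** k'"])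
    qed
    have "g ** k ** matrix_inv k = g" using matrix_inv_cancel(3)[OF K.invertible_mem[OF g(2)]] .
    then show ?thesis using 1[of g k] 1[of "g ** k" "matrix_inv k"] g U.mult_mem kU K.inv_mem by auto
  qed
  have Kcut: "K_invariant (\<lambda>g. if g \<in> N then \<Theta> (\<iota> g) else 0)" for \<Theta> :: "real^'n^'n \<Rightarrow> real"
    using N_K \<iota>_mult_K by (auto simp: K_invariant_def)
  have cut_\<pi>: "cut \<Theta> (\<pi> g) = (if g \<in> N then \<Theta> (\<iota> g) else 0)" if "g \<in> U" for \<Theta> g
    unfolding cut_def by (rule descend_\<pi>[OF Kcut that])
  have one_N: "mat 1 \<in> N" unfolding N_def using U.one_mem K.one_mem \<delta>1(1) by (auto intro!: bexI[of _ "mat 1"])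
  have cut_mem: "cut \<Theta> \<in> C" if \<Theta>: "smooth_on UNIV \<Theta>" "\<And>y. dist H0 y \<ge> \<rho>1/2 \<Longrightarrow> \<Theta> y = 0" for \<Theta>
    unfolding cut_def
  proof (rule descend_mem[OF Kcut sub_smoothI])
    fix a assume a: "a \<in> U"
    let ?f = "\<lambda>g. if g \<in> N then \<Theta> (\<iota> g) else 0"
    have ai: "invertible a" using a U.invertible_mem by blast
    \<comment> \<open>Near a point of the open tube the function is \<open>\<Theta>\<close> of the
      orbit map; near the shell it is 0 because the orbit map is far from \<open>H0\<close>; off the
      compact tube it is 0 by definition.\<close>
    consider "a \<in> N" | "a \<in> S" | "a \<notin> Q" using S_def by blast
    then show "\<exists>W F. open W \<and> a \<in> W \<and> smooth_on W F \<and> (\<forall>x\<in>U \<inter> W. ?f x = F x)"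
    proof cases
      case 1
      then obtain W where W: "open W" "a \<in> W" "U \<inter> W \<subseteq> N" using oN by blast
      have "smooth_on (W \<inter> {g. invertible g}) (\<lambda>g. \<Theta> (\<iota> g))"
        by (intro smooth_on_compose[OF \<Theta>(1)] smooth_on_subset[OF smooth_\<iota>] open_Int W(1) open_invertible) auto
      then show ?thesis using W ai
        by (intro exI[of _ "W \<inter> {g. invertible g}"] exI[of _ "\<lambda>g. \<Theta> (\<iota> g)"]) (auto intro: open_Int open_invertible)
    next
      case 2
      let ?W = "{g. invertible g} \<inter> \<iota> -` {y. \<rho>1/2 < dist H0 y}"
      have "open {y. \<rho>1/2 < dist H0 y}" by (intro open_Collect_less continuous_intros)
      then have "open ?W" using continuous_open_preimage[OF c\<iota> open_invertible] by blast
      then show ?thesis using 2 ai \<rho>1(1) \<rho>1(2)[OF 2] \<Theta>(2)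
        by (intro exI[of _ ?W] exI[of _ "\<lambda>g. 0"]) auto
    next
      case 3
      then show ?thesis using NQ compact_imp_closed[OF cQ]
        by (intro exI[of _ "- Q"] exI[of _ "\<lambda>g. 0"]) auto
    qed
  qed
  define co where "co b = orbit_fn (\<lambda>y. (y - H0) \<bullet> b)" for b
  have co: "co b \<in> C" for b unfolding co_def
    by (intro orbit_fn_mem smooth_on_bounded_linear_compose[OF bounded_linear_inner_left] smooth_on_diff) auto
  have co_\<pi>: "co b (\<pi> g) = (\<iota> g - H0) \<bullet> b" if "g \<in> U" for b g
    unfolding co_def by (rule orbit_fn_\<pi>[OF that])
  \<comment> \<open>\<open>V\<close> is the velocity of the orbit map under \<open>v\<close>,
    assembled from its coordinates; the derivative \<open>L\<close> of the section turns it into an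
    element of the Lie algebra.\<close>
  define V where "V = (\<Sum>b\<in>Basis. v (co b) *\<^sub>R b)"
  have LV: "L V \<in> lie_algebra U" using s(7) by blast
  have "v f = tv (mat 1) (L V) f" for f
  proof (cases "f \<in> C")
    case f: True
    obtain W1 F1 where W1: "open W1" "mat 1 \<in> W1" "smooth_on W1 F1" "\<And>x. x \<in> U \<Longrightarrow> x \<in> W1 \<Longrightarrow> f (\<pi> x) = F1 x"
      using C_extension[OF f U.one_mem] by blast
    have "open (ball H0 \<rho> \<inter> s -` W1)"
      using smooth_on_continuous[OF s(3)] open_ball W1(1) by (rule continuous_open_preimage)
    moreover have "H0 \<in> ball H0 \<rho> \<inter> s -` W1" using s(1,5) W1(2) by simp
    ultimately obtain r0 where r0: "r0 > 0" "ball H0 r0 \<subseteq> ball H0 \<rho> \<inter> s -` W1" using openE by blast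
    define Fy where "Fy y = F1 (s y)" for y
    have Fs: "smooth_on (ball H0 r0) Fy" unfolding Fy_def
      by (intro smooth_on_compose[OF W1(3)] smooth_on_subset[OF s(3)] open_ball W1(1)) (use r0 in auto)
    obtain G where G: "\<And>b. smooth_on (ball H0 r0) (G b)" "\<And>b. G b H0 = frechet_derivative Fy (at H0) b"
      "\<And>y. y \<in> ball H0 r0 \<Longrightarrow> Fy y = Fy H0 + (\<Sum>b\<in>Basis. ((y - H0) \<bullet> b) * G b y)"
      by (rule hadamard[OF Fs]) (rule that)
    define r where "r = min (r0/2) (\<rho>1/2)"
    have r: "r > 0" "r < r0" "r \<le> \<rho>1/2" using r0(1) \<rho>1(1) by (auto simp: r_def)
    obtain \<psi> :: "real^'n^'n \<Rightarrow> real" where \<psi>: "smooth_on UNIV \<psi>" "\<psi> H0 = 1" "\<And>y. dist H0 y \<ge> r \<Longrightarrow> \<psi> y = 0"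
      by (rule smooth_bump[OF r(1), of H0]) (rule that)
    have \<psi>z: "\<psi> y = 0" if "dist H0 y \<ge> \<rho>1/2" for y using \<psi>(3) r(3) that by simp
    define \<zeta> where "\<zeta> = cut \<psi>"
    define \<gamma> where "\<gamma> b = cut (\<lambda>y. \<psi> y * G b y)" for b
    define e where "e b = (\<lambda>q. \<zeta> q * co b q)" for b
    have \<zeta>: "\<zeta> \<in> C" unfolding \<zeta>_def by (rule cut_mem[OF \<psi>(1) \<psi>z])
    have \<gamma>: "\<gamma> b \<in> C" for b unfolding \<gamma>_def
      by (rule cut_mem[OF smooth_on_bump_mult[OF G(1) \<psi>(1,3) r(2)]]) (simp_all add: \<psi>z)
    have e: "e b \<in> C" for b unfolding e_def by (rule A.mult_fn_mem[OF \<zeta> co])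
    have \<zeta>1: "\<zeta> (\<pi> (mat 1)) = 1" unfolding \<zeta>_def using cut_\<pi>[OF U.one_mem] one_N \<psi>(2) by simp
    have co1: "co b (\<pi> (mat 1)) = 0" for b using co_\<pi>[OF U.one_mem] by simp
    have \<gamma>1: "\<gamma> b (\<pi> (mat 1)) = G b H0" for b unfolding \<gamma>_def using cut_\<pi>[OF U.one_mem] one_N \<psi>(2) by simp
    have ve: "v (e b) = v (co b)" for b unfolding e_def A.TS_mult[OF v \<zeta> co] by (simp add: co1 \<zeta>1)
    define c where "c = f (\<pi> (mat 1))"
    have FyH: "Fy H0 = c" using W1(4)[OF U.one_mem W1(2)] s(5) by (simp add: Fy_def c_def)
    define h where "h = (\<lambda>q. 1 * f q + (- c) * one_fn q)"
    have h: "h \<in> C" unfolding h_def by (rule A.lincomb_mem[OF f one_fn(1)])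
    have vh: "v h = v f" unfolding h_def A.TS_lincomb[OF v f one_fn(1)] using TS_one_fn[OF v U.one_mem] by simp
    have h\<pi>: "h (\<pi> g) = f (\<pi> g) - c" if "g \<in> U" for g using one_fn(2)[OF that] by (simp add: h_def)
    have vl: "v (\<lambda>q. (\<zeta> q * \<zeta> q) * h q) = v f"
      unfolding A.TS_mult[OF v A.mult_fn_mem[OF \<zeta> \<zeta>] h] using vh h\<pi>[OF U.one_mem] \<zeta>1 by (simp add: c_def)
    have m: "(\<lambda>q. e b q * \<gamma> b q) \<in> C" for b by (rule A.mult_fn_mem[OF e \<gamma>])
    have vb: "v (\<lambda>q. e b q * \<gamma> b q) = v (co b) * G b H0" for b
      unfolding A.TS_mult[OF v e \<gamma>] ve \<gamma>1 by (simp add: e_def co1)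
    have sm: "(\<lambda>q. \<Sum>b\<in>Basis. e b q * \<gamma> b q) \<in> C"
      "v (\<lambda>q. \<Sum>b\<in>Basis. e b q * \<gamma> b q) = (\<Sum>b\<in>Basis. v (co b) * G b H0)"
      using A.TS_sum[of v _ Basis "\<lambda>b q. e b q * \<gamma> b q", OF v zero_fn m finite_Basis] by (auto simp: vb)
    \<comment> \<open>One factor \<open>\<zeta>\<close> localises the coordinate
      \<open>co b\<close>, the other the coefficient \<open>G b\<close> of Hadamard's formula, which
      is defined only near \<open>H0\<close>. Since \<open>co b\<close> vanishes at the base point,
      applying \<open>v\<close> leaves just the terms \<open>v (co b) * G b H0\<close>.\<close>
    have "(\<lambda>q. (\<zeta> q * \<zeta> q) * h q) = (\<lambda>q. \<Sum>b\<in>Basis. e b q * \<gamma> b q)"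
    proof (rule C_eqI[OF A.mult_fn_mem[OF A.mult_fn_mem[OF \<zeta> \<zeta>] h] sm(1)])
      fix g assume g: "g \<in> U"
      show "\<zeta> (\<pi> g) * \<zeta> (\<pi> g) * h (\<pi> g) = (\<Sum>b\<in>Basis. e b (\<pi> g) * \<gamma> b (\<pi> g))"
      proof (cases "g \<in> N \<and> dist H0 (\<iota> g) < r")
        case True
        then have gQ: "g \<in> Q" and y: "\<iota> g \<in> ball H0 r0" using NQ r(2) by auto
        have "f (\<pi> g) = Fy (\<iota> g)"
          using near_section[OF gQ] W1(4)[OF s(4)[of "\<iota> g"]] y r0(2) by (auto simp: Fy_def)
        then have "h (\<pi> g) = (\<Sum>b\<in>Basis. ((\<iota> g - H0) \<bullet> b) * G b (\<iota> g))"
          using G(3)[OF y] h\<pi>[OF g] FyH by simp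
        then show ?thesis using True g
          by (simp add: e_def \<zeta>_def \<gamma>_def cut_\<pi> co_\<pi> sum_distrib_left mult_ac)
      next
        case False
        then have "\<zeta> (\<pi> g) = 0" using \<psi>(3) g by (auto simp: \<zeta>_def cut_\<pi> not_less)
        then show ?thesis by (simp add: e_def)
      qed
    qed
    then have "v f = (\<Sum>b\<in>Basis. v (co b) * G b H0)" using vl sm(2) by simp
    also have "\<dots> = (\<Sum>b\<in>Basis. v (co b) * frechet_derivative F1 (at (mat 1)) (L b))"
    proof -
      have F1d: "(F1 has_derivative frechet_derivative F1 (at (mat 1))) (at (s H0))"
        unfolding s(5) by (rule smooth_on_has_derivative[OF W1(3,2)])
      have "(Fy has_derivative (\<lambda>b. frechet_derivative F1 (at (mat 1)) (L b))) (at H0)"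
        unfolding Fy_def by (rule has_derivative_compose[OF s(8) F1d])
      then show ?thesis unfolding G(2) using frechet_derivative_at by metis
    qed
    also have "\<dots> = frechet_derivative F1 (at (mat 1)) (L V)"
    proof -
      have l: "linear (frechet_derivative F1 (at (mat 1)))"
        using smooth_on_has_derivative[OF W1(3,2)] has_derivative_linear by blast
      show ?thesis unfolding V_def
        by (simp add: linear_sum[OF s(6)] linear_cmul[OF s(6)] linear_sum[OF l] linear_cmul[OF l])
    qed
    also have "\<dots> = tv (mat 1) (L V) f"
      using tv_eq[OF f W1 U.one_mem LV] by simp
    finally show ?thesis .
  qed (use A.TS_outside[OF v] in \<open>simp add: tv_def\<close>)
  then show thesis using that[OF LV] by blast
qed

lemma tangent_space_eq:
  assumes g: "g \<in> U"
  shows "tangent_space C (\<pi> g) = tv g ` lie_algebra U"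
proof
  show "tv g ` lie_algebra U \<subseteq> tangent_space C (\<pi> g)" using tv_mem[OF g] by blast
  show "tangent_space C (\<pi> g) \<subseteq> tv g ` lie_algebra U"
  proof
    fix v assume v: "v \<in> tangent_space C (\<pi> g)"
    let ?a = "matrix_inv g"
    have a: "?a \<in> U" using U.inv_mem g .
    have c: "left_translation U g (left_translation U ?a p) = p" if "p \<in> M" for p
      using that matrix_inv_cancel(2)[OF U.invertible_mem[OF g]] by (auto simp: M_eq left_translation_\<pi>)
    have "differential M C (left_translation U ?a) v \<in> tangent_space C (\<pi> (?a ** g))"
      using A.differential_mem[OF translation_smooth[OF a] \<pi>_mem[OF g] v] by (simp add: left_translation_\<pi>)
    then have "differential M C (left_translation U ?a) v \<in> tangent_space C (\<pi> (mat 1))"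
      using U.left_inv[OF g] by simp
    then obtain X where X: "X \<in> lie_algebra U" "differential M C (left_translation U ?a) v = tv (mat 1) X"
      by (rule tangent_at_base)
    have "v = differential M C (left_translation U g) (differential M C (left_translation U ?a) v)"
      using A.differential_inverse[OF v translation_smooth[OF g] translation_smooth[OF a] c] by simp
    also have "\<dots> = tv g X" unfolding X(2) using differential_translation[OF g U.one_mem X(1)] by simp
    finally show "v \<in> tv g ` lie_algebra U" using X(1) by blast
  qed
qed

end

section \<open>Invariant vector fields and almost complex structures\<close>

context orbit
begin

lemma lie_K_commutes: assumes X: "X \<in> lie_algebra K" shows "commutator X H0 = 0"
proof -
  have d: "((\<lambda>s. commutator (mexp (s *\<^sub>R X)) H0) has_vector_derivative commutator X H0) (at 0)"
    using bounded_linear.has_vector_derivative[OF linear_commutator_left[unfolded linear_conv_bounded_linear] mexp_has_vector_derivative[of X 0]]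
    by simp
  have "commutator (mexp (s *\<^sub>R X)) H0 = 0" for s
    using K_centralizes[OF K.mexp_mem[OF X]] by (simp add: commutator_def)
  then have "((\<lambda>s. 0) has_vector_derivative commutator X H0) (at 0)" using d by simp
  then show ?thesis using has_vector_derivative_const vector_derivative_unique_at by blast
qed

text \<open>The orbit map shows \<open>A\<close> only through \<open>[A, H0]\<close>. A left inverse
  of this bracket on the orthogonal complement of \<open>lie_algebra K\<close> recovers
  \<open>A\<close> modulo \<open>lie_algebra K\<close>, and since it is linear it preserves smooth
  dependence.\<close>

lemma coset_projection:
  obtains R where "linear R" "\<And>A. A \<in> lie_algebra U \<Longrightarrow> R (commutator A H0) \<in> lie_algebra U"
    "\<And>A. A \<in> lie_algebra U \<Longrightarrow> A - R (commutator A H0) \<in> lie_algebra K"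
proof -
  define m where "m = {X \<in> lie_algebra U. \<forall>Y\<in>lie_algebra K. X \<bullet> Y = 0}"
  have sm: "subspace m"
    unfolding m_def using U.subspace_lie_algebra by (auto simp: subspace_def inner_add_left)
  have mK: "X = 0" if X: "X \<in> m" "commutator X H0 = 0" for X
  proof -
    have "X \<in> lie_algebra K" using X centralizer_lie by (simp add: m_def)
    then have "X \<bullet> X = 0" using X(1) by (simp add: m_def)
    then show ?thesis by simp
  qed
  have injm: "inj_on (\<lambda>X. commutator X H0) m"
    by (rule linear_injective_on_subspace_0[THEN iffD2, OF linear_commutator_left sm]) (use mK in auto)
  obtain R where R: "range R \<subseteq> m" "linear R" "\<And>X. X \<in> m \<Longrightarrow> R (commutator X H0) = X"
    using linear_exists_left_inverse_on[OF linear_commutator_left sm injm] by auto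
  show thesis
  proof
    fix A assume A: "A \<in> lie_algebra U"
    show "R (commutator A H0) \<in> lie_algebra U" using R(1) by (auto simp: m_def)
    obtain y z where yz: "y \<in> span (lie_algebra K)" "\<And>w. w \<in> span (lie_algebra K) \<Longrightarrow> orthogonal z w" "A = y + z"
      using orthogonal_subspace_decomp_exists[of "lie_algebra K" A] by metis
    have y: "y \<in> lie_algebra K" using yz(1) span_eq_iff[THEN iffD2, OF K.subspace_lie_algebra] by simp
    have "z = A - y" using yz(3) by simp
    then have "z \<in> lie_algebra U" using subspace_diff[OF U.subspace_lie_algebra A lie_KU[OF y]] by simp
    then have z: "z \<in> m" using yz(2) span_base by (auto simp: m_def orthogonal_def)
    have "commutator A H0 = commutator z H0"
      using linear_add[OF linear_commutator_left, of y z H0] lie_K_commutes[OF y] yz(3) by simp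
    then have "R (commutator A H0) = z" using R(3)[OF z] by simp
    then show "A - R (commutator A H0) \<in> lie_algebra K" using y yz(3) by simp
  qed fact
qed

lemma tv_eqI:
  assumes g: "g \<in> U" and A: "A \<in> lie_algebra U" and B: "B \<in> lie_algebra U" and e: "A - B \<in> lie_algebra K"
  shows "tv g A = tv g B"
proof
  fix f show "tv g A f = tv g B f" using tv_linear[OF g A B, of 1 "-1" f] tv_K[OF g e, of f] by simp
qed

text \<open>Left trivialisation: a field on \<open>U / K\<close> is represented by a Lie algebra
  valued function on \<open>U\<close>, which it determines only modulo
  \<open>lie_algebra K\<close>.\<close>

definition lifts :: "((real^'n^'n) set \<Rightarrow> ((real^'n^'n) set \<Rightarrow> real) \<Rightarrow> real) \<Rightarrow> (real^'n^'n \<Rightarrow> real^'n^'n) \<Rightarrow> bool" where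
  "lifts X Xh \<longleftrightarrow> (\<forall>g\<in>U. X (\<pi> g) = tv g (Xh g) \<and> Xh g \<in> lie_algebra U) \<and> sub_smooth U Xh"

lemma tv_lift_extension:
  assumes f: "f \<in> C" and Xh: "\<And>g. g \<in> U \<Longrightarrow> Xh g \<in> lie_algebra U" and g: "g \<in> U"
    and F: "open W" "g \<in> W" "smooth_on W F" "\<And>x. x \<in> U \<Longrightarrow> x \<in> W \<Longrightarrow> f (\<pi> x) = F x"
    and X1: "open V" "g \<in> V" "smooth_on V X1" "\<And>x. x \<in> U \<Longrightarrow> x \<in> V \<Longrightarrow> Xh x = X1 x"
  shows "smooth_on (W \<inter> V) (\<lambda>h. frechet_derivative F (at h) (h ** X1 h))"
    "\<And>h. h \<in> U \<Longrightarrow> h \<in> W \<inter> V \<Longrightarrow> tv h (Xh h) f = frechet_derivative F (at h) (h ** X1 h)"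
proof -
  show "smooth_on (W \<inter> V) (\<lambda>h. frechet_derivative F (at h) (h ** X1 h))"
    by (intro smooth_on_frechet_apply smooth_on_matrix_mult smooth_on_ident open_Int F(1) X1(1)
        smooth_on_subset[OF F(3)] smooth_on_subset[OF X1(3)]) auto
  fix h assume h: "h \<in> U" "h \<in> W \<inter> V"
  then show "tv h (Xh h) f = frechet_derivative F (at h) (h ** X1 h)"
    using tv_eq[OF f F(1) _ F(3,4) h(1) Xh[OF h(1)]] X1(4) by auto
qed

lemma sub_smooth_tv:
  assumes f: "f \<in> C" and Xh: "\<And>g. g \<in> U \<Longrightarrow> Xh g \<in> lie_algebra U" "sub_smooth U Xh"
  shows "sub_smooth U (\<lambda>g. tv g (Xh g) f)"
proof (rule sub_smoothI)
  fix g assume g: "g \<in> U"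
  obtain W F where F: "open W" "g \<in> W" "smooth_on W F" "\<And>x. x \<in> U \<Longrightarrow> x \<in> W \<Longrightarrow> f (\<pi> x) = F x"
    using C_extension[OF f g] by blast
  obtain V X1 where X1: "open V" "g \<in> V" "smooth_on V X1" "\<And>x. x \<in> U \<Longrightarrow> x \<in> V \<Longrightarrow> Xh x = X1 x"
    by (rule sub_smoothE[OF Xh(2) g]) (rule that)
  note e = tv_lift_extension[OF f Xh(1) g F X1]
  show "\<exists>W F. open W \<and> g \<in> W \<and> smooth_on W F \<and> (\<forall>x\<in>U \<inter> W. tv x (Xh x) f = F x)"
    using F(1,2) X1(1,2) e
    by (intro exI[of _ "W \<inter> V"] exI[of _ "\<lambda>h. frechet_derivative F (at h) (h ** X1 h)"]) auto
qed

lemma lifts_field: assumes "lifts X Xh" shows "smooth_vector_field M C X"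
  unfolding smooth_vector_field_def
proof (intro conjI ballI)
  have X: "\<And>g. g \<in> U \<Longrightarrow> X (\<pi> g) = tv g (Xh g)" "\<And>g. g \<in> U \<Longrightarrow> Xh g \<in> lie_algebra U" "sub_smooth U Xh"
    using assms by (auto simp: lifts_def)
  show "X p \<in> tangent_space C p" if "p \<in> M" for p
    using that X(1,2) tv_mem by (auto simp: M_eq)
  show "(\<lambda>p. if p \<in> M then X p f else 0) \<in> C" if f: "f \<in> C" for f
    unfolding C_iff using sub_smooth_cong[OF sub_smooth_tv[OF f X(2,3)]] X(1) by auto
qed

text \<open>Applying \<open>X\<close> to the coordinates of the orbit map yields the matrix
  \<open>g [A, H0] g^-1\<close>, smoothly in \<open>g\<close>. Undoing the conjugation and applying
  the projection \<open>R\<close> gives a smooth lift on all of \<open>U\<close>.\<close>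

lemma lift_exists: assumes X: "smooth_vector_field M C X" shows "\<exists>Xh. lifts X Xh"
proof -
  obtain R where R: "linear R" "\<And>A. A \<in> lie_algebra U \<Longrightarrow> R (commutator A H0) \<in> lie_algebra U"
    "\<And>A. A \<in> lie_algebra U \<Longrightarrow> A - R (commutator A H0) \<in> lie_algebra K"
    by (rule coset_projection) (rule that)
  define \<Xi> where "\<Xi> g = (\<Sum>b\<in>Basis. X (\<pi> g) (orbit_fn (\<lambda>y. y \<bullet> b)) *\<^sub>R b)" for g
  define Xh where "Xh g = R (matrix_inv g ** \<Xi> g ** g)" for g
  have fC: "orbit_fn (\<lambda>y. y \<bullet> b) \<in> C" for b
    by (intro orbit_fn_mem smooth_on_bounded_linear bounded_linear_inner_left)
  have sm\<Xi>: "sub_smooth U \<Xi>" unfolding \<Xi>_def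
  proof (intro sub_smooth_sum sub_smooth_bilinear[OF bounded_bilinear_scaleR] sub_smooth_const)
    fix b :: "real^'n^'n"
    have "sub_smooth U (\<lambda>g. A.act X (orbit_fn (\<lambda>y. y \<bullet> b)) (\<pi> g))"
      using A.fieldD(2)[OF X fC] by (simp add: C_iff)
    then show "sub_smooth U (\<lambda>g. X (\<pi> g) (orbit_fn (\<lambda>y. y \<bullet> b)))"
      by (rule sub_smooth_cong) (simp add: A.act_def)
  qed
  have smX: "sub_smooth U Xh" unfolding Xh_def
    by (intro sub_smooth_linear[OF R(1)[unfolded linear_conv_bounded_linear]] sub_smooth_matrix_mult sm\<Xi>
      sub_smooth_of_smooth[OF open_invertible _ smooth_on_matrix_inv[OF open_invertible smooth_on_ident]]
      sub_smooth_of_smooth[OF open_UNIV _ smooth_on_ident]) (use U.invertible_mem in auto)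
  have "X (\<pi> g) = tv g (Xh g) \<and> Xh g \<in> lie_algebra U" if g: "g \<in> U" for g
  proof -
    obtain A where A: "A \<in> lie_algebra U" "X (\<pi> g) = tv g A"
      using A.fieldD(1)[OF X \<pi>_mem[OF g]] tangent_space_eq[OF g] by blast
    have gi: "invertible g" using U.invertible_mem g .
    have l: "linear (\<lambda>y::real^'n^'n. y \<bullet> b)" for b by (intro linearI) (auto simp: inner_add_left)
    have "\<Xi> g = g ** commutator A H0 ** matrix_inv g"
      unfolding \<Xi>_def A(2) tv_orbit_fn[OF l g A(1)] by (rule euclidean_representation)
    then have "matrix_inv g ** \<Xi> g ** g = commutator A H0"
      using matrix_inv_cancel[OF gi] by (simp add: matrix_mul_assoc[symmetric] matrix_inv_left[OF gi])
    then have "Xh g = R (commutator A H0)" by (simp add: Xh_def)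
    then show ?thesis using R(2,3)[OF A(1)] A tv_eqI[OF g A(1)] by simp
  qed
  then show ?thesis using smX unfolding lifts_def by blast
qed

section \<open>Brackets of lifted fields\<close>

definition ld :: "real^'n^'n \<Rightarrow> (real^'n^'n \<Rightarrow> real^'n^'n) \<Rightarrow> real^'n^'n \<Rightarrow> real^'n^'n" where
  "ld A \<Phi> g = vector_derivative (\<lambda>s. \<Phi> (g ** mexp (s *\<^sub>R A))) (at 0)"

lemma ld_eq:
  assumes X1: "open V" "g \<in> V" "smooth_on V X1" "\<And>x. x \<in> U \<Longrightarrow> x \<in> V \<Longrightarrow> \<Phi> x = X1 x"
    and g: "g \<in> U" and A: "A \<in> lie_algebra U"
  shows "((\<lambda>s. \<Phi> (g ** mexp (s *\<^sub>R A))) has_vector_derivative ld A \<Phi> g) (at 0)"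
    "ld A \<Phi> g = frechet_derivative X1 (at g) (g ** A)"
proof -
  note d = curve_has_derivative[OF X1 left_curve[OF g A]]
  show e: "ld A \<Phi> g = frechet_derivative X1 (at g) (g ** A)"
    unfolding ld_def by (rule vector_derivative_at[OF d])
  show "((\<lambda>s. \<Phi> (g ** mexp (s *\<^sub>R A))) has_vector_derivative ld A \<Phi> g) (at 0)"
    unfolding e by (rule d)
qed

lemma ld_derivative:
  assumes "sub_smooth U \<Phi>" "g \<in> U" "A \<in> lie_algebra U"
  shows "((\<lambda>s. \<Phi> (g ** mexp (s *\<^sub>R A))) has_vector_derivative ld A \<Phi> g) (at 0)"
proof -
  obtain V X1 where X1: "open V" "g \<in> V" "smooth_on V X1" "\<And>x. x \<in> U \<Longrightarrow> x \<in> V \<Longrightarrow> \<Phi> x = X1 x"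
    by (rule sub_smoothE[OF assms(1,2)]) (rule that)
  show ?thesis by (rule ld_eq(1)[OF X1 assms(2,3)])
qed

lemma ld_mem:
  assumes \<Phi>: "sub_smooth U \<Phi>" "\<And>h. h \<in> U \<Longrightarrow> \<Phi> h \<in> lie_algebra U" and g: "g \<in> U" and A: "A \<in> lie_algebra U"
  shows "ld A \<Phi> g \<in> lie_algebra U"
  by (rule U.curve_derivative_mem[OF ld_derivative[OF \<Phi>(1) g A] U.subspace_lie_algebra])
    (rule \<Phi>(2)[OF left_curve(1)[OF g A]])

lemma ld_linear:
  assumes "linear L" "sub_smooth U \<Phi>" "g \<in> U" "A \<in> lie_algebra U"
  shows "ld A (\<lambda>h. L (\<Phi> h)) g = L (ld A \<Phi> g)"
proof -
  have "((\<lambda>s. L (\<Phi> (g ** mexp (s *\<^sub>R A)))) has_vector_derivative L (ld A \<Phi> g)) (at 0)"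
    by (rule bounded_linear.has_vector_derivative[OF assms(1)[unfolded linear_conv_bounded_linear] ld_derivative[OF assms(2-)]])
  then show ?thesis unfolding ld_def by (rule vector_derivative_at)
qed

text \<open>\<open>DF\<close> and \<open>H\<close> are the first and second derivatives at
  \<open>g\<close> of an extension of \<open>f\<close>. The two iterated derivatives contain the
  same \<open>H\<close> term by symmetry, and it cancels; the commutator arises from differentiating
  the factor \<open>h\<close> in \<open>h ** X1 h\<close>, that is, from the left translation
  itself.\<close>

lemma bracket_lift:
  assumes X: "lifts X Xh" and Y: "lifts Y Yh" and g: "g \<in> U" and f: "f \<in> C"
  shows "A.bracket X Y (\<pi> g) f = tv g (commutator (Xh g) (Yh g) + ld (Xh g) Yh g - ld (Yh g) Xh g) f"
proof -
  obtain W F where F: "open W" "g \<in> W" "smooth_on W F" "\<And>x. x \<in> U \<Longrightarrow> x \<in> W \<Longrightarrow> f (\<pi> x) = F x"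
    using C_extension[OF f g] by blast
  define DF where "DF = frechet_derivative F (at g)"
  define H where "H v w = frechet_derivative (\<lambda>h. frechet_derivative F (at h) v) (at g) w" for v w
  have Hsym: "H v w = H w v" for v w
    unfolding H_def by (rule symmetric_second_derivative[OF F(1,2,3)])
  have lDF: "linear DF" unfolding DF_def
    using smooth_on_has_derivative[OF F(3,2)] has_derivative_linear by blast
  have lH: "linear (H v)" for v
    unfolding H_def using smooth_on_has_derivative[OF smooth_on_frechet[OF F(3)] F(2)] has_derivative_linear by blast
  have main: "A.act Z f \<in> C \<and> tv g B (A.act Z f) = DF (g ** (B ** Zh g)) + DF (g ** ld B Zh g) + H (g ** B) (g ** Zh g)"
    if Z: "lifts Z Zh" and B: "B \<in> lie_algebra U" for Z Zh B
  proof
    have Z': "\<And>h. h \<in> U \<Longrightarrow> Z (\<pi> h) = tv h (Zh h)" "\<And>h. h \<in> U \<Longrightarrow> Zh h \<in> lie_algebra U" "sub_smooth U Zh"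
      using Z by (auto simp: lifts_def)
    show aC: "A.act Z f \<in> C" by (rule A.fieldD(2)[OF lifts_field[OF Z] f])
    obtain V X1 where X1: "open V" "g \<in> V" "smooth_on V X1" "\<And>x. x \<in> U \<Longrightarrow> x \<in> V \<Longrightarrow> Zh x = X1 x"
      by (rule sub_smoothE[OF Z'(3) g]) (rule that)
    let ?E = "\<lambda>h. frechet_derivative F (at h) (h ** X1 h)"
    have e1: "smooth_on (W \<inter> V) ?E"
      by (rule tv_lift_extension(1)[of f Zh g W F V X1]) (fact f Z' g F X1)+
    have e2: "tv h (Zh h) f = ?E h" if "h \<in> U" "h \<in> W \<inter> V" for h
      by (rule tv_lift_extension(2)[of f Zh g W F V X1]) (fact f Z' g F X1 that)+
    have "tv g B (A.act Z f) = frechet_derivative ?E (at g) (g ** B)"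
    proof (rule tv_eq[OF aC _ _ e1 _ g B])
      show "open (W \<inter> V)" "g \<in> W \<inter> V" using F X1 by auto
      show "A.act Z f (\<pi> h) = ?E h" if "h \<in> U" "h \<in> W \<inter> V" for h
        using e2[OF that] Z'(1) that by (simp add: A.act_def)
    qed
    also have "frechet_derivative ?E (at g) w = DF (w ** X1 g) + DF (g ** frechet_derivative X1 (at g) w) + H w (g ** X1 g)" for w
    proof -
      let ?D = "\<lambda>w. \<Sum>b\<in>Basis. ((g ** X1 g) \<bullet> b) * H b w + ((g ** frechet_derivative X1 (at g) w + w ** X1 g) \<bullet> b) * DF b"
      have "((\<lambda>h. \<Sum>b\<in>Basis. ((h ** X1 h) \<bullet> b) * frechet_derivative F (at h) b) has_derivative ?D) (at g)"
      proof (intro has_derivative_sum)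
        fix b :: "real^'n^'n"
        have d1: "((\<lambda>h. h ** X1 h) has_derivative (\<lambda>w. g ** frechet_derivative X1 (at g) w + w ** X1 g)) (at g)"
          by (rule bounded_bilinear.FDERIV[OF bounded_bilinear_matrix_matrix_mult has_derivative_ident smooth_on_has_derivative[OF X1(3,2)]])
        have d2: "((\<lambda>h. frechet_derivative F (at h) b) has_derivative H b) (at g)"
          unfolding H_def by (rule smooth_on_has_derivative[OF smooth_on_frechet[OF F(3)] F(2)])
        show "((\<lambda>h. ((h ** X1 h) \<bullet> b) * frechet_derivative F (at h) b) has_derivative
          (\<lambda>w. ((g ** X1 g) \<bullet> b) * H b w + ((g ** frechet_derivative X1 (at g) w + w ** X1 g) \<bullet> b) * DF b)) (at g)"
          unfolding DF_def
          by (rule has_derivative_mult[OF bounded_linear.has_derivative[OF bounded_linear_inner_left d1] d2])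
      qed
      then have "(?E has_derivative ?D) (at g)"
      proof (rule has_derivative_transform_within_open[OF _ F(1,2)])
        fix h assume "h \<in> W"
        then have l: "linear (frechet_derivative F (at h))"
          using smooth_on_has_derivative[OF F(3)] has_derivative_linear by blast
        have "frechet_derivative F (at h) (\<Sum>b\<in>Basis. ((h ** X1 h) \<bullet> b) *\<^sub>R b) = (\<Sum>b\<in>Basis. ((h ** X1 h) \<bullet> b) * frechet_derivative F (at h) b)"
          by (simp add: linear_sum[OF l] linear_cmul[OF l])
        then show "(\<Sum>b\<in>Basis. ((h ** X1 h) \<bullet> b) * frechet_derivative F (at h) b) = ?E h"
          by (simp add: euclidean_representation)
      qed
      then have "frechet_derivative ?E (at g) = ?D" by (rule frechet_derivative_at[symmetric])
      moreover have "(\<Sum>b\<in>Basis. (v \<bullet> b) * DF b) = DF v" for v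
      proof -
        have "DF (\<Sum>b\<in>Basis. (v \<bullet> b) *\<^sub>R b) = (\<Sum>b\<in>Basis. (v \<bullet> b) * DF b)"
          by (simp add: linear_sum[OF lDF] linear_cmul[OF lDF])
        then show ?thesis by (simp add: euclidean_representation)
      qed
      moreover have "(\<Sum>b\<in>Basis. (v \<bullet> b) * H b w) = H w v" for v
      proof -
        have "H w (\<Sum>b\<in>Basis. (v \<bullet> b) *\<^sub>R b) = (\<Sum>b\<in>Basis. (v \<bullet> b) * H b w)"
          by (simp add: linear_sum[OF lH] linear_cmul[OF lH] Hsym[of w])
        then show ?thesis by (simp add: euclidean_representation)
      qed
      ultimately show ?thesis by (simp add: sum.distrib linear_add[OF lDF])
    qed
    also have "frechet_derivative X1 (at g) (g ** B) = ld B Zh g"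
      using ld_eq(2)[OF X1 g B] by simp
    finally show "tv g B (A.act Z f) = DF (g ** (B ** Zh g)) + DF (g ** ld B Zh g) + H (g ** B) (g ** Zh g)"
      using X1(4)[OF g X1(2)] by (simp add: matrix_mul_assoc)
  qed
  have X': "X (\<pi> g) = tv g (Xh g)" "Xh g \<in> lie_algebra U" "sub_smooth U Xh" "\<And>h. h \<in> U \<Longrightarrow> Xh h \<in> lie_algebra U"
    using X g by (auto simp: lifts_def)
  have Y': "Y (\<pi> g) = tv g (Yh g)" "Yh g \<in> lie_algebra U" "sub_smooth U Yh" "\<And>h. h \<in> U \<Longrightarrow> Yh h \<in> lie_algebra U"
    using Y g by (auto simp: lifts_def)
  have mem: "commutator (Xh g) (Yh g) + ld (Xh g) Yh g - ld (Yh g) Xh g \<in> lie_algebra U"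
    by (intro subspace_add[OF U.subspace_lie_algebra] subspace_diff[OF U.subspace_lie_algebra] U.bracket_mem
      ld_mem X' Y' g)
  have "A.bracket X Y (\<pi> g) f = tv g (Xh g) (A.act Y f) - tv g (Yh g) (A.act X f)"
    using f X' Y' by (simp add: A.bracket_def)
  also have "tv g (Xh g) (A.act Y f) = DF (g ** (Xh g ** Yh g)) + DF (g ** ld (Xh g) Yh g) + H (g ** Xh g) (g ** Yh g)"
    using main[OF Y X'(2)] by (rule conjunct2)
  also have "tv g (Yh g) (A.act X f) = DF (g ** (Yh g ** Xh g)) + DF (g ** ld (Yh g) Xh g) + H (g ** Yh g) (g ** Xh g)"
    using main[OF X Y'(2)] by (rule conjunct2)
  also have "H (g ** Yh g) (g ** Xh g) = H (g ** Xh g) (g ** Yh g)" by (rule Hsym)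
  also have "DF (g ** (Xh g ** Yh g)) + DF (g ** ld (Xh g) Yh g) + H (g ** Xh g) (g ** Yh g)
      - (DF (g ** (Yh g ** Xh g)) + DF (g ** ld (Yh g) Xh g) + H (g ** Xh g) (g ** Yh g))
      = DF (g ** (Xh g ** Yh g)) + DF (g ** ld (Xh g) Yh g) - DF (g ** (Yh g ** Xh g)) - DF (g ** ld (Yh g) Xh g)"
    by (simp only: algebra_simps)
  also have "\<dots> = DF (g ** (commutator (Xh g) (Yh g) + ld (Xh g) Yh g - ld (Yh g) Xh g))"
    unfolding commutator_def
    by (simp add: linear_add[OF lDF] linear_diff[OF lDF] bounded_bilinear.add_right[OF bounded_bilinear_matrix_matrix_mult]
      bounded_bilinear.diff_right[OF bounded_bilinear_matrix_matrix_mult])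
  also have "\<dots> = tv g (commutator (Xh g) (Yh g) + ld (Xh g) Yh g - ld (Yh g) Xh g) f"
    unfolding DF_def using tv_eq[OF f F g mem] by simp
  finally show ?thesis .
qed

text \<open>On the tangent vector represented by \<open>g\<close> and \<open>A\<close> the structure
  acts by \<open>A \<mapsto> J0 A\<close>. The choice is immaterial once \<open>J0\<close> kills
  \<open>lie_algebra K\<close> and commutes with conjugation by \<open>K\<close>.\<close>

definition acs_of :: "(real^'n^'n \<Rightarrow> real^'n^'n) \<Rightarrow> (real^'n^'n) set endo_field" where
  "acs_of J0 p v = (SOME w. \<exists>g\<in>U. \<exists>A\<in>lie_algebra U. p = \<pi> g \<and> v = tv g A \<and> w = tv g (J0 A))"

text \<open>The velocity field of left translation by \<open>exp (t A)\<close>, written in the left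
  trivialisation: \<open>exp (t A) g = g exp (t g^-1 A g)\<close>.\<close>

definition fundamental_lift :: "real^'n^'n \<Rightarrow> real^'n^'n \<Rightarrow> real^'n^'n" where
  "fundamental_lift A g = matrix_inv g ** A ** g"

definition fundamental_field where
  "fundamental_field A p = tv (SOME g. g \<in> U \<and> p = \<pi> g) (fundamental_lift A (SOME g. g \<in> U \<and> p = \<pi> g))"

lemma lifts_fundamental: assumes A: "A \<in> lie_algebra U" shows "lifts (fundamental_field A) (fundamental_lift A)"
proof -
  have mem: "fundamental_lift A g \<in> lie_algebra U" if g: "g \<in> U" for g
    using U.Ad_mem[OF U.inv_mem[OF g] A] matrix_inv_inv[OF U.invertible_mem[OF g]] by (simp add: fundamental_lift_def)
  have "fundamental_field A (\<pi> g) = tv g (fundamental_lift A g)" if g: "g \<in> U" for g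
  proof -
    define h where "h = (SOME h. h \<in> U \<and> \<pi> g = \<pi> h)"
    have "\<exists>h. h \<in> U \<and> \<pi> g = \<pi> h" using g by blast
    then have h: "h \<in> U" "\<pi> g = \<pi> h" unfolding h_def by (metis (mono_tags, lifting) someI_ex)+
    obtain k where k: "k \<in> K" "h = g ** k" using h(2) by (rule \<pi>_eqD)
    have i: "invertible g" "invertible k" using U.invertible_mem K.invertible_mem g k by auto
    have "fundamental_lift A h = matrix_inv k ** (fundamental_lift A g) ** k"
      by (simp add: k(2) fundamental_lift_def matrix_inv_mult[OF i] matrix_mul_assoc)
    then have "k ** fundamental_lift A h ** matrix_inv k = fundamental_lift A g"
      using matrix_inv_cancel[OF i(2)] by (simp add: matrix_mul_assoc[symmetric] matrix_inv_right[OF i(2)])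
    then have "tv h (fundamental_lift A h) = tv g (fundamental_lift A g)"
      using tv_mult_K[OF g k(1) mem[OF h(1)]] k(2) by simp
    then show ?thesis by (simp add: fundamental_field_def h_def)
  qed
  moreover have "sub_smooth U (fundamental_lift A)"
    unfolding fundamental_lift_def
    by (intro sub_smooth_matrix_mult sub_smooth_const
      sub_smooth_of_smooth[OF open_invertible _ smooth_on_matrix_inv[OF open_invertible smooth_on_ident]]
      sub_smooth_of_smooth[OF open_UNIV _ smooth_on_ident]) (use U.invertible_mem in auto)
  ultimately show ?thesis using mem by (simp add: lifts_def)
qed

end

section \<open>Invariant almost complex structures induced by an endomorphism of the Lie
  algebra\<close>

locale orbit_acs = orbit U K H0 for U K :: "(real^'n^'n) set" and H0 +
  fixes J0 :: "real^'n^'n \<Rightarrow> real^'n^'n"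
  assumes J0_linear: "linear J0"
    and J0_mem: "A \<in> lie_algebra U \<Longrightarrow> J0 A \<in> lie_algebra U"
    and J0_K: "A \<in> lie_algebra K \<Longrightarrow> J0 A = 0"
    and J0_square: "A \<in> lie_algebra U \<Longrightarrow> J0 (J0 A) + A \<in> lie_algebra K"
    and J0_Ad: "k \<in> K \<Longrightarrow> A \<in> lie_algebra U \<Longrightarrow> J0 (k ** A ** matrix_inv k) = k ** J0 A ** matrix_inv k"
begin

abbreviation "J \<equiv> acs_of J0"

lemma J_tv: assumes g: "g \<in> U" and A: "A \<in> lie_algebra U" shows "J (\<pi> g) (tv g A) = tv g (J0 A)"
proof -
  have "w = tv g (J0 A)" if w: "\<exists>h\<in>U. \<exists>B\<in>lie_algebra U. \<pi> g = \<pi> h \<and> tv g A = tv h B \<and> w = tv h (J0 B)" for w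
  proof -
    obtain h B where h: "h \<in> U" "B \<in> lie_algebra U" "\<pi> g = \<pi> h" "tv g A = tv h B" "w = tv h (J0 B)" using w by blast
    obtain k where k: "k \<in> K" "h = g ** k" using h(3) by (rule \<pi>_eqD)
    let ?B = "k ** B ** matrix_inv k"
    have kU: "k \<in> U" using k KU by blast
    have B': "?B \<in> lie_algebra U" by (rule U.Ad_mem[OF kU h(2)])
    have "tv g A = tv g ?B" using h(4) tv_mult_K[OF g k(1) h(2)] k(2) by simp
    then have "A - ?B \<in> lie_algebra K" by (rule tv_eqD[OF g A B'])
    then have "J0 A = J0 ?B" using J0_K linear_diff[OF J0_linear, of A ?B] by simp
    moreover have "w = tv g (J0 ?B)"
      using h(5) tv_mult_K[OF g k(1) J0_mem[OF h(2)]] k(2) J0_Ad[OF k(1) h(2)] by simp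
    ultimately show ?thesis by simp
  qed
  moreover have "\<exists>w. \<exists>h\<in>U. \<exists>B\<in>lie_algebra U. \<pi> g = \<pi> h \<and> tv g A = tv h B \<and> w = tv h (J0 B)" using g A by blast
  ultimately show ?thesis unfolding acs_of_def by (intro someI2_ex[where Q = "\<lambda>w. w = tv g (J0 A)"])
qed

lemma lifts_J: assumes "lifts X Xh" shows "lifts (\<lambda>p. J p (X p)) (\<lambda>g. J0 (Xh g))"
  using assms J_tv J0_mem sub_smooth_linear[OF J0_linear[unfolded linear_conv_bounded_linear]] by (auto simp: lifts_def)

lemma acs: "almost_complex_structure M C J"
  unfolding almost_complex_structure_def
proof (intro conjI ballI allI impI)
  fix p v assume p: "p \<in> M" and v: "v \<in> tangent_space C p"
  obtain g where g: "g \<in> U" "p = \<pi> g" using p by (rule M_cases)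
  obtain A where A: "A \<in> lie_algebra U" "v = tv g A" using v tangent_space_eq[OF g(1)] g(2) by blast
  show "J p v \<in> tangent_space C p" using J_tv[OF g(1) A(1)] tv_mem[OF g(1) J0_mem[OF A(1)]] g A by simp
  have m: "- A \<in> lie_algebra U" using subspace_neg[OF U.subspace_lie_algebra A(1)] .
  have "J0 (J0 A) - (- A) \<in> lie_algebra K" using J0_square[OF A(1)] by simp
  then have "tv g (J0 (J0 A)) = tv g (- A)" by (rule tv_eqI[OF g(1) J0_mem[OF J0_mem[OF A(1)]] m])
  moreover have "tv g (- A) f = - tv g A f" for f using tv_linear[OF g(1) A(1) A(1), of "-1" 0] by simp
  moreover have "J p (J p v) = tv g (J0 (J0 A))"
    using J_tv[OF g(1) A(1)] J_tv[OF g(1) J0_mem[OF A(1)]] g A by simp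
  ultimately show "J p (J p v) = (\<lambda>f. - v f)" by (simp add: A(2) fun_eq_iff)
  fix w a b assume "w \<in> tangent_space C p"
  then obtain B where B: "B \<in> lie_algebra U" "w = tv g B" using tangent_space_eq[OF g(1)] g(2) by blast
  have AB: "a *\<^sub>R A + b *\<^sub>R B \<in> lie_algebra U"
    using U.subspace_lie_algebra A(1) B(1) by (intro subspace_add subspace_scale)
  have "(\<lambda>f. a * v f + b * w f) = tv g (a *\<^sub>R A + b *\<^sub>R B)" using tv_linear[OF g(1) A(1) B(1)] A B by (simp add: fun_eq_iff)
  moreover have "J0 (a *\<^sub>R A + b *\<^sub>R B) = a *\<^sub>R J0 A + b *\<^sub>R J0 B" by (simp add: linear_add[OF J0_linear] linear_cmul[OF J0_linear])
  ultimately have "J p (\<lambda>f. a * v f + b * w f) = tv g (a *\<^sub>R J0 A + b *\<^sub>R J0 B)"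
    using J_tv[OF g(1) AB] g(2) by simp
  moreover have "J p v = tv g (J0 A)" "J p w = tv g (J0 B)"
    using J_tv[OF g(1) A(1)] J_tv[OF g(1) B(1)] g A B by auto
  ultimately show "J p (\<lambda>f. a * v f + b * w f) = (\<lambda>f. a * J p v f + b * J p w f)"
    using tv_linear[OF g(1) J0_mem[OF A(1)] J0_mem[OF B(1)]] by (simp add: fun_eq_iff)
next
  fix X assume "smooth_vector_field M C X"
  then obtain Xh where "lifts X Xh" using lift_exists by blast
  then show "smooth_vector_field M C (\<lambda>p. J p (X p))" by (rule lifts_field[OF lifts_J])
qed

lemma invariant: "invariant_acs U K J"
  unfolding invariant_acs_def Let_def
proof (intro conjI ballI acs)
  fix a p v assume a: "a \<in> U" and p: "p \<in> M" and v: "v \<in> tangent_space C p"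
  obtain g where g: "g \<in> U" "p = \<pi> g" using p by (rule M_cases)
  obtain A where A: "A \<in> lie_algebra U" "v = tv g A" using v tangent_space_eq[OF g(1)] g(2) by blast
  have ag: "a ** g \<in> U" using U.mult_mem a g by blast
  show "differential M C (left_translation U a) (J p v) = J (left_translation U a p) (differential M C (left_translation U a) v)"
    using J_tv[OF g(1) A(1)] J_tv[OF ag A(1)] differential_translation[OF a g(1) A(1)]
      differential_translation[OF a g(1) J0_mem[OF A(1)]] g A by (simp add: left_translation_\<pi>)
qed

text \<open>The Nijenhuis expression on the Lie algebra; it represents the tensor when read modulo
  \<open>lie_algebra K\<close>.\<close>

definition torsion :: "real^'n^'n \<Rightarrow> real^'n^'n \<Rightarrow> real^'n^'n" where
  "torsion A B = commutator (J0 A) (J0 B) - J0 (commutator (J0 A) B) - J0 (commutator A (J0 B)) - commutator A B"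

lemma torsion_mem: "A \<in> lie_algebra U \<Longrightarrow> B \<in> lie_algebra U \<Longrightarrow> torsion A B \<in> lie_algebra U"
  unfolding torsion_def by (intro subspace_diff[OF U.subspace_lie_algebra] U.bracket_mem J0_mem)

text \<open>The derivative terms of the four brackets cancel up to expressions
  \<open>J0 (J0 Z) + Z\<close> with \<open>Z\<close> a derivative of a lift. These lie in
  \<open>lie_algebra K\<close>, so the tensor depends only on the values of the lifts at
  \<open>g\<close>.\<close>

lemma nijenhuis_lift:
  assumes X: "lifts X Xh" and Y: "lifts Y Yh" and g: "g \<in> U" and f: "f \<in> C"
  shows "A.nijenhuis J X Y (\<pi> g) f = tv g (torsion (Xh g) (Yh g)) f"
proof -
  have X': "Xh g \<in> lie_algebra U" "sub_smooth U Xh" "\<And>h. h \<in> U \<Longrightarrow> Xh h \<in> lie_algebra U"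
    using X g by (auto simp: lifts_def)
  have Y': "Yh g \<in> lie_algebra U" "sub_smooth U Yh" "\<And>h. h \<in> U \<Longrightarrow> Yh h \<in> lie_algebra U"
    using Y g by (auto simp: lifts_def)
  have br: "A.bracket Z1 Z2 (\<pi> g) = tv g (commutator (Zh1 g) (Zh2 g) + ld (Zh1 g) Zh2 g - ld (Zh2 g) Zh1 g)"
    if "lifts Z1 Zh1" "lifts Z2 Zh2" for Z1 Z2 Zh1 Zh2
  proof
    fix f show "A.bracket Z1 Z2 (\<pi> g) f = tv g (commutator (Zh1 g) (Zh2 g) + ld (Zh1 g) Zh2 g - ld (Zh2 g) Zh1 g) f"
      by (cases "f \<in> C") (use bracket_lift[OF that g] in \<open>auto simp: A.bracket_def tv_def\<close>)
  qed
  note J0l = J0_linear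
  let ?x = "Xh g" and ?y = "Yh g"
  let ?a = "ld (J0 ?x) Yh g" and ?b = "ld (J0 ?y) Xh g" and ?c = "ld ?x Yh g" and ?d = "ld ?y Xh g"
  have mems: "J0 ?x \<in> lie_algebra U" "J0 ?y \<in> lie_algebra U" using J0_mem X' Y' by auto
  have lm: "?a \<in> lie_algebra U" "?b \<in> lie_algebra U" "?c \<in> lie_algebra U" "?d \<in> lie_algebra U"
    using ld_mem X' Y' g mems by auto
  have ldl: "ld B (\<lambda>g. J0 (Xh g)) g = J0 (ld B Xh g)" "ld B (\<lambda>g. J0 (Yh g)) g = J0 (ld B Yh g)"
    if "B \<in> lie_algebra U" for B using ld_linear[OF J0l _ g that] X'(2) Y'(2) by auto
  define t1 where "t1 = commutator (J0 ?x) (J0 ?y) + J0 ?a - J0 ?b"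
  define t2 where "t2 = commutator (J0 ?x) ?y + ?a - J0 ?d"
  define t3 where "t3 = commutator ?x (J0 ?y) + J0 ?c - ?b"
  define t4 where "t4 = commutator ?x ?y + ?c - ?d"
  note ss = U.subspace_lie_algebra
  have t: "t1 \<in> lie_algebra U" "t2 \<in> lie_algebra U" "t3 \<in> lie_algebra U" "t4 \<in> lie_algebra U"
    unfolding t1_def t2_def t3_def t4_def
    by (intro subspace_add[OF ss] subspace_diff[OF ss] U.bracket_mem mems X' Y' lm J0_mem)+
  have "A.nijenhuis J X Y (\<pi> g) f = tv g t1 f - tv g (J0 t2) f - tv g (J0 t3) f - tv g t4 f"
    unfolding A.nijenhuis_def br[OF lifts_J[OF X] lifts_J[OF Y]] br[OF lifts_J[OF X] Y] br[OF X lifts_J[OF Y]] br[OF X Y]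
    using J_tv[OF g t(2)] J_tv[OF g t(3)] ldl mems X'(1) Y'(1) unfolding t1_def t2_def t3_def t4_def by simp
  also have "\<dots> = tv g (t1 - J0 t2 - J0 t3 - t4) f"
  proof -
    have d: "tv g (P - Q) f = tv g P f - tv g Q f" if "P \<in> lie_algebra U" "Q \<in> lie_algebra U" for P Q
      using tv_linear[OF g that, of 1 "-1" f] by simp
    show ?thesis using t J0_mem subspace_diff[OF ss] by (simp add: d)
  qed
  also have "tv g (t1 - J0 t2 - J0 t3 - t4) = tv g (torsion ?x ?y)"
  proof (rule tv_eqI[OF g])
    show "t1 - J0 t2 - J0 t3 - t4 \<in> lie_algebra U" using t J0_mem by (intro subspace_diff[OF ss]) auto
    show "torsion ?x ?y \<in> lie_algebra U" using torsion_mem X'(1) Y'(1) by blast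
    have "t1 - J0 t2 - J0 t3 - t4 - torsion ?x ?y = (J0 (J0 ?d) + ?d) - (J0 (J0 ?c) + ?c)"
      unfolding t1_def t2_def t3_def t4_def torsion_def
      by (simp add: linear_add[OF J0l] linear_diff[OF J0l])
    then show "t1 - J0 t2 - J0 t3 - t4 - torsion ?x ?y \<in> lie_algebra K"
      using subspace_diff[OF K.subspace_lie_algebra J0_square[OF lm(4)] J0_square[OF lm(3)]] by simp
  qed
  finally show ?thesis .
qed

lemma torsion_freeI:
  assumes "\<And>A B. A \<in> lie_algebra U \<Longrightarrow> B \<in> lie_algebra U \<Longrightarrow> torsion A B \<in> lie_algebra K"
  shows "A.torsion_free J"
  unfolding A.torsion_free_def
proof (intro allI impI ballI)
  fix X Y p f assume X: "A.field X" and Y: "A.field Y" and p: "p \<in> M" and f: "f \<in> C"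
  obtain Xh Yh where l: "lifts X Xh" "lifts Y Yh" using lift_exists X Y by blast
  obtain g where g: "g \<in> U" "p = \<pi> g" using p by (rule M_cases)
  have "torsion (Xh g) (Yh g) \<in> lie_algebra K" using l g assms by (auto simp: lifts_def)
  then show "A.nijenhuis J X Y p f = 0" using nijenhuis_lift[OF l g(1) f] tv_K[OF g(1)] g(2) by simp
qed

text \<open>Conjugating by \<open>g\<close> before forming the fundamental fields makes their lifts
  take the prescribed values \<open>A\<close> and \<open>B\<close> at \<open>g\<close>.\<close>

lemma nijenhuis_fundamental:
  assumes g: "g \<in> U" and A: "A \<in> lie_algebra U" and B: "B \<in> lie_algebra U"
  obtains X Y where "A.field X" "A.field Y" "\<And>f. f \<in> C \<Longrightarrow> A.nijenhuis J X Y (\<pi> g) f = tv g (torsion A B) f"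
proof
  let ?A = "g ** A ** matrix_inv g" and ?B = "g ** B ** matrix_inv g"
  have m: "?A \<in> lie_algebra U" "?B \<in> lie_algebra U" using U.Ad_mem g A B by auto
  note l = lifts_fundamental[OF m(1)] lifts_fundamental[OF m(2)]
  show "A.field (fundamental_field ?A)" "A.field (fundamental_field ?B)" using l lifts_field by auto
  have "fundamental_lift (g ** Z ** matrix_inv g) g = Z" for Z
    using matrix_inv_cancel[OF U.invertible_mem[OF g]] unfolding fundamental_lift_def
    by (simp add: matrix_mul_assoc[symmetric] matrix_inv_left[OF U.invertible_mem[OF g]])
  then show "A.nijenhuis J (fundamental_field ?A) (fundamental_field ?B) (\<pi> g) f = tv g (torsion A B) f" if "f \<in> C" for f
    using nijenhuis_lift[OF l g that] by simp
qed

lemma not_torsion_freeI: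
  assumes A: "A \<in> lie_algebra U" and B: "B \<in> lie_algebra U" and n: "torsion A B \<notin> lie_algebra K"
  shows "\<not> A.torsion_free J"
proof
  assume t: "A.torsion_free J"
  obtain X Y where X: "A.field X" "A.field Y" "\<And>f. f \<in> C \<Longrightarrow> A.nijenhuis J X Y (\<pi> (mat 1)) f = tv (mat 1) (torsion A B) f"
    by (rule nijenhuis_fundamental[OF U.one_mem A B]) (rule that)
  have "tv (mat 1) (torsion A B) f = 0" for f
    using t X \<pi>_mem[OF U.one_mem] unfolding A.torsion_free_def by (cases "f \<in> C") (auto simp: tv_def)
  moreover have "tv (mat 1) 0 f = 0" for f using tv_K[OF U.one_mem subspace_0[OF K.subspace_lie_algebra]] .
  ultimately have "tv (mat 1) (torsion A B) = tv (mat 1) 0" by (simp add: fun_eq_iff)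
  then have "torsion A B - 0 \<in> lie_algebra K"
    by (rule tv_eqD[OF U.one_mem torsion_mem[OF A B] subspace_0[OF U.subspace_lie_algebra]])
  then show False using n by simp
qed

text \<open>The differential of a function at a point, read on the Lie algebra, is a functional of
  the kind quantified over in the hypothesis; fullness thus becomes linear algebra.\<close>

lemma torsion_fullI:
  assumes "\<And>\<xi> :: real^'n^'n \<Rightarrow> real. linear \<xi> \<Longrightarrow> (\<And>A. A \<in> lie_algebra K \<Longrightarrow> \<xi> A = 0) \<Longrightarrow>
      (\<And>A B. A \<in> lie_algebra U \<Longrightarrow> B \<in> lie_algebra U \<Longrightarrow> \<xi> (torsion A B) = 0) \<Longrightarrow>
      (\<And>A. A \<in> lie_algebra U \<Longrightarrow> \<xi> A = 0)"
  shows "A.torsion_full J"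
  unfolding A.torsion_full_def
proof (intro allI impI ballI)
  fix p f v assume p: "p \<in> M" and f: "f \<in> C" and v: "v \<in> tangent_space C p"
    and z: "\<forall>X Y. A.field X \<longrightarrow> A.field Y \<longrightarrow> A.nijenhuis J X Y p f = 0"
  obtain g where g: "g \<in> U" "p = \<pi> g" using p by (rule M_cases)
  obtain A where A: "A \<in> lie_algebra U" "v = tv g A" using v tangent_space_eq[OF g(1)] g(2) by blast
  obtain W F where F: "open W" "g \<in> W" "smooth_on W F" "\<And>x. x \<in> U \<Longrightarrow> x \<in> W \<Longrightarrow> f (\<pi> x) = F x"
    using C_extension[OF f g(1)] by blast
  define \<xi> where "\<xi> B = frechet_derivative F (at g) (g ** B)" for B
  have t\<xi>: "tv g B f = \<xi> B" if "B \<in> lie_algebra U" for B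
    unfolding \<xi>_def by (rule tv_eq[OF f F g(1) that])
  have "linear (frechet_derivative F (at g))"
    using smooth_on_has_derivative[OF F(3,2)] has_derivative_linear by blast
  then have "linear \<xi>" unfolding \<xi>_def
    by (intro linearI) (simp_all add: linear_add linear_cmul bounded_bilinear.add_right[OF bounded_bilinear_matrix_matrix_mult]
      bounded_bilinear.scaleR_right[OF bounded_bilinear_matrix_matrix_mult])
  moreover have "\<xi> B = 0" if "B \<in> lie_algebra K" for B using t\<xi>[OF lie_KU[OF that]] tv_K[OF g(1) that] by simp
  moreover have "\<xi> (torsion B D) = 0" if BD: "B \<in> lie_algebra U" "D \<in> lie_algebra U" for B D
  proof -
    obtain X Y where X: "A.field X" "A.field Y" "\<And>f. f \<in> C \<Longrightarrow> A.nijenhuis J X Y (\<pi> g) f = tv g (torsion B D) f"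
      by (rule nijenhuis_fundamental[OF g(1) BD]) (rule that)
    have "A.nijenhuis J X Y p f = 0" using z X(1,2) by blast
    then show ?thesis using X(3)[OF f] g(2) t\<xi>[OF torsion_mem[OF BD]] by simp
  qed
  ultimately have "\<xi> A = 0" using assms A(1) by blast
  then show "v f = 0" using t\<xi>[OF A(1)] A(2) by simp
qed

text \<open>Conversely every functional vanishing on \<open>lie_algebra K\<close> is the
  differential at the base point of some function: compose it with \<open>R\<close> from
  \<open>coset_projection\<close> and pull back along the orbit map.\<close>

lemma not_torsion_fullI:
  assumes \<xi>: "linear (\<xi> :: real^'n^'n \<Rightarrow> real)" "\<And>A. A \<in> lie_algebra K \<Longrightarrow> \<xi> A = 0"
      "\<And>A B. A \<in> lie_algebra U \<Longrightarrow> B \<in> lie_algebra U \<Longrightarrow> \<xi> (torsion A B) = 0"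
    and A: "A \<in> lie_algebra U" "\<xi> A \<noteq> 0"
  shows "\<not> A.torsion_full J"
proof
  assume t: "A.torsion_full J"
  obtain R where R: "linear R" "\<And>A. A \<in> lie_algebra U \<Longrightarrow> R (commutator A H0) \<in> lie_algebra U"
    "\<And>A. A \<in> lie_algebra U \<Longrightarrow> A - R (commutator A H0) \<in> lie_algebra K"
    by (rule coset_projection) (rule that)
  define f where "f = orbit_fn (\<lambda>y. \<xi> (R y))"
  have l: "linear (\<lambda>y. \<xi> (R y))" using linear_compose[OF R(1) \<xi>(1)] by (simp add: o_def)
  have f: "f \<in> C" unfolding f_def
    by (intro orbit_fn_mem smooth_on_bounded_linear l[unfolded linear_conv_bounded_linear])
  have tvf: "tv (mat 1) B f = \<xi> B" if B: "B \<in> lie_algebra U" for B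
  proof -
    have "tv (mat 1) B f = \<xi> (R (commutator B H0))"
      unfolding f_def using tv_orbit_fn[OF l U.one_mem B] by simp
    moreover have "\<xi> (B - R (commutator B H0)) = 0" by (rule \<xi>(2)[OF R(3)[OF B]])
    ultimately show ?thesis by (simp add: linear_diff[OF \<xi>(1)])
  qed
  have "A.nijenhuis J X Y (\<pi> (mat 1)) f = 0" if XY: "A.field X" "A.field Y" for X Y
  proof -
    obtain Xh Yh where h: "lifts X Xh" "lifts Y Yh" using lift_exists XY by blast
    have m: "Xh (mat 1) \<in> lie_algebra U" "Yh (mat 1) \<in> lie_algebra U" using h U.one_mem by (auto simp: lifts_def)
    show ?thesis using nijenhuis_lift[OF h U.one_mem f] tvf[OF torsion_mem[OF m]] \<xi>(3)[OF m] by simp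
  qed
  then have "\<forall>v\<in>tangent_space C (\<pi> (mat 1)). v f = 0"
    using t f \<pi>_mem[OF U.one_mem] unfolding A.torsion_full_def by blast
  then have "tv (mat 1) A f = 0" using tv_mem[OF U.one_mem A(1)] by blast
  then show False using tvf[OF A(1)] A(2) by simp
qed

end

section \<open>Joint eigenvectors and the invariant form\<close>

text \<open>A maximiser of the quotient \<open>B (A x) x / B x x\<close> on the unit sphere of
  \<open>N\<close> is an eigenvector, by the first-order condition. The ambient inner product
  supplies the compact sphere, self-adjointness refers to \<open>B\<close>.\<close>

lemma Rayleigh_eigenvector:
  fixes B :: "'a::euclidean_space \<Rightarrow> 'a \<Rightarrow> real"
  assumes B: "bilinear B" "\<And>x y. B x y = B y x"
    and N: "subspace N" "\<And>x. x \<in> N \<Longrightarrow> x \<noteq> 0 \<Longrightarrow> B x x > 0" "x1 \<in> N" "x1 \<noteq> 0"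
    and A: "linear A" "\<And>x. x \<in> N \<Longrightarrow> A x \<in> N" "\<And>x y. x \<in> N \<Longrightarrow> y \<in> N \<Longrightarrow> B (A x) y = B x (A y)"
  obtains x \<mu> where "x \<in> N" "x \<noteq> 0" "A x = \<mu> *\<^sub>R x"
proof -
  have bB: "bounded_bilinear B" using B(1) by (simp add: bilinear_conv_bounded_bilinear)
  have cA: "continuous_on S A" for S using A(1) by (simp add: linear_continuous_on linear_conv_bounded_linear)
  let ?S = "sphere 0 1 \<inter> N"
  have "compact ?S" using closed_subspace[OF N(1)] by (intro compact_Int_closed) auto
  moreover have "x1 /\<^sub>R norm x1 \<in> ?S" using N by (simp add: subspace_scale)
  then have "?S \<noteq> {}" by blast
  moreover have "continuous_on ?S (\<lambda>x. B (A x) x / B x x)"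
    by (intro continuous_intros bounded_bilinear.continuous_on[OF bB] cA) (use N(2) in force)
  ultimately have "\<exists>x\<in>?S. \<forall>y\<in>?S. B (A y) y / B y y \<le> B (A x) x / B x x" by (rule continuous_attains_sup)
  then obtain x where x: "x \<in> ?S" "\<And>y. y \<in> ?S \<Longrightarrow> B (A y) y / B y y \<le> B (A x) x / B x x" by blast
  define \<mu> where "\<mu> = B (A x) x / B x x"
  have xN: "x \<in> N" "x \<noteq> 0" using x(1) by auto
  note bl = bilinear_ladd[OF B(1)] bilinear_radd[OF B(1)] bilinear_lmul[OF B(1)] bilinear_rmul[OF B(1)]
    linear_add[OF A(1)] linear_cmul[OF A(1)]
  have q: "B (A y) y \<le> \<mu> * B y y" if y: "y \<in> N" for y
  proof (cases "y = 0")
    case True then show ?thesis using bilinear_lzero[OF B(1)] bilinear_rzero[OF B(1)] by simp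
  next
    case False
    let ?z = "y /\<^sub>R norm y"
    have "?z \<in> ?S" using y False N(1) by (simp add: subspace_scale)
    from x(2)[OF this] have "B (A y) y / B y y \<le> \<mu>"
      using False by (simp add: bl \<mu>_def)
    then show ?thesis using N(2)[OF y False] by (simp add: divide_le_eq)
  qed
  have orth: "B (A x) y - \<mu> * B x y = 0" if y: "y \<in> N" for y
  proof -
    define b where "b = B (A x) y - \<mu> * B x y"
    define c where "c = B (A y) y - \<mu> * B y y"
    have x0: "B (A x) x = \<mu> * B x x" using N(2)[OF xN] by (simp add: \<mu>_def)
    have sym: "B (A y) x = B (A x) y" using A(3)[OF y xN(1)] B(2) by metis
    have le: "2 * t * b + t\<^sup>2 * c \<le> 0" for t
    proof -
      have "x + t *\<^sub>R y \<in> N" using xN y N(1) by (intro subspace_add subspace_scale)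
      from q[OF this] show ?thesis
        unfolding b_def c_def using x0 sym B(2)[of y x] by (simp add: bl power2_eq_square algebra_simps)
    qed
    have c0: "c \<le> 0" using q[OF y] by (simp add: c_def)
    show ?thesis
    proof (rule ccontr)
      assume "B (A x) y - \<mu> * B x y \<noteq> 0"
      then have b: "b \<noteq> 0" by (simp add: b_def)
      \<comment> \<open>Chosen so that \<open>2 * t * b + t\<^sup>2 * c\<close> equals
        \<open>t\<^sup>2 * (2 - c)\<close>, which is positive since \<open>c \<le> 0\<close> and
        contradicts \<open>le\<close>.\<close>
      define t where "t = b / (1 - c)"
      have tb: "b = t * (1 - c)" "t \<noteq> 0" using c0 b by (auto simp: t_def)
      have "2 * t * b + t\<^sup>2 * c = t\<^sup>2 * (2 - c)" by (simp add: tb(1) power2_eq_square algebra_simps)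
      also have "\<dots> > 0" using c0 tb(2) by simp
      finally show False using le[of t] by simp
    qed
  qed
  have m: "A x - \<mu> *\<^sub>R x \<in> N" using A(2)[OF xN(1)] xN(1) N(1) by (intro subspace_diff subspace_scale)
  have "B (A x - \<mu> *\<^sub>R x) (A x - \<mu> *\<^sub>R x) = 0"
    using orth[OF m] by (simp add: bilinear_lsub[OF B(1)] bl)
  then have "A x - \<mu> *\<^sub>R x = 0" using N(2)[OF m] by force
  then show thesis using that xN by simp
qed

text \<open>The \<open>B\<close>-orthogonal complement \<open>N\<close> of the joint eigenvectors is
  invariant; if it were nonzero it would contain a joint eigenvector, which positivity of
  \<open>B\<close> forbids. It remains to decompose \<open>S\<close> into \<open>span E\<close> and
  this complement.\<close>

lemma joint_eigenvectors_span:
  fixes B :: "'a::euclidean_space \<Rightarrow> 'a \<Rightarrow> real"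
  assumes B: "bilinear B" "\<And>x y. B x y = B y x"
    and S: "subspace S" "\<And>x. x \<in> S \<Longrightarrow> x \<noteq> 0 \<Longrightarrow> B x x > 0"
    and F: "\<And>A. A \<in> F \<Longrightarrow> linear A" "\<And>A x. A \<in> F \<Longrightarrow> x \<in> S \<Longrightarrow> A x \<in> S"
      "\<And>A x y. A \<in> F \<Longrightarrow> x \<in> S \<Longrightarrow> y \<in> S \<Longrightarrow> B (A x) y = B x (A y)"
      "\<And>A A' x. A \<in> F \<Longrightarrow> A' \<in> F \<Longrightarrow> x \<in> S \<Longrightarrow> A (A' x) = A' (A x)"
  shows "S = span {x \<in> S. \<forall>A\<in>F. \<exists>\<mu>. A x = \<mu> *\<^sub>R x}"
proof -
  define E where "E = {x \<in> S. \<forall>A\<in>F. \<exists>\<mu>. A x = \<mu> *\<^sub>R x}"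
  have joint: "\<exists>x\<in>N. x \<noteq> 0 \<and> x \<in> E"
    if N: "subspace N" "N \<subseteq> S" "N \<noteq> {0}" "\<And>A x. A \<in> F \<Longrightarrow> x \<in> N \<Longrightarrow> A x \<in> N" for N
  proof -
    define P where "P N \<longleftrightarrow> subspace N \<and> N \<subseteq> S \<and> N \<noteq> {0} \<and> (\<forall>A\<in>F. \<forall>x\<in>N. A x \<in> N)" for N
    \<comment> \<open>On a nonzero invariant subspace of least dimension each operator of the family
      is a scalar, because its eigenspace is again invariant under the commuting family.\<close>
    have "\<exists>N'. (P N' \<and> N' \<subseteq> N) \<and> (\<forall>N''. P N'' \<and> N'' \<subseteq> N \<longrightarrow> dim N' \<le> dim N'')"
      using N by (intro ex_has_least_nat[where m = dim and k = N]) (auto simp: P_def)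
    then obtain N' where N': "P N'" "N' \<subseteq> N" "\<And>N''. P N'' \<Longrightarrow> N'' \<subseteq> N \<Longrightarrow> dim N' \<le> dim N''" by blast
    obtain x1 where x1: "x1 \<in> N'" "x1 \<noteq> 0" using N'(1) subspace_0 unfolding P_def by blast
    have "\<exists>\<mu>. A x1 = \<mu> *\<^sub>R x1" if A: "A \<in> F" for A
    proof -
      have s: "subspace N'" "N' \<subseteq> S" "\<And>x. x \<in> N' \<Longrightarrow> A x \<in> N'" using N'(1) A by (auto simp: P_def)
      obtain x \<mu> where x: "x \<in> N'" "x \<noteq> 0" "A x = \<mu> *\<^sub>R x"
        by (rule Rayleigh_eigenvector[OF B s(1) _ x1 F(1)[OF A] s(3), of thesis]) (use s S(2) F(3)[OF A subsetD[OF s(2)] subsetD[OF s(2)]] in auto)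
      define N2 where "N2 = {x \<in> N'. A x = \<mu> *\<^sub>R x}"
      have "subspace N2" unfolding N2_def using s(1) F(1)[OF A]
        by (auto simp: subspace_def linear_add linear_cmul linear_0 scaleR_add_right)
      moreover have "A' y \<in> N2" if "A' \<in> F" "y \<in> N2" for A' y
        using that N'(1) F(4)[OF A that(1), of y] s(2) linear_cmul[OF F(1)[OF that(1)]] by (auto simp: N2_def P_def)
      moreover have "N2 \<noteq> {0}" "N2 \<subseteq> N'" using x by (auto simp: N2_def)
      ultimately have "P N2" using s(2) by (auto simp: P_def)
      then have "dim N' \<le> dim N2" using N'(2,3) \<open>N2 \<subseteq> N'\<close> by blast
      then have "N2 = N'" using subspace_dim_equal[OF \<open>subspace N2\<close> s(1) \<open>N2 \<subseteq> N'\<close>] by simp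
      then show ?thesis using x1(1) by (auto simp: N2_def)
    qed
    then show ?thesis using x1 N'(1,2) by (auto simp: E_def P_def)
  qed
  have ES: "span E \<subseteq> S" using S(1) by (intro span_minimal) (auto simp: E_def)
  define N where "N = {x \<in> S. \<forall>y\<in>E. B x y = 0}"
  have sN: "subspace N" unfolding N_def using S(1)
    by (auto simp: subspace_def bilinear_ladd[OF B(1)] bilinear_lmul[OF B(1)] bilinear_lzero[OF B(1)])
  have "A x \<in> N" if A: "A \<in> F" and x: "x \<in> N" for A x
  proof -
    have "B (A x) y = 0" if y: "y \<in> E" for y
    proof -
      obtain \<mu> where "A y = \<mu> *\<^sub>R y" using y A by (auto simp: E_def)
      then show ?thesis using F(3)[OF A, of x y] x y by (auto simp: N_def E_def bilinear_rmul[OF B(1)])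
    qed
    then show ?thesis using F(2)[OF A] x by (auto simp: N_def)
  qed
  then have N0: "N = {0}"
  proof -
    assume inv: "\<And>A x. A \<in> F \<Longrightarrow> x \<in> N \<Longrightarrow> A x \<in> N"
    show ?thesis
    proof (rule ccontr)
      assume "N \<noteq> {0}"
      moreover have "N \<subseteq> S" by (auto simp: N_def)
      ultimately have "\<exists>x\<in>N. x \<noteq> 0 \<and> x \<in> E" by (intro joint[OF sN]) (auto intro: inv)
      then obtain x where "x \<in> N" "x \<noteq> 0" "x \<in> E" by blast
      then show False using S(2)[of x] by (auto simp: N_def)
    qed
  qed
  obtain b where b: "b \<subseteq> span E" "independent b" "span b = span E"
    using basis_exists[of "span E"] span_span by (metis span_eq subset_antisym span_minimal subspace_span)
  have fb: "finite b" using b(2) by (rule independent_imp_finite)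
  \<comment> \<open>Gram operator of \<open>B\<close> with respect to a basis of
    \<open>span E\<close>. By positivity it is injective on \<open>span E\<close>, hence maps it
    onto itself; solving \<open>T x = T v\<close> gives the \<open>B\<close>-orthogonal projection
    \<open>v\<close> of \<open>x\<close>.\<close>
  define T where "T x = (\<Sum>c\<in>b. B x c *\<^sub>R c)" for x
  have lT: "linear T" unfolding T_def
    by (intro linear_compose_sum ballI linearI) (auto simp: bilinear_ladd[OF B(1)] bilinear_lmul[OF B(1)] scaleR_add_left)
  have T0: "B x y = 0" if "T x = 0" "y \<in> span E" for x y
  proof -
    have "B x c = 0" if "c \<in> b" for c
      using independentD[OF b(2) fb subset_refl _ that] \<open>T x = 0\<close> by (simp add: T_def)
    then have "b \<subseteq> {y. B x y = 0}" by blast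
    moreover have "subspace {y. B x y = 0}"
      by (auto simp: subspace_def bilinear_radd[OF B(1)] bilinear_rmul[OF B(1)] bilinear_rzero[OF B(1)])
    ultimately show ?thesis using span_minimal b(3) that(2) by blast
  qed
  have inj: "inj_on T (span E)"
  proof (rule linear_injective_on_subspace_0[THEN iffD2, OF lT subspace_span], intro ballI impI)
    fix x assume x: "x \<in> span E" "T x = 0"
    then show "x = 0" using T0[OF x(2,1)] S(2)[of x] ES by force
  qed
  have Tm: "T x \<in> span E" for x
    unfolding T_def using b(1) by (intro subspace_sum subspace_scale subspace_span) auto
  then have "T ` span E \<subseteq> span E" by blast
  moreover have "dim (T ` span E) = dim (span E)" using dim_image_eq[OF lT, of "span E"] inj by (simp add: span_span)
  ultimately have img: "T ` span E = span E"
    using subspace_dim_equal[OF linear_subspace_image[OF lT subspace_span] subspace_span] by simp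
  have "S \<subseteq> span E"
  proof
    fix x assume x: "x \<in> S"
    obtain v where v: "v \<in> span E" "T x = T v" using img Tm[of x] by blast
    have "T (x - v) = 0" using v(2) by (simp add: linear_diff[OF lT])
    then have "B (x - v) y = 0" if "y \<in> E" for y by (rule T0) (rule span_base[OF that])
    then have "x - v \<in> N" using x v(1) ES S(1) by (auto simp: N_def intro!: subspace_diff)
    then show "x \<in> span E" using N0 v(1) by simp
  qed
  then show ?thesis using ES unfolding E_def by blast
qed

section \<open>Invariant forms and the sign of the trace form\<close>

lemma trace_linear:
  fixes A B :: "'a::comm_ring_1^'n^'n"
  shows "trace (A + B) = trace A + trace B" "trace (A - B) = trace A - trace B" "trace (- A) = - trace A" "trace 0 = (0 :: 'a)"
  by (simp_all add: trace_def sum.distrib sum_subtractf sum_negf)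

lemma trace_commute: "trace (A ** B) = trace (B ** (A :: 'a::comm_ring_1^'n^'n))"
  by (rule trace_mul_sym)

text \<open>Among the points of the convex hull of the orbit of the identity, one that minimizes the largest
  norm along its orbit is unique by strict convexity of the Euclidean norm, hence fixed.\<close>

lemma (in compact_matrix_group) invariant_form:
  obtains P where "P \<in> convex hull ((\<lambda>g. g ** transpose g) ` U)" "\<And>g. g \<in> U \<Longrightarrow> g ** P ** transpose g = P"
proof -
  let ?O = "(\<lambda>g. g ** transpose g) ` U"
  let ?a = "\<lambda>(g :: real^'n^'n) (P :: real^'n^'n). g ** P ** transpose g"
  have bt: "bounded_linear (transpose :: real^'n^'n \<Rightarrow> real^'n^'n)"
    by (intro linear_conv_bounded_linear[THEN iffD1] linearI) (auto simp: transpose_def vec_eq_iff)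
  have ct [continuous_intros]: "continuous_on S (\<lambda>x. transpose (f x))" if "continuous_on S f" for S and f :: "'b::topological_space \<Rightarrow> real^'n^'n"
    by (rule bounded_linear.continuous_on[OF bt that])
  define Q where "Q = convex hull ?O"
  have cQ: "compact Q" unfolding Q_def
    by (intro compact_convex_hull compact_continuous_image compact continuous_intros)
  have l: "linear (?a g)" for g
    by (intro linearI) (simp_all add: bounded_bilinear.add_left[OF bounded_bilinear_matrix_matrix_mult]
      bounded_bilinear.add_right[OF bounded_bilinear_matrix_matrix_mult] bounded_bilinear.scaleR_left[OF bounded_bilinear_matrix_matrix_mult]
      bounded_bilinear.scaleR_right[OF bounded_bilinear_matrix_matrix_mult])
  have aQ: "?a g P \<in> Q" if g: "g \<in> U" and P: "P \<in> Q" for g P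
  proof -
    have "?a g ` ?O \<subseteq> ?O"
    proof safe
      fix h assume "h \<in> U"
      have "?a g (h ** transpose h) = (g ** h) ** transpose (g ** h)"
        by (simp add: matrix_transpose_mul matrix_mul_assoc)
      then show "?a g (h ** transpose h) \<in> ?O" using mult_mem[OF g \<open>h \<in> U\<close>] by blast
    qed
    then have "?a g ` Q \<subseteq> Q" unfolding Q_def convex_hull_linear_image[OF l] by (rule hull_mono)
    then show ?thesis using P by blast
  qed
  have "\<exists>g\<in>U. \<forall>h\<in>U. norm (?a h P) \<le> norm (?a g P)" for P
    by (rule continuous_attains_sup[OF compact]) (use one_mem in \<open>auto intro!: continuous_intros\<close>)
  then obtain \<gamma> where \<gamma>: "\<And>P. \<gamma> P \<in> U" "\<And>P h. h \<in> U \<Longrightarrow> norm (?a h P) \<le> norm (?a (\<gamma> P) P)" by metis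
  define F where "F P = norm (?a (\<gamma> P) P)" for P
  obtain k where k: "\<forall>A B. norm ((A :: real^'n^'n) ** (B :: real^'n^'n)) \<le> norm A * norm B * k" "k > 0"
    using bounded_bilinear.pos_bounded[OF bounded_bilinear_matrix_matrix_mult] by blast
  have "bounded U" using compact compact_imp_bounded by blast
  then obtain b where b: "\<And>g. g \<in> U \<Longrightarrow> norm g \<le> b" unfolding bounded_iff by blast
  have "compact (transpose ` U)" by (intro compact_continuous_image compact continuous_intros)
  then obtain b' where b': "\<And>g. g \<in> U \<Longrightarrow> norm (transpose g) \<le> b'"
    using compact_imp_bounded[of "transpose ` U"] unfolding bounded_iff by auto
  define c where "c = b * k * b' * k"
  have b0: "0 \<le> b" "0 \<le> b'" using b[OF one_mem] b'[OF one_mem] norm_ge_zero order_trans by blast+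
  have c: "norm (?a g P) \<le> c * norm P" if g: "g \<in> U" for g P
  proof -
    have "norm (?a g P) \<le> norm (g ** P) * norm (transpose g) * k" using k(1) by blast
    also have "\<dots> \<le> (norm g * norm P * k) * norm (transpose g) * k"
      using k by (intro mult_right_mono) auto
    also have "\<dots> \<le> (b * norm P * k) * b' * k"
      using b[OF g] b'[OF g] b0 k(2) by (intro mult_right_mono mult_mono) auto
    finally show ?thesis by (simp add: c_def mult_ac)
  qed
  have c0: "c \<ge> 0" using b0 k(2) by (simp add: c_def)
  have Flip: "F P \<le> F P' + c * norm (P - P')" for P P'
  proof -
    have "?a (\<gamma> P) P = ?a (\<gamma> P) P' + ?a (\<gamma> P) (P - P')"
      using linear_add[OF l, of "\<gamma> P" P' "P - P'"] by simp
    then have "F P \<le> norm (?a (\<gamma> P) P') + norm (?a (\<gamma> P) (P - P'))"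
      unfolding F_def by (metis norm_triangle_ineq)
    also have "\<dots> \<le> F P' + c * norm (P - P')"
      unfolding F_def using \<gamma> c by (intro add_mono) auto
    finally show ?thesis .
  qed
  have "continuous_on Q F"
  proof (rule continuous_onI)
    fix P e :: real and x assume "x \<in> Q" "0 < e"
    have "dist (F x') (F x) \<le> e" if "dist x' x < e / (c + 1)" for x'
    proof -
      have "c * norm (x' - x) \<le> (c + 1) * norm (x' - x)" by (simp add: mult_right_mono)
      also have "\<dots> < e" using that c0 by (simp add: dist_norm pos_less_divide_eq mult.commute)
      finally show ?thesis using Flip[of x' x] Flip[of x x'] by (simp add: dist_real_def norm_minus_commute abs_le_iff)
    qed
    moreover have "e / (c + 1) > 0" using \<open>0 < e\<close> c0 by simp
    ultimately show "\<exists>d>0. \<forall>x'\<in>Q. dist x' x < d \<longrightarrow> dist (F x') (F x) \<le> e" by blast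
  qed
  moreover have "Q \<noteq> {}" using one_mem unfolding Q_def by auto
  ultimately obtain P where P: "P \<in> Q" "\<And>P'. P' \<in> Q \<Longrightarrow> F P \<le> F P'"
    using continuous_attains_inf[OF cQ] by metis
  have "?a h P = P" if h: "h \<in> U" for h
  proof -
    let ?P1 = "?a h P"
    define M where "M = (1/2) *\<^sub>R (P + ?P1)"
    have "M \<in> Q"
    proof -
      have "convex Q" unfolding Q_def by (rule convex_convex_hull)
      then have "(1/2) *\<^sub>R P + (1/2) *\<^sub>R ?P1 \<in> Q" using P(1) aQ[OF h P(1)] by (intro convexD) auto
      then show ?thesis by (simp add: M_def scaleR_add_right)
    qed
    then have FM: "F P \<le> F M" by (rule P(2))
    let ?g = "\<gamma> M"
    let ?u = "?a ?g P" and ?v = "?a ?g ?P1"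
    have u: "norm ?u \<le> F P" unfolding F_def by (rule \<gamma>(2)[OF \<gamma>(1)])
    have "?v = ?a (?g ** h) P" by (simp add: matrix_transpose_mul matrix_mul_assoc)
    then have v: "norm ?v \<le> F P" unfolding F_def using \<gamma>(2)[OF mult_mem[OF \<gamma>(1) h]] by metis
    have "F M = norm ((1/2) *\<^sub>R (?u + ?v))"
      unfolding F_def M_def linear_cmul[OF l] linear_add[OF l] ..
    then have m: "2 * F P \<le> norm (?u + ?v)" using FM by simp
    \<comment> \<open>Parallelogram law: \<open>?u\<close> and \<open>?v\<close> have norm at most
      \<open>F P\<close>, while their sum has norm at least \<open>2 * F P\<close> by minimality at
      the midpoint, so they coincide.\<close>
    have "(norm (?u + ?v))\<^sup>2 + (norm (?u - ?v))\<^sup>2 = 2 * (norm ?u)\<^sup>2 + 2 * (norm ?v)\<^sup>2"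
      by (simp add: power2_norm_eq_inner inner_add inner_diff inner_commute)
    moreover have F0: "F P \<ge> 0" by (simp add: F_def)
    have "(norm ?u)\<^sup>2 \<le> (F P)\<^sup>2" "(norm ?v)\<^sup>2 \<le> (F P)\<^sup>2"
      using u v by (auto intro!: power_mono)
    moreover have "(2 * F P)\<^sup>2 \<le> (norm (?u + ?v))\<^sup>2" by (rule power_mono[OF m]) (use F0 in simp)
    moreover have "(2 * F P)\<^sup>2 = 4 * (F P)\<^sup>2" by (simp add: power_mult_distrib)
    ultimately have "(norm (?u - ?v))\<^sup>2 \<le> 0" by linarith
    then have "?u = ?v" by simp
    then have "matrix_inv ?g ** ?u ** matrix_inv (transpose ?g) = matrix_inv ?g ** ?v ** matrix_inv (transpose ?g)" by simp
    moreover have "matrix_inv ?g ** ?a ?g Z ** matrix_inv (transpose ?g) = Z" for Z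
    proof -
      have i: "invertible ?g" "invertible (transpose ?g)"
        using invertible_mem[OF \<gamma>(1)] transpose_invertible by auto
      show ?thesis using matrix_inv_cancel[OF i(1)] matrix_inv_cancel[OF i(2)]
        by (simp add: matrix_mul_assoc[symmetric] matrix_inv_right[OF i(2)])
    qed
    ultimately show ?thesis by metis
  qed
  then show thesis using that P(1) unfolding Q_def by blast
qed

text \<open>Differentiating the invariance of \<open>P\<close> gives \<open>X P = - P X^T\<close>,
  hence \<open>trace (X X) = - trace (X P X^T P^-1)\<close>, which is negative because
  \<open>P\<close> is positive definite.\<close>

lemma (in compact_matrix_group) trace_square_neg:
  assumes X: "X \<in> lie_algebra U" "X \<noteq> 0"
  shows "trace (X ** X) < 0"
proof -
  obtain P where P: "P \<in> convex hull ((\<lambda>g. g ** transpose g) ` U)" "\<And>g. g \<in> U \<Longrightarrow> g ** P ** transpose g = P"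
    by (rule invariant_form) (rule that)
  have bt: "bounded_linear (transpose :: real^'n^'n \<Rightarrow> real^'n^'n)"
    by (intro linear_conv_bounded_linear[THEN iffD1] linearI) (auto simp: transpose_def vec_eq_iff)
  have skew: "X ** P = - (P ** transpose X)"
  proof -
    note d = mexp_has_vector_derivative[of X 0]
    have "((\<lambda>t. (mexp (t *\<^sub>R X) ** P) ** transpose (mexp (t *\<^sub>R X))) has_vector_derivative
        (mexp (0 *\<^sub>R X) ** P) ** transpose (X ** mexp (0 *\<^sub>R X)) + ((X ** mexp (0 *\<^sub>R X)) ** P) ** transpose (mexp (0 *\<^sub>R X))) (at 0)"
      by (intro bounded_bilinear.has_vector_derivative[OF bounded_bilinear_matrix_matrix_mult]
        bounded_linear.has_vector_derivative[OF bt] d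
        bounded_linear.has_vector_derivative[OF bounded_bilinear.bounded_linear_left[OF bounded_bilinear_matrix_matrix_mult]])
    then have "((\<lambda>t. P) has_vector_derivative P ** transpose X + X ** P) (at (0::real))"
      using P(2)[OF mexp_mem[OF X(1)]] by simp
    then have "P ** transpose X + X ** P = 0"
      using has_vector_derivative_const vector_derivative_unique_at by blast
    then show ?thesis by (simp add: eq_neg_iff_add_eq_0 add.commute)
  qed
  define q where "q R x = x \<bullet> (R *v x)" for R :: "real^'n^'n" and x
  have lq: "linear (\<lambda>R. q R x)" for x unfolding q_def
    by (intro linearI) (simp_all add: matrix_vector_mult_add_rdistrib inner_add_right scaleR_matrix_vector_assoc[symmetric])
  \<comment> \<open>\<open>P\<close> is known only as a point of a convex hull; a linear functional
    is positive at \<open>P\<close> as soon as it is positive on all products of \<open>g\<close>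
    with its transpose.\<close>
  have hull: "\<phi> P > 0" if "linear \<phi>" "\<And>g. g \<in> U \<Longrightarrow> \<phi> (g ** transpose g) > 0" for \<phi> :: "real^'n^'n \<Rightarrow> real"
  proof -
    have "convex (\<phi> -` {0<..})" using that(1) by (intro convex_linear_vimage) auto
    moreover have "(\<lambda>g. g ** transpose g) ` U \<subseteq> \<phi> -` {0<..}" using that(2) by auto
    ultimately show ?thesis using hull_minimal P(1) by blast
  qed
  have Pq: "q P x > 0" if "x \<noteq> 0" for x
  proof (rule hull[OF lq])
    fix g assume g: "g \<in> U"
    have "invertible (transpose g)" using invertible_mem[OF g] transpose_invertible by blast
    then have "transpose g *v x \<noteq> 0"
      using that by (metis matrix_inv_left matrix_vector_mul_assoc matrix_vector_mul_lid matrix_vector_mult_0_right)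
    moreover have "q (g ** transpose g) x = (transpose g *v x) \<bullet> (transpose g *v x)"
      unfolding q_def by (simp only: matrix_vector_mul_assoc[symmetric] dot_lmul_matrix[symmetric] transpose_matrix_vector)
    ultimately show "q (g ** transpose g) x > 0" by simp
  qed
  have iP: "invertible P"
  proof -
    have "x = 0" if "P *v x = 0" for x using Pq[of x] that by (force simp: q_def)
    then have "\<exists>B. B ** P = mat 1" using matrix_left_invertible_ker by blast
    then show ?thesis using matrix_left_right_inverse invertible_def by metis
  qed
  define R where "R = matrix_inv P"
  have Rq: "q R x > 0" if "x \<noteq> 0" for x
  proof -
    have x: "P *v (R *v x) = x" by (simp add: R_def matrix_vector_mul_assoc matrix_inv_right[OF iP])
    then have "R *v x \<noteq> 0" using that by (metis matrix_vector_mult_0_right)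
    from Pq[OF this] show ?thesis by (simp add: q_def x inner_commute)
  qed
  have tr: "trace (transpose Y ** R ** Y) = (\<Sum>i\<in>UNIV. q R (column i Y))" for Y :: "real^'n^'n"
  proof -
    have "(transpose Y ** R ** Y) $ i $ i = q R (column i Y)" for i
    proof -
      have "(transpose Y ** R ** Y) $ i $ i = (transpose Y ** (R ** Y)) $ i $ i" by (simp add: matrix_mul_assoc)
      also have "\<dots> = (\<Sum>k\<in>UNIV. Y $ k $ i * (\<Sum>j\<in>UNIV. R $ k $ j * Y $ j $ i))"
        by (simp add: matrix_matrix_mult_def transpose_def)
      also have "\<dots> = q R (column i Y)"
        by (simp add: q_def inner_vec_def matrix_vector_mult_def column_def)
      finally show ?thesis .
    qed
    then show ?thesis by (simp add: trace_def)
  qed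
  define \<phi> where "\<phi> Z = trace (X ** Z ** transpose X ** R)" for Z
  have "\<phi> P > 0"
  proof (rule hull)
    show "linear \<phi>" unfolding \<phi>_def
      by (intro linearI) (simp_all add: bounded_bilinear.add_left[OF bounded_bilinear_matrix_matrix_mult]
        bounded_bilinear.add_right[OF bounded_bilinear_matrix_matrix_mult] bounded_bilinear.scaleR_left[OF bounded_bilinear_matrix_matrix_mult]
        bounded_bilinear.scaleR_right[OF bounded_bilinear_matrix_matrix_mult] trace_linear, simp add: trace_def sum_distrib_left)
    fix g assume g: "g \<in> U"
    let ?Y = "X ** g"
    have "?Y \<noteq> 0"
    proof
      assume "?Y = 0"
      then have "?Y ** matrix_inv g = 0" by simp
      then show False using X(2) matrix_inv_cancel(3)[OF invertible_mem[OF g], of X] by simp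
    qed
    then obtain i where i: "column i ?Y \<noteq> 0" by (auto simp: vec_eq_iff column_def)
    have "\<phi> (g ** transpose g) = trace (?Y ** (transpose ?Y ** R))"
      by (simp add: \<phi>_def matrix_transpose_mul matrix_mul_assoc)
    also have "\<dots> = trace (transpose ?Y ** R ** ?Y)" by (rule trace_commute)
    also have "\<dots> > 0" unfolding tr
    proof (rule sum_pos2[of _ i])
      show "0 \<le> q R (column j ?Y)" for j using Rq[of "column j ?Y"] by (cases "column j ?Y = 0") (auto simp: q_def)
    qed (use Rq i in auto)
    finally show "\<phi> (g ** transpose g) > 0" .
  qed
  moreover have "\<phi> P = - trace (X ** X)"
  proof -
    have "X ** (X ** P) = - (X ** (P ** transpose X))"
      unfolding skew by (rule bounded_bilinear.minus_right[OF bounded_bilinear_matrix_matrix_mult])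
    then have "X ** P ** transpose X = - (X ** (X ** P))" by (simp add: matrix_mul_assoc)
    then have "X ** P ** transpose X ** R = - (X ** (X ** P) ** R)"
      by (simp add: bounded_bilinear.minus_left[OF bounded_bilinear_matrix_matrix_mult])
    also have "X ** (X ** P) ** R = X ** X"
      using matrix_inv_cancel(3)[OF iP, of "X ** X"] by (simp add: R_def matrix_mul_assoc)
    finally show ?thesis by (simp add: \<phi>_def trace_linear)
  qed
  ultimately show ?thesis by simp
qed

section \<open>Root spaces\<close>

text \<open>The operation \<open>*\<^sub>R\<close> is the real scalar action on complex matrices;
  \<open>cs\<close> is the complex one, \<open>cnjM\<close> the conjugation with respect to the real
  form, and \<open>cof\<close> the inclusion of real matrices.\<close>

definition cs :: "complex \<Rightarrow> complex^'n^'n \<Rightarrow> complex^'n^'n" where "cs c = map_matrix ((*) c)"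
definition cnjM :: "complex^'n^'n \<Rightarrow> complex^'n^'n" where "cnjM = map_matrix cnj"
definition cof :: "real^'n^'n \<Rightarrow> complex^'n^'n" where "cof = map_matrix complex_of_real"

lemma cs_nth [simp]: "cs c Z $ i $ j = c * Z $ i $ j"
  and cnjM_nth [simp]: "cnjM Z $ i $ j = cnj (Z $ i $ j)"
  and cof_nth [simp]: "cof X $ i $ j = complex_of_real (X $ i $ j)"
  by (simp_all add: cs_def cnjM_def cof_def map_matrix_def)

lemma cs_simps: "cs c (A + B) = cs c A + cs c B" "cs c (A - B) = cs c A - cs c B" "cs c (- A) = - cs c A" "cs c 0 = 0"
  "cs a (cs b Z) = cs (a * b) Z" "cs 1 Z = Z" "cs 0 Z = 0" "cs (-1) Z = - Z" "r *\<^sub>R Z = cs (of_real r) Z"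
  by (simp_all add: vec_eq_iff algebra_simps, simp_all add: scaleR_conv_of_real)

lemma cs_add_left: "cs (a + b) Z = cs a Z + cs b Z" "cs (a - b) Z = cs a Z - cs b Z" "cs (- a) Z = - cs a Z"
  by (simp_all add: vec_eq_iff algebra_simps)

lemma cs_eq_0_iff: "cs c Z = 0 \<longleftrightarrow> c = 0 \<or> Z = 0"
  by (auto simp: vec_eq_iff)

lemma cs_inject: "Z \<noteq> 0 \<Longrightarrow> cs a Z = cs b Z \<Longrightarrow> a = b"
  by (auto simp: vec_eq_iff)

lemma mmult_distrib:
  fixes A B C :: "'a::comm_ring_1^'n^'n"
  shows "(A + B) ** C = A ** C + B ** C" "A ** (B + C) = A ** B + A ** C" "(A - B) ** C = A ** C - B ** C"
    "A ** (B - C) = A ** B - A ** C" "(- A) ** B = - (A ** B)" "A ** (- B) = - (A ** B)"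
  by (simp_all add: matrix_matrix_mult_def vec_eq_iff sum.distrib sum_subtractf sum_negf algebra_simps)

lemma cs_mmult: "cs c A ** B = cs c (A ** B)" "A ** cs c B = cs c (A ** B)"
  by (simp_all add: matrix_matrix_mult_def vec_eq_iff sum_distrib_left mult_ac)

lemma cs_trace: "trace (cs c A) = c * trace A"
  by (simp add: trace_def sum_distrib_left)

lemma cnjM_simps: "cnjM (A + B) = cnjM A + cnjM B" "cnjM (A - B) = cnjM A - cnjM B" "cnjM (- A) = - cnjM A" "cnjM 0 = 0"
  "cnjM (cnjM A) = A" "cnjM (cs c A) = cs (cnj c) (cnjM A)" "cnjM (A ** B) = cnjM A ** cnjM B" "cnjM (cof X) = cof X"
  by (simp_all add: matrix_matrix_mult_def vec_eq_iff)

lemma cnjM_trace: "trace (cnjM A) = cnj (trace A)" by (simp add: trace_def)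

lemma cof_simps: "cof (A + B) = cof A + cof B" "cof (A - B) = cof A - cof B" "cof (- A) = - cof A" "cof 0 = 0"
  "cof (A ** B) = cof A ** cof B" "cof (r *\<^sub>R A) = cs (of_real r) (cof A)" "trace (cof A) = of_real (trace A)"
  by (simp_all add: matrix_matrix_mult_def vec_eq_iff trace_def)

lemma commutator_simps:
  fixes A B C :: "'a::comm_ring_1^'n^'n"
  shows "commutator (A + B) C = commutator A C + commutator B C" "commutator A (B + C) = commutator A B + commutator A C"
    "commutator (A - B) C = commutator A C - commutator B C" "commutator A (B - C) = commutator A B - commutator A C"
    "commutator (- A) B = - commutator A B" "commutator A (- B) = - commutator A B" "commutator A 0 = 0" "commutator 0 B = 0"
    "commutator A A = 0"
  by (simp_all add: commutator_def mmult_distrib)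

lemma commutator_anti: "commutator A B = - commutator B (A :: 'a::comm_ring_1^'n^'n)"
  by (simp add: commutator_def)

lemma commutator_cs: "commutator (cs c A) B = cs c (commutator A B)" "commutator A (cs c B) = cs c (commutator A B)"
  by (simp_all add: commutator_def cs_mmult cs_simps)

lemma commutator_cnjM: "cnjM (commutator A B) = commutator (cnjM A) (cnjM B)"
  by (simp add: commutator_def cnjM_simps)

lemma commutator_cof: "cof (commutator A B) = commutator (cof A) (cof B)"
  by (simp add: commutator_def cof_simps)

lemma jacobi:
  fixes A B C :: "'a::comm_ring_1^'n^'n"
  shows "commutator A (commutator B C) = commutator (commutator A B) C + commutator B (commutator A C)"
  by (simp add: commutator_def mmult_distrib matrix_mul_assoc)

lemma trace_commutator: "trace (commutator A B ** C) = - trace (B ** commutator A (C :: 'a::comm_ring_1^'n^'n))"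
proof -
  have "trace (A ** B ** C) = trace (B ** C ** A)" by (metis matrix_mul_assoc trace_commute)
  then show ?thesis by (simp add: commutator_def mmult_distrib trace_linear matrix_mul_assoc)
qed

section \<open>Complexified Lie algebras\<close>

lemma cof_decomp_unique:
  assumes "cof X + cs \<i> (cof Y) = cof X' + cs \<i> (cof Y')" shows "X = X'" "Y = Y'"
  using assms by (auto simp: vec_eq_iff complex_eq_iff)

lemma complexification_iff:
  fixes L :: "(real^'n^'n) set"
  shows "Z \<in> complexification L \<longleftrightarrow> (\<exists>X\<in>L. \<exists>Y\<in>L. Z = cof X + cs \<i> (cof Y))"
proof -
  have "(\<chi> i j. Complex (X $ i $ j) (Y $ i $ j)) = cof X + cs \<i> (cof Y)" for X Y :: "real^'n^'n"
    by (simp add: vec_eq_iff complex_eq_iff)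
  then have "complexification L = {cof X + cs \<i> (cof Y) | X Y. X \<in> L \<and> Y \<in> L}" by (simp add: complexification_def)
  then show ?thesis by blast
qed

lemma complexificationI: "X \<in> L \<Longrightarrow> Y \<in> L \<Longrightarrow> Z = cof X + cs \<i> (cof Y) \<Longrightarrow> Z \<in> complexification L"
  by (subst complexification_iff) (rule bexI, rule bexI)

lemma complexificationE:
  assumes "Z \<in> complexification L" obtains X Y where "X \<in> L" "Y \<in> L" "Z = cof X + cs \<i> (cof Y)"
  using assms complexification_iff by metis

lemma cof_mem_complexification:
  assumes "subspace L" shows "cof X \<in> complexification L \<longleftrightarrow> X \<in> L"
proof
  assume "cof X \<in> complexification L"
  then obtain X' Y' where "X' \<in> L" "cof X = cof X' + cs \<i> (cof Y')" by (rule complexificationE)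
  then show "X \<in> L" using cof_decomp_unique(1)[of X 0 X' Y'] by (simp add: cof_simps cs_simps)
next
  assume "X \<in> L"
  moreover have "cof X = cof X + cs \<i> (cof 0)" by (simp add: cof_simps cs_simps)
  ultimately show "cof X \<in> complexification L" using subspace_0[OF assms] unfolding complexification_iff by (intro bexI[of _ X] bexI[of _ 0])
qed

lemma complexification_closed:
  assumes L: "subspace L" and Z: "Z \<in> complexification L"
  shows "W \<in> complexification L \<Longrightarrow> Z + W \<in> complexification L" "cs c Z \<in> complexification L" "cnjM Z \<in> complexification L"
proof -
  obtain X Y where X: "X \<in> L" "Y \<in> L" "Z = cof X + cs \<i> (cof Y)" using Z by (rule complexificationE)
  show "Z + W \<in> complexification L" if WL: "W \<in> complexification L"
  proof -
    obtain X' Y' where X': "X' \<in> L" "Y' \<in> L" "W = cof X' + cs \<i> (cof Y')" using WL by (rule complexificationE)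
    have "Z + W = cof (X + X') + cs \<i> (cof (Y + Y'))" using X X' by (simp add: cof_simps cs_simps)
    then show ?thesis by (rule complexificationI[rotated 2]) (intro subspace_add[OF L] X X')+
  qed
  have "cs c Z = cof (Re c *\<^sub>R X - Im c *\<^sub>R Y) + cs \<i> (cof (Im c *\<^sub>R X + Re c *\<^sub>R Y))"
    using X by (simp add: vec_eq_iff complex_eq_iff)
  then show "cs c Z \<in> complexification L"
    by (rule complexificationI[rotated 2]) (intro subspace_add[OF L] subspace_diff[OF L] subspace_scale[OF L] X)+
  have "cnjM Z = cof X + cs \<i> (cof (- Y))" using X by (simp add: vec_eq_iff complex_eq_iff)
  then show "cnjM Z \<in> complexification L" by (rule complexificationI[rotated 2]) (intro subspace_neg[OF L] X)+
qed

lemma subspace_complexification: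
  assumes "subspace L" shows "subspace (complexification L)"
proof (rule subspaceI)
  show "0 \<in> complexification L" using cof_mem_complexification[OF assms, of 0] subspace_0[OF assms] by (simp add: cof_simps)
qed (use complexification_closed[OF assms] in \<open>auto simp: cs_simps(9)\<close>)

lemma complexification_commutator:
  assumes L: "subspace L" and br: "\<And>X Y. X \<in> L \<Longrightarrow> Y \<in> L \<Longrightarrow> commutator X Y \<in> L"
    and Z: "Z \<in> complexification L" "W \<in> complexification L"
  shows "commutator Z W \<in> complexification L"
proof -
  obtain X Y where X: "X \<in> L" "Y \<in> L" "Z = cof X + cs \<i> (cof Y)" using Z(1) by (rule complexificationE)
  obtain X' Y' where X': "X' \<in> L" "Y' \<in> L" "W = cof X' + cs \<i> (cof Y')" using Z(2) by (rule complexificationE)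
  have "commutator Z W = cof (commutator X X' - commutator Y Y') + cs \<i> (cof (commutator X Y' + commutator Y X'))"
    unfolding X(3) X'(3) by (simp add: commutator_simps commutator_cs commutator_cof cof_simps cs_simps)
  then show ?thesis by (rule complexificationI[rotated 2]) (intro subspace_add[OF L] subspace_diff[OF L] br X X')+
qed

text \<open>The Hermitian form built from the trace form and the conjugation. It is positive
  definite on the complexified Lie algebra because of \<open>trace_square_neg\<close>, and the
  adjoint of \<open>ad A\<close> is \<open>- ad (cnjM A)\<close>.\<close>

definition hp :: "complex^'n^'n \<Rightarrow> complex^'n^'n \<Rightarrow> complex" where "hp Z W = - trace (Z ** cnjM W)"
definition hq :: "complex^'n^'n \<Rightarrow> real" where "hq Z = Re (hp Z Z)"

lemma hp_simps: "hp (A + B) C = hp A C + hp B C" "hp A (B + C) = hp A B + hp A C" "hp (A - B) C = hp A C - hp B C"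
  "hp A (B - C) = hp A B - hp A C" "hp (cs c A) B = c * hp A B" "hp A (cs c B) = cnj c * hp A B"
  "hp (- A) B = - hp A B" "hp A (- B) = - hp A B" "hp 0 B = 0" "hp A 0 = 0"
  by (simp_all add: hp_def mmult_distrib cnjM_simps cs_mmult cs_trace trace_linear cs_simps)

lemma hp_cnj: "hp B A = cnj (hp A B)"
proof -
  have "cnj (trace (A ** cnjM B)) = trace (cnjM A ** B)" by (simp add: cnjM_trace[symmetric] cnjM_simps)
  then show ?thesis by (simp add: hp_def trace_commute)
qed

lemma hp_commutator: "hp (commutator A B) C = - hp B (commutator (cnjM A) C)"
  by (simp add: hp_def trace_commutator commutator_cnjM cnjM_simps)

lemma hq_cs: "hq (cs c Z) = (cmod c)\<^sup>2 * hq Z"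
proof -
  have "hp (cs c Z) (cs c Z) = of_real ((cmod c)\<^sup>2) * hp Z Z"
    unfolding hp_simps complex_norm_square by simp
  then show ?thesis by (simp add: hq_def)
qed

lemma hp_self: "hp Z Z = of_real (hq Z)"
  using hp_cnj[of Z Z] by (simp add: hq_def complex_eq_iff)

section \<open>The root space decomposition\<close>

locale root_data =
  fixes U T :: "(real^'n^'n) set"
  assumes U: "compact_matrix_group U" and T: "maximal_torus U T"
begin

abbreviation "\<gg> \<equiv> complexification (lie_algebra U)"
abbreviation "\<hh> \<equiv> cartan_subalgebra T"
abbreviation "rs \<equiv> root_space U T"

sublocale U: compact_matrix_group U by (rule U)

lemma torus: "subgroup T GL" "T \<subseteq> U" "compact T" "connected T" "\<And>A B. A \<in> T \<Longrightarrow> B \<in> T \<Longrightarrow> A ** B = B ** A"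
  using T by (auto simp: maximal_torus_def torus_in_def)

sublocale T: compact_matrix_group T by (rule compact_matrix_groupI[OF torus(1,3)])

lemmas sub\<gg> = subspace_complexification[OF U.subspace_lie_algebra]
lemmas \<gg>_closed = complexification_closed[OF U.subspace_lie_algebra]
lemma \<gg>_commutator: "Z \<in> \<gg> \<Longrightarrow> W \<in> \<gg> \<Longrightarrow> commutator Z W \<in> \<gg>"
  by (rule complexification_commutator[OF U.subspace_lie_algebra U.bracket_mem])
lemmas \<hh>_closed = complexification_closed[OF T.subspace_lie_algebra, folded cartan_subalgebra_def]

lemma cof_\<gg>: "cof X \<in> \<gg> \<longleftrightarrow> X \<in> lie_algebra U"
  by (rule cof_mem_complexification[OF U.subspace_lie_algebra])

lemma cof_\<hh>: "cof X \<in> \<hh> \<longleftrightarrow> X \<in> lie_algebra T"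
  unfolding cartan_subalgebra_def by (rule cof_mem_complexification[OF T.subspace_lie_algebra])

lemma \<hh>E: assumes "H \<in> \<hh>" obtains X Y where "X \<in> lie_algebra T" "Y \<in> lie_algebra T" "H = cof X + cs \<i> (cof Y)"
  using assms unfolding cartan_subalgebra_def by (rule complexificationE)

lemma lie_TU: "X \<in> lie_algebra T \<Longrightarrow> X \<in> lie_algebra U"
  using T.mexp_mem torus(2) by (intro U.lie_algebra_mexpI) blast

lemma \<hh>_\<gg>: "H \<in> \<hh> \<Longrightarrow> H \<in> \<gg>"
  using lie_TU by (elim \<hh>E) (auto simp: complexification_iff)

text \<open>Commutativity of the torus is differentiated once in each factor.\<close>

lemma lie_T_commute: assumes X: "X \<in> lie_algebra T" and Y: "Y \<in> lie_algebra T" shows "commutator X Y = 0"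
proof -
  have diff: "commutator Z B = 0" if Z: "\<And>s. mexp (s *\<^sub>R Z) ** B = B ** mexp (s *\<^sub>R Z)" for Z B :: "real^'n^'n"
  proof -
    note d = mexp_has_vector_derivative[of Z 0]
    have "((\<lambda>s. mexp (s *\<^sub>R Z) ** B - B ** mexp (s *\<^sub>R Z)) has_vector_derivative (Z ** mexp (0 *\<^sub>R Z)) ** B - B ** (Z ** mexp (0 *\<^sub>R Z))) (at 0)"
      by (intro has_vector_derivative_diff d
        bounded_linear.has_vector_derivative[OF bounded_bilinear.bounded_linear_left[OF bounded_bilinear_matrix_matrix_mult]]
        bounded_linear.has_vector_derivative[OF bounded_bilinear.bounded_linear_right[OF bounded_bilinear_matrix_matrix_mult]])
    then have "((\<lambda>s::real. 0) has_vector_derivative commutator Z B) (at 0)" by (simp add: Z commutator_def)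
    then show ?thesis using has_vector_derivative_const vector_derivative_unique_at by blast
  qed
  have "commutator X (mexp (t *\<^sub>R Y)) = 0" for t
    using torus(5) T.mexp_mem[OF X] T.mexp_mem[OF Y] by (intro diff) auto
  then have "commutator Y X = 0" by (intro diff) (simp add: commutator_def)
  then show ?thesis using commutator_anti[of X Y] by simp
qed

lemma hq_pos: assumes Z: "Z \<in> \<gg>" "Z \<noteq> 0" shows "hq Z > 0"
proof -
  obtain X Y where X: "X \<in> lie_algebra U" "Y \<in> lie_algebra U" "Z = cof X + cs \<i> (cof Y)" using Z(1) by (rule complexificationE)
  have "hp (cof A) (cof B) = of_real (- trace (A ** B))" for A B :: "real^'n^'n"
    by (simp add: hp_def cnjM_simps cof_simps[symmetric])
  then have "hq Z = - trace (X ** X) - trace (Y ** Y)"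
    unfolding hq_def X(3) by (simp add: hp_simps trace_commute[of X Y])
  moreover have "trace (A ** A) \<le> 0" if "A \<in> lie_algebra U" for A
    using U.trace_square_neg[OF that] by (cases "A = 0") (auto simp: trace_def)
  moreover have "X \<noteq> 0 \<or> Y \<noteq> 0" using Z(2) X(3) by (auto simp: cof_simps cs_simps)
  ultimately show ?thesis using U.trace_square_neg[of X] U.trace_square_neg[of Y] X(1,2) by fastforce
qed

lemma hq_eq_0: "Z \<in> \<gg> \<Longrightarrow> hq Z = 0 \<longleftrightarrow> Z = 0"
  using hq_pos by (force simp: hq_def hp_simps)

text \<open>The real and imaginary parts of \<open>Z\<close> commute with the Lie algebra of
  \<open>T\<close>, so maximality of the torus applies to each.\<close>

lemma zero_weight: assumes Z: "Z \<in> \<gg>" and c: "\<And>H. H \<in> lie_algebra T \<Longrightarrow> commutator (cof H) Z = 0" shows "Z \<in> \<hh>"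
proof -
  obtain X Y where X: "X \<in> lie_algebra U" "Y \<in> lie_algebra U" "Z = cof X + cs \<i> (cof Y)" using Z by (rule complexificationE)
  have "commutator H X = 0 \<and> commutator H Y = 0" if H: "H \<in> lie_algebra T" for H
  proof -
    have "cof (commutator H X) + cs \<i> (cof (commutator H Y)) = cof 0 + cs \<i> (cof 0)"
      using c[OF H] X(3) by (simp add: commutator_simps commutator_cs commutator_cof cof_simps cs_simps)
    then show ?thesis using cof_decomp_unique by blast
  qed
  then have "X \<in> lie_algebra T" "Y \<in> lie_algebra T"
    using X by (auto intro!: maximal_torus_centralizer[OF U T] simp: commutator_def)
  then show ?thesis unfolding cartan_subalgebra_def complexification_iff using X(3) by blast
qed

lemma rs_iff: "Z \<in> rs \<beta> \<longleftrightarrow> Z \<in> \<gg> \<and> (\<forall>H\<in>\<hh>. commutator H Z = cs (\<beta> H) Z)"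
  by (simp add: root_space_def cs_def)

lemma rs_0: "Z \<in> rs (\<lambda>H. 0) \<Longrightarrow> Z \<in> \<hh>"
  using cof_\<hh> by (intro zero_weight) (auto simp: rs_iff cs_simps)

lemma rs_closed: "Z \<in> rs \<beta> \<Longrightarrow> cs c Z \<in> rs \<beta>" "Z \<in> rs \<beta> \<Longrightarrow> W \<in> rs \<beta> \<Longrightarrow> Z + W \<in> rs \<beta>"
  "Z \<in> rs \<beta> \<Longrightarrow> W \<in> rs \<beta> \<Longrightarrow> Z - W \<in> rs \<beta>" "0 \<in> rs \<beta>"
  using \<gg>_closed subspace_diff[OF sub\<gg>] subspace_0[OF sub\<gg>]
  by (auto simp: rs_iff commutator_simps commutator_cs cs_simps mult.commute)

lemma rs_commutator: "Z \<in> rs \<beta> \<Longrightarrow> W \<in> rs \<gamma> \<Longrightarrow> commutator Z W \<in> rs (\<lambda>H. \<beta> H + \<gamma> H)"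
  using \<gg>_commutator by (auto simp: rs_iff jacobi[of _ Z W] commutator_cs cs_add_left)

text \<open>For \<open>H\<close> in the Lie algebra of \<open>T\<close> the operator
  \<open>i ad H\<close> is self-adjoint for the real part of \<open>hp\<close>, and these operators
  commute. Their joint eigenvectors are root vectors or, for the zero functional, elements of the
  Cartan subalgebra.\<close>

lemma joint_span: "\<gg> \<subseteq> span (\<hh> \<union> (\<Union>\<beta>\<in>roots U T. rs \<beta>))"
proof -
  let ?A = "\<lambda>H Z. cs \<i> (commutator (cof H) Z)"
  let ?F = "?A ` lie_algebra T"
  let ?B = "\<lambda>Z W. Re (hp Z W)"
  have lin: "linear (?A H)" for H
    by (intro linearI) (simp_all add: cs_simps commutator_simps commutator_cs mult.commute)
  have "\<gg> = span {Z \<in> \<gg>. \<forall>A\<in>?F. \<exists>\<mu>. A Z = \<mu> *\<^sub>R Z}"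
  proof (rule joint_eigenvectors_span[where B = ?B])
    show "bilinear ?B" unfolding bilinear_def
      by (auto intro!: linearI simp: hp_simps cs_simps(9))
    show "?B Z W = ?B W Z" for Z W by (subst hp_cnj) simp
    show "?B Z Z > 0" if "Z \<in> \<gg>" "Z \<noteq> 0" for Z using hq_pos[OF that] by (simp add: hq_def)
    show "A Z \<in> \<gg>" if "A \<in> ?F" "Z \<in> \<gg>" for A Z
      using that lie_TU cof_\<gg> by (auto intro!: \<gg>_closed(2) \<gg>_commutator)
    show "?B (A Z) W = ?B Z (A W)" if "A \<in> ?F" for A Z W
      using that by (auto simp: hp_simps hp_commutator cnjM_simps)
    show "A (A' Z) = A' (A Z)" if AA: "A \<in> ?F" "A' \<in> ?F" for A A' Z
    proof -
      obtain H H' where H: "H \<in> lie_algebra T" "H' \<in> lie_algebra T" "A = ?A H" "A' = ?A H'" using AA by blast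
      have "commutator (cof H) (cof H') = 0" using lie_T_commute[OF H(1,2)] by (simp add: commutator_cof[symmetric] cof_simps)
      then show ?thesis using jacobi[of "cof H" "cof H'" Z] H by (simp add: commutator_cs commutator_simps)
    qed
  qed (use sub\<gg> lin in auto)
  also have "\<dots> \<subseteq> span (\<hh> \<union> (\<Union>\<beta>\<in>roots U T. rs \<beta>))"
  proof (rule span_mono, rule subsetI)
    fix Z assume "Z \<in> {Z \<in> \<gg>. \<forall>A\<in>?F. \<exists>\<mu>. A Z = \<mu> *\<^sub>R Z}"
    then have Z: "Z \<in> \<gg>" "\<And>H. H \<in> lie_algebra T \<Longrightarrow> \<exists>\<mu>. ?A H Z = \<mu> *\<^sub>R Z" by auto
    show "Z \<in> \<hh> \<union> (\<Union>\<beta>\<in>roots U T. rs \<beta>)"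
    proof (cases "Z = 0")
      case True
      then show ?thesis using cof_\<hh>[of 0] subspace_0[OF T.subspace_lie_algebra] by (simp add: cof_simps)
    next
      case False
      have ev: "\<exists>c. commutator (cof H) Z = cs c Z" if H: "H \<in> lie_algebra T" for H
      proof -
        obtain \<mu> where "?A H Z = \<mu> *\<^sub>R Z" using Z(2)[OF H] by blast
        then have "cs (-\<i>) (?A H Z) = cs (-\<i>) (\<mu> *\<^sub>R Z)" by simp
        then have "commutator (cof H) Z = cs (- \<i> * of_real \<mu>) Z" by (simp add: cs_simps)
        then show ?thesis by blast
      qed
      have "\<exists>c. commutator H Z = cs c Z" if H: "H \<in> \<hh>" for H
      proof -
        obtain X Y where X: "X \<in> lie_algebra T" "Y \<in> lie_algebra T" "H = cof X + cs \<i> (cof Y)" using H by (rule \<hh>E)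
        obtain c d where "commutator (cof X) Z = cs c Z" "commutator (cof Y) Z = cs d Z" using ev X by blast
        then have "commutator H Z = cs (c + \<i> * d) Z" by (simp add: X(3) commutator_simps commutator_cs cs_simps cs_add_left)
        then show ?thesis by blast
      qed
      then obtain \<beta>0 where \<beta>0: "\<And>H. H \<in> \<hh> \<Longrightarrow> commutator H Z = cs (\<beta>0 H) Z" by metis
      define \<beta> where "\<beta> H = (if H \<in> \<hh> then \<beta>0 H else 0)" for H
      have rs: "Z \<in> rs \<beta>" using Z(1) \<beta>0 by (simp add: rs_iff \<beta>_def)
      show ?thesis
      proof (cases "\<beta> = (\<lambda>H. 0)")
        case True then show ?thesis using rs rs_0 by simp
      next
        case f: False
        have "\<beta> \<in> roots U T" unfolding roots_def using rs False f by (auto simp: \<beta>_def)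
        then show ?thesis using rs by blast
      qed
    qed
  qed
  finally show ?thesis .
qed

text \<open>Collects what is used of roots: the default 0 off the Cartan subalgebra, complex
  linearity on it, and imaginary values on the real form. The last property makes conjugation
  exchange opposite root spaces.\<close>

definition weight :: "(complex^'n^'n \<Rightarrow> complex) \<Rightarrow> bool" where
  "weight \<beta> \<longleftrightarrow> (\<forall>H. H \<notin> \<hh> \<longrightarrow> \<beta> H = 0) \<and> (\<forall>X\<in>\<hh>. \<forall>Y\<in>\<hh>. \<beta> (X + Y) = \<beta> X + \<beta> Y) \<and>
     (\<forall>X\<in>\<hh>. \<forall>c. \<beta> (cs c X) = c * \<beta> X) \<and> (\<forall>X\<in>lie_algebra T. Re (\<beta> (cof X)) = 0)"

lemma root_vector: assumes "\<beta> \<in> roots U T" obtains Z where "Z \<in> rs \<beta>" "Z \<noteq> 0"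
  using assms rs_closed(4)[of \<beta>] unfolding roots_def by blast

lemma root_weight: assumes \<beta>: "\<beta> \<in> roots U T" shows "weight \<beta>"
proof -
  obtain Z where Z: "Z \<in> rs \<beta>" "Z \<noteq> 0" using \<beta> by (rule root_vector)
  have e: "commutator H Z = cs (\<beta> H) Z" if "H \<in> \<hh>" for H using Z that by (simp add: rs_iff)
  have 1: "\<beta> (X + Y) = \<beta> X + \<beta> Y" if "X \<in> \<hh>" "Y \<in> \<hh>" for X Y
  proof (rule cs_inject[OF Z(2)])
    show "cs (\<beta> (X + Y)) Z = cs (\<beta> X + \<beta> Y) Z"
      using e[OF that(1)] e[OF that(2)] e[OF \<hh>_closed(1)[OF that]] by (simp add: commutator_simps cs_add_left)
  qed
  have 2: "\<beta> (cs c X) = c * \<beta> X" if "X \<in> \<hh>" for X c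
  proof (rule cs_inject[OF Z(2)])
    show "cs (\<beta> (cs c X)) Z = cs (c * \<beta> X) Z"
      using e[OF that] e[OF \<hh>_closed(2)[OF that, of c]] by (simp add: commutator_cs cs_simps)
  qed
  have 3: "Re (\<beta> (cof X)) = 0" if X: "X \<in> lie_algebra T" for X
  proof -
    have "commutator (cof X) Z = cs (\<beta> (cof X)) Z" using e cof_\<hh> X by blast
    then have "\<beta> (cof X) * hp Z Z = - (cnj (\<beta> (cof X)) * hp Z Z)"
      using hp_commutator[of "cof X" Z Z] by (simp add: hp_simps cnjM_simps)
    moreover have "hp Z Z \<noteq> 0" using hp_self[of Z] hq_pos[of Z] Z by (auto simp: rs_iff)
    ultimately have "\<beta> (cof X) = - cnj (\<beta> (cof X))" by (metis mult_minus_left mult_right_cancel)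
    then show ?thesis by (simp add: complex_eq_iff)
  qed
  show ?thesis unfolding weight_def using \<beta> 1 2 3 by (auto simp: roots_def)
qed

lemma rs_cnj: assumes w: "weight \<beta>" and Z: "Z \<in> rs \<beta>" shows "cnjM Z \<in> rs (\<lambda>H. - \<beta> H)"
  unfolding rs_iff
proof (intro conjI ballI)
  show "cnjM Z \<in> \<gg>" using Z \<gg>_closed(3) by (simp add: rs_iff)
  fix H assume H: "H \<in> \<hh>"
  then obtain X Y where X: "X \<in> lie_algebra T" "Y \<in> lie_algebra T" "H = cof X + cs \<i> (cof Y)" by (rule \<hh>E)
  have r: "cnj (\<beta> (cof W)) = - \<beta> (cof W)" if "W \<in> lie_algebra T" for W
    using w that by (simp add: weight_def complex_eq_iff)
  have XY: "cof X \<in> \<hh>" "cof Y \<in> \<hh>" using X cof_\<hh> by auto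
  have c: "commutator (cof W) (cnjM Z) = cs (- \<beta> (cof W)) (cnjM Z)" if W: "W \<in> lie_algebra T" for W
  proof -
    have "commutator (cof W) (cnjM Z) = cnjM (commutator (cof W) Z)" by (simp add: commutator_cnjM cnjM_simps)
    also have "\<dots> = cs (- \<beta> (cof W)) (cnjM Z)" using Z W cof_\<hh> r[OF W] by (simp add: rs_iff cnjM_simps)
    finally show ?thesis .
  qed
  have "\<beta> H = \<beta> (cof X) + \<i> * \<beta> (cof Y)"
    using w XY \<hh>_closed(2)[OF XY(2)] unfolding weight_def X(3) by simp
  then show "commutator H (cnjM Z) = cs (- \<beta> H) (cnjM Z)"
    using c[OF X(1)] c[OF X(2)] by (simp add: X(3) commutator_simps commutator_cs cs_simps cs_add_left)
qed

lemma root_uminus: assumes \<beta>: "\<beta> \<in> roots U T" shows "(\<lambda>H. - \<beta> H) \<in> roots U T"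
proof -
  obtain Z where Z: "Z \<in> rs \<beta>" "Z \<noteq> 0" using \<beta> by (rule root_vector)
  have "cnjM Z \<in> rs (\<lambda>H. - \<beta> H)" by (rule rs_cnj[OF root_weight[OF \<beta>] Z(1)])
  moreover have "cnjM Z \<noteq> 0" using Z(2) by (auto simp: vec_eq_iff)
  ultimately show ?thesis using \<beta> by (auto simp: roots_def fun_eq_iff)
qed

lemma coroot_mem: assumes \<gamma>: "weight \<gamma>" and x: "x \<in> rs \<gamma>" shows "commutator x (cnjM x) \<in> \<hh>"
  using rs_commutator[OF x rs_cnj[OF \<gamma> x]] by (intro rs_0) simp

text \<open>With \<open>h = [x, cnjM x]\<close> the Jacobi identity gives
  \<open>[ad x, ad (cnjM x)] = ad h\<close>, and \<open>ad x\<close> has adjoint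
  \<open>- ad (cnjM x)\<close>; pairing with \<open>V\<close> turns this into a relation of squared
  norms. It takes the place of the representation theory of sl2.\<close>

lemma norm_identity:
  assumes \<gamma>: "weight \<gamma>" and x: "x \<in> rs \<gamma>" and V: "V \<in> rs \<beta>"
  shows "hq (commutator x V) = hq (commutator (cnjM x) V) + Re (\<beta> (commutator x (cnjM x))) * hq V"
proof -
  let ?h = "commutator x (cnjM x)"
  let ?E = "commutator x" and ?F = "commutator (cnjM x)"
  have h: "commutator ?h V = cs (\<beta> ?h) V" using V coroot_mem[OF \<gamma> x] by (simp add: rs_iff)
  have "?E (?F V) - ?F (?E V) = cs (\<beta> ?h) V"
    using jacobi[of x "cnjM x" V] h by simp
  then have FE: "?F (?E V) = ?E (?F V) - cs (\<beta> ?h) V" by (simp add: algebra_simps)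
  have "hp (?E V) (?E V) = - hp V (?F (?E V))" by (rule hp_commutator)
  also have "\<dots> = - hp V (?E (?F V)) + cnj (\<beta> ?h) * hp V V" by (simp add: FE hp_simps)
  also have "- hp V (?E (?F V)) = hp (?F V) (?F V)"
    using hp_commutator[of "cnjM x" V "?F V"] by (simp add: cnjM_simps)
  finally have "hp (?E V) (?E V) = hp (?F V) (?F V) + cnj (\<beta> ?h) * of_real (hq V)"
    unfolding hp_self[of V] .
  from arg_cong[OF this, of Re] show ?thesis unfolding hq_def by simp
qed

text \<open>For \<open>V = x\<close> the left side of \<open>norm_identity\<close> vanishes, so the
  real part of \<open>\<gamma> h\<close> times \<open>hq x\<close> is \<open>- hq h\<close>. If
  \<open>h\<close> were 0, invariance of the trace form would make \<open>\<gamma>\<close> vanish on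
  the Cartan subalgebra.\<close>

lemma coroot_neg:
  assumes \<gamma>: "\<gamma> \<in> roots U T" and x: "x \<in> rs \<gamma>" "x \<noteq> 0"
  shows "Re (\<gamma> (commutator x (cnjM x))) < 0"
proof -
  let ?h = "commutator x (cnjM x)"
  have xg: "x \<in> \<gg>" using x by (simp add: rs_iff)
  have hx: "hq x > 0" by (rule hq_pos[OF xg x(2)])
  have w: "weight \<gamma>" by (rule root_weight[OF \<gamma>])
  have hg: "?h \<in> \<gg>" using coroot_mem[OF w x(1)] \<hh>_\<gg> by blast
  have "?h \<noteq> 0"
  proof
    assume h0: "?h = 0"
    have "\<gamma> t = 0" for t
    proof (cases "t \<in> \<hh>")
      case True
      have "trace (?h ** t) = - trace (cnjM x ** commutator x t)" by (rule trace_commutator)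
      also have "commutator x t = - cs (\<gamma> t) x" using x(1) True commutator_anti[of x t] by (simp add: rs_iff)
      finally have "\<gamma> t * trace (cnjM x ** x) = 0" by (simp add: h0 mmult_distrib trace_linear cs_mmult cs_trace)
      moreover have "trace (cnjM x ** x) = - hp x x" by (simp add: hp_def trace_commute)
      ultimately show ?thesis using hp_self[of x] hx by simp
    qed (use w in \<open>simp add: weight_def\<close>)
    then show False using \<gamma> by (auto simp: roots_def)
  qed
  then have "hq ?h > 0" by (rule hq_pos[OF hg])
  moreover have "commutator (cnjM x) x = - ?h" by (rule commutator_anti)
  then have "hq (commutator (cnjM x) x) = hq ?h" by (simp add: hq_def hp_simps)
  moreover have "0 = hq (commutator (cnjM x) x) + Re (\<gamma> ?h) * hq x"
    using norm_identity[OF w x(1) x(1)] by (simp add: commutator_simps hq_def hp_simps)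
  ultimately have "Re (\<gamma> ?h) * hq x < 0" by simp
  then show ?thesis using hx by (simp add: mult_less_0_iff)
qed

text \<open>A vector \<open>z\<close> of the root space orthogonal to \<open>x\<close> is killed by
  \<open>ad x\<close>, since \<open>two\<close> excludes the doubled root, and by
  \<open>ad (cnjM x)\<close>, since that bracket lies in the Cartan subalgebra and turns out to be
  orthogonal to itself. Then \<open>norm_identity\<close> and \<open>coroot_neg\<close> force
  \<open>z = 0\<close>.\<close>

lemma root_space_one_dim:
  assumes \<gamma>: "\<gamma> \<in> roots U T" and two: "rs (\<lambda>H. \<gamma> H + \<gamma> H) = {0}"
    and x: "x \<in> rs \<gamma>" "x \<noteq> 0" and y: "y \<in> rs \<gamma>"
  shows "\<exists>c. y = cs c x"
proof -
  have w: "weight \<gamma>" by (rule root_weight[OF \<gamma>])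
  have xg: "x \<in> \<gg>" using x by (simp add: rs_iff)
  have hx: "hp x x \<noteq> 0" using hp_self[of x] hq_pos[OF xg x(2)] by simp
  define c where "c = hp y x / hp x x"
  define z where "z = y - cs c x"
  have z: "z \<in> rs \<gamma>" unfolding z_def using x y rs_closed by blast
  have zg: "z \<in> \<gg>" using z by (simp add: rs_iff)
  have zx: "hp z x = 0" using hx by (simp add: z_def c_def hp_simps)
  have "commutator x z \<in> rs (\<lambda>H. \<gamma> H + \<gamma> H)" by (rule rs_commutator[OF x(1) z])
  then have E: "commutator x z = 0" using two by simp
  let ?t = "commutator (cnjM x) z"
  have "?t \<in> rs (\<lambda>H. - \<gamma> H + \<gamma> H)" by (rule rs_commutator[OF rs_cnj[OF w x(1)] z])
  then have t: "?t \<in> \<hh>" by (intro rs_0) simp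
  have "hp ?t ?t = - hp z (commutator x ?t)" using hp_commutator[of "cnjM x" z ?t] by (simp add: cnjM_simps)
  also have "commutator x ?t = - cs (\<gamma> ?t) x" using x(1) t commutator_anti[of x ?t] by (simp add: rs_iff)
  finally have "hp ?t ?t = 0" by (simp add: hp_simps zx)
  then have "hq ?t = 0" by (simp add: hq_def)
  then have "0 = Re (\<gamma> (commutator x (cnjM x))) * hq z"
    using norm_identity[OF w x(1) z] E by (simp add: hq_def hp_simps)
  then have "hq z = 0" using coroot_neg[OF \<gamma> x] by simp
  then have "z = 0" using hq_eq_0[OF zg] by simp
  then show ?thesis unfolding z_def by (intro exI[of _ c]) simp
qed

end

section \<open>Root strings in type $G_2$\<close>

text \<open>Along the string \<open>v, [x, v], [x, [x, v]], \<dots>\<close> of root vectors, \<open>c j\<close> and \<open>d j\<close> are the squared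
  norms, relative to the \<open>j\<close>-th vector, of its brackets with \<open>x\<close> and with the conjugate of \<open>x\<close>.\<close>

lemma finite_root_string:
  fixes c d :: "nat \<Rightarrow> real"
  assumes "c 0 = d 0 + \<kappa>" "c 1 = d 1 + (\<kappa> + \<mu>)" "c 2 = d 2 + (\<kappa> + 2 * \<mu>)" "c 3 = d 3 + (\<kappa> + 3 * \<mu>)"
    "d 0 = 0" "c 3 = 0" "d 1 = c 0" "d 2 = c 1" "d 3 = c 2" "\<mu> < 0"
  shows "c 1 > 0" "c 2 > 0"
  \<comment> \<open>Telescoping gives \<open>4 * \<kappa> + 6 * \<mu> = 0\<close>, hence
    \<open>c 1 = - 2 * \<mu>\<close> and \<open>c 2 = - 3 * \<mu> / 2\<close>.\<close>
  using assms by linarith+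

locale g2_data = root_data U T for U T :: "(real^'n^'n) set" +
  fixes \<alpha>1 \<alpha>2 :: "complex^'n^'n \<Rightarrow> complex"
  assumes distinct: "\<alpha>1 \<noteq> \<alpha>2"
    and simple: "simple_roots (roots U T) {\<alpha>1, \<alpha>2}"
    and positive: "positive_roots (roots U T) {\<alpha>1, \<alpha>2} =
      {\<alpha>1, \<alpha>2, (\<lambda>H. \<alpha>1 H + \<alpha>2 H), (\<lambda>H. \<alpha>1 H + 2 * \<alpha>2 H),
       (\<lambda>H. \<alpha>1 H + 3 * \<alpha>2 H), (\<lambda>H. 2 * \<alpha>1 H + 3 * \<alpha>2 H)}"
begin

definition rt :: "int \<Rightarrow> int \<Rightarrow> complex^'n^'n \<Rightarrow> complex" where
  "rt a b = (\<lambda>H. of_int a * \<alpha>1 H + of_int b * \<alpha>2 H)"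

definition L :: "(int \<times> int) set" where
  "L = {(1,0), (0,1), (1,1), (1,2), (1,3), (2,3), (-1,0), (0,-1), (-1,-1), (-1,-2), (-1,-3), (-2,-3)}"

abbreviation "rsg a b \<equiv> rs (rt a b)"

lemma rt_simps: "rt 1 0 = \<alpha>1" "rt 0 1 = \<alpha>2" "rt 0 0 = (\<lambda>H. 0)" "rt (- a) (- b) = (\<lambda>H. - rt a b H)"
  "(\<lambda>H. rt a b H + rt c d H) = rt (a + c) (b + d)"
  by (auto simp: rt_def algebra_simps)

lemma \<alpha>_roots: "\<alpha>1 \<in> roots U T" "\<alpha>2 \<in> roots U T"
  using simple by (auto simp: simple_roots_def)

lemma independent: assumes "\<And>H. a * \<alpha>1 H + b * \<alpha>2 H = 0" shows "a = 0" "b = 0"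
proof -
  have ind: "\<And>c. (\<lambda>H. \<Sum>\<delta>\<in>{\<alpha>1, \<alpha>2}. c \<delta> * \<delta> H) = (\<lambda>H. 0) \<Longrightarrow> \<forall>\<delta>\<in>{\<alpha>1, \<alpha>2}. c \<delta> = 0"
    using simple by (auto simp: simple_roots_def)
  let ?c = "\<lambda>\<delta>. if \<delta> = \<alpha>1 then a else b"
  have "(\<lambda>H. \<Sum>\<delta>\<in>{\<alpha>1, \<alpha>2}. ?c \<delta> * \<delta> H) = (\<lambda>H. 0)"
    by (rule ext) (use assms distinct in simp)
  from ind[OF this] show "a = 0" "b = 0" using distinct by auto
qed

lemma rt_inj: assumes "rt a b = rt c d" shows "a = c" "b = d"
proof -
  have "of_int (a - c) * \<alpha>1 H + of_int (b - d) * \<alpha>2 H = 0" for H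
    using fun_cong[OF assms, of H] by (simp add: rt_def algebra_simps)
  from independent[OF this] show "a = c" "b = d" by simp_all
qed

lemma roots_eq: "\<beta> \<in> roots U T \<longleftrightarrow> (\<exists>(a, b)\<in>L. \<beta> = rt a b)"
proof -
  have e: "rt 1 1 = (\<lambda>H. \<alpha>1 H + \<alpha>2 H)" "rt 1 2 = (\<lambda>H. \<alpha>1 H + 2 * \<alpha>2 H)"
    "rt 1 3 = (\<lambda>H. \<alpha>1 H + 3 * \<alpha>2 H)" "rt 2 3 = (\<lambda>H. 2 * \<alpha>1 H + 3 * \<alpha>2 H)"
    by (simp_all add: rt_def)
  have pos: "positive_roots (roots U T) {\<alpha>1, \<alpha>2} = {rt 1 0, rt 0 1, rt 1 1, rt 1 2, rt 1 3, rt 2 3}"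
    unfolding positive e rt_simps ..
  have sub: "\<beta> \<in> roots U T" if "\<beta> \<in> {rt 1 0, rt 0 1, rt 1 1, rt 1 2, rt 1 3, rt 2 3}" for \<beta>
    using that unfolding pos[symmetric] by (simp add: positive_roots_def)
  have neg: "rt (- a) (- b) \<in> roots U T" if "rt a b \<in> roots U T" for a b
    using root_uminus[OF that] by (simp add: rt_simps)
  show ?thesis
  proof
    assume \<beta>: "\<beta> \<in> roots U T"
    then obtain c :: "(complex^'n^'n \<Rightarrow> complex) \<Rightarrow> nat" where
      c: "\<beta> = (\<lambda>H. \<Sum>\<delta>\<in>{\<alpha>1, \<alpha>2}. of_nat (c \<delta>) * \<delta> H) \<or> \<beta> = (\<lambda>H. - (\<Sum>\<delta>\<in>{\<alpha>1, \<alpha>2}. of_nat (c \<delta>) * \<delta> H))"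
      using simple unfolding simple_roots_def by blast
    define \<gamma> where "\<gamma> = (\<lambda>H. \<Sum>\<delta>\<in>{\<alpha>1, \<alpha>2}. of_nat (c \<delta>) * \<delta> H)"
    have \<gamma>: "\<beta> = \<gamma> \<or> \<beta> = (\<lambda>H. - \<gamma> H)" using c unfolding \<gamma>_def .
    have m: "\<gamma> = (\<lambda>H. - \<beta> H)" if "\<beta> = (\<lambda>H. - \<gamma> H)" using that by simp
    have "\<gamma> \<in> roots U T" using \<gamma> \<beta> root_uminus[OF \<beta>] m by metis
    then have "\<gamma> \<in> positive_roots (roots U T) {\<alpha>1, \<alpha>2}"
      unfolding positive_roots_def mem_Collect_eq by (intro conjI exI[of _ c]) (auto simp: \<gamma>_def)
    then obtain a b where ab: "(a, b) \<in> {(1,0), (0,1), (1,1), (1,2), (1,3), (2,3)}" "\<gamma> = rt a b" unfolding pos by blast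
    from \<gamma> show "\<exists>(a, b)\<in>L. \<beta> = rt a b"
    proof
      assume "\<beta> = \<gamma>" then show ?thesis using ab by (auto simp: L_def)
    next
      assume "\<beta> = (\<lambda>H. - \<gamma> H)"
      then have "\<beta> = rt (- a) (- b)" using ab(2) by (simp add: rt_simps)
      moreover have "(- a, - b) \<in> L" using ab(1) by (auto simp: L_def)
      ultimately show ?thesis by blast
    qed
  next
    assume "\<exists>(a, b)\<in>L. \<beta> = rt a b"
    then obtain a b where ab: "(a, b) \<in> L" "\<beta> = rt a b" by blast
    show "\<beta> \<in> roots U T"
    proof (cases "(a, b) \<in> {(1,0), (0,1), (1,1), (1,2), (1,3), (2,3)}")
      case True
      then show ?thesis unfolding ab(2) by (intro sub) auto
    next
      case False
      then have "(- a, - b) \<in> {(1,0), (0,1), (1,1), (1,2), (1,3), (2,3)}"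
        using ab(1) unfolding L_def by (elim insertE emptyE) simp_all
      then have "rt (- a) (- b) \<in> roots U T" by (intro sub) auto
      from neg[OF this] show ?thesis unfolding ab(2) by simp
    qed
  qed
qed

lemma rt_root: "(a, b) \<in> L \<Longrightarrow> rt a b \<in> roots U T"
  using roots_eq by blast

lemma rsg_trivial: assumes "(a, b) \<notin> L" "(a, b) \<noteq> (0, 0)" shows "rsg a b = {0}"
proof (rule ccontr)
  assume n: "rsg a b \<noteq> {0}"
  have "rt a b \<noteq> (\<lambda>H. 0)" using rt_inj[of a b 0 0] assms(2) by (auto simp: rt_simps)
  moreover have "rt a b H = 0" if "H \<notin> \<hh>" for H
    using that \<alpha>_roots by (simp add: rt_def roots_def)
  ultimately have "rt a b \<in> roots U T" using n by (simp add: roots_def)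
  then show False using assms(1) rt_inj roots_eq by blast
qed

lemma rsg_commutator: "Z \<in> rsg a b \<Longrightarrow> W \<in> rsg c d \<Longrightarrow> commutator Z W \<in> rsg (a + c) (b + d)"
  using rs_commutator[of Z "rt a b" W "rt c d"] by (simp add: rt_simps(5))

lemma rsg_cnj: "(a, b) \<in> L \<Longrightarrow> Z \<in> rsg a b \<Longrightarrow> cnjM Z \<in> rsg (- a) (- b)"
  using rs_cnj[OF root_weight[OF rt_root]] by (simp add: rt_simps(4))

lemma rsg_one_dim:
  assumes "(a, b) \<in> L" "x \<in> rsg a b" "x \<noteq> 0" "y \<in> rsg a b" shows "\<exists>c. y = cs c x"
proof -
  have "(a + a, b + b) \<notin> L" "(a + a, b + b) \<noteq> (0, 0)" using assms(1) by (auto simp: L_def)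
  then have "rs (\<lambda>H. rt a b H + rt a b H) = {0}" unfolding rt_simps(5) by (rule rsg_trivial)
  then show ?thesis by (rule root_space_one_dim[OF rt_root[OF assms(1)] _ assms(2-)])
qed

text \<open>\<open>ad x\<close> climbs a string of exactly four one-dimensional root spaces. The
  relations of \<open>finite_root_string\<close> hold along it, with zeros at both ends, and they
  make the second and third step of the string nonzero.\<close>

lemma root_string:
  assumes pq: "(p, q) \<in> L" and str: "\<And>k. k \<in> {0, 1, 2, 3} \<Longrightarrow> (a + k * p, b + k * q) \<in> L"
    and ends: "(a - p, b - q) \<notin> L" "(a - p, b - q) \<noteq> (0, 0)" "(a + 4 * p, b + 4 * q) \<notin> L" "(a + 4 * p, b + 4 * q) \<noteq> (0, 0)"
    and x: "x \<in> rsg p q" "x \<noteq> 0"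
  shows "y \<in> rsg (a + p) (b + q) \<Longrightarrow> y \<noteq> 0 \<Longrightarrow> commutator x y \<noteq> 0"
    "y \<in> rsg (a + 2 * p) (b + 2 * q) \<Longrightarrow> y \<noteq> 0 \<Longrightarrow> commutator x y \<noteq> 0"
proof -
  let ?S = "\<lambda>k::nat. rsg (a + int k * p) (b + int k * q)"
  let ?h = "commutator x (cnjM x)"
  let ?E = "commutator x" and ?F = "commutator (cnjM x)"
  have inL: "(a + int k * p, b + int k * q) \<in> L" if "k \<le> 3" for k
    using that by (intro str) auto
  have w: "weight (rt p q)" by (rule root_weight[OF rt_root[OF pq]])
  have xc: "cnjM x \<in> rsg (- p) (- q)" by (rule rsg_cnj[OF pq x(1)])
  have "\<exists>z. z \<in> ?S k \<and> z \<noteq> 0" if "k \<le> 3" for k using root_vector[OF rt_root[OF inL[OF that]]] by blast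
  then obtain v where v: "\<And>k. k \<le> 3 \<Longrightarrow> v k \<in> ?S k" "\<And>k. k \<le> 3 \<Longrightarrow> v k \<noteq> 0" by metis
  have vg: "v k \<in> \<gg>" if "k \<le> 3" for k using v(1)[OF that] by (simp add: rs_iff)
  have qv: "hq (v k) > 0" if "k \<le> 3" for k by (rule hq_pos[OF vg[OF that] v(2)[OF that]])
  define c where "c k = hq (?E (v k)) / hq (v k)" for k
  define d where "d k = hq (?F (v k)) / hq (v k)" for k
  define \<kappa> where "\<kappa> = Re (rt a b ?h)"
  define \<mu> where "\<mu> = Re (rt p q ?h)"
  have \<mu>: "\<mu> < 0" unfolding \<mu>_def by (rule coroot_neg[OF rt_root[OF pq] x])
  have step: "c k = d k + (\<kappa> + real k * \<mu>)" if k: "k \<le> 3" for k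
  proof -
    have "Re (rt (a + int k * p) (b + int k * q) ?h) = \<kappa> + real k * \<mu>"
      unfolding \<kappa>_def \<mu>_def rt_def by (simp add: algebra_simps)
    then have "hq (?E (v k)) = hq (?F (v k)) + (\<kappa> + real k * \<mu>) * hq (v k)"
      using norm_identity[OF w x(1) v(1)[OF k]] by simp
    then show ?thesis using qv[OF k] by (simp add: c_def d_def field_simps)
  qed
  have Emem: "?E (v k) \<in> ?S (Suc k)" if "k \<le> 3" for k
    using rsg_commutator[OF x(1) v(1)[OF that]] by (simp add: algebra_simps)
  have Fmem: "?F (v (Suc k)) \<in> ?S k" if "k \<le> 2" for k
    using rsg_commutator[OF xc v(1)[of "Suc k"]] that by (simp add: algebra_simps)
  have c3: "c 3 = 0"
  proof -
    have "?E (v 3) \<in> rsg (a + 4 * p) (b + 4 * q)" using Emem[of 3] by simp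
    then have "?E (v 3) = 0" using rsg_trivial[OF ends(3,4)] by simp
    then show ?thesis by (simp add: c_def hq_def hp_simps)
  qed
  have d0: "d 0 = 0"
  proof -
    have "?F (v 0) \<in> rsg (a - p) (b - q)" using rsg_commutator[OF xc v(1)[of 0]] by (simp add: algebra_simps)
    then have "?F (v 0) = 0" using rsg_trivial[OF ends(1,2)] by simp
    then show ?thesis by (simp add: d_def hq_def hp_simps)
  qed
  \<comment> \<open>\<open>ad x\<close> and \<open>- ad (cnjM x)\<close> are adjoint, so the scalars
    \<open>s\<close> and \<open>t\<close> by which the two brackets move between \<open>v k\<close>
    and \<open>v (Suc k)\<close> satisfy \<open>cmod s * ?n = cmod t * ?m\<close>; this equates the
    two ratios.\<close>
  have cd: "d (Suc k) = c k" if k: "k \<le> 2" for k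
  proof -
    have k3: "k \<le> 3" "Suc k \<le> 3" using k by auto
    obtain s where s: "?E (v k) = cs s (v (Suc k))"
      using rsg_one_dim[OF inL[OF k3(2)] v[OF k3(2)] Emem[OF k3(1)]] by blast
    obtain t where t: "?F (v (Suc k)) = cs t (v k)"
      using rsg_one_dim[OF inL[OF k3(1)] v[OF k3(1)] Fmem[OF k]] by blast
    let ?m = "hq (v k)" and ?n = "hq (v (Suc k))"
    have mn: "?m > 0" "?n > 0" using qv k3 by auto
    have "s * hp (v (Suc k)) (v (Suc k)) = - (cnj t * hp (v k) (v k))"
      using hp_commutator[of x "v k" "v (Suc k)"] unfolding s t hp_simps by simp
    then have "cmod (s * of_real ?n) = cmod (- (cnj t * of_real ?m))" unfolding hp_self by simp
    then have st: "cmod s * ?n = cmod t * ?m" using mn by (simp add: norm_mult)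
    have "c k = (cmod s)\<^sup>2 * ?n / ?m" unfolding c_def s hq_cs ..
    moreover have "d (Suc k) = (cmod t)\<^sup>2 * ?m / ?n" unfolding d_def t hq_cs ..
    moreover have "(cmod s)\<^sup>2 * ?n * ?n = (cmod t)\<^sup>2 * ?m * ?m"
      using arg_cong[OF st, of "\<lambda>z. z\<^sup>2"] by (simp add: power2_eq_square mult_ac)
    ultimately have "c k * ?m = (cmod s)\<^sup>2 * ?n" "d (Suc k) * ?n = (cmod t)\<^sup>2 * ?m"
      "(cmod s)\<^sup>2 * ?n * ?n = (cmod t)\<^sup>2 * ?m * ?m" using mn by auto
    then have "d (Suc k) * ?n * ?m = c k * ?m * ?n" by metis
    then show ?thesis using mn by simp
  qed
  have "c 1 > 0" "c 2 > 0"
    using finite_root_string[of c d \<kappa> \<mu>] step[of 0] step[of 1] step[of 2] step[of 3] c3 d0 cd[of 0] cd[of 1] cd[of 2] \<mu>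
    by (simp_all add: numeral_2_eq_2 numeral_3_eq_3)
  then have nz: "?E (v 1) \<noteq> 0" "?E (v 2) \<noteq> 0" by (auto simp: c_def hq_def hp_simps)
  have fin: "commutator x y \<noteq> 0" if k: "k \<le> 3" "?E (v k) \<noteq> 0" "y \<in> ?S k" "y \<noteq> 0" for k y
  proof -
    obtain s where "v k = cs s y" using rsg_one_dim[OF inL[OF k(1)] k(3,4) v(1)[OF k(1)]] by blast
    then show ?thesis using k(2) by (auto simp: commutator_cs cs_simps)
  qed
  show "y \<in> rsg (a + p) (b + q) \<Longrightarrow> y \<noteq> 0 \<Longrightarrow> commutator x y \<noteq> 0" using fin[of 1 y] nz by simp
  show "y \<in> rsg (a + 2 * p) (b + 2 * q) \<Longrightarrow> y \<noteq> 0 \<Longrightarrow> commutator x y \<noteq> 0" using fin[of 2 y] nz by simp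
qed

text \<open>The first two brackets are inner steps of the \<alpha>2-string \<open>\<alpha>1\<close>,
  \<open>\<alpha>1 + \<alpha>2\<close>, \<open>\<alpha>1 + 2 \<alpha>2\<close>,
  \<open>\<alpha>1 + 3 \<alpha>2\<close>; the third belongs to the string
  \<open>- \<alpha>1\<close>, \<open>\<alpha>2\<close>, \<open>\<alpha>1 + 2 \<alpha>2\<close>,
  \<open>2 \<alpha>1 + 3 \<alpha>2\<close> in direction
  \<open>\<alpha>1 + \<alpha>2\<close>.\<close>

lemma nonzero_brackets:
  "x \<in> rsg 0 1 \<Longrightarrow> y \<in> rsg 1 1 \<Longrightarrow> x \<noteq> 0 \<Longrightarrow> y \<noteq> 0 \<Longrightarrow> commutator x y \<noteq> 0"
  "x \<in> rsg 0 1 \<Longrightarrow> y \<in> rsg 1 2 \<Longrightarrow> x \<noteq> 0 \<Longrightarrow> y \<noteq> 0 \<Longrightarrow> commutator x y \<noteq> 0"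
  "x \<in> rsg 1 1 \<Longrightarrow> y \<in> rsg 1 2 \<Longrightarrow> x \<noteq> 0 \<Longrightarrow> y \<noteq> 0 \<Longrightarrow> commutator x y \<noteq> 0"
proof -
  have s1: "(1 + k * 0, 0 + k * 1) \<in> L" if "k \<in> {0, 1, 2, 3}" for k :: int using that by (auto simp: L_def)
  have s2: "(- 1 + k * 1, 0 + k * 1) \<in> L" if "k \<in> {0, 1, 2, 3}" for k :: int using that by (auto simp: L_def)
  show "x \<in> rsg 0 1 \<Longrightarrow> y \<in> rsg 1 1 \<Longrightarrow> x \<noteq> 0 \<Longrightarrow> y \<noteq> 0 \<Longrightarrow> commutator x y \<noteq> 0"
    using root_string(1)[of 0 1 1 0 x y, OF _ s1] by (simp add: L_def)
  show "x \<in> rsg 0 1 \<Longrightarrow> y \<in> rsg 1 2 \<Longrightarrow> x \<noteq> 0 \<Longrightarrow> y \<noteq> 0 \<Longrightarrow> commutator x y \<noteq> 0"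
    using root_string(2)[of 0 1 1 0 x y, OF _ s1] by (simp add: L_def)
  show "x \<in> rsg 1 1 \<Longrightarrow> y \<in> rsg 1 2 \<Longrightarrow> x \<noteq> 0 \<Longrightarrow> y \<noteq> 0 \<Longrightarrow> commutator x y \<noteq> 0"
    using root_string(2)[of 1 1 "-1" 0 x y, OF _ s2] by (simp add: L_def)
qed

text \<open>Independence of the simple roots yields an element on which the first vanishes and the
  second does not. After rescaling, its real part already works, because roots take imaginary values
  on \<open>lie_algebra T\<close>.\<close>

lemma grading_element: "\<exists>H0\<in>lie_algebra T. \<alpha>1 (cof H0) = 0 \<and> \<alpha>2 (cof H0) = \<i>"
proof -
  have w: "weight \<alpha>1" "weight \<alpha>2" using root_weight \<alpha>_roots by auto
  have "\<exists>H\<in>\<hh>. \<alpha>1 H = 0 \<and> \<alpha>2 H \<noteq> 0"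
  proof (rule ccontr)
    assume "\<not> ?thesis"
    then have n: "\<alpha>2 H = 0" if "H \<in> \<hh>" "\<alpha>1 H = 0" for H using that by blast
    obtain H1 where H1: "\<alpha>1 H1 \<noteq> 0" using \<alpha>_roots(1) by (auto simp: roots_def fun_eq_iff)
    then have H1h: "H1 \<in> \<hh>" using w(1) by (auto simp: weight_def)
    have "\<alpha>2 H1 * \<alpha>1 H + (- \<alpha>1 H1) * \<alpha>2 H = 0" for H
    proof (cases "H \<in> \<hh>")
      case True
      let ?H = "cs (\<alpha>1 H1) H + cs (- \<alpha>1 H) H1"
      have m: "cs (\<alpha>1 H1) H \<in> \<hh>" "cs (- \<alpha>1 H) H1 \<in> \<hh>" using \<hh>_closed(2) True H1h by auto
      have "\<alpha>1 ?H = 0" using w(1) m True H1h by (simp add: weight_def)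
      then have "\<alpha>2 ?H = 0" using n \<hh>_closed(1)[OF m] by blast
      then show ?thesis using w(2) m True H1h by (simp add: weight_def algebra_simps)
    qed (use w in \<open>simp add: weight_def\<close>)
    from independent(2)[OF this] show False using H1 by simp
  qed
  then obtain H where H: "H \<in> \<hh>" "\<alpha>1 H = 0" "\<alpha>2 H \<noteq> 0" by blast
  let ?H = "cs (\<i> / \<alpha>2 H) H"
  have H': "?H \<in> \<hh>" "\<alpha>1 ?H = 0" "\<alpha>2 ?H = \<i>" using \<hh>_closed(2)[OF H(1)] w H by (simp_all add: weight_def)
  obtain X Y where X: "X \<in> lie_algebra T" "Y \<in> lie_algebra T" "?H = cof X + cs \<i> (cof Y)" using H'(1) by (rule \<hh>E)
  have XY: "cof X \<in> \<hh>" "cof Y \<in> \<hh>" using X cof_\<hh> by auto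
  have e: "\<alpha> ?H = \<alpha> (cof X) + \<i> * \<alpha> (cof Y)" "Re (\<alpha> (cof X)) = 0" "Re (\<alpha> (cof Y)) = 0" if "weight \<alpha>" for \<alpha>
    using that XY \<hh>_closed(2)[OF XY(2)] X(1,2) unfolding weight_def X(3) by auto
  have "\<alpha>1 (cof X) = 0" using e[OF w(1)] H'(2) by (simp add: complex_eq_iff)
  moreover have "\<alpha>2 (cof X) = \<i>" using e[OF w(2)] H'(3) by (simp add: complex_eq_iff)
  ultimately show ?thesis using X(1) by blast
qed

end

section \<open>The three structures\<close>

lemma i_mult_i: "(\<i> * x) * (\<i> * y) = - (x * y)"
  by (simp add: complex_eq_iff algebra_simps)

locale g2_flag = g2_data U T \<alpha>1 \<alpha>2 for U T :: "(real^'n^'n) set" and \<alpha>1 \<alpha>2 +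
  fixes K :: "(real^'n^'n) set" and H0 :: "real^'n^'n"
  assumes K: "flag_isotropy_group U T {\<alpha>1, (\<lambda>H. - \<alpha>1 H)} K"
    and H0: "H0 \<in> lie_algebra T" "\<alpha>1 (cof H0) = 0" "\<alpha>2 (cof H0) = \<i>"
begin

lemma K_group: "subgroup K GL" "K \<subseteq> U" "closed K" "connected K"
  using K by (auto simp: flag_isotropy_group_def)

sublocale K: compact_matrix_group K
proof (rule compact_matrix_groupI[OF K_group(1)])
  show "compact K" using compact_Int_closed[OF U.compact K_group(3)] K_group(2) by (simp add: Int_absorb1)
qed

abbreviation "\<kk> \<equiv> complexification (lie_algebra K)"
lemmas \<kk>_closed = complexification_closed[OF K.subspace_lie_algebra]

lemma cof_\<kk>: "cof X \<in> \<kk> \<longleftrightarrow> X \<in> lie_algebra K"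
  by (rule cof_mem_complexification[OF K.subspace_lie_algebra])

lemma \<kk>_eq: "Z \<in> \<kk> \<longleftrightarrow> (\<exists>H\<in>\<hh>. \<exists>X\<in>rsg 1 0. \<exists>Y\<in>rsg (-1) 0. Z = H + X + Y)"
proof -
  have r: "rsg 1 0 = rs \<alpha>1" "rsg (-1) 0 = rs (\<lambda>H. - \<alpha>1 H)" using rt_simps(1) rt_simps(4)[of 1 0] by auto
  have ne: "\<alpha>1 \<noteq> (\<lambda>H. - \<alpha>1 H)" using rt_inj(1)[of 1 0 "-1" 0] rt_simps(1) rt_simps(4)[of 1 0] by auto
  have eq: "\<kk> = {H + (\<Sum>\<beta>\<in>{\<alpha>1, (\<lambda>H. - \<alpha>1 H)}. Z \<beta>) | H Z. H \<in> \<hh> \<and> (\<forall>\<beta>\<in>{\<alpha>1, (\<lambda>H. - \<alpha>1 H)}. Z \<beta> \<in> rs \<beta>)}"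
    using K by (simp only: flag_isotropy_group_def)
  show ?thesis
  proof
    assume "Z \<in> \<kk>"
    then obtain H W where "H \<in> \<hh>" "\<forall>\<beta>\<in>{\<alpha>1, (\<lambda>H. - \<alpha>1 H)}. W \<beta> \<in> rs \<beta>" "Z = H + (\<Sum>\<beta>\<in>{\<alpha>1, (\<lambda>H. - \<alpha>1 H)}. W \<beta>)"
      unfolding eq by blast
    moreover from this have "Z = H + W \<alpha>1 + W (\<lambda>H. - \<alpha>1 H)" using ne by (simp add: add.assoc)
    ultimately show "\<exists>H\<in>\<hh>. \<exists>X\<in>rsg 1 0. \<exists>Y\<in>rsg (-1) 0. Z = H + X + Y" unfolding r by blast
  next
    assume "\<exists>H\<in>\<hh>. \<exists>X\<in>rsg 1 0. \<exists>Y\<in>rsg (-1) 0. Z = H + X + Y"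
    then obtain H X Y where h: "H \<in> \<hh>" "X \<in> rs \<alpha>1" "Y \<in> rs (\<lambda>H. - \<alpha>1 H)" "Z = H + X + Y" unfolding r by blast
    let ?W = "\<lambda>\<beta>. if \<beta> = \<alpha>1 then X else Y"
    have "Z = H + (\<Sum>\<beta>\<in>{\<alpha>1, (\<lambda>H. - \<alpha>1 H)}. ?W \<beta>)" using ne ne[symmetric] h(4) by (simp add: add.assoc)
    moreover have "\<forall>\<beta>\<in>{\<alpha>1, (\<lambda>H. - \<alpha>1 H)}. ?W \<beta> \<in> rs \<beta>" using h ne[symmetric] by simp
    ultimately show "Z \<in> \<kk>" unfolding eq using h(1) by blast
  qed
qed

lemma zero_\<hh>: "0 \<in> \<hh>"
  using cof_\<hh>[of 0] subspace_0[OF T.subspace_lie_algebra] by (simp add: cof_simps)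

lemma \<kk>_contains: "H \<in> \<hh> \<Longrightarrow> H \<in> \<kk>" "X \<in> rsg 1 0 \<Longrightarrow> X \<in> \<kk>" "Y \<in> rsg (-1) 0 \<Longrightarrow> Y \<in> \<kk>"
  using zero_\<hh> rs_closed(4) unfolding \<kk>_eq
  by (force intro: bexI[of _ H] bexI[of _ 0])+

abbreviation "D \<equiv> commutator (cof H0)"

definition gr :: "int \<Rightarrow> (complex^'n^'n) set" where
  "gr k = {Z \<in> \<gg>. D Z = cs (\<i> * of_int k) Z}"

lemma gr\<gg>: "Z \<in> gr k \<Longrightarrow> Z \<in> \<gg>" by (simp add: gr_def)

lemma D_\<gg>: "Z \<in> \<gg> \<Longrightarrow> D Z \<in> \<gg>"
  using cof_\<gg> lie_TU[OF H0(1)] by (auto intro: \<gg>_commutator)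

lemma rsg_gr: "Z \<in> rsg a b \<Longrightarrow> Z \<in> gr b"
  using cof_\<hh> H0 by (auto simp: gr_def rs_iff rt_def mult.commute)

lemma gr_commutator: "Z \<in> gr a \<Longrightarrow> W \<in> gr b \<Longrightarrow> commutator Z W \<in> gr (a + b)"
  using \<gg>_commutator by (auto simp: gr_def jacobi[of _ Z W] commutator_cs cs_add_left[symmetric] algebra_simps)

lemma gr_cs: "Z \<in> gr a \<Longrightarrow> cs c Z \<in> gr a"
  using \<gg>_closed(2) by (auto simp: gr_def commutator_cs cs_simps mult.commute)

lemma gr_cnj: assumes "Z \<in> gr a" shows "cnjM Z \<in> gr (- a)"
proof -
  have "D (cnjM Z) = cnjM (D Z)" by (simp add: commutator_cnjM cnjM_simps)
  then show ?thesis using assms \<gg>_closed(3) by (simp add: gr_def cnjM_simps)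
qed

lemma gr_distinct: "Z \<in> gr a \<Longrightarrow> Z \<in> gr b \<Longrightarrow> a \<noteq> b \<Longrightarrow> Z = 0"
  using cs_inject[of Z "\<i> * of_int a" "\<i> * of_int b"] by (auto simp: gr_def)

lemma gr_trace: assumes Z: "Z \<in> gr a" and W: "W \<in> gr b" and ab: "a + b \<noteq> 0" shows "trace (Z ** W) = 0"
proof -
  have "trace (D Z ** W) = - trace (Z ** D W)" by (rule trace_commutator)
  then have "(\<i> * of_int a) * trace (Z ** W) = - ((\<i> * of_int b) * trace (Z ** W))"
    using Z W by (simp add: gr_def cs_mmult cs_trace)
  then have "\<i> * (of_int (a + b) * trace (Z ** W)) = 0" by (simp add: algebra_simps)
  then show ?thesis using ab by (simp del: of_int_add)
qed

lemma \<kk>_gr: "Z \<in> \<kk> \<Longrightarrow> Z \<in> gr 0"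
proof -
  assume "Z \<in> \<kk>"
  then obtain H X Y where h: "H \<in> \<hh>" "X \<in> rsg 1 0" "Y \<in> rsg (-1) 0" "Z = H + X + Y" unfolding \<kk>_eq by blast
  obtain A B where AB: "A \<in> lie_algebra T" "B \<in> lie_algebra T" "H = cof A + cs \<i> (cof B)" using h(1) by (rule \<hh>E)
  have "D H = 0" unfolding AB(3)
    using lie_T_commute[OF H0(1) AB(1)] lie_T_commute[OF H0(1) AB(2)]
    by (simp add: commutator_simps commutator_cs commutator_cof[symmetric] cof_simps cs_simps)
  then have "H \<in> gr 0" using \<hh>_\<gg>[OF h(1)] by (simp add: gr_def cs_simps)
  then show "Z \<in> gr 0" using rsg_gr[OF h(2)] rsg_gr[OF h(3)] \<gg>_closed(1) unfolding h(4)
    by (auto simp: gr_def commutator_simps cs_simps)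
qed

lemma \<gg>_span: "\<gg> \<subseteq> span (\<hh> \<union> (\<Union>(a, b)\<in>L. rsg a b))"
proof -
  have "rs \<beta> \<subseteq> (\<Union>(a, b)\<in>L. rsg a b)" if \<beta>: "\<beta> \<in> roots U T" for \<beta>
  proof -
    obtain a b where "(a, b) \<in> L" "\<beta> = rt a b" using \<beta> roots_eq by auto
    then show ?thesis by blast
  qed
  then have "\<hh> \<union> (\<Union>\<beta>\<in>roots U T. rs \<beta>) \<subseteq> \<hh> \<union> (\<Union>(a, b)\<in>L. rsg a b)" by blast
  then show ?thesis using joint_span span_mono by blast
qed

text \<open>Induction form of the root space decomposition, with the Cartan subalgebra and the root
  spaces of degree 0 merged into the isotropy algebra.\<close>

lemma \<gg>_induct:
  assumes Z: "Z \<in> \<gg>" and P: "subspace {Z. P Z}" "\<And>Z. Z \<in> \<kk> \<Longrightarrow> P Z"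
    "\<And>a b Z. (a, b) \<in> L \<Longrightarrow> b \<noteq> 0 \<Longrightarrow> Z \<in> rsg a b \<Longrightarrow> P Z"
  shows "P Z"
proof -
  have "Z \<in> span (\<hh> \<union> (\<Union>(a, b)\<in>L. rsg a b))" using \<gg>_span Z by blast
  then show "P Z"
  proof (rule span_induct[OF _ P(1)])
    fix W assume "W \<in> \<hh> \<union> (\<Union>(a, b)\<in>L. rsg a b)"
    then show "P W"
    proof
      assume "W \<in> \<hh>" then show ?thesis by (intro P(2) \<kk>_contains)
    next
      assume "W \<in> (\<Union>(a, b)\<in>L. rsg a b)"
      then obtain a b where ab: "(a, b) \<in> L" "W \<in> rsg a b" by blast
      show ?thesis
      proof (cases "b = 0")
        case True
        then have "a = 1 \<or> a = -1" using ab(1) by (auto simp: L_def)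
        then show ?thesis using ab(2) True by (auto intro: P(2) \<kk>_contains)
      qed (use ab P(3) in blast)
    qed
  qed
qed

text \<open>\<open>damp j\<close> annihilates \<open>gr j\<close> and \<open>gr (- j)\<close>; composing these operators for \<open>j = 1, 2, 3\<close> leaves only
  the isotropy subalgebra.\<close>

definition damp :: "real \<Rightarrow> complex^'n^'n \<Rightarrow> complex^'n^'n" where
  "damp k Z = Z + cs (of_real (1 / k\<^sup>2)) (D (D Z))"

lemma damp_gr: assumes "Z \<in> gr j" shows "damp k Z = cs (of_real (1 - (of_int j)\<^sup>2 / k\<^sup>2)) Z"
proof -
  have "D (D Z) = cs ((\<i> * of_int j) * (\<i> * of_int j)) Z" using assms by (simp add: gr_def commutator_cs cs_simps)
  also have "(\<i> * of_int j) * (\<i> * of_int j) = - of_real ((of_int j)\<^sup>2)"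
    by (simp only: i_mult_i) (simp add: power2_eq_square)
  finally have "damp k Z = cs 1 Z + cs (of_real (1 / k\<^sup>2) * - of_real ((of_int j)\<^sup>2)) Z"
    by (simp add: damp_def cs_simps)
  then show ?thesis by (simp add: cs_add_left[symmetric])
qed

lemma damp_simps: "damp k (A + B) = damp k A + damp k B" "damp k (cs c A) = cs c (damp k A)" "damp k 0 = 0"
  by (simp_all add: damp_def commutator_simps commutator_cs cs_simps mult.commute)

definition Damp where "Damp Z = damp 1 (damp 2 (damp 3 Z))"

lemma Damp_gr: "Z \<in> gr j \<Longrightarrow> Damp Z = cs (of_real ((1 - (of_int j)\<^sup>2) * (1 - (of_int j)\<^sup>2 / 4) * (1 - (of_int j)\<^sup>2 / 9))) Z"
  unfolding Damp_def by (simp add: damp_gr damp_simps cs_simps mult_ac)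

lemma Damp_\<kk>: "Z \<in> \<gg> \<Longrightarrow> Damp Z \<in> \<kk>"
proof (erule \<gg>_induct)
  show "subspace {Z. Damp Z \<in> \<kk>}"
    using \<kk>_closed subspace_0[OF subspace_complexification[OF K.subspace_lie_algebra]]
    by (auto simp: subspace_def Damp_def damp_simps cs_simps(9))
  show "Damp Z \<in> \<kk>" if "Z \<in> \<kk>" for Z using Damp_gr[OF \<kk>_gr[OF that]] that by (simp add: cs_simps)
  show "Damp Z \<in> \<kk>" if "(a, b) \<in> L" "b \<noteq> 0" "Z \<in> rsg a b" for a b Z
  proof -
    have "b \<in> {-3, -2, -1, 1, 2, 3}" using that(1,2) by (auto simp: L_def)
    then have "Damp Z = 0" unfolding Damp_gr[OF rsg_gr[OF that(3)]] by (auto simp: cs_simps)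
    then show ?thesis using subspace_0[OF subspace_complexification[OF K.subspace_lie_algebra]] by simp
  qed
qed

text \<open>\<open>Damp\<close> maps all of \<open>\<gg>\<close> into \<open>\<kk>\<close> and is
  the identity in degree 0. This identifies the centraliser of \<open>H0\<close> in
  \<open>\<gg>\<close> with the isotropy algebra.\<close>

lemma gr_0: "Z \<in> gr 0 \<longleftrightarrow> Z \<in> \<kk>"
  using \<kk>_gr[of Z] Damp_\<kk>[of Z] gr\<gg>[of Z 0] Damp_gr[of Z 0] by (auto simp: cs_simps)

text \<open>\<open>Damp Z\<close> has degree 0, but it is also a nonzero multiple of
  \<open>Z\<close>, which has degree \<open>k\<close>.\<close>

lemma gr_large: assumes Z: "Z \<in> gr k" and k: "k > 3 \<or> k < -3" shows "Z = 0"
proof -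
  have k2: "(of_int k)\<^sup>2 > (9 :: real)"
  proof -
    have "\<bar>k\<bar> \<ge> 4" using k by auto
    then have "\<bar>real_of_int k\<bar> \<ge> 4" by linarith
    then have "\<bar>real_of_int k\<bar>\<^sup>2 \<ge> 4\<^sup>2" by (intro power_mono) auto
    then show ?thesis by simp
  qed
  let ?c = "(1 - (of_int k)\<^sup>2) * (1 - (of_int k)\<^sup>2 / 4) * (1 - (of_int k)\<^sup>2 / 9) :: real"
  have "cs (of_real ?c) Z \<in> gr 0" using Damp_\<kk>[OF gr\<gg>[OF Z]] Damp_gr[OF Z] gr_0 by simp
  moreover have "cs (of_real ?c) Z \<in> gr k" by (rule gr_cs[OF Z])
  ultimately have "cs (of_real ?c) Z = 0" using k by (intro gr_distinct[of _ 0 k]) auto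
  moreover have "complex_of_real ?c \<noteq> 0" using k2 by (simp only: of_real_eq_0_iff) simp
  ultimately show ?thesis unfolding cs_eq_0_iff by blast
qed

lemma lie_K_commutes_H0: "X \<in> lie_algebra K \<Longrightarrow> commutator H0 X = 0"
proof -
  assume "X \<in> lie_algebra K"
  then have "cof X \<in> gr 0" using cof_\<kk> gr_0 by blast
  then have "cof (commutator H0 X) + cs \<i> (cof 0) = cof 0 + cs \<i> (cof 0)" by (simp add: gr_def cs_simps commutator_cof cof_simps)
  then show ?thesis by (rule cof_decomp_unique(1))
qed

text \<open>Connectedness of \<open>K\<close> lifts the vanishing of brackets with \<open>H0\<close>
  to the group; the condition on the Lie algebra is the content of \<open>gr_0\<close>.\<close>

sublocale O: orbit U K H0
proof
  show "K \<subseteq> U" by (rule K_group)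
  show "k ** H0 = H0 ** k" if "k \<in> K" for k
  proof (rule K.centralizes[OF K_group(4) _ that])
    show "X ** H0 = H0 ** X" if "X \<in> lie_algebra K" for X
      using lie_K_commutes_H0[OF that] by (simp add: commutator_def)
  qed
  show "X \<in> lie_algebra K" if "X \<in> lie_algebra U" "commutator X H0 = 0" for X
  proof -
    have "commutator H0 X = 0" using that(2) commutator_anti[of H0 X] by simp
    then have "D (cof X) = 0" by (simp add: commutator_cof[symmetric] cof_simps)
    then have "cof X \<in> gr 0" using cof_\<gg> that(1) by (simp add: gr_def cs_simps)
    then show ?thesis using gr_0 cof_\<kk> by blast
  qed
qed

end

section \<open>Structures for a choice of signs\<close>

locale g2_signs = g2_flag U T \<alpha>1 \<alpha>2 K H0 for U T :: "(real^'n^'n) set" and \<alpha>1 \<alpha>2 K H0 +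
  fixes e1 e2 e3 :: real
  assumes signs: "e1\<^sup>2 = 1" "e2\<^sup>2 = 1" "e3\<^sup>2 = 1"
begin

text \<open>The coefficients solve the interpolation problem \<open>e k = e\<^sub>k\<close> for \<open>k = 1, 2, 3\<close> with an odd polynomial
  of degree 5; the almost complex structure is then the corresponding polynomial in \<open>ad H0\<close>, with
  alternating signs because \<open>ad H0\<close> acts as \<open>i k\<close>.\<close>

definition p5 :: real where "p5 = (5 * e1 - 4 * e2 + e3) / 120"
definition p3 :: real where "p3 = 5 * p5 - (e2 / 2 - e1) / 3"
definition p1 :: real where "p1 = e1 + p3 - p5"

definition e :: "int \<Rightarrow> real" where "e k = p1 * of_int k - p3 * of_int k ^ 3 + p5 * of_int k ^ 5"

lemma e_values: "e 0 = 0" "e 1 = e1" "e 2 = e2" "e 3 = e3" "e (-1) = - e1" "e (-2) = - e2" "e (-3) = - e3"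
  by (simp_all add: e_def p1_def p3_def p5_def field_simps)

abbreviation "d \<equiv> commutator H0"

text \<open>As a real polynomial in \<open>ad H0\<close> this preserves \<open>lie_algebra U\<close>
  and commutes with conjugation by \<open>K\<close>, which fixes \<open>H0\<close>. Its values on
  root vectors are computed in the complexified version \<open>JC\<close>.\<close>

definition J0 :: "real^'n^'n \<Rightarrow> real^'n^'n" where
  "J0 A = p1 *\<^sub>R d A + p3 *\<^sub>R d (d (d A)) + p5 *\<^sub>R d (d (d (d (d A))))"

definition JC :: "complex^'n^'n \<Rightarrow> complex^'n^'n" where
  "JC Z = cs (of_real p1) (D Z) + cs (of_real p3) (D (D (D Z))) + cs (of_real p5) (D (D (D (D (D Z)))))"

lemma cof_J0: "cof (J0 A) = JC (cof A)"
  by (simp add: J0_def JC_def cof_simps commutator_cof)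

lemma JC_simps: "JC (A + B) = JC A + JC B" "JC (A - B) = JC A - JC B" "JC (cs c A) = cs c (JC A)"
  by (simp_all add: JC_def commutator_simps commutator_cs cs_simps mult.commute algebra_simps)

lemma JC_gr: assumes "Z \<in> gr k" shows "JC Z = cs (\<i> * of_real (e k)) Z"
proof -
  let ?x = "\<i> * of_int k :: complex"
  have D: "D (cs c Z) = cs (c * ?x) Z" for c using assms by (simp add: gr_def commutator_cs cs_simps)
  have D1: "D Z = cs ?x Z" using assms by (simp add: gr_def)
  have "JC Z = cs (of_real p1 * ?x + of_real p3 * (?x * ?x * ?x) + of_real p5 * (?x * ?x * ?x * ?x * ?x)) Z"
    unfolding JC_def D1 D cs_simps cs_add_left ..
  also have "of_real p1 * ?x + of_real p3 * (?x * ?x * ?x) + of_real p5 * (?x * ?x * ?x * ?x * ?x) = \<i> * of_real (e k)"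
  proof -
    have "?x * ?x = - (of_int k * of_int k)" by (rule i_mult_i)
    then have "?x * ?x * ?x = - (\<i> * of_int k ^ 3)" "?x * ?x * ?x * ?x * ?x = \<i> * of_int k ^ 5"
      by (simp_all only: mult.assoc[of "?x * ?x" ?x ?x, symmetric] mult.assoc[of "_ * _" "?x * ?x", symmetric])
        (simp_all add: power3_eq_cube numeral_eq_Suc mult_ac)
    then show ?thesis by (simp add: e_def algebra_simps)
  qed
  finally show ?thesis .
qed

lemma JC_\<gg>: "Z \<in> \<gg> \<Longrightarrow> JC Z \<in> \<gg>"
  unfolding JC_def by (intro \<gg>_closed(1) \<gg>_closed(2) D_\<gg>)

lemma JC_square: "Z \<in> \<gg> \<Longrightarrow> JC (JC Z) + Z \<in> \<kk>"
proof (erule \<gg>_induct)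
  show "subspace {Z. JC (JC Z) + Z \<in> \<kk>}"
  proof (rule subspaceI)
    show "0 \<in> {Z. JC (JC Z) + Z \<in> \<kk>}"
      using \<kk>_contains(1)[OF zero_\<hh>] by (simp add: JC_def commutator_simps cs_simps)
    show "A + B \<in> {Z. JC (JC Z) + Z \<in> \<kk>}" if "A \<in> {Z. JC (JC Z) + Z \<in> \<kk>}" "B \<in> {Z. JC (JC Z) + Z \<in> \<kk>}" for A B
    proof -
      have "JC (JC (A + B)) + (A + B) = (JC (JC A) + A) + (JC (JC B) + B)" by (simp add: JC_simps)
      then show ?thesis using that by (simp only: mem_Collect_eq \<kk>_closed(1))
    qed
    show "c *\<^sub>R A \<in> {Z. JC (JC Z) + Z \<in> \<kk>}" if "A \<in> {Z. JC (JC Z) + Z \<in> \<kk>}" for c A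
      using that \<kk>_closed(2) by (simp add: cs_simps(9) JC_simps cs_simps(1)[symmetric])
  qed
  fix Z assume Z: "Z \<in> \<kk>"
  have "JC Z = 0" using JC_gr[OF \<kk>_gr[OF Z]] by (simp add: e_values cs_simps)
  then show "JC (JC Z) + Z \<in> \<kk>" using Z by (simp add: JC_def commutator_simps cs_simps)
next
  fix a b Z assume ab: "(a, b) \<in> L" "b \<noteq> 0" "Z \<in> rsg a b"
  have "b \<in> {-3, -2, -1, 1, 2, 3}" using ab(1,2) by (auto simp: L_def)
  then have "e b * e b = 1" using signs by (auto simp: e_values power2_eq_square)
  moreover have "JC (JC Z) = cs (- of_real (e b * e b)) Z"
    by (simp add: JC_gr[OF rsg_gr[OF ab(3)]] JC_simps cs_simps i_mult_i)
  ultimately have "JC (JC Z) + Z = 0" by (simp add: cs_simps)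
  then show "JC (JC Z) + Z \<in> \<kk>" using \<kk>_contains(1)[OF zero_\<hh>] by simp
qed

sublocale S: orbit_acs U K H0 J0
proof (rule orbit_acs.intro[OF O.orbit_axioms orbit_acs_axioms.intro])
  have d: "d (c *\<^sub>R A) = c *\<^sub>R d A" for c A
    by (simp add: commutator_def bounded_bilinear.scaleR_left[OF bounded_bilinear_matrix_matrix_mult]
        bounded_bilinear.scaleR_right[OF bounded_bilinear_matrix_matrix_mult] scaleR_diff_right)
  show "linear J0" unfolding J0_def
    by (intro linearI) (simp_all add: commutator_simps d algebra_simps)
  show J0m: "J0 A \<in> lie_algebra U" if "A \<in> lie_algebra U" for A
    using JC_\<gg>[of "cof A"] that cof_\<gg> by (simp add: cof_J0[symmetric])
  show "J0 A = 0" if "A \<in> lie_algebra K" for A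
    using lie_K_commutes_H0[OF that] by (simp add: J0_def commutator_simps)
  show "J0 (J0 A) + A \<in> lie_algebra K" if "A \<in> lie_algebra U" for A
    using JC_square[of "cof A"] that cof_\<gg> cof_\<kk>[of "J0 (J0 A) + A"] by (simp add: cof_J0 cof_simps)
  fix k A assume k: "k \<in> K"
  have i: "invertible k" using K.invertible_mem k .
  have "d (k ** A ** matrix_inv k) = k ** d A ** matrix_inv k" for A
  proof -
    have c: "H0 ** k = k ** H0" using O.K_centralizes[OF k] by simp
    have c': "matrix_inv k ** H0 = H0 ** matrix_inv k"
      using O.K_centralizes[OF K.inv_mem[OF k]] .
    have "H0 ** (k ** A ** matrix_inv k) = k ** (H0 ** A) ** matrix_inv k" by (simp add: matrix_mul_assoc c)
    moreover have "k ** A ** matrix_inv k ** H0 = k ** (A ** H0) ** matrix_inv k"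
      using c' by (metis matrix_mul_assoc)
    ultimately show ?thesis by (simp add: commutator_def mmult_distrib)
  qed
  then show "J0 (k ** A ** matrix_inv k) = k ** J0 A ** matrix_inv k"
    by (simp add: J0_def mmult_distrib bounded_bilinear.scaleR_left[OF bounded_bilinear_matrix_matrix_mult]
      bounded_bilinear.scaleR_right[OF bounded_bilinear_matrix_matrix_mult])
qed

definition TC :: "complex^'n^'n \<Rightarrow> complex^'n^'n \<Rightarrow> complex^'n^'n" where
  "TC Z W = commutator (JC Z) (JC W) - JC (commutator (JC Z) W) - JC (commutator Z (JC W)) - commutator Z W"

lemma cof_torsion: "cof (S.torsion A B) = TC (cof A) (cof B)"
  by (simp add: S.torsion_def TC_def cof_simps commutator_cof cof_J0)

lemma TC_simps: "TC (A + B) C = TC A C + TC B C" "TC A (B + C) = TC A B + TC A C"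
  "TC (cs c A) B = cs c (TC A B)" "TC A (cs c B) = cs c (TC A B)"
  by (simp_all add: TC_def JC_simps commutator_simps commutator_cs cs_simps)

definition coef :: "int \<Rightarrow> int \<Rightarrow> real" where
  "coef a b = - e a * e b + (e a + e b) * e (a + b) - 1"

lemma TC_gr: assumes Z: "Z \<in> gr a" and W: "W \<in> gr b" shows "TC Z W = cs (of_real (coef a b)) (commutator Z W)"
proof -
  have "TC Z W = cs ((\<i> * of_real (e a)) * (\<i> * of_real (e b)) - (\<i> * of_real (e a)) * (\<i> * of_real (e (a + b)))
      - (\<i> * of_real (e b)) * (\<i> * of_real (e (a + b))) - 1) (commutator Z W)"
    unfolding TC_def JC_gr[OF Z] JC_gr[OF W] commutator_cs JC_simps JC_gr[OF gr_commutator[OF Z W]]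
    by (simp add: cs_simps cs_add_left mult.commute mult.left_commute)
  also have "(\<i> * of_real (e a)) * (\<i> * of_real (e b)) - (\<i> * of_real (e a)) * (\<i> * of_real (e (a + b)))
      - (\<i> * of_real (e b)) * (\<i> * of_real (e (a + b))) - 1 = of_real (coef a b)"
    by (simp add: coef_def algebra_simps)
  finally show ?thesis .
qed

text \<open>\<open>TC\<close> is bilinear, so each argument can be decomposed by
  \<open>\<gg>_induct\<close>; on homogeneous elements the torsion is \<open>coef\<close> times the
  bracket.\<close>

lemma TC_induct:
  assumes V: "subspace V" and gen: "\<And>a b Z W. a \<in> {-3..3} \<Longrightarrow> b \<in> {-3..3} \<Longrightarrow> Z \<in> gr a \<Longrightarrow> W \<in> gr b \<Longrightarrow>
      cs (of_real (coef a b)) (commutator Z W) \<in> V"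
    and Z: "Z \<in> \<gg>" and W: "W \<in> \<gg>"
  shows "TC Z W \<in> V"
proof -
  have T0: "TC 0 Y = 0" "TC Y 0 = 0" for Y
    using TC_simps(3)[of 0 0 Y] TC_simps(4)[of Y 0 0] by (simp_all add: cs_simps)
  have rng: "b \<in> {-3..3}" if "(a, b) \<in> L" for a b using that by (auto simp: L_def)
  have 1: "TC Z W \<in> V" if ZW: "Z \<in> gr a" "a \<in> {-3..3}" "W \<in> \<gg>" for Z a W
    using ZW(3)
  proof (rule \<gg>_induct)
    show "subspace {W. TC Z W \<in> V}"
      using V by (auto simp: subspace_def TC_simps T0 cs_simps(9))
    show "TC Z W \<in> V" if "W \<in> \<kk>" for W
      unfolding TC_gr[OF ZW(1) \<kk>_gr[OF that]] using ZW \<kk>_gr[OF that] by (intro gen) auto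
    show "TC Z W \<in> V" if "(a, b) \<in> L" "b \<noteq> 0" "W \<in> rsg a b" for a b W
      unfolding TC_gr[OF ZW(1) rsg_gr[OF that(3)]] using ZW rsg_gr[OF that(3)] rng[OF that(1)] by (intro gen) auto
  qed
  show ?thesis using Z
  proof (rule \<gg>_induct)
    show "subspace {Z. TC Z W \<in> V}"
      using V by (auto simp: subspace_def TC_simps T0 cs_simps(9))
    show "TC Z W \<in> V" if "Z \<in> \<kk>" for Z using 1[OF \<kk>_gr[OF that] _ W] by simp
    show "TC Z W \<in> V" if "(a, b) \<in> L" "b \<noteq> 0" "Z \<in> rsg a b" for a b Z
      using 1[OF rsg_gr[OF that(3)] rng[OF that(1)] W] .
  qed
qed

text \<open>Complex bilinearity of \<open>TC\<close> transfers information on real torsion values to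
  the complexification, so that single root vectors may be inserted.\<close>

lemma TC_of_torsion:
  assumes V: "\<And>X Y. X \<in> V \<Longrightarrow> Y \<in> V \<Longrightarrow> X + Y \<in> V" "\<And>c X. X \<in> V \<Longrightarrow> cs c X \<in> V"
    and t: "\<And>A B. A \<in> lie_algebra U \<Longrightarrow> B \<in> lie_algebra U \<Longrightarrow> cof (S.torsion A B) \<in> V"
    and Z: "Z \<in> \<gg>" and W: "W \<in> \<gg>"
  shows "TC Z W \<in> V"
proof -
  obtain X Y where X: "X \<in> lie_algebra U" "Y \<in> lie_algebra U" "Z = cof X + cs \<i> (cof Y)" using Z by (rule complexificationE)
  obtain X' Y' where X': "X' \<in> lie_algebra U" "Y' \<in> lie_algebra U" "W = cof X' + cs \<i> (cof Y')" using W by (rule complexificationE)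
  show ?thesis unfolding X(3) X'(3) TC_simps
    using t[unfolded cof_torsion] X(1,2) X'(1,2) by (intro V) auto
qed

lemma coef_values:
  "coef 1 2 = - e1 * e2 + (e1 + e2) * e3 - 1" "coef (-1) 3 = e1 * e3 + (e3 - e1) * e2 - 1"
  "coef (-2) 3 = e2 * e3 + (e3 - e2) * e1 - 1" "coef 1 1 = - e1 * e1 + 2 * e1 * e2 - 1"
  by (simp_all add: coef_def e_values algebra_simps)

text \<open>A nonzero torsion value of degree \<open>b + k \<noteq> 0\<close> cannot lie in the
  isotropy algebra, which has degree 0.\<close>

lemma not_torsion_free_signs:
  assumes x: "x \<in> rsg a b" and y: "y \<in> rsg c k" and ne: "commutator x y \<noteq> 0" "coef b k \<noteq> 0" "b + k \<noteq> 0"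
  shows "\<not> O.A.torsion_free S.J"
proof -
  have "\<exists>A\<in>lie_algebra U. \<exists>B\<in>lie_algebra U. S.torsion A B \<notin> lie_algebra K"
  proof (rule ccontr)
    assume "\<not> ?thesis"
    then have "cof (S.torsion A B) \<in> \<kk>" if "A \<in> lie_algebra U" "B \<in> lie_algebra U" for A B using that cof_\<kk> by blast
    then have "TC x y \<in> \<kk>"
      using x y by (intro TC_of_torsion[where V = \<kk>] \<kk>_closed) (auto simp: rs_iff)
    then have "TC x y \<in> gr 0" by (rule \<kk>_gr)
    moreover have "TC x y \<in> gr (b + k)"
      unfolding TC_gr[OF rsg_gr[OF x] rsg_gr[OF y]] by (intro gr_cs gr_commutator rsg_gr[OF x] rsg_gr[OF y])
    ultimately have "TC x y = 0" using ne(3) by (intro gr_distinct[of _ 0 "b + k"]) auto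
    then show False using ne unfolding TC_gr[OF rsg_gr[OF x] rsg_gr[OF y]] cs_eq_0_iff by simp
  qed
  then show ?thesis using S.not_torsion_freeI by blast
qed

lemma torsion_free_signs: assumes "e1 = 1" "e2 = 1" "e3 = 1" shows "O.A.torsion_free S.J"
proof (rule S.torsion_freeI)
  fix A B assume A: "A \<in> lie_algebra U" and B: "B \<in> lie_algebra U"
  have "TC (cof A) (cof B) \<in> \<kk>"
  proof (rule TC_induct[OF subspace_complexification[OF K.subspace_lie_algebra]])
    fix a b :: int and Z W assume ab: "a \<in> {-3..3}" "b \<in> {-3..3}" and Z: "Z \<in> gr a" and W: "W \<in> gr b"
    note c = gr_commutator[OF Z W]
    \<comment> \<open>Degree 0 is the isotropy algebra and degrees beyond 3 are zero, so
      \<open>coef\<close> has to vanish only for finitely many pairs.\<close>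
    consider "a + b = 0" | "a + b > 3 \<or> a + b < -3" | "a + b \<noteq> 0" "- 3 \<le> a + b" "a + b \<le> 3" by linarith
    then show "cs (of_real (coef a b)) (commutator Z W) \<in> \<kk>"
    proof cases
      case 1
      then show ?thesis using c gr_0 \<kk>_closed(2) by simp
    next
      case 2
      then have "commutator Z W = 0" by (rule gr_large[OF c])
      then show ?thesis using \<kk>_contains(1)[OF zero_\<hh>] by (simp add: cs_simps)
    next
      case 3
      have "a = -3 \<or> a = -2 \<or> a = -1 \<or> a = 0 \<or> a = 1 \<or> a = 2 \<or> a = 3" "b = -3 \<or> b = -2 \<or> b = -1 \<or> b = 0 \<or> b = 1 \<or> b = 2 \<or> b = 3"
        using ab by auto
      then have "coef a b = 0" using 3 by (elim disjE) (simp_all add: coef_def e_values, (simp_all add: assms)?)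
      then show ?thesis using \<kk>_contains(1)[OF zero_\<hh>] by (simp add: cs_simps)
    qed
  qed (use A B cof_\<gg> in auto)
  then show "S.torsion A B \<in> lie_algebra K" using cof_\<kk> cof_torsion by metis
qed

text \<open>The trace form pairs degree \<open>a\<close> only with degree \<open>- a\<close>.
  Pairing with the real element \<open>w = z + cnjM z\<close>, of degrees 3 and -3, kills the
  isotropy algebra and all torsion values, as \<open>coef a b = 0\<close> whenever
  \<open>a + b\<close> is 3 or -3; at \<open>w\<close> itself it is nonzero by
  \<open>trace_square_neg\<close>.\<close>

lemma not_torsion_full_signs: assumes "e1 = 1" "e2 = -1" "e3 = 1" shows "\<not> O.A.torsion_full S.J"
proof -
  obtain z where z: "z \<in> rsg 1 3" "z \<noteq> 0" using root_vector[OF rt_root, of 1 3] by (auto simp: L_def)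
  have zg: "z \<in> gr 3" by (rule rsg_gr[OF z(1)])
  have zc: "cnjM z \<in> gr (-3)" using gr_cnj[OF zg] by simp
  obtain X Y where X: "X \<in> lie_algebra U" "Y \<in> lie_algebra U" "z = cof X + cs \<i> (cof Y)"
    using gr\<gg>[OF zg] by (rule complexificationE)
  define w where "w = 2 *\<^sub>R X"
  have w: "w \<in> lie_algebra U" unfolding w_def using X(1) U.subspace_lie_algebra by (intro subspace_scale)
  have cw: "cof w = z + cnjM z"
    unfolding w_def X(3) by (simp add: vec_eq_iff complex_eq_iff)
  have w0: "w \<noteq> 0"
  proof
    assume "w = 0"
    then have "z = cs (-1) (cnjM z)" using cw by (simp add: cof_simps cs_simps eq_neg_iff_add_eq_0)
    then have "z \<in> gr (-3)" using gr_cs[OF zc] by metis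
    then show False using gr_distinct[OF zg, of "-3"] z(2) by simp
  qed
  define \<xi> where "\<xi> A = trace (A ** w)" for A
  have c: "of_real (\<xi> A) = trace (cof A ** cof w)" for A
    by (simp add: \<xi>_def cof_simps[symmetric])
  have tz: "trace (Y ** cof w) = 0" if "Y \<in> gr k" "k \<noteq> 3" "k \<noteq> -3" for Y k
    using gr_trace[OF that(1) zg] gr_trace[OF that(1) zc] that(2,3) by (simp add: cw mmult_distrib trace_linear)
  show ?thesis
  proof (rule S.not_torsion_fullI[of \<xi> w])
    show "linear \<xi>" unfolding \<xi>_def
      by (intro linearI) (simp_all add: mmult_distrib trace_linear bounded_bilinear.scaleR_left[OF bounded_bilinear_matrix_matrix_mult],
        simp add: trace_def sum_distrib_left)
    show "\<xi> A = 0" if "A \<in> lie_algebra K" for A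
      using tz[of "cof A" 0] c[of A] that cof_\<kk> gr_0 by simp
    show "\<xi> (S.torsion A B) = 0" if AB: "A \<in> lie_algebra U" "B \<in> lie_algebra U" for A B
    proof -
      have "TC (cof A) (cof B) \<in> {Y. trace (Y ** cof w) = 0}"
      proof (rule TC_induct)
        show "subspace {Y. trace (Y ** cof w) = 0}"
          by (auto simp: subspace_def mmult_distrib trace_linear cs_simps(9) cs_mmult cs_trace)
        fix a b :: int and Z W assume ab: "a \<in> {-3..3}" "b \<in> {-3..3}" and Z: "Z \<in> gr a" and W: "W \<in> gr b"
        have "coef a b = 0" if "a + b = 3 \<or> a + b = -3"
        proof -
          have "a = -3 \<or> a = -2 \<or> a = -1 \<or> a = 0 \<or> a = 1 \<or> a = 2 \<or> a = 3" "b = -3 \<or> b = -2 \<or> b = -1 \<or> b = 0 \<or> b = 1 \<or> b = 2 \<or> b = 3"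
            using ab by auto
          then show ?thesis using that by (elim disjE) (simp_all add: coef_def e_values, (simp_all add: assms)?)
        qed
        then show "cs (of_real (coef a b)) (commutator Z W) \<in> {Y. trace (Y ** cof w) = 0}"
          using tz[OF gr_commutator[OF Z W]] by (auto simp: cs_mmult cs_trace)
      qed (use AB cof_\<gg> in auto)
      then show ?thesis using c[of "S.torsion A B"] by (simp add: cof_torsion)
    qed
    show "w \<in> lie_algebra U" by (rule w)
    show "\<xi> w \<noteq> 0" using U.trace_square_neg[OF w w0] by (simp add: \<xi>_def)
  qed
qed

text \<open>\<open>V\<close>, the complexified kernel of \<open>\<xi>\<close>, contains the isotropy
  algebra and all torsion values. For these signs \<open>coef\<close> is nonzero at 1 + 2 = 3, -1 +
  3 = 2 and -2 + 3 = 1, so every root space of positive degree receives a nonzero torsion value;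
  conjugation treats the negative degrees.\<close>

lemma torsion_full_signs: assumes "e1 = 1" "e2 = 1" "e3 = -1" shows "O.A.torsion_full S.J"
proof (rule S.torsion_fullI)
  fix \<xi> :: "real^'n^'n \<Rightarrow> real" and A
  assume \<xi>: "linear \<xi>" "\<And>A. A \<in> lie_algebra K \<Longrightarrow> \<xi> A = 0"
    "\<And>A B. A \<in> lie_algebra U \<Longrightarrow> B \<in> lie_algebra U \<Longrightarrow> \<xi> (S.torsion A B) = 0" and A: "A \<in> lie_algebra U"
  define V where "V = {cof X + cs \<i> (cof Y) | X Y. \<xi> X = 0 \<and> \<xi> Y = 0}"
  have VI: "Z \<in> V" if "Z = cof X + cs \<i> (cof Y)" "\<xi> X = 0" "\<xi> Y = 0" for X Y Z using that by (auto simp: V_def)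
  have \<xi>l: "\<xi> (X + Y) = \<xi> X + \<xi> Y" "\<xi> (X - Y) = \<xi> X - \<xi> Y" "\<xi> (r *\<^sub>R X) = r * \<xi> X" "\<xi> (- X) = - \<xi> X" "\<xi> 0 = 0" for X Y r
    using \<xi>(1) by (simp_all add: linear_add linear_diff linear_cmul linear_neg linear_0)
  have Vadd: "Z + W \<in> V" if ZW: "Z \<in> V" "W \<in> V" for Z W
  proof -
    obtain X Y X' Y' where h: "Z = cof X + cs \<i> (cof Y)" "W = cof X' + cs \<i> (cof Y')" "\<xi> X = 0" "\<xi> Y = 0" "\<xi> X' = 0" "\<xi> Y' = 0"
      using ZW unfolding V_def by blast
    show ?thesis by (rule VI[of _ "X + X'" "Y + Y'"]) (simp_all add: h \<xi>l cof_simps cs_simps)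
  qed
  have Vcs: "cs c Z \<in> V" if ZV: "Z \<in> V" for c Z
  proof -
    obtain X Y where h: "Z = cof X + cs \<i> (cof Y)" "\<xi> X = 0" "\<xi> Y = 0" using ZV unfolding V_def by blast
    show ?thesis
    proof (rule VI)
      show "cs c Z = cof (Re c *\<^sub>R X - Im c *\<^sub>R Y) + cs \<i> (cof (Im c *\<^sub>R X + Re c *\<^sub>R Y))"
        by (simp add: h(1) vec_eq_iff complex_eq_iff)
    qed (simp_all add: h \<xi>l)
  qed
  have Vcnj: "cnjM Z \<in> V" if ZV: "Z \<in> V" for Z
  proof -
    obtain X Y where h: "Z = cof X + cs \<i> (cof Y)" "\<xi> X = 0" "\<xi> Y = 0" using ZV unfolding V_def by blast
    show ?thesis by (rule VI[of _ X "- Y"]) (simp_all add: h \<xi>l cof_simps cnjM_simps cs_simps cs_add_left)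
  qed
  have cofV: "cof X \<in> V \<longleftrightarrow> \<xi> X = 0" for X
  proof
    assume "cof X \<in> V"
    then obtain X' Y' where "cof X = cof X' + cs \<i> (cof Y')" "\<xi> X' = 0" unfolding V_def by blast
    then show "\<xi> X = 0" using cof_decomp_unique(1)[of X 0 X' Y'] by (simp add: cof_simps cs_simps)
  qed (rule VI[of _ X 0], simp_all add: \<xi>l cof_simps cs_simps)
  have \<kk>V: "Z \<in> V" if ZK: "Z \<in> \<kk>" for Z
  proof -
    obtain X Y where "X \<in> lie_algebra K" "Y \<in> lie_algebra K" "Z = cof X + cs \<i> (cof Y)" using ZK by (rule complexificationE)
    then show ?thesis using \<xi>(2) by (intro VI[of Z X Y]) auto
  qed
  have TV: "TC Z W \<in> V" if "Z \<in> \<gg>" "W \<in> \<gg>" for Z W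
    by (rule TC_of_torsion[OF Vadd Vcs _ that]) (simp_all add: cofV \<xi>(3))
  \<comment> \<open>Since the root space is one-dimensional, a single nonzero torsion value in it
    puts all of it into \<open>V\<close>.\<close>
  have br: "W \<in> V" if Z: "Z1 \<in> rsg a b" "Z2 \<in> rsg c k" and ne: "commutator Z1 Z2 \<noteq> 0" "coef b k \<noteq> 0"
      and W: "W \<in> rsg (a + c) (b + k)" "(a + c, b + k) \<in> L" for W Z1 Z2 a b c k
  proof -
    have "cs (of_real (coef b k)) (commutator Z1 Z2) \<in> V"
      using TV[of Z1 Z2] TC_gr[OF rsg_gr[OF Z(1)] rsg_gr[OF Z(2)]] gr\<gg> rsg_gr Z by metis
    then have "cs (of_real (1 / coef b k)) (cs (of_real (coef b k)) (commutator Z1 Z2)) \<in> V" by (rule Vcs)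
    then have "commutator Z1 Z2 \<in> V" using ne(2) by (simp add: cs_simps)
    moreover obtain s where "W = cs s (commutator Z1 Z2)"
      using rsg_one_dim[OF W(2) rsg_commutator[OF Z] ne(1) W(1)] by blast
    ultimately show ?thesis using Vcs by simp
  qed
  have cf: "coef 1 2 \<noteq> 0" "coef (-1) 3 \<noteq> 0" "coef (-2) 3 \<noteq> 0"
    unfolding coef_values unfolding assms by simp_all
  \<comment> \<open>\<open>ad (cnjM x)\<close> is minus the adjoint of \<open>ad x\<close>, so it
    cannot annihilate a nonzero vector in the image of \<open>ad x\<close>. This supplies the
    brackets that lower the degree.\<close>
  have bnz: "commutator (cnjM x) (commutator x y) \<noteq> 0" if "commutator x y \<noteq> 0" "x \<in> \<gg>" "y \<in> \<gg>" for x y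
  proof
    assume "commutator (cnjM x) (commutator x y) = 0"
    then have "hp (commutator x y) (commutator x y) = 0"
      using hp_commutator[of x y "commutator x y"] by (simp add: hp_simps)
    then show False using hq_eq_0[OF \<gg>_commutator[OF that(2,3)]] that(1) by (simp add: hq_def)
  qed
  obtain x where x: "x \<in> rsg 0 1" "x \<noteq> 0" using root_vector[OF rt_root, of 0 1] by (auto simp: L_def)
  obtain x' where x': "x' \<in> rsg 1 1" "x' \<noteq> 0" using root_vector[OF rt_root, of 1 1] by (auto simp: L_def)
  obtain y where y: "y \<in> rsg 1 2" "y \<noteq> 0" using root_vector[OF rt_root, of 1 2] by (auto simp: L_def)
  have m: "x \<in> \<gg>" "x' \<in> \<gg>" "y \<in> \<gg>" using x x' y by (auto simp: rs_iff)
  have n: "commutator x y \<noteq> 0" "commutator x' y \<noteq> 0" using nonzero_brackets x x' y by auto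
  then have n': "commutator y x \<noteq> 0" "commutator y x' \<noteq> 0" using commutator_anti[of y x] commutator_anti[of y x'] by auto
  have cc: "cnjM x \<in> rsg 0 (-1)" "cnjM y \<in> rsg (-1) (-2)"
    using rsg_cnj[of 0 1 x] rsg_cnj[of 1 2 y] x y by (auto simp: L_def)
  have z: "commutator x y \<in> rsg 1 3" "commutator y x \<in> rsg 1 3" "commutator y x' \<in> rsg 2 3"
    using rsg_commutator[OF x(1) y(1)] rsg_commutator[OF y(1) x(1)] rsg_commutator[OF y(1) x'(1)] by auto
  \<comment> \<open>The roots (1,3) and (2,3) are reached by brackets with \<open>y\<close>; from
    these, \<open>cnjM y\<close> leads back to (0,1) and (1,1), and \<open>cnjM x\<close> leads from
    (1,3) to (1,2).\<close>
  have pos: "W \<in> V" if "W \<in> rsg a b" "(a, b) \<in> {(0,1), (1,1), (1,2), (1,3), (2,3)}" for W a b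
    using that(2)
  proof (elim insertE emptyE)
    assume "(a, b) = (0, 1)"
    then show ?thesis using br[OF cc(2) z(2) bnz[OF n'(1) m(3,1)] cf(3), of W] that(1) by (simp add: L_def)
  next
    assume "(a, b) = (1, 1)"
    then show ?thesis using br[OF cc(2) z(3) bnz[OF n'(2) m(3,2)] cf(3), of W] that(1) by (simp add: L_def)
  next
    assume "(a, b) = (1, 2)"
    then show ?thesis using br[OF cc(1) z(1) bnz[OF n(1) m(1,3)] cf(2), of W] that(1) by (simp add: L_def)
  next
    assume "(a, b) = (1, 3)"
    then show ?thesis using br[OF x(1) y(1) n(1) cf(1), of W] that(1) by (simp add: L_def)
  next
    assume "(a, b) = (2, 3)"
    then show ?thesis using br[OF x'(1) y(1) n(2) cf(1), of W] that(1) by (simp add: L_def)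
  qed
  have "cof A \<in> \<gg>" using A cof_\<gg> by simp
  then have "cof A \<in> V"
  proof (rule \<gg>_induct)
    show "subspace {Z. Z \<in> V}"
      using Vadd Vcs \<kk>V[OF \<kk>_contains(1)[OF zero_\<hh>]] by (auto simp: subspace_def cs_simps(9))
    show "Z \<in> V" if "Z \<in> \<kk>" for Z using \<kk>V[OF that] .
    fix a b Z assume ab: "(a, b) \<in> L" "b \<noteq> 0" "Z \<in> rsg a b"
    show "Z \<in> V"
    proof (cases "b > 0")
      case True
      then have "(a, b) \<in> {(0,1), (1,1), (1,2), (1,3), (2,3)}" using ab(1) by (auto simp: L_def)
      then show ?thesis by (rule pos[OF ab(3)])
    next
      case False
      then have "(- a, - b) \<in> {(0,1), (1,1), (1,2), (1,3), (2,3)}" using ab(1,2) by (auto simp: L_def)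
      then have "cnjM Z \<in> V" by (rule pos[OF rsg_cnj[OF ab(1,3)]])
      from Vcnj[OF this] show ?thesis by (simp add: cnjM_simps)
    qed
  qed
  then show "\<xi> A = 0" using cofV by simp
qed

end

section \<open>Separating the three structures\<close>

context g2_flag
begin

text \<open>\<open>torsion_free\<close> separates the first structure from the other two, and
  \<open>torsion_full\<close> separates these from each other.\<close>

lemma three_invariant_structures:
  "\<exists>\<J>. card \<J> = 3 \<and> (\<forall>J\<in>\<J>. invariant_acs U K J) \<and>
    pairwise (\<lambda>J1 J2. \<not> acs_equivalent_or_conjugate (homogeneous_space U K) (homogeneous_smooth_functions U K) J1 J2) \<J>"
proof -
  interpret P1: g2_signs U T \<alpha>1 \<alpha>2 K H0 1 1 1 by unfold_locales simp_all
  interpret P2: g2_signs U T \<alpha>1 \<alpha>2 K H0 1 1 "-1" by unfold_locales simp_all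
  interpret P3: g2_signs U T \<alpha>1 \<alpha>2 K H0 1 "-1" 1 by unfold_locales simp_all
  have inv: "invariant_acs U K P1.S.J" "invariant_acs U K P2.S.J" "invariant_acs U K P3.S.J"
    by (rule P1.S.invariant P2.S.invariant P3.S.invariant)+
  obtain x where x: "x \<in> rsg 0 1" "x \<noteq> 0" using root_vector[OF rt_root, of 0 1] by (auto simp: L_def)
  obtain x' where x': "x' \<in> rsg 1 1" "x' \<noteq> 0" using root_vector[OF rt_root, of 1 1] by (auto simp: L_def)
  obtain y where y: "y \<in> rsg 1 2" "y \<noteq> 0" using root_vector[OF rt_root, of 1 2] by (auto simp: L_def)
  have f: "O.A.torsion_free P1.S.J" by (rule P1.torsion_free_signs) simp_all
  have nf2: "\<not> O.A.torsion_free P2.S.J"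
    by (rule P2.not_torsion_free_signs[OF x(1) y(1) nonzero_brackets(2)[OF x(1) y(1) x(2) y(2)]])
      (simp_all add: P2.coef_values)
  \<comment> \<open>Two vectors of degree 1 are taken here because \<open>coef 1 2\<close> vanishes
    for these signs, whereas \<open>coef 1 1\<close> is -4.\<close>
  have nf3: "\<not> O.A.torsion_free P3.S.J"
    by (rule P3.not_torsion_free_signs[OF x(1) x'(1) nonzero_brackets(1)[OF x(1) x'(1) x(2) x'(2)]])
      (simp_all add: P3.coef_values)
  have full: "O.A.torsion_full P2.S.J" by (rule P2.torsion_full_signs) simp_all
  have nfull: "\<not> O.A.torsion_full P3.S.J" by (rule P3.not_torsion_full_signs) simp_all
  let ?E = "acs_equivalent_or_conjugate (homogeneous_space U K) (homogeneous_smooth_functions U K)"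
  have ne: "\<not> ?E P1.S.J P2.S.J" "\<not> ?E P2.S.J P1.S.J" "\<not> ?E P1.S.J P3.S.J" "\<not> ?E P3.S.J P1.S.J"
    "\<not> ?E P2.S.J P3.S.J" "\<not> ?E P3.S.J P2.S.J"
    using O.A.torsion_invariant f nf2 nf3 full nfull by blast+
  have d: "P1.S.J \<noteq> P2.S.J" "P1.S.J \<noteq> P3.S.J" "P2.S.J \<noteq> P3.S.J"
    using f nf2 nf3 full nfull by metis+
  show ?thesis
    by (rule exI[of _ "{P1.S.J, P2.S.J, P3.S.J}"]) (use inv ne d in \<open>auto simp: pairwise_def\<close>)
qed

end

theorem proposition8p10:
  fixes U T K :: "(real^'n^'n) set"
    and \<alpha>\<^sub>1 \<alpha>\<^sub>2 :: "complex^'n^'n \<Rightarrow> complex"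
  assumes "compact_simple_lie_group U"
    and "maximal_torus U T"
    and "\<alpha>\<^sub>1 \<noteq> \<alpha>\<^sub>2"
    and "simple_roots (roots U T) {\<alpha>\<^sub>1, \<alpha>\<^sub>2}"
    and "positive_roots (roots U T) {\<alpha>\<^sub>1, \<alpha>\<^sub>2} =
      {\<alpha>\<^sub>1, \<alpha>\<^sub>2, (\<lambda>H. \<alpha>\<^sub>1 H + \<alpha>\<^sub>2 H), (\<lambda>H. \<alpha>\<^sub>1 H + 2 * \<alpha>\<^sub>2 H),
       (\<lambda>H. \<alpha>\<^sub>1 H + 3 * \<alpha>\<^sub>2 H), (\<lambda>H. 2 * \<alpha>\<^sub>1 H + 3 * \<alpha>\<^sub>2 H)}"
    and "flag_isotropy_group U T {\<alpha>\<^sub>1, (\<lambda>H. - \<alpha>\<^sub>1 H)} K"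
  shows "\<exists>\<J>. card \<J> = 3 \<and> (\<forall>J\<in>\<J>. invariant_acs U K J) \<and>
    pairwise (\<lambda>J1 J2. \<not> acs_equivalent_or_conjugate
      (homogeneous_space U K) (homogeneous_smooth_functions U K) J1 J2) \<J>"
proof -
  have U: "compact_matrix_group U"
    using assms(1) by (auto simp: compact_simple_lie_group_def intro: compact_matrix_groupI)
  interpret g2_data U T \<alpha>\<^sub>1 \<alpha>\<^sub>2
    by (rule g2_data.intro[OF root_data.intro[OF U assms(2)] g2_data_axioms.intro[OF assms(3-5)]])
  obtain H0 where "H0 \<in> lie_algebra T" "\<alpha>\<^sub>1 (cof H0) = 0" "\<alpha>\<^sub>2 (cof H0) = \<i>"
    using grading_element by blast
  then interpret g2_flag U T \<alpha>\<^sub>1 \<alpha>\<^sub>2 K H0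
    using assms(6) by unfold_locales
  show ?thesis by (rule three_invariant_structures)
qed

end
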